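(* Let $\gamma_1\le\dots\le\gamma_l$ be integers ($l\ge1$), let $\Lambda=\Lambda_{\gamma_1}+\dots+\Lambda_{\gamma_l}$ be the corresponding dominant weight of type $A_\infty$, and let $\mathbf w\in(\mathbb Z_{\ge0})^{\mathbb Z}$ be the vector with $\mathbf w_i=\#\{j : \gamma_j=i\}$. For every $\mathbf v$, the irreducible components of $\mathcal L(\mathbf v,\mathbf w)$ (type $A_\infty$) are precisely those $X_f$, $f\in\tilde Z^\infty_{\mathbf V}$, where $f=f_M$ for some $M\in\mathcal M[\Lambda]$. Denote the component $X_{f_M}$ by $X_M$. Then $M\leftrightarrow X_M$ is a one-to-one correspondence between the set $$\{(m_1,\dots,m_l)\in\mathcal M[\Lambda] : m_1\le\dots\le m_l\}$$ and the set of irreducible components of $\bigcup_{\mathbf v}\mathcal L(\mathbf v,\mathbf w)$ (i.e. the disjoint union over all $\mathbf v$ of the sets of irreducible components of $\mathcal L(\mathbf v,\mathbf w)$).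
   Context: Quiver. $I=\mathbb Z$. For every $i\in I$ there is an arrow $i\to i-1$ (with $\mathrm{out}=i$, $\mathrm{in}=i-1$) and an opposite arrow $i\leftarrow i-1$ (with $\mathrm{out}=i-1$, $\mathrm{in}=i$). $\Omega$ is the set of arrows $i\to i-1$, $\bar\Omega$ the set of arrows $i\leftarrow i-1$, $H=\Omega\sqcup\bar\Omega$, and $h\mapsto\bar h$ interchanges $i\to i-1$ and $i\leftarrow i-1$. $\varepsilon(h)=1$ for $h\in\Omega$, $\varepsilon(h)=-1$ for $h\in\bar\Omega$. For a finite-dimensional $I$-graded complex vector space $\mathbf V=\bigoplus_i\mathbf V_i$ of graded dimension $\mathbf v$, let $\mathbf E_{\mathbf V}=\bigoplus_{h\in H}\mathrm{Hom}(\mathbf V_{\mathrm{out}(h)},\mathbf V_{\mathrm{in}(h)})$, let $\mathbf E_{\mathbf V,\Omega}$, $\mathbf E_{\mathbf V,\bar\Omega}$ be the subspaces of $x$ with $x_h=0$ for $h\notin\Omega$, resp. $h\notin\bar\Omega$, and let $G_{\mathbf V}=\prod_i\mathrm{Aut}(\mathbf V_i)$ act by $(gx)_h=g_{\mathrm{in}(h)}x_hg_{\mathrm{out}(h)}^{-1}$. Put $\langle x,y\rangle=\sum_{h\in H}\varepsilon(h)\,\mathrm{tr}(x_hy_{\bar h})$ and $\psi_i(x)=\sum_{h\in H,\ \mathrm{in}(h)=i}\varepsilon(h)x_hx_{\bar h}\in\mathrm{End}(\mathbf V_i)$. $x\in\mathbf E_{\mathbf V}$ is nilpotent if for some $N\ge1$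 all compositions $x_{h_1}\cdots x_{h_N}$ along composable sequences of $N$ arrows vanish. $\Lambda_{\mathbf V}$ is the set of nilpotent $x\in\mathbf E_{\mathbf V}$ with $\psi_i(x)=0$ for all $i$. Orbits. For integers $k'\le k$ let $x_\infty(k',k)$ be the representation of $(I,\Omega)$ with basis $e_r$ ($k'\le r\le k$), $e_r$ of degree $r$, $e_r\mapsto e_{r-1}$, $e_{k'-1}=0$. $Z^\infty$ is the set of pairs of integers $(k'\le k)$; $\tilde Z^\infty$ is the set of finitely supported functions $Z^\infty\to\mathbb N$ ($\mathbb N\ni0$); $\tilde Z^\infty_{\mathbf V}$ is the subset of those $f$ with $\sum_{k'\le i\le k}f(k',k)=\dim\mathbf V_i$ for all $i$. For $f\in\tilde Z^\infty_{\mathbf V}$, $\mathcal O_f\subset\mathbf E_{\mathbf V,\Omega}$ is the $G_{\mathbf V}$-orbit of representations isomorphic to $\bigoplus x_\infty(k',k)^{\oplus f(k',k)}$; $\mathcal C_f\subset\mathbf E_{\mathbf V}$ is its conormal bundle, i.e. the set of $x'+x''$ with $x'\in\mathcal O_f$, $x''\in\mathbf E_{\mathbf V,\bar\Omega}$ orthogonal under $\langle\,,\rangle$ to the tangent space of $\mathcal O_f$ at $x'$; $\bar{\mathcal C}_f$ is its closure. Nakajima varieties. For $I$-graded $\mathbf V,\mathbf W$ of finite graded dimensions $\mathbf v,\mathbf w$, let $\Lambda(\mathbf v,\mathbf w)=\Lambda_{\mathbf V}\times\bigoplus_i\mathrm{Hom}(\mathbf V_i,\mathbf W_i)$ with $G_{\mathbf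 V}$-action $g(x,j)=(gx,(j_ig_i^{-1}))$; $\Lambda(\mathbf v,\mathbf w)^{\mathrm{st}}$ is the set of $(x,j)$ such that the only graded subspace $\mathbf S\subset\mathbf V$ with $x(\mathbf S)\subset\mathbf S$ and $j(\mathbf S)=0$ is $0$; $\mathcal L(\mathbf v,\mathbf w)=\Lambda(\mathbf v,\mathbf w)^{\mathrm{st}}/G_{\mathbf V}$ (the action is free). Put $X_f=\big((\bar{\mathcal C}_f\times\bigoplus_i\mathrm{Hom}(\mathbf V_i,\mathbf W_i))\cap\Lambda(\mathbf v,\mathbf w)^{\mathrm{st}}\big)/G_{\mathbf V}$. Maya diagrams. A Maya diagram is a bijection $m:\mathbb Z\to\mathbb Z$ such that $(m(j))_{j<0}$ and $(m(j))_{j\ge0}$ are both increasing; its charge is the integer $\gamma$ with $m(j)-j=\gamma$ for $|j|\gg0$. $\mathcal M[\gamma]$ is the set of Maya diagrams of charge $\gamma$. Maya diagrams correspond bijectively to pairs $(Y,\gamma)$, $Y=[l_1,\dots,l_s]$ a Young diagram (weakly decreasing positive integers, $l_j=0$ for $j>s$), $\gamma\in\mathbb Z$, as follows: $m(k)=\gamma+k-\#\{i : l_i\ge k+1\}$ for $k\ge0$. (Pictorially: the numbers $m(k)$, $k\ge 0$, label the horizontal edges of the boundary path of the infinite Young diagram consisting of the quadrant $\{x\ge0,\ y\ge\gamma\}$ with $Y$ attached below the line $y=\gamma$, the edge starting at $(i,j)$ being labelled $i+j$.) Write $m\le m'$ if $m(j)\le m'(j)$ for all $j\ge0$; equivalently,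 the infinite Young diagram of $m$ contains that of $m'$. $\mathcal M[\Lambda]=\mathcal M[\gamma_1]\times\dots\times\mathcal M[\gamma_l]$. For $Y=[l_1,\dots,l_s]$ set $A^\gamma_Y=\{(\gamma+1-i,\gamma+l_i-i) : 1\le i\le s\}$. For $M=((Y_1,\gamma_1),\dots,(Y_l,\gamma_l))\in\mathcal M[\Lambda]$, let $A_M$ be the union with multiplicity of the $A^{\gamma_i}_{Y_i}$, $i=1,\dots,l$, and let $f_M\in\tilde Z^\infty$ be the function with $f_M(k',k)$ equal to the number of times $(k',k)$ appears in $A_M$. *)

theory Defs
  imports
    "HOL-Analysis.Abstract_Topology"
    "HOL-Library.Groups_Big_Fun"
    "HOL-Library.Multiset"
    "Jordan_Normal_Form.Matrix"
    "Jordan_Normal_Form.VS_Connect"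
begin

section \<open>Irreducible components, Zariski topology, quotients\<close>

definition irreducible_in :: "'a topology \<Rightarrow> 'a set \<Rightarrow> bool" where
  "irreducible_in X S \<longleftrightarrow> S \<subseteq> topspace X \<and> S \<noteq> {} \<and>
     (\<forall>A B. closedin X A \<longrightarrow> closedin X B \<longrightarrow> S \<subseteq> A \<union> B \<longrightarrow> S \<subseteq> A \<or> S \<subseteq> B)"

definition irreducible_components :: "'a topology \<Rightarrow> 'a set set" where
  "irreducible_components X =
     {S. irreducible_in X S \<and> (\<forall>T. irreducible_in X T \<longrightarrow> S \<subseteq> T \<longrightarrow> T = S)}"

text \<open>Polynomial functions in a given set \<open>C\<close> of coordinate functions.\<close>

inductive_set poly_funs :: "('a \<Rightarrow> complex) set \<Rightarrow> ('a \<Rightarrow> complex) set"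
  for C :: "('a \<Rightarrow> complex) set" where
  const: "(\<lambda>_. c) \<in> poly_funs C"
| coord: "p \<in> C \<Longrightarrow> p \<in> poly_funs C"
| add: "p \<in> poly_funs C \<Longrightarrow> q \<in> poly_funs C \<Longrightarrow> (\<lambda>x. p x + q x) \<in> poly_funs C"
| mult: "p \<in> poly_funs C \<Longrightarrow> q \<in> poly_funs C \<Longrightarrow> (\<lambda>x. p x * q x) \<in> poly_funs C"

definition zariski :: "('a \<Rightarrow> complex) set \<Rightarrow> 'a set \<Rightarrow> 'a topology" where
  "zariski C S = topology (\<lambda>U. \<exists>F \<subseteq> poly_funs C. U = {x \<in> S. \<exists>p\<in>F. p x \<noteq> 0})"

lemma istopology_zariski:
  "istopology (\<lambda>U. \<exists>F \<subseteq> poly_funs C. U = {x \<in> S. \<exists>p\<in>F. p x \<noteq> 0})"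
proof -
  let ?P = "\<lambda>U. \<exists>F \<subseteq> poly_funs C. U = {x \<in> S. \<exists>p\<in>F. p x \<noteq> 0}"
  define Q where "Q U x p \<longleftrightarrow> p \<in> poly_funs C \<and> p x \<noteq> 0 \<and> (\<forall>y\<in>S. p y \<noteq> 0 \<longrightarrow> y \<in> U)"
    for U :: "'a set" and x p
  have iff: "?P U \<longleftrightarrow> U \<subseteq> S \<and> (\<forall>x\<in>U. \<exists>p. Q U x p)" for U
  proof
    assume "?P U"
    then show "U \<subseteq> S \<and> (\<forall>x\<in>U. \<exists>p. Q U x p)" unfolding Q_def by auto
  next
    assume *: "U \<subseteq> S \<and> (\<forall>x\<in>U. \<exists>p. Q U x p)"
    define F where "F = {p \<in> poly_funs C. \<forall>y\<in>S. p y \<noteq> 0 \<longrightarrow> y \<in> U}"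
    have "U = {x \<in> S. \<exists>p\<in>F. p x \<noteq> 0}"
      using * unfolding Q_def F_def by auto
    moreover have "F \<subseteq> poly_funs C" unfolding F_def by simp
    ultimately show "?P U" by (intro exI[of _ F] conjI)
  qed
  have mult: "Q (U \<inter> V) x (\<lambda>y. p y * q y)" if "Q U x p" "Q V x q" for U V x p q
    using that unfolding Q_def by (simp add: poly_funs.mult)
  have mono: "Q V x p" if "Q U x p" "U \<subseteq> V" for U V x p
    using that unfolding Q_def by auto
  show ?thesis
    unfolding istopology_def iff
  proof (intro conjI allI impI ballI)
    fix U V x
    assume "U \<subseteq> S \<and> (\<forall>x\<in>U. \<exists>p. Q U x p)" "V \<subseteq> S \<and> (\<forall>x\<in>V. \<exists>p. Q V x p)" "x \<in> U \<inter> V"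
    then obtain p q where "Q U x p" "Q V x q" by blast
    then show "\<exists>p. Q (U \<inter> V) x p" by (intro exI, rule mult)
  next
    fix \<K> x
    assume *: "\<forall>K\<in>\<K>. K \<subseteq> S \<and> (\<forall>x\<in>K. \<exists>p. Q K x p)" and "x \<in> \<Union>\<K>"
    then obtain K p where "K \<in> \<K>" "Q K x p" by blast
    then have "Q (\<Union>\<K>) x p" by (intro mono[of K x p "\<Union>\<K>"] Union_upper)
    then show "\<exists>p. Q (\<Union>\<K>) x p" by (intro exI[of _ p])
  qed auto
qed

lemma openin_zariski:
  "openin (zariski C S) U \<longleftrightarrow> (\<exists>F \<subseteq> poly_funs C. U = {x \<in> S. \<exists>p\<in>F. p x \<noteq> 0})"
  unfolding zariski_def by (simp add: topology_inverse'[OF istopology_zariski])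

lemma topspace_zariski: "topspace (zariski C S) = S"
proof
  show "topspace (zariski C S) \<subseteq> S"
    by (auto simp: topspace_def openin_zariski)
  have "openin (zariski C S) S"
    unfolding openin_zariski
    by (rule exI[of _ "{\<lambda>_. 1}"]) (auto intro: poly_funs.const)
  then show "S \<subseteq> topspace (zariski C S)" by (rule openin_subset)
qed

definition quotient_topology :: "'a topology \<Rightarrow> ('a \<Rightarrow> 'b) \<Rightarrow> 'b topology" where
  "quotient_topology X q =
     topology (\<lambda>U. U \<subseteq> q ` topspace X \<and> openin X {x \<in> topspace X. q x \<in> U})"

lemma istopology_quotient:
  "istopology (\<lambda>U. U \<subseteq> q ` topspace X \<and> openin X {x \<in> topspace X. q x \<in> U})"
  unfolding istopology_def
proof (intro conjI allI impI)
  fix U V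
  assume U: "U \<subseteq> q ` topspace X \<and> openin X {x \<in> topspace X. q x \<in> U}"
    and V: "V \<subseteq> q ` topspace X \<and> openin X {x \<in> topspace X. q x \<in> V}"
  show "U \<inter> V \<subseteq> q ` topspace X" using U by blast
  have "{x \<in> topspace X. q x \<in> U \<inter> V} =
      {x \<in> topspace X. q x \<in> U} \<inter> {x \<in> topspace X. q x \<in> V}" by blast
  moreover have "openin X ({x \<in> topspace X. q x \<in> U} \<inter> {x \<in> topspace X. q x \<in> V})"
    using U V by (intro openin_Int) blast+
  ultimately show "openin X {x \<in> topspace X. q x \<in> U \<inter> V}" by (rule ssubst)
next
  fix \<K>
  assume K: "\<forall>K\<in>\<K>. K \<subseteq> q ` topspace X \<and> openin X {x \<in> topspace X. q x \<in> K}"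
  show "\<Union>\<K> \<subseteq> q ` topspace X" using K by blast
  have "{x \<in> topspace X. q x \<in> \<Union>\<K>} = (\<Union>K\<in>\<K>. {x \<in> topspace X. q x \<in> K})" by blast
  moreover have "openin X (\<Union>K\<in>\<K>. {x \<in> topspace X. q x \<in> K})"
    using K by (intro openin_Union) blast
  ultimately show "openin X {x \<in> topspace X. q x \<in> \<Union>\<K>}" by (rule ssubst)
qed

lemma openin_quotient_topology:
  "openin (quotient_topology X q) U \<longleftrightarrow>
     U \<subseteq> q ` topspace X \<and> openin X {x \<in> topspace X. q x \<in> U}"
  unfolding quotient_topology_def by (simp add: topology_inverse'[OF istopology_quotient])

lemma topspace_quotient_topology: "topspace (quotient_topology X q) = q ` topspace X"
proof
  show "topspace (quotient_topology X q) \<subseteq> q ` topspace X"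
    by (auto simp: topspace_def openin_quotient_topology)
  have "{x \<in> topspace X. q x \<in> q ` topspace X} = topspace X" by blast
  then have "openin (quotient_topology X q) (q ` topspace X)"
    by (simp add: openin_quotient_topology)
  then show "q ` topspace X \<subseteq> topspace (quotient_topology X q)" by (rule openin_subset)
qed

lemma quotient_map_quotient_topology: "quotient_map X (quotient_topology X q) q"
  by (auto simp: quotient_map_def topspace_quotient_topology openin_quotient_topology)

section \<open>The quiver of type \<open>A\<^sub>\<infinity>\<close> and its representations\<close>

text \<open>\<open>Om i\<close> is the arrow from \<open>i\<close> to \<open>i - 1\<close> and \<open>OmBar i\<close> the opposite arrow.\<close>

datatype arrow = Om int | OmBar int

fun out_v :: "arrow \<Rightarrow> int" where
  "out_v (Om i) = i"
| "out_v (OmBar i) = i - 1"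

fun in_v :: "arrow \<Rightarrow> int" where
  "in_v (Om i) = i - 1"
| "in_v (OmBar i) = i"

fun opp :: "arrow \<Rightarrow> arrow" where
  "opp (Om i) = OmBar i"
| "opp (OmBar i) = Om i"

fun eps :: "arrow \<Rightarrow> complex" where
  "eps (Om i) = 1"
| "eps (OmBar i) = -1"

text \<open>The graded space of graded dimension \<open>v\<close> is taken to be \<open>\<bigoplus>\<^sub>i \<complex>\<^bsup>v i\<^esup>\<close>, so a point of
  \<open>E_V\<close> is a family of matrices; the dimension vectors of interest have finite support.\<close>

type_synonym rep = "arrow \<Rightarrow> complex mat"
type_synonym framed = "rep \<times> (int \<Rightarrow> complex mat)"

definition rep_space :: "(int \<Rightarrow> nat) \<Rightarrow> rep set" where
  "rep_space v = {x. \<forall>h. x h \<in> carrier_mat (v (in_v h)) (v (out_v h))}"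

definition rep_space_Om :: "(int \<Rightarrow> nat) \<Rightarrow> rep set" where
  "rep_space_Om v =
     {x \<in> rep_space v. \<forall>i. x (OmBar i) = 0\<^sub>m (v (in_v (OmBar i))) (v (out_v (OmBar i)))}"

definition rep_space_OmBar :: "(int \<Rightarrow> nat) \<Rightarrow> rep set" where
  "rep_space_OmBar v =
     {x \<in> rep_space v. \<forall>i. x (Om i) = 0\<^sub>m (v (in_v (Om i))) (v (out_v (Om i)))}"

definition rep_add :: "rep \<Rightarrow> rep \<Rightarrow> rep" where
  "rep_add x y = (\<lambda>h. x h + y h)"

definition rep_smult :: "complex \<Rightarrow> rep \<Rightarrow> rep" where
  "rep_smult c x = (\<lambda>h. c \<cdot>\<^sub>m x h)"

definition gauge_group :: "(int \<Rightarrow> nat) \<Rightarrow> (int \<Rightarrow> complex mat) set" where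
  "gauge_group v = {g. \<forall>i. g i \<in> Units (ring_mat TYPE(complex) (v i) ())}"

definition gauge_inv :: "(int \<Rightarrow> nat) \<Rightarrow> (int \<Rightarrow> complex mat) \<Rightarrow> int \<Rightarrow> complex mat" where
  "gauge_inv v g i = inv\<^bsub>ring_mat TYPE(complex) (v i) ()\<^esub> (g i)"

definition gauge_act :: "(int \<Rightarrow> nat) \<Rightarrow> (int \<Rightarrow> complex mat) \<Rightarrow> rep \<Rightarrow> rep" where
  "gauge_act v g x = (\<lambda>h. g (in_v h) * x h * gauge_inv v g (out_v h))"

definition mat_trace :: "complex mat \<Rightarrow> complex" where
  "mat_trace A = (\<Sum>a<dim_row A. A $$ (a, a))"

text \<open>For \<open>v\<close> of finite support only finitely many summands are nonzero, and \<open>Sum_any\<close> is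
  then their sum.\<close>

definition pairing :: "rep \<Rightarrow> rep \<Rightarrow> complex" where
  "pairing x y = Sum_any (\<lambda>h. eps h * mat_trace (x h * y (opp h)))"

definition moment :: "(int \<Rightarrow> nat) \<Rightarrow> rep \<Rightarrow> int \<Rightarrow> complex mat" where
  "moment v x i = mat (v i) (v i)
     (\<lambda>(a, b). \<Sum>h \<in> {h. in_v h = i}. eps h * (x h * x (opp h)) $$ (a, b))"

fun path_comp :: "rep \<Rightarrow> arrow list \<Rightarrow> complex mat" where
  "path_comp x [] = undefined"
| "path_comp x [h] = x h"
| "path_comp x (h # h' # hs) = x h * path_comp x (h' # hs)"

definition nilpotent_rep :: "(int \<Rightarrow> nat) \<Rightarrow> rep \<Rightarrow> bool" where
  "nilpotent_rep v x \<longleftrightarrow> (\<exists>N\<ge>1. \<forall>hs. length hs = N \<longrightarrow>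
     successively (\<lambda>h h'. out_v h = in_v h') hs \<longrightarrow>
     path_comp x hs = 0\<^sub>m (v (in_v (hd hs))) (v (out_v (last hs))))"

definition Lambda_V :: "(int \<Rightarrow> nat) \<Rightarrow> rep set" where
  "Lambda_V v = {x \<in> rep_space v. nilpotent_rep v x \<and> (\<forall>i. moment v x i = 0\<^sub>m (v i) (v i))}"

definition rep_coords :: "(int \<Rightarrow> nat) \<Rightarrow> (rep \<Rightarrow> complex) set" where
  "rep_coords v = {\<lambda>x. x h $$ (a, b) | h a b. a < v (in_v h) \<and> b < v (out_v h)}"

section \<open>Orbits and conormal bundles\<close>

definition seg_rep :: "int \<times> int \<Rightarrow> rep" where
  "seg_rep z h =
     (let d = (\<lambda>r. if fst z \<le> r \<and> r \<le> snd z then 1 else 0)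
      in mat (d (in_v h)) (d (out_v h)) (\<lambda>_. case h of Om _ \<Rightarrow> 1 | OmBar _ \<Rightarrow> 0))"

definition rep_dsum :: "rep list \<Rightarrow> rep" where
  "rep_dsum xs h = diag_block_mat (map (\<lambda>x. x h) xs)"

definition Z_inf :: "(int \<times> int) set" where
  "Z_inf = {(k', k). k' \<le> k}"

text \<open>Functions on \<open>Z_inf\<close> are extended by zero to all pairs of integers.\<close>

definition Zt_inf :: "(int \<times> int \<Rightarrow> nat) set" where
  "Zt_inf = {f. finite {z. f z \<noteq> 0} \<and> {z. f z \<noteq> 0} \<subseteq> Z_inf}"

definition seg_dim :: "(int \<times> int \<Rightarrow> nat) \<Rightarrow> int \<Rightarrow> nat" where
  "seg_dim f i = (\<Sum>z | f z \<noteq> 0 \<and> fst z \<le> i \<and> i \<le> snd z. f z)"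

definition Zt_V :: "(int \<Rightarrow> nat) \<Rightarrow> (int \<times> int \<Rightarrow> nat) set" where
  "Zt_V v = {f \<in> Zt_inf. \<forall>i. seg_dim f i = v i}"

definition orbit :: "(int \<Rightarrow> nat) \<Rightarrow> (int \<times> int \<Rightarrow> nat) \<Rightarrow> rep set" where
  "orbit v f = {x \<in> rep_space_Om v. \<exists>zs. (\<forall>z. count_list zs z = f z) \<and>
     (\<exists>g\<in>gauge_group v. x = gauge_act v g (rep_dsum (map seg_rep zs)))}"

text \<open>Zariski tangent space at \<open>x\<close> of a locally closed subvariety \<open>S\<close>: the common kernel of the
  differentials at \<open>x\<close> of the polynomials vanishing on \<open>S\<close>.\<close>

definition tangent_space :: "(int \<Rightarrow> nat) \<Rightarrow> rep set \<Rightarrow> rep \<Rightarrow> rep set" where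
  "tangent_space v S x = {y \<in> rep_space v.
     \<forall>p \<in> poly_funs (rep_coords v). (\<forall>s\<in>S. p s = 0) \<longrightarrow>
       ((\<lambda>t. p (rep_add x (rep_smult t y))) has_field_derivative 0) (at 0)}"

definition conormal :: "(int \<Rightarrow> nat) \<Rightarrow> (int \<times> int \<Rightarrow> nat) \<Rightarrow> rep set" where
  "conormal v f = {rep_add x' x'' | x' x''. x' \<in> orbit v f \<and> x'' \<in> rep_space_OmBar v \<and>
     (\<forall>y \<in> tangent_space v (orbit v f) x'. pairing x'' y = 0)}"

definition conormal_closure :: "(int \<Rightarrow> nat) \<Rightarrow> (int \<times> int \<Rightarrow> nat) \<Rightarrow> rep set" where
  "conormal_closure v f = (zariski (rep_coords v) (rep_space v)) closure_of (conormal v f)"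

section \<open>Nakajima varieties\<close>

definition hom_space :: "(int \<Rightarrow> nat) \<Rightarrow> (int \<Rightarrow> nat) \<Rightarrow> (int \<Rightarrow> complex mat) set" where
  "hom_space v w = {j. \<forall>i. j i \<in> carrier_mat (w i) (v i)}"

definition framed_coords :: "(int \<Rightarrow> nat) \<Rightarrow> (int \<Rightarrow> nat) \<Rightarrow> (framed \<Rightarrow> complex) set" where
  "framed_coords v w = {\<lambda>(x, j). c x | c. c \<in> rep_coords v} \<union>
     {\<lambda>(x, j). j i $$ (a, b) | i a b. a < w i \<and> b < v i}"

definition framed_act ::
  "(int \<Rightarrow> nat) \<Rightarrow> (int \<Rightarrow> complex mat) \<Rightarrow> framed \<Rightarrow> framed" where
  "framed_act v g = (\<lambda>(x, j). (gauge_act v g x, \<lambda>i. j i * gauge_inv v g i))"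

definition stable :: "(int \<Rightarrow> nat) \<Rightarrow> (int \<Rightarrow> nat) \<Rightarrow> framed \<Rightarrow> bool" where
  "stable v w = (\<lambda>(x, j). \<forall>S.
     (\<forall>i. subspace class_ring (S i) (module_vec TYPE(complex) (v i))) \<longrightarrow>
     (\<forall>h. \<forall>s \<in> S (out_v h). x h *\<^sub>v s \<in> S (in_v h)) \<longrightarrow>
     (\<forall>i. \<forall>s \<in> S i. j i *\<^sub>v s = 0\<^sub>v (w i)) \<longrightarrow>
     (\<forall>i. S i = {0\<^sub>v (v i)}))"

definition Lambda_st :: "(int \<Rightarrow> nat) \<Rightarrow> (int \<Rightarrow> nat) \<Rightarrow> framed set" where
  "Lambda_st v w = {p \<in> Lambda_V v \<times> hom_space v w. stable v w p}"

definition framed_orbit :: "(int \<Rightarrow> nat) \<Rightarrow> framed \<Rightarrow> framed set" where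
  "framed_orbit v p = (\<lambda>g. framed_act v g p) ` gauge_group v"

text \<open>The points of the variety are the \<open>G_V\<close>-orbits in the stable locus. The quotient is
  geometric, so its Zariski topology is the quotient topology.\<close>

definition nakajima_L :: "(int \<Rightarrow> nat) \<Rightarrow> (int \<Rightarrow> nat) \<Rightarrow> framed set topology" where
  "nakajima_L v w = quotient_topology
     (subtopology (zariski (framed_coords v w) (rep_space v \<times> hom_space v w)) (Lambda_st v w))
     (framed_orbit v)"

definition X_comp ::
  "(int \<Rightarrow> nat) \<Rightarrow> (int \<Rightarrow> nat) \<Rightarrow> (int \<times> int \<Rightarrow> nat) \<Rightarrow> framed set set" where
  "X_comp v w f =
     framed_orbit v ` ((conormal_closure v f \<times> hom_space v w) \<inter> Lambda_st v w)"

section \<open>Maya diagrams\<close>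

definition maya :: "(int \<Rightarrow> int) \<Rightarrow> bool" where
  "maya m \<longleftrightarrow> bij m \<and> strict_mono_on {..<0} m \<and> strict_mono_on {0..} m"

definition has_charge :: "(int \<Rightarrow> int) \<Rightarrow> int \<Rightarrow> bool" where
  "has_charge m \<gamma> \<longleftrightarrow> (\<exists>N. \<forall>j. \<bar>j\<bar> \<ge> N \<longrightarrow> m j - j = \<gamma>)"

definition charge :: "(int \<Rightarrow> int) \<Rightarrow> int" where
  "charge m = (THE \<gamma>. has_charge m \<gamma>)"

definition maya_diagrams :: "int \<Rightarrow> (int \<Rightarrow> int) set" where
  "maya_diagrams \<gamma> = {m. maya m \<and> has_charge m \<gamma>}"

definition young_diagram :: "nat list \<Rightarrow> bool" where
  "young_diagram Y \<longleftrightarrow> sorted_wrt (\<ge>) Y \<and> (\<forall>l\<in>set Y. l > 0)"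

definition young_of :: "(int \<Rightarrow> int) \<Rightarrow> nat list" where
  "young_of m = (THE Y. young_diagram Y \<and>
     (\<forall>k::nat. m (int k) = charge m + int k - int (card {i. i < length Y \<and> Y ! i \<ge> k + 1})))"

definition maya_le :: "(int \<Rightarrow> int) \<Rightarrow> (int \<Rightarrow> int) \<Rightarrow> bool" where
  "maya_le m m' \<longleftrightarrow> (\<forall>j\<ge>0. m j \<le> m' j)"

text \<open>The row lengths \<open>l\<^sub>i\<close> of \<open>Y\<close>, numbered from 1, are \<open>Y ! (i - 1)\<close>.\<close>

definition young_segs :: "int \<Rightarrow> nat list \<Rightarrow> (int \<times> int) set" where
  "young_segs \<gamma> Y =
     (\<lambda>i. (\<gamma> + 1 - int i, \<gamma> + int (Y ! (i - 1)) - int i)) ` {1..length Y}"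

text \<open>The dominant weight \<open>\<Lambda>\<^bsub>\<gamma>\<^sub>1\<^esub> + \<dots> + \<Lambda>\<^bsub>\<gamma>\<^sub>l\<^esub>\<close> is represented by the list of the \<open>\<gamma>\<^sub>i\<close>.\<close>

definition maya_tuples :: "int list \<Rightarrow> (int \<Rightarrow> int) list set" where
  "maya_tuples \<gamma>s = {M. list_all2 (\<lambda>m \<gamma>. m \<in> maya_diagrams \<gamma>) M \<gamma>s}"

definition tuple_segs :: "(int \<Rightarrow> int) list \<Rightarrow> (int \<times> int) multiset" where
  "tuple_segs M = (\<Sum>m\<leftarrow>M. mset_set (young_segs (charge m) (young_of m)))"

definition tuple_fun :: "(int \<Rightarrow> int) list \<Rightarrow> int \<times> int \<Rightarrow> nat" where
  "tuple_fun M = count (tuple_segs M)"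

definition weight_vec :: "int list \<Rightarrow> int \<Rightarrow> nat" where
  "weight_vec \<gamma>s i = card {j. j < length \<gamma>s \<and> \<gamma>s ! j = i}"

end

theory Submission
  imports Defs "Jordan_Normal_Form.Determinant" "HOL-Computational_Algebra.Polynomial"
    "HOL-Combinatorics.Permutations"
begin

text \<open>Nakajima's variety \<open>\<L>(v, w)\<close> is a quotient of the stable part of \<open>Lambda_V v\<close> times a linear space, so its
  irreducible components are governed by those of Lusztig's nilpotent variety. The proof has a geometric and a
  combinatorial half, which meet in the predicate \<open>chainable\<close>.

  For the geometry, \<open>conormal_iff\<close> identifies the conormal variety of an orbit with the zero set of the moment
  map over that orbit: the tangent space consists of the commutators (\<open>comm_in_tangent_space\<close>,
  \<open>tangent_space_orthogonal\<close>), and the moment map is the transpose of the commutator. Every representation of the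
  linear quiver is a sum of segments (\<open>orbits_cover\<close>) and nilpotency follows from the moment map equations
  (\<open>nilpotent_of_moment_zero\<close>), so the finitely many conormal varieties cover \<open>Lambda_V v\<close>. They are irreducible
  (\<open>conormal_framed_prime\<close>) and none lies in the closure of another: all have the same dimension, so an inclusion
  of closures is an equality (\<open>conormal_chart\<close>, \<open>dense_of_full_dimension\<close>), and then the ranks of all paths agree
  generically, which determines the multisegment (\<open>conormal_in_closure_eq\<close>). Dimension is handled through the
  counting of monomials only. Stability is an open condition (\<open>jointly_injective_open\<close>) invariant under the
  group. Hence the components of the quotient are the \<open>X_comp v w f\<close> for which the conormal variety of \<open>f\<close>
  contains a stable point (\<open>nakajima_components\<close>).

  Stability of \<open>(x, j)\<close> means that in each degree the maps \<open>x (Om i)\<close>, \<open>x (OmBar (i + 1))\<close> and \<open>j i\<close> are jointly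
  injective (\<open>Lambda_st_iff\<close>). In a basis of segments the bottom vector of a segment from \<open>i\<close> to \<open>k\<close> is killed by
  \<open>Om\<close>, and its image under the opposite arrow involves only segments that start at \<open>i + 1\<close> and reach beyond \<open>k\<close>.
  Counting dimensions shows that \<open>f\<close> is chainable (\<open>canonical_chainable\<close>). Conversely, the rows of a tuple of
  Maya diagrams give a matching of segments from which a stable point is written down (\<open>maya_conormal_stable\<close>).

  For the combinatorics, the segments of a Maya diagram are the pairs of a row and the value of the diagram there
  (\<open>young_segs_maya\<close>), with values strictly increasing along the rows. A chainable \<open>f\<close> distributes in exactly one
  way over a nested tuple: among the segments with a given start, the longest goes to the first diagram whose
  charge permits it, and so on (\<open>nested_maya_tuple_exists\<close>, \<open>nested_maya_tuple_unique\<close>).\<close>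

section \<open>Linear algebra and polynomial functions\<close>

abbreviation fin_supp :: "(int => nat) => bool" where
 "fin_supp v \<equiv> finite {i. v i ~= 0}"

abbreviation rep_polys :: "(int => nat) => (rep => complex) set" where
 "rep_polys v \<equiv> poly_funs (rep_coords v)"

abbreviation framed_polys :: "(int => nat) => (int => nat) => (framed => complex) set" where
 "framed_polys v w \<equiv> poly_funs (framed_coords v w)"

abbreviation moment_zero :: "(int => nat) => rep => int => bool" where
 "moment_zero v x i \<equiv> moment v x i = 0\<^sub>m (v i) (v i)"

text \<open>Gaussian elimination on one equation at a time.\<close>

lemma homogeneous_system_nontrivial:
 fixes A :: "'q => 'p => 'k::field"
 assumes "finite Q" "finite P" "card Q < card P"
 shows "\<exists>c. (\<exists>p\<in>P. c p ~= 0) & (\<forall>q\<in>Q. (\<Sum>p\<in>P. A q p * c p) = 0)"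
 using assms
proof (induction Q arbitrary: P A rule: finite_induct)
 case empty
 then obtain p where "p \<in> P" by fastforce
 then show ?case by (intro exI[of _ "%_. 1"]) auto
next
 case (insert q Q)
 show ?case
 proof (cases "\<forall>p\<in>P. A q p = 0")
  case True
  have "card Q < card P" using insert.prems insert.hyps by simp
  from insert.IH[OF insert.prems(1) this, of A] obtain c
   where "\<exists>p\<in>P. c p ~= 0" "\<forall>q\<in>Q. (\<Sum>p\<in>P. A q p * c p) = 0" by blast
  with True show ?thesis by (intro exI[of _ c]) auto
 next
  case False
  then obtain p0 where p0: "p0 \<in> P" "A q p0 ~= 0" by blast
  define P' where "P' = P - {p0}"
  define A' where "A' r p = A r p - A r p0 * A q p / A q p0" for r p
  have finP': "finite P'" unfolding P'_def using insert.prems by simp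
  have "card Q < card P'" unfolding P'_def using insert.prems insert.hyps p0 by simp
  from insert.IH[OF finP' this, of A'] obtain c'
   where c': "\<exists>p\<in>P'. c' p ~= 0" "\<forall>q\<in>Q. (\<Sum>p\<in>P'. A' q p * c' p) = 0" by blast
  define s where "s = (\<Sum>p\<in>P'. A q p * c' p)"
  define c where "c p = (if p = p0 then - s / A q p0 else c' p)" for p
  have P: "P = insert p0 P'" "p0 \<notin> P'" using p0 unfolding P'_def by auto
  have sum: "(\<Sum>p\<in>P. A r p * c p) = A r p0 * (- s / A q p0) + (\<Sum>p\<in>P'. A r p * c' p)" for r
  proof -
   have "(\<Sum>p\<in>P'. A r p * c p) = (\<Sum>p\<in>P'. A r p * c' p)"
    using P(2) by (intro sum.cong) (auto simp: c_def)
   then show ?thesis using P finP' by (simp add: c_def)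
  qed
  have "(\<Sum>p\<in>P. A r p * c p) = 0" if "r \<in> insert q Q" for r
  proof (cases "r = q")
   case True
   then show ?thesis using sum[of q] p0 by (simp add: s_def)
  next
   case False
   then have "(\<Sum>p\<in>P'. A' r p * c' p) = 0" using that c' by blast
   also have "(\<Sum>p\<in>P'. A' r p * c' p) = (\<Sum>p\<in>P'. A r p * c' p) - A r p0 / A q p0 * s"
    unfolding A'_def s_def by (simp add: algebra_simps sum_subtractf sum_distrib_left)
   finally show ?thesis using sum[of r] by simp
  qed
  moreover have "\<exists>p\<in>P. c p ~= 0" using c' P unfolding c_def by (metis insertCI)
  ultimately show ?thesis by blast
 qed
qed

lemma sum_mult_delta:
 fixes g :: "'a => 'k::semiring_1"
 assumes "finite A" "a \<in> A"
 shows "(\<Sum>x\<in>A. g x * (if x = a then 1 else 0)) = g a"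
  and "(\<Sum>x\<in>A. g x * (if a = x then 1 else 0)) = g a"
  and "(\<Sum>x\<in>A. (if x = a then 1 else 0) * g x) = g a"
  and "(\<Sum>x\<in>A. (if a = x then 1 else 0) * g x) = g a"
proof -
 have *: "(\<Sum>x\<in>A. if x = a then g x else 0) = g a"
  using assms by simp
 show "(\<Sum>x\<in>A. g x * (if x = a then 1 else 0)) = g a"
  "(\<Sum>x\<in>A. g x * (if a = x then 1 else 0)) = g a"
  "(\<Sum>x\<in>A. (if x = a then 1 else 0) * g x) = g a"
  "(\<Sum>x\<in>A. (if a = x then 1 else 0) * g x) = g a"
  by (subst *[symmetric], rule sum.cong, auto)+
qed

lemmas sum_times_cong = sum.cong refl arg_cong2[where f = "(*)"]

lemma sum_left_cong: "(!!x. x \<in> A ==> f x = g x) ==> (\<Sum>x\<in>A. f x * h x) = (\<Sum>x\<in>A. g x * h x)"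
 by simp

lemma sum_right_cong: "(!!x. x \<in> A ==> f x = g x) ==> (\<Sum>x\<in>A. h x * f x) = (\<Sum>x\<in>A. h x * g x)"
 by simp

text \<open>Vectors \<open>\<xi>\<close> mapping to independent images and covectors \<open>\<phi>\<close> dual to these images; the second property says
  that the images span the whole range, so \<open>r\<close> is the rank. Both data are needed as functions on the index
  sets, because the matrices that occur later are indexed by matrix entries of a graded endomorphism.\<close>

lemma rank_normal_form:
 fixes k :: "'q => 'p => 'k::field"
 assumes finP: "finite P" and finQ: "finite Q"
 obtains r :: nat and \<xi> :: "nat => 'p => 'k" and \<phi> :: "nat => 'q => 'k" where
  "!!i j. i < r ==> j < r ==>
    (\<Sum>q\<in>Q. \<phi> i q * (\<Sum>p\<in>P. k q p * \<xi> j p)) = (if i = j then 1 else 0)"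
  "!!q p. q \<in> Q ==> p \<in> P ==>
    k q p = (\<Sum>i<r. (\<Sum>p'\<in>P. k q p' * \<xi> i p') * (\<Sum>q'\<in>Q. \<phi> i q' * k q' p))"
proof -
 define K where "K \<zeta> q = (\<Sum>p\<in>P. k q p * \<zeta> p)" for \<zeta> q
 define K' where "K' \<psi> p = (\<Sum>q\<in>Q. \<psi> q * k q p)" for \<psi> p
 define B where "B \<psi> \<zeta> = (\<Sum>q\<in>Q. \<psi> q * K \<zeta> q)" for \<psi> \<zeta>
 have BK': "B \<psi> \<zeta> = (\<Sum>p\<in>P. K' \<psi> p * \<zeta> p)" for \<psi> \<zeta>
  unfolding B_def K_def K'_def sum_distrib_left sum_distrib_right
  by (subst sum.swap) (simp add: mult.assoc)
 define good where "good r \<longleftrightarrow> (\<exists>\<xi> \<phi>. \<forall>i<r. \<forall>j<r. B (\<phi> i) (\<xi> j) = (if i = j then 1 else 0))"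
  for r :: nat
 have bound: "r <= card P" if "good r" for r
 proof (rule ccontr)
  assume "\<not> r <= card P"
  from that obtain \<xi> \<phi> where *: "\<forall>i<r. \<forall>j<r. B (\<phi> i) (\<xi> j) = (if i = j then 1 else 0)"
   unfolding good_def by blast
  obtain c where c: "\<exists>j\<in>{..<r}. c j ~= 0" "\<forall>p\<in>P. (\<Sum>j\<in>{..<r}. \<xi> j p * c j) = 0"
   using homogeneous_system_nontrivial[of P "{..<r}" "%p j. \<xi> j p"] \<open>\<not> r <= card P\<close> finP by auto
  have "c i = 0" if "i < r" for i
  proof -
   have "c i = (\<Sum>j<r. (if i = j then 1 else 0) * c j)" 
    using sum_mult_delta(4)[of "{..<r}" i c] that by simp
   also have "... = (\<Sum>j<r. B (\<phi> i) (\<xi> j) * c j)" using * that by (intro sum.cong) auto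
   also have "... = (\<Sum>j<r. \<Sum>p\<in>P. K' (\<phi> i) p * (\<xi> j p * c j))"
    unfolding BK' sum_distrib_right by (simp add: mult.assoc)
   also have "... = (\<Sum>p\<in>P. K' (\<phi> i) p * (\<Sum>j<r. \<xi> j p * c j))"
    by (subst sum.swap) (simp add: sum_distrib_left)
   also have "... = 0" using c(2) by simp
   finally show ?thesis .
  qed
  with c(1) show False by blast
 qed
 have "good 0" unfolding good_def by simp
 then obtain r where r: "good r" "!!s. good s ==> s <= r"
  using ex_has_greatest_nat[of good 0 "%x. x" "Suc (card P)"] bound by (meson le_imp_less_Suc)
 from r(1) obtain \<xi> \<phi> where *: "!!i j. i < r ==> j < r ==> B (\<phi> i) (\<xi> j) = (if i = j then 1 else 0)"
  unfolding good_def by blast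
 define R where "R q p = k q p - (\<Sum>i<r. K (\<xi> i) q * K' (\<phi> i) p)" for q p
 have "R q0 p0 = 0" if q0: "q0 \<in> Q" and p0: "p0 \<in> P" for q0 p0
 proof (rule ccontr)
  assume nz: "R q0 p0 ~= 0"
  \<comment> \<open>one elimination step at a nonzero entry of the residual would give a larger \<open>r\<close>\<close>
  define \<xi>' where "\<xi>' p = (if p = p0 then 1 else 0) - (\<Sum>i<r. K' (\<phi> i) p0 * \<xi> i p)" for p
  define \<phi>' where "\<phi>' q = ((if q = q0 then 1 else 0) - (\<Sum>i<r. K (\<xi> i) q0 * \<phi> i q)) / R q0 p0" for q
  have B1: "B \<psi> \<xi>' = K' \<psi> p0 - (\<Sum>i<r. K' (\<phi> i) p0 * B \<psi> (\<xi> i))" for \<psi>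
  proof -
   have "B \<psi> \<xi>' = (\<Sum>p\<in>P. K' \<psi> p * (if p = p0 then 1 else 0))
     - (\<Sum>p\<in>P. \<Sum>i<r. K' (\<phi> i) p0 * (K' \<psi> p * \<xi> i p))"
    unfolding BK' \<xi>'_def by (simp add: algebra_simps sum_subtractf sum_distrib_left)
   also have "(\<Sum>p\<in>P. K' \<psi> p * (if p = p0 then 1 else 0)) = K' \<psi> p0"
    by (rule sum_mult_delta(1)[OF finP p0])
   also have "(\<Sum>p\<in>P. \<Sum>i<r. K' (\<phi> i) p0 * (K' \<psi> p * \<xi> i p))
     = (\<Sum>i<r. K' (\<phi> i) p0 * B \<psi> (\<xi> i))"
    by (subst sum.swap) (simp add: BK' sum_distrib_left)
   finally show ?thesis .
  qed
  have B2: "B \<phi>' \<zeta> * R q0 p0 = K \<zeta> q0 - (\<Sum>i<r. K (\<xi> i) q0 * B (\<phi> i) \<zeta>)" for \<zeta>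
  proof -
   have "B \<phi>' \<zeta> * R q0 p0 = (\<Sum>q\<in>Q. ((if q = q0 then 1 else 0) - (\<Sum>i<r. K (\<xi> i) q0 * \<phi> i q)) * K \<zeta> q)"
    unfolding B_def \<phi>'_def using nz by (simp add: sum_distrib_right)
   also have "... = (\<Sum>q\<in>Q. (if q = q0 then 1 else 0) * K \<zeta> q)
     - (\<Sum>q\<in>Q. \<Sum>i<r. K (\<xi> i) q0 * (\<phi> i q * K \<zeta> q))"
    by (simp add: algebra_simps sum_subtractf sum_distrib_left)
   also have "(\<Sum>q\<in>Q. (if q = q0 then 1 else 0) * K \<zeta> q) = K \<zeta> q0"
    by (rule sum_mult_delta(3)[OF finQ q0])
   also have "(\<Sum>q\<in>Q. \<Sum>i<r. K (\<xi> i) q0 * (\<phi> i q * K \<zeta> q)) = (\<Sum>i<r. K (\<xi> i) q0 * B (\<phi> i) \<zeta>)"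
    by (subst sum.swap) (simp add: B_def sum_distrib_left)
   finally show ?thesis .
  qed
  have dl: "(\<Sum>i<r. c i * (if j = i then 1 else 0)) = c j"
   "(\<Sum>i<r. c i * (if i = j then 1 else 0)) = c j" if "j < r" for c :: "nat => 'k" and j
   using sum_mult_delta(1,2)[of "{..<r}" j c] that by simp_all
  have row: "B (\<phi> j) \<xi>' = 0" if j: "j < r" for j
  proof -
   have "(\<Sum>i<r. K' (\<phi> i) p0 * B (\<phi> j) (\<xi> i)) = (\<Sum>i<r. K' (\<phi> i) p0 * (if j = i then 1 else 0))"
    using * j by (intro sum.cong) auto
   then show ?thesis using B1 dl(1)[OF j] by simp
  qed
  have col: "B \<phi>' (\<xi> j) = 0" if j: "j < r" for j
  proof -
   have "(\<Sum>i<r. K (\<xi> i) q0 * B (\<phi> i) (\<xi> j)) = (\<Sum>i<r. K (\<xi> i) q0 * (if i = j then 1 else 0))"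
    using * j by (intro sum.cong) auto
   then have "B \<phi>' (\<xi> j) * R q0 p0 = 0" using B2 dl(2)[OF j] by simp
   then show ?thesis using nz by simp
  qed
  have "K \<xi>' q0 = R q0 p0"
  proof -
   have "K \<xi>' q0 = (\<Sum>p\<in>P. k q0 p * (if p = p0 then 1 else 0))
     - (\<Sum>p\<in>P. \<Sum>i<r. K' (\<phi> i) p0 * (k q0 p * \<xi> i p))"
    unfolding K_def \<xi>'_def by (simp add: algebra_simps sum_subtractf sum_distrib_left)
   also have "(\<Sum>p\<in>P. k q0 p * (if p = p0 then 1 else 0)) = k q0 p0"
    by (rule sum_mult_delta(1)[OF finP p0])
   also have "(\<Sum>p\<in>P. \<Sum>i<r. K' (\<phi> i) p0 * (k q0 p * \<xi> i p))
     = (\<Sum>i<r. K (\<xi> i) q0 * K' (\<phi> i) p0)"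
    unfolding K_def sum_distrib_right by (subst sum.swap) (simp add: mult_ac)
   finally show ?thesis unfolding R_def .
  qed
  moreover have "(\<Sum>i<r. K (\<xi> i) q0 * B (\<phi> i) \<xi>') = 0" using row by simp
  ultimately have diag: "B \<phi>' \<xi>' = 1" using B2[of \<xi>'] nz by simp
  have "good (Suc r)"
   unfolding good_def
  proof (intro exI allI impI)
   fix i j assume "i < Suc r" "j < Suc r"
   then show "B ((\<phi>(r := \<phi>')) i) ((\<xi>(r := \<xi>')) j) = (if i = j then 1 else 0)"
    using row[of i] col[of j] diag *[of i j] by (cases "i = r"; cases "j = r") simp_all
  qed
  then show False using r(2)[of "Suc r"] by simp
 qed
 then have R: "k q p = (\<Sum>i<r. K (\<xi> i) q * K' (\<phi> i) p)" if "q \<in> Q" "p \<in> P" for q p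
  using that unfolding R_def by (metis eq_iff_diff_eq_0)
 show ?thesis
  by (rule that[of r \<phi> \<xi>]) (fact *[unfolded B_def K_def] R[unfolded K_def K'_def])+
qed

lemma poly_funs_sum: "(!!i. i \<in> I ==> f i \<in> poly_funs C) ==> (%x. \<Sum>i\<in>I. f i x) \<in> poly_funs C"
 by (induction I rule: infinite_finite_induct) (auto intro: poly_funs.intros)

lemma poly_funs_prod: "(!!i. i \<in> I ==> f i \<in> poly_funs C) ==> (%x. \<Prod>i\<in>I. f i x) \<in> poly_funs C"
 by (induction I rule: infinite_finite_induct) (auto intro: poly_funs.intros)

lemma poly_funs_power: "f \<in> poly_funs C ==> (%x. f x ^ n) \<in> poly_funs C"
 by (induction n) (auto intro: poly_funs.intros)

lemma poly_funs_uminus: "f \<in> poly_funs C ==> (%x. - f x) \<in> poly_funs C"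
 using poly_funs.mult[OF poly_funs.const[of "-1"], of f C] by simp

lemma poly_funs_diff: "f \<in> poly_funs C ==> g \<in> poly_funs C ==> (%x. f x - g x) \<in> poly_funs C"
 using poly_funs.add[of f C "%x. - g x"] poly_funs_uminus[of g C] by simp

lemmas poly_funs_intros = poly_funs.const poly_funs.add poly_funs.mult poly_funs_sum poly_funs_prod
 poly_funs_power poly_funs_uminus poly_funs_diff

lemma poly_funs_compose:
 assumes "p \<in> poly_funs C" and "!!c. c \<in> C ==> (%s. c (\<sigma> s)) \<in> poly_funs C'"
 shows "(%s. p (\<sigma> s)) \<in> poly_funs C'"
 using assms(1) by induction (auto intro: poly_funs.intros assms(2))

lemma permutes_less: "p permutes {0..<n} ==> i < n ==> p i < (n::nat)"
 using permutes_in_image[of p "{0..<n}" i] by simp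

lemma poly_funs_det:
 assumes "!!s. M s \<in> carrier_mat n n"
  and "!!a b. a < n ==> b < n ==> (%s. M s $$ (a, b)) \<in> poly_funs C"
 shows "(%s. det (M s)) \<in> poly_funs C"
 unfolding det_def'[OF assms(1)]
 by (intro poly_funs_intros assms(2)) (auto intro: permutes_less)

lemma tendsto_det:
 fixes M :: "'t => complex mat"
 assumes "!!s. M s \<in> carrier_mat n n" "N \<in> carrier_mat n n"
  and "!!a b. a < n ==> b < n ==> ((%s. M s $$ (a, b)) \<longlongrightarrow> N $$ (a, b)) F"
 shows "((%s. det (M s)) \<longlongrightarrow> det N) F"
 unfolding det_def'[OF assms(1)] det_def'[OF assms(2)]
 by (intro tendsto_intros assms(3)) (auto intro: permutes_less)

lemma adj_mat_index:
 assumes "A \<in> carrier_mat n n" "a < n" "b < n"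
 shows "adj_mat A $$ (a, b) = (-1) ^ (b + a) * det (mat_delete A b a)"
 using assms unfolding adj_mat_def cofactor_def by simp

lemma mat_delete_entry:
 assumes "A \<in> carrier_mat n n" "a < n - 1" "b < n - 1"
 shows "mat_delete A i j $$ (a, b) = A $$ (if a < i then a else Suc a, if b < j then b else Suc b)"
 using assms unfolding mat_delete_def by simp

lemma poly_funs_adj_mat:
 assumes "!!s. M s \<in> carrier_mat n n"
  and "!!a b. a < n ==> b < n ==> (%s. M s $$ (a, b)) \<in> poly_funs C"
  and "a < n" "b < n"
 shows "(%s. adj_mat (M s) $$ (a, b)) \<in> poly_funs C"
 unfolding adj_mat_index[OF assms(1,3,4)]
proof (intro poly_funs_intros)
 show "(%s. det (mat_delete (M s) b a)) \<in> poly_funs C"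
 proof (rule poly_funs_det[of _ "n - 1"])
  show "mat_delete (M s) b a \<in> carrier_mat (n - 1) (n - 1)" for s
   using assms(1)[of s] assms(3) by auto
  show "(%s. mat_delete (M s) b a $$ (c, d)) \<in> poly_funs C" if "c < n - 1" "d < n - 1" for c d
   unfolding mat_delete_entry[OF assms(1) that] using that assms(2) by auto
 qed
qed

lemma tendsto_adj_mat:
 fixes M :: "'t => complex mat"
 assumes "!!s. M s \<in> carrier_mat n n" "N \<in> carrier_mat n n"
  and "!!a b. a < n ==> b < n ==> ((%s. M s $$ (a, b)) \<longlongrightarrow> N $$ (a, b)) F"
  and "a < n" "b < n"
 shows "((%s. adj_mat (M s) $$ (a, b)) \<longlongrightarrow> adj_mat N $$ (a, b)) F"
 unfolding adj_mat_index[OF assms(1,4,5)] adj_mat_index[OF assms(2,4,5)]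
proof (intro tendsto_intros)
 show "((%s. det (mat_delete (M s) b a)) \<longlongrightarrow> det (mat_delete N b a)) F"
 proof (rule tendsto_det[of _ "n - 1"])
  show "mat_delete (M s) b a \<in> carrier_mat (n - 1) (n - 1)" for s
   using assms(1)[of s] assms(4) by auto
  show "mat_delete N b a \<in> carrier_mat (n - 1) (n - 1)"
   using assms(2) assms(4) by auto
  show "((%s. mat_delete (M s) b a $$ (c, d)) \<longlongrightarrow> mat_delete N b a $$ (c, d)) F" if "c < n - 1" "d < n - 1" for c d
   unfolding mat_delete_entry[OF assms(1) that] mat_delete_entry[OF assms(2) that] using that assms(3) by auto
 qed
qed

lemma inverse_times_det:
 fixes A :: "'k::comm_ring_1 mat"
 assumes A: "A \<in> carrier_mat n n" and B: "B \<in> carrier_mat n n" and AB: "A * B = 1\<^sub>m n"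
 shows "det A \<cdot>\<^sub>m B = adj_mat A"
proof -
 note adj = adj_mat[OF A]
 have "adj_mat A = adj_mat A * (A * B)" using adj(1) AB by simp
 also have "... = (adj_mat A * A) * B" using adj(1) A B by (simp add: assoc_mult_mat)
 also have "... = det A \<cdot>\<^sub>m B" using adj(3) B by (simp add: mult_smult_assoc_mat[OF one_carrier_mat B])
 finally show ?thesis by simp
qed

lemma inverse_entry_times_det:
 fixes A :: "'k::comm_ring_1 mat"
 assumes "A \<in> carrier_mat n n" "B \<in> carrier_mat n n" "A * B = 1\<^sub>m n" "a < n" "b < n"
 shows "B $$ (a, b) * det A = adj_mat A $$ (a, b)"
 using arg_cong[OF inverse_times_det[OF assms(1-3)], of "%X. X $$ (a, b)"] assms by (simp add: mult.commute)

lemma adj_mat_one: "adj_mat (1\<^sub>m n :: 'k::comm_ring_1 mat) = 1\<^sub>m n"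
proof -
 have "det (1\<^sub>m n :: 'k mat) \<cdot>\<^sub>m 1\<^sub>m n = adj_mat (1\<^sub>m n)"
  by (rule inverse_times_det[where n = n]) auto
 moreover have "(1::'k) \<cdot>\<^sub>m 1\<^sub>m n = 1\<^sub>m n" by (rule eq_matI) auto
 ultimately show ?thesis by simp
qed

text \<open>The inverse is the adjugate divided by the determinant, and both are polynomial in the entries.\<close>

lemma tendsto_inverse_near_one:
 fixes M :: "'t => complex mat"
 assumes M: "!!s. M s \<in> carrier_mat n n"
  and lim: "!!a b. a < n ==> b < n ==> ((%s. M s $$ (a, b)) \<longlongrightarrow> (1\<^sub>m n :: complex mat) $$ (a, b)) F"
  and B: "\<forall>\<^sub>F s in F. B s \<in> carrier_mat n n & M s * B s = 1\<^sub>m n"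
  and ab: "a < n" "b < n"
 shows "((%s. B s $$ (a, b)) \<longlongrightarrow> (1\<^sub>m n :: complex mat) $$ (a, b)) F"
proof -
 have d: "((%s. det (M s)) \<longlongrightarrow> 1) F"
  using tendsto_det[OF M one_carrier_mat lim] by simp
 have a: "((%s. adj_mat (M s) $$ (a, b)) \<longlongrightarrow> (1\<^sub>m n :: complex mat) $$ (a, b)) F"
  using tendsto_adj_mat[OF M one_carrier_mat lim ab] by (simp only: adj_mat_one)
 have "((%s. adj_mat (M s) $$ (a, b) / det (M s)) \<longlongrightarrow> (1\<^sub>m n :: complex mat) $$ (a, b) / 1) F"
  by (intro tendsto_intros a d) simp
 moreover have "\<forall>\<^sub>F s in F. adj_mat (M s) $$ (a, b) / det (M s) = B s $$ (a, b)"
  using B tendsto_imp_eventually_ne[OF d zero_neq_one[symmetric]]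
 proof eventually_elim
  case (elim s)
  then show ?case using inverse_entry_times_det[OF M[of s], of "B s" a b] ab by (simp add: field_simps)
 qed
 ultimately show ?thesis by (simp add: tendsto_cong)
qed

section \<open>Rational functions, prime sets and algebraic dependence\<close>

text \<open>The functions that become polynomial after multiplication by a power of \<open>D\<close>, on the locus where \<open>D\<close> does not
  vanish. Nothing is required elsewhere, so values such as the inverse of a singular matrix do no harm.\<close>

definition rational_over :: "('a => complex) set => ('a => complex) => ('a => complex) set" where
 "rational_over C D = {h. \<exists>K. \<exists>P \<in> poly_funs C. \<forall>s. D s ~= 0 --> h s * D s ^ K = P s}"

lemma rational_overI:
 "P \<in> poly_funs C ==> (!!s. D s ~= 0 ==> h s * D s ^ K = P s) ==> h \<in> rational_over C D"
 unfolding rational_over_def by blast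

lemma rational_overE:
 assumes "h \<in> rational_over C D"
 obtains K P where "P \<in> poly_funs C" "!!s. D s ~= 0 ==> h s * D s ^ K = P s"
 using assms unfolding rational_over_def by blast

lemma rational_over_poly: "h \<in> poly_funs C ==> h \<in> rational_over C D"
 by (rule rational_overI[where K = 0 and P = h]) auto

lemma rational_over_add:
 assumes "f \<in> rational_over C D" "g \<in> rational_over C D" "D \<in> poly_funs C"
 shows "(%s. f s + g s) \<in> rational_over C D"
proof -
 obtain K P where 1: "P \<in> poly_funs C" "!!s. D s ~= 0 ==> f s * D s ^ K = P s"
  using assms(1) by (rule rational_overE) blast
 obtain L Q where 2: "Q \<in> poly_funs C" "!!s. D s ~= 0 ==> g s * D s ^ L = Q s"
  using assms(2) by (rule rational_overE) blast
 show ?thesis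
 proof (rule rational_overI)
  show "(%s. P s * D s ^ L + Q s * D s ^ K) \<in> poly_funs C"
   by (intro poly_funs_intros 1 2 assms(3))
  show "(f s + g s) * D s ^ (K + L) = P s * D s ^ L + Q s * D s ^ K" if "D s ~= 0" for s
   using 1(2)[OF that, symmetric] 2(2)[OF that, symmetric] by (simp add: algebra_simps power_add)
 qed
qed

lemma rational_over_mult:
 assumes "f \<in> rational_over C D" "g \<in> rational_over C D"
 shows "(%s. f s * g s) \<in> rational_over C D"
proof -
 obtain K P where 1: "P \<in> poly_funs C" "!!s. D s ~= 0 ==> f s * D s ^ K = P s"
  using assms(1) by (rule rational_overE) blast
 obtain L Q where 2: "Q \<in> poly_funs C" "!!s. D s ~= 0 ==> g s * D s ^ L = Q s"
  using assms(2) by (rule rational_overE) blast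
 show ?thesis
 proof (rule rational_overI)
  show "(%s. P s * Q s) \<in> poly_funs C"
   by (intro poly_funs_intros 1 2)
  show "(f s * g s) * D s ^ (K + L) = P s * Q s" if "D s ~= 0" for s
   using 1(2)[OF that, symmetric] 2(2)[OF that, symmetric] by (simp add: algebra_simps power_add)
 qed
qed

lemma rational_over_sum:
 assumes "!!i. i \<in> I ==> f i \<in> rational_over C D" "D \<in> poly_funs C"
 shows "(%s. \<Sum>i\<in>I. f i s) \<in> rational_over C D"
 using assms(1)
 by (induction I rule: infinite_finite_induct)
   (auto intro: rational_over_add rational_over_poly poly_funs.const assms(2))

lemma rational_over_compose:
 assumes "p \<in> poly_funs C" "D \<in> poly_funs C'"
  and "!!c. c \<in> C ==> (%s. c (\<sigma> s)) \<in> rational_over C' D"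
 shows "(%s. p (\<sigma> s)) \<in> rational_over C' D"
 using assms(1)
 by induction (auto intro: rational_over_add rational_over_mult rational_over_poly poly_funs.const assms(2,3))

lemma univariate_poly_fun:
 assumes "p \<in> poly_funs {%t::complex. t}"
 shows "\<exists>P. p = poly P"
 using assms
proof induction
 case (const c)
 show ?case by (rule exI[of _ "[:c:]"]) auto
next
 case (coord p)
 then show ?case by (intro exI[of _ "[:0, 1:]"]) auto
next
 case (add p q)
 then obtain P Q where "p = poly P" "q = poly Q" by blast
 then show ?case by (intro exI[of _ "P + Q"]) auto
next
 case (mult p q)
 then obtain P Q where "p = poly P" "q = poly Q" by blast
 then show ?case by (intro exI[of _ "P * Q"]) auto
qed

lemma univariate_finite_zeros:
 assumes "p \<in> poly_funs {%t::complex. t}" "p t0 ~= 0"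
 shows "finite {t. p t = 0}"
proof -
 obtain P where P: "p = poly P" using univariate_poly_fun[OF assms(1)] by blast
 then have "P ~= 0" using assms(2) by auto
 then show ?thesis using poly_roots_finite P by simp
qed

lemma univariate_rational_finite_zeros:
 assumes "D \<in> poly_funs {%t::complex. t}" "h \<in> rational_over {%t. t} D" "D t0 ~= 0" "h t0 ~= 0"
 shows "finite {t. D t = 0 \<or> h t = 0}"
proof -
 obtain K P where P: "P \<in> poly_funs {%t. t}" "!!s. D s ~= 0 ==> h s * D s ^ K = P s"
  using assms(2) by (rule rational_overE) blast
 have "P t0 ~= 0" using P(2)[OF assms(3)] assms(3,4) by auto
 then have "finite {t. P t = 0}" using univariate_finite_zeros P(1) by blast
 moreover have "finite {t. D t = 0}" using univariate_finite_zeros assms(1,3) by blast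
 ultimately have "finite ({t. D t = 0} \<union> {t. P t = 0})" by simp
 moreover have "{t. D t = 0 \<or> h t = 0} \<subseteq> {t. D t = 0} \<union> {t. P t = 0}"
  using P(2) by fastforce
 ultimately show ?thesis by (rule rev_finite_subset)
qed

text \<open>Irreducibility of the Zariski closure of \<open>S\<close>, phrased for functions: the ideal of \<open>S\<close> is prime.\<close>

definition zariski_prime :: "('a => complex) set => 'a set => bool" where
 "zariski_prime C S \<longleftrightarrow> S ~= {} & (\<forall>p \<in> poly_funs C. \<forall>q \<in> poly_funs C.
   (\<forall>x\<in>S. p x * q x = 0) --> (\<forall>x\<in>S. p x = 0) \<or> (\<forall>x\<in>S. q x = 0))"

lemma zariski_primeD:
 assumes "zariski_prime C S" "p \<in> poly_funs C" "q \<in> poly_funs C" "!!x. x \<in> S ==> p x * q x = 0"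
 shows "(\<forall>x\<in>S. p x = 0) \<or> (\<forall>x\<in>S. q x = 0)"
 using assms unfolding zariski_prime_def by blast

text \<open>If any two points of \<open>S\<close> lie on a common rational curve in \<open>S\<close>, the ideal is prime: a product vanishing on
  \<open>S\<close> with factors nonzero at \<open>x\<close> and \<open>y\<close> would restrict to a rational function of one variable that vanishes
  almost everywhere, while each factor has only finitely many zeros on the curve.\<close>

lemma zariski_primeI_curves:
 fixes S :: "'a set"
 assumes "S ~= {}"
  and curves: "!!x y. x \<in> S ==> y \<in> S ==> \<exists>c D. c 0 = x & c 1 = y &
   D \<in> poly_funs {%t::complex. t} & D 0 ~= 0 & D 1 ~= 0 & (\<forall>t. D t ~= 0 --> c t \<in> S) &
   (\<forall>p\<in>C. (%t. p (c t)) \<in> rational_over {%t. t} D)"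
 shows "zariski_prime C S"
 unfolding zariski_prime_def
proof (intro conjI ballI impI)
 fix p q assume p: "p \<in> poly_funs C" and q: "q \<in> poly_funs C" and pq: "\<forall>x\<in>S. p x * q x = 0"
 show "(\<forall>x\<in>S. p x = 0) \<or> (\<forall>x\<in>S. q x = 0)"
 proof (rule ccontr)
  assume "\<not> ?thesis"
  then obtain x y where xy: "x \<in> S" "y \<in> S" "p x ~= 0" "q y ~= 0" by blast
  obtain c D where c: "c 0 = x" "c 1 = y" "D \<in> poly_funs {%t::complex. t}" "D 0 ~= 0" "D 1 ~= 0"
   "!!t. D t ~= 0 ==> c t \<in> S" "!!p. p \<in> C ==> (%t. p (c t)) \<in> rational_over {%t. t} D"
   using curves[OF xy(1,2)] by blast
  have "finite {t. D t = 0 \<or> p (c t) = 0}"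
   using univariate_rational_finite_zeros[OF c(3) rational_over_compose[where \<sigma> = c, OF p c(3) c(7)], where ?t0.0 = 0] c xy by simp
  moreover have "finite {t. D t = 0 \<or> q (c t) = 0}"
   using univariate_rational_finite_zeros[OF c(3) rational_over_compose[where \<sigma> = c, OF q c(3) c(7)], where ?t0.0 = 1] c xy by simp
  ultimately have "finite ({t. D t = 0 \<or> p (c t) = 0} \<union> {t. D t = 0 \<or> q (c t) = 0})" by simp
  then obtain t where "t \<notin> {t. D t = 0 \<or> p (c t) = 0} \<union> {t. D t = 0 \<or> q (c t) = 0}"
   using ex_new_if_finite[OF infinite_UNIV_char_0[where 'a = complex]] by blast
  then have "c t \<in> S" "p (c t) ~= 0" "q (c t) ~= 0" using c(6) by auto
  then show False using pq by auto
 qed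
qed (fact assms(1))

abbreviation coord_funs :: "nat => ((nat => complex) => complex) set" where
 "coord_funs d \<equiv> {%z. z i | i. i < d}"

text \<open>Polynomial functions whose degree in each single variable is at most \<open>m\<close>; this bound is additive under
  multiplication and leaves \<open>(m + 1) ^ d\<close> monomials.\<close>

inductive_set bounded_deg :: "nat => nat => ((nat => complex) => complex) set" for d m where
 monom: "(!!i. i < d ==> e i <= m) ==> (%z. c * (\<Prod>i<d. z i ^ e i)) \<in> bounded_deg d m"
| add: "f \<in> bounded_deg d m ==> g \<in> bounded_deg d m ==> (%z. f z + g z) \<in> bounded_deg d m"

lemma bounded_deg_mono: "f \<in> bounded_deg d m ==> m <= m' ==> f \<in> bounded_deg d m'"
 by (induction rule: bounded_deg.induct)
   (auto intro!: bounded_deg.intros intro: order_trans)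

lemma bounded_deg_const: "(%_. c) \<in> bounded_deg d m"
 using bounded_deg.monom[of d "%_. 0" m c] by simp

lemma bounded_deg_mult:
 assumes "f \<in> bounded_deg d m" "g \<in> bounded_deg d m'"
 shows "(%z. f z * g z) \<in> bounded_deg d (m + m')"
 using assms(1)
proof induction
 case (monom e c)
 show ?case using assms(2)
 proof induction
  case (monom e' c')
  have "(%z. (c * c') * (\<Prod>i<d. z i ^ (e i + e' i))) \<in> bounded_deg d (m + m')"
   using monom \<open>!!i. i < d ==> e i <= m\<close> by (intro bounded_deg.monom add_mono) auto
  then show ?case by (simp add: power_add prod.distrib mult_ac)
 next
  case (add f g)
  then show ?case using bounded_deg.add[OF add.IH] by (simp add: algebra_simps)
 qed
next
 case (add f g)
 then show ?case using bounded_deg.add[OF add.IH] by (simp add: algebra_simps)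
qed

lemma bounded_deg_power: "f \<in> bounded_deg d m ==> (%z. f z ^ n) \<in> bounded_deg d (n * m)"
proof (induction n)
 case 0
 then show ?case using bounded_deg_const[of 1] by simp
next
 case (Suc n)
 then show ?case using bounded_deg_mult[of f d m "%z. f z ^ n" "n * m"] by simp
qed

lemma bounded_deg_prod:
 "finite I ==> (!!i. i \<in> I ==> f i \<in> bounded_deg d (m i)) ==>
   (%z. \<Prod>i\<in>I. f i z) \<in> bounded_deg d (\<Sum>i\<in>I. m i)"
proof (induction I rule: finite_induct)
 case empty
 then show ?case using bounded_deg_const[of 1] by simp
next
 case (insert i I)
 then show ?case using bounded_deg_mult[of "f i" d "m i" "%z. \<Prod>i\<in>I. f i z"] by simp
qed

lemma poly_funs_bounded_deg:
 assumes "p \<in> poly_funs (coord_funs d)"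
 shows "\<exists>m. p \<in> bounded_deg d m"
 using assms
proof induction
 case (const c)
 then show ?case using bounded_deg_const by blast
next
 case (coord p)
 then obtain i where i: "i < d" "p = (%z. z i)" by blast
 have "(%z. 1 * (\<Prod>j<d. z j ^ (if j = i then 1 else 0))) \<in> bounded_deg d 1"
  by (intro bounded_deg.monom) auto
 moreover have "(\<Prod>j<d. z j ^ (if j = i then 1 else 0)) = z i" for z :: "nat => complex"
 proof -
  have "(\<Prod>j<d. z j ^ (if j = i then 1 else 0)) = (\<Prod>j<d. if j = i then z j else 1)"
   by (intro prod.cong) auto
  then show ?thesis using i by simp
 qed
 ultimately show ?case using i by auto
next
 case (add p q)
 then obtain m m' where "p \<in> bounded_deg d m" "q \<in> bounded_deg d m'" by blast
 then have "p \<in> bounded_deg d (m + m')" "q \<in> bounded_deg d (m + m')"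
  by (auto elim: bounded_deg_mono)
 then show ?case by (blast intro: bounded_deg.add)
next
 case (mult p q)
 then show ?case by (blast intro: bounded_deg_mult)
qed

lemma bounded_deg_expand:
 assumes "f \<in> bounded_deg d m"
 shows "\<exists>c. \<forall>z. f z = (\<Sum>e \<in> PiE {..<d} (%_. {..m}). c e * (\<Prod>i<d. z i ^ e i))"
 using assms
proof induction
 case (monom e c)
 let ?E = "PiE {..<d} (%_. {..m})"
 have e: "restrict e {..<d} \<in> ?E" using monom by auto
 have "c * (\<Prod>i<d. z i ^ e i) =
   (\<Sum>e' \<in> ?E. (if e' = restrict e {..<d} then c else 0) * (\<Prod>i<d. z i ^ e' i))" for z :: "nat => complex"
 proof -
  have "(\<Sum>e' \<in> ?E. (if e' = restrict e {..<d} then c else 0) * (\<Prod>i<d. z i ^ e' i))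
   = (\<Sum>e' \<in> ?E. if e' = restrict e {..<d} then c * (\<Prod>i<d. z i ^ e' i) else 0)"
   by (intro sum.cong) auto
  also have "... = c * (\<Prod>i<d. z i ^ restrict e {..<d} i)"
   using e by (simp add: finite_PiE)
  finally show ?thesis by simp
 qed
 then show ?case by (intro exI[of _ "%e'. if e' = restrict e {..<d} then c else 0"] allI)
next
 case (add f g)
 then obtain c c' where
  c: "\<forall>z. f z = (\<Sum>e \<in> PiE {..<d} (%_. {..m}). c e * (\<Prod>i<d. z i ^ e i))"
   "\<forall>z. g z = (\<Sum>e \<in> PiE {..<d} (%_. {..m}). c' e * (\<Prod>i<d. z i ^ e i))" by blast
 show ?case
  by (rule exI[of _ "%e. c e + c' e"]) (simp add: c sum.distrib distrib_right)
qed

lemma monomials_independent: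
 fixes b :: "(nat => nat) => complex"
 assumes "finite W" and "!!e e'. e \<in> W ==> e' \<in> W ==> \<forall>i<d. e i = e' i ==> e = e'"
  and "!!z. (\<Sum>e\<in>W. b e * (\<Prod>i<d. z i ^ e i)) = 0"
  and "e \<in> W"
 shows "b e = 0"
 using assms
proof (induction d arbitrary: W e)
 case 0
 then have "W = {e}" by blast
 then show ?case using "0.prems"(3) by simp
next
 case (Suc d)
 define N where "N = Max ((%e. e d) ` W)"
 have N: "e' d <= N" if "e' \<in> W" for e' unfolding N_def using that Suc.prems(1) by simp
 define V where "V k = {e \<in> W. e d = k}" for k
 have "(\<Sum>e\<in>V k. b e * (\<Prod>i<d. z i ^ e i)) = 0" if "k <= N" for z :: "nat => complex" and k
 proof -
  have "(\<Sum>k\<le>N. (\<Sum>e\<in>V k. b e * (\<Prod>i<d. z i ^ e i)) * x ^ k) = 0" for x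
  proof -
   have "(\<Sum>k\<le>N. (\<Sum>e\<in>V k. b e * (\<Prod>i<d. z i ^ e i)) * x ^ k)
    = (\<Sum>k\<le>N. \<Sum>e\<in>{e \<in> W. e d = k}. b e * (\<Prod>i<Suc d. (z(d := x)) i ^ e i))"
    unfolding V_def sum_distrib_right
    by (intro sum.cong refl) (auto simp: mult.assoc)
   also have "... = (\<Sum>e\<in>W. b e * (\<Prod>i<Suc d. (z(d := x)) i ^ e i))"
    by (rule sum.group) (use Suc.prems(1) N in auto)
   also have "... = 0" by (rule Suc.prems(3))
   finally show ?thesis .
  qed
  then show ?thesis using polyfun_eq_0[of "%k. \<Sum>e\<in>V k. b e * (\<Prod>i<d. z i ^ e i)" N] that by blast
 qed
 note * = this
 show ?case
 proof (rule Suc.IH[of "V (e d)"])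
  show "finite (V (e d))" unfolding V_def using Suc.prems(1) by simp
  show "e1 = e2" if "e1 \<in> V (e d)" "e2 \<in> V (e d)" "\<forall>i<d. e1 i = e2 i" for e1 e2
   using that Suc.prems(2)[of e1 e2] unfolding V_def by (auto simp: less_Suc_eq)
  show "e \<in> V (e d)" unfolding V_def using Suc.prems(4) by simp
 qed (use * N[OF Suc.prems(4)] in blast)
qed

text \<open>The counting form of the statement that a variety parametrised by \<open>d\<close> rational parameters has dimension at
  most \<open>d\<close>. The monomials of degree at most \<open>n\<close> in \<open>d + 1\<close> functions number \<open>(n + 1) ^ (d + 1)\<close>, whereas after
  clearing denominators they all lie in a space of dimension of order \<open>n ^ d\<close>; for large \<open>n\<close> there must be a
  linear relation.\<close>

lemma algebraic_dependence:
 fixes C :: "('a => complex) set"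
 assumes D: "D \<in> poly_funs (coord_funs d)"
  and \<sigma>: "!!c. c \<in> C ==> (%z. c (\<sigma> z)) \<in> rational_over (coord_funs d) D"
  and G: "!!i. i <= d ==> G i \<in> poly_funs C"
 shows "\<exists>n b. (\<exists>e \<in> PiE {..d} (%_. {..n::nat}). b e ~= 0) &
  (\<forall>z. D z ~= 0 --> (\<Sum>e \<in> PiE {..d} (%_. {..n}). b e * (\<Prod>i\<le>d. G i (\<sigma> z) ^ e i)) = 0)"
proof -
 let ?R = "%i K P. P \<in> poly_funs (coord_funs d) & (\<forall>z. D z ~= 0 --> G i (\<sigma> z) * D z ^ K = P z)"
 let ?M = "%e z. \<Prod>i\<le>d. G i (\<sigma> z) ^ e i" and ?m = "%(z :: nat => complex) a. \<Prod>i<d. z i ^ a i"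
 have "\<forall>i. \<exists>K P. i <= d --> ?R i K P"
 proof
  fix i
  show "\<exists>K P. i <= d --> ?R i K P"
  proof (cases "i <= d")
   case True
   from rational_over_compose[where \<sigma> = \<sigma>, OF G[OF True] D \<sigma>] show ?thesis
    unfolding rational_over_def by blast
  qed simp
 qed
 then obtain K where "\<forall>i. \<exists>P. i <= d --> ?R i (K i) P"
  by (rule choice[THEN exE])
 then obtain P0 where P0': "\<forall>i. i <= d --> ?R i (K i) (P0 i)"
  by (rule choice[THEN exE])
 then have P0: "!!i. i <= d ==> P0 i \<in> poly_funs (coord_funs d)"
  "!!i z. i <= d ==> D z ~= 0 ==> G i (\<sigma> z) * D z ^ K i = P0 i z"
  by blast+
 define k where "k = (\<Sum>i\<le>d. K i)"
 define P where "P i z = P0 i z * D z ^ (k - K i)" for i z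
 have K: "K i <= k" if "i <= d" for i
  unfolding k_def using that by (intro member_le_sum) auto
 have P: "G i (\<sigma> z) * D z ^ k = P i z" if "i <= d" "D z ~= 0" for i z
  unfolding P_def P0(2)[OF that, symmetric] using K[OF that(1)]
  by (simp add: mult.assoc power_add[symmetric])
 have "\<exists>m. P i \<in> bounded_deg d m" if "i <= d" for i
  unfolding P_def[abs_def] by (intro poly_funs_bounded_deg poly_funs_intros P0(1) D that)
 then have "\<forall>i. \<exists>m. i <= d --> P i \<in> bounded_deg d m" by blast
 then obtain m0 where "\<forall>i. i <= d --> P i \<in> bounded_deg d (m0 i)"
  by (rule choice[THEN exE])
 then have m0: "!!i. i <= d ==> P i \<in> bounded_deg d (m0 i)" by blast
 obtain m1 where m1: "(%z. D z ^ k) \<in> bounded_deg d m1"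
  using poly_funs_bounded_deg[OF poly_funs_power[OF D]] by blast
 define m where "m = m1 + (\<Sum>i\<le>d. m0 i)"
 have m: "P i \<in> bounded_deg d m" if "i <= d" for i
  using m0[OF that] by (rule bounded_deg_mono)
   (unfold m_def, intro trans_le_add2 member_le_sum, use that in auto)
 have mD: "(%z. D z ^ k) \<in> bounded_deg d m"
  using m1 by (rule bounded_deg_mono) (simp add: m_def)
 \<comment> \<open>chosen so that \<open>(N + 1) ^ d < (n + 1) ^ (d + 1)\<close>\<close>
 define n where "n = ((d + 1) * (m + 1)) ^ d"
 define N where "N = (d + 1) * (n * m)"
 define E where "E = PiE {..d} (%_. {..n})"
 define A where "A = PiE {..<d} (%_. {..N})"
 have finE: "finite E" and finA: "finite A" unfolding E_def A_def by (auto intro: finite_PiE)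
 have expand: "\<exists>c. \<forall>z. D z ~= 0 --> ?M e z * (D z ^ k) ^ ((d + 1) * n)
   = (\<Sum>a\<in>A. c a * ?m z a)" if e: "e \<in> E" for e
 proof -
  have en: "e i <= n" if "i <= d" for i using e that unfolding E_def by auto
  define H where "H z = (\<Prod>i\<le>d. P i z ^ e i * (D z ^ k) ^ (n - e i))" for z
  have "H \<in> bounded_deg d (\<Sum>i\<le>d. e i * m + (n - e i) * m)"
   unfolding H_def
   by (intro bounded_deg_prod bounded_deg_mult bounded_deg_power m mD) auto
  also have "(\<Sum>i\<le>d. e i * m + (n - e i) * m) = (\<Sum>i\<le>d. n * m)"
   using en by (intro sum.cong) (auto simp: distrib_right[symmetric])
  also have "... = N" unfolding N_def by simp
  finally obtain c where c: "\<forall>z. H z = (\<Sum>a\<in>A. c a * ?m z a)"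
   using bounded_deg_expand unfolding A_def by blast
  have "?M e z * (D z ^ k) ^ ((d + 1) * n) = H z" if "D z ~= 0" for z
  proof -
   have "H z = (\<Prod>i\<le>d. G i (\<sigma> z) ^ e i * (D z ^ k) ^ n)"
    unfolding H_def
   proof (intro prod.cong refl)
    fix i assume "i \<in> {..d}"
    then have "P i z ^ e i * (D z ^ k) ^ (n - e i) = G i (\<sigma> z) ^ e i * ((D z ^ k) ^ e i * (D z ^ k) ^ (n - e i))"
     using P[of i z] that by (simp add: power_mult_distrib[symmetric] mult.assoc[symmetric])
    also have "(D z ^ k) ^ e i * (D z ^ k) ^ (n - e i) = (D z ^ k) ^ n"
     using en[of i] \<open>i \<in> {..d}\<close> by (simp add: power_add[symmetric])
    finally show "P i z ^ e i * (D z ^ k) ^ (n - e i) = G i (\<sigma> z) ^ e i * (D z ^ k) ^ n" .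
   qed
   also have "... = ?M e z * ((D z ^ k) ^ n) ^ (d + 1)"
    by (simp add: prod.distrib)
   finally show ?thesis by (simp only: power_mult[symmetric] mult_ac)
  qed
  then show ?thesis using c by (intro exI[of _ c]) simp
 qed
 have "\<forall>e. \<exists>c. e \<in> E --> (\<forall>z. D z ~= 0 --> ?M e z * (D z ^ k) ^ ((d + 1) * n)
   = (\<Sum>a\<in>A. c a * ?m z a))"
  using expand by blast
 then obtain c where "\<forall>e. e \<in> E --> (\<forall>z. D z ~= 0 --> ?M e z * (D z ^ k) ^ ((d + 1) * n)
   = (\<Sum>a\<in>A. c e a * ?m z a))"
  by (rule choice[THEN exE])
 then have c: "!!e z. e \<in> E ==> D z ~= 0 ==>
   ?M e z * (D z ^ k) ^ ((d + 1) * n) = (\<Sum>a\<in>A. c e a * ?m z a)"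
  by blast
 \<comment> \<open>there are more monomials in the \<open>d + 1\<close> functions than coefficients\<close>
 have "card A < card E"
 proof -
  have "N + 1 <= ((d + 1) * (m + 1)) * (n + 1)" unfolding N_def by (simp add: algebra_simps)
  then have "(N + 1) ^ d <= (((d + 1) * (m + 1)) * (n + 1)) ^ d" by (rule power_mono) simp
  also have "... = n * (n + 1) ^ d" unfolding n_def power_mult_distrib by simp
  also have "... < (n + 1) ^ (d + 1)" by simp
  finally show ?thesis unfolding A_def E_def by (simp add: card_PiE)
 qed
 from homogeneous_system_nontrivial[OF finA finE this, of "%a e. c e a"]
 obtain b where b: "\<exists>e\<in>E. b e ~= 0" "\<forall>a\<in>A. (\<Sum>e\<in>E. c e a * b e) = 0" by blast
 have "(\<Sum>e\<in>E. b e * ?M e z) = 0" if z: "D z ~= 0" for z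
 proof -
  have "(\<Sum>e\<in>E. b e * ?M e z) * (D z ^ k) ^ ((d + 1) * n)
   = (\<Sum>e\<in>E. b e * (\<Sum>a\<in>A. c e a * ?m z a))"
   unfolding sum_distrib_right mult.assoc by (intro sum_times_cong c z)
  also have "... = (\<Sum>e\<in>E. \<Sum>a\<in>A. (c e a * b e) * ?m z a)"
   by (simp add: sum_distrib_left mult_ac)
  also have "... = (\<Sum>a\<in>A. (\<Sum>e\<in>E. c e a * b e) * ?m z a)"
   by (subst sum.swap) (simp add: sum_distrib_right)
  also have "... = 0" using b(2) by simp
  finally show ?thesis using z by simp
 qed
 then show ?thesis using b(1) unfolding E_def by blast
qed

text \<open>The opposite bound. If \<open>S\<close> contains curves through a point with every tangent direction in the coordinates
  \<open>q\<close>, then the \<open>q i\<close> satisfy no polynomial relation on \<open>S\<close>: along the curve with direction \<open>z\<close> the lowest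
  homogeneous part of a relation dominates, and it would vanish at every \<open>z\<close>.\<close>

lemma tangent_monomials_independent:
 fixes b :: "(nat => nat) => complex" and q :: "nat => 'a => complex"
 assumes fin: "finite W" and inj: "!!e e'. e \<in> W ==> e' \<in> W ==> \<forall>i<d. e i = e' i ==> e = e'"
  and \<tau>: "!!z. \<forall>\<^sub>F t in at (0::complex). \<tau> z t \<in> S"
  and lim: "!!z i. i < d ==> ((%t. q i (\<tau> z t) / t) \<longlongrightarrow> z i) (at 0)"
  and rel: "!!x. x \<in> S ==> (\<Sum>e\<in>W. b e * (\<Prod>i<d. q i x ^ e i)) = 0"
  and eW: "e \<in> W"
 shows "b e = 0"
proof (rule ccontr)
 assume "b e ~= 0"
 define V where "V = {e \<in> W. b e ~= 0}"
 define s where "s e = (\<Sum>i<d. e i)" for e :: "nat => nat"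
 have V: "finite V" "V ~= {}" unfolding V_def using fin eW \<open>b e ~= 0\<close> by auto
 define \<mu> where "\<mu> = Min (s ` V)"
 have \<mu>: "\<mu> <= s e" if "e \<in> V" for e unfolding \<mu>_def using V that by simp
 have "\<mu> \<in> s ` V" unfolding \<mu>_def using V by (intro Min_in) auto
 then obtain e0 where e0: "e0 \<in> V" "s e0 = \<mu>" by blast
 define V0 where "V0 = {e \<in> V. s e = \<mu>}"
 have "(\<Sum>e\<in>V0. b e * (\<Prod>i<d. z i ^ e i)) = 0" for z
 proof -
  let ?L = "%e. b e * (0 ^ (s e - \<mu>) * (\<Prod>i<d. z i ^ e i))"
  let ?T = "%t e. b e * (t ^ (s e - \<mu>) * (\<Prod>i<d. (q i (\<tau> z t) / t) ^ e i))"
  have "((%t. \<Sum>e\<in>V. ?T t e)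
    \<longlongrightarrow> (\<Sum>e\<in>V. ?L e)) (at 0)"
   by (intro tendsto_intros lim) auto
  moreover have "\<forall>\<^sub>F t in at 0. (\<Sum>e\<in>V. ?T t e) = 0"
   using \<tau>[of z] eventually_neq_at_within[of 0 0 UNIV]
  proof eventually_elim
   case (elim t)
   have "(\<Sum>e\<in>V. ?T t e) * t ^ \<mu>
    = (\<Sum>e\<in>V. b e * (\<Prod>i<d. q i (\<tau> z t) ^ e i))"
    unfolding sum_distrib_right
   proof (intro sum.cong refl)
    fix e assume "e \<in> V"
    have "(\<Prod>i<d. (q i (\<tau> z t) / t) ^ e i) = (\<Prod>i<d. q i (\<tau> z t) ^ e i) / t ^ s e"
     unfolding s_def power_sum by (simp add: power_divide prod_dividef)
    moreover have "t ^ (s e - \<mu>) * t ^ \<mu> = t ^ s e"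
     using \<mu>[OF \<open>e \<in> V\<close>] by (simp add: power_add[symmetric])
    moreover have "\<beta> * (u * (x / v)) * w = \<beta> * x" if "u * w = v" "v ~= 0" for \<beta> u v w x :: complex
     using that by auto
    ultimately show "?T t e * t ^ \<mu>
      = b e * (\<Prod>i<d. q i (\<tau> z t) ^ e i)"
     using elim by simp
   qed
   also have "... = (\<Sum>e\<in>W. b e * (\<Prod>i<d. q i (\<tau> z t) ^ e i))"
    unfolding V_def using fin by (intro sum.mono_neutral_left) auto
   also have "... = 0" using rel elim by blast
   finally show ?case using elim by simp
  qed
  ultimately have "((%t::complex. 0) \<longlongrightarrow> (\<Sum>e\<in>V. ?L e)) (at 0)"
   by (rule Lim_transform_eventually)
  then have "(\<Sum>e\<in>V. ?L e) = 0"
   by (simp add: tendsto_const_iff)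
  moreover have "(\<Sum>e\<in>V. ?L e) = (\<Sum>e\<in>V0. b e * (\<Prod>i<d. z i ^ e i))"
  proof -
   have "(\<Sum>e\<in>V. ?L e)
    = (\<Sum>e\<in>V0. ?L e)"
   proof (intro sum.mono_neutral_right)
    show "\<forall>e\<in>V - V0. ?L e = 0"
    proof
     fix e assume "e \<in> V - V0"
     then have "0 < s e - \<mu>" using \<mu>[of e] unfolding V0_def by auto
     then show "?L e = 0" by (simp add: zero_power)
    qed
   qed (use V(1) in \<open>auto simp: V0_def\<close>)
   also have "... = (\<Sum>e\<in>V0. b e * (\<Prod>i<d. z i ^ e i))"
    by (intro sum.cong refl) (simp add: V0_def)
   finally show ?thesis .
  qed
  ultimately show ?thesis by simp
 qed
 note vanish = this
 have "finite V0" unfolding V0_def using V(1) by simp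
 have sub: "V0 \<subseteq> W" unfolding V0_def V_def by blast
 from \<open>finite V0\<close> have "b e0 = 0"
 proof (rule monomials_independent[where d = d and b = b and e = e0 and W = V0])
  show "e = e'" if "e \<in> V0" "e' \<in> V0" "\<forall>i<d. e i = e' i" for e e'
   using inj that sub by blast
  show "e0 \<in> V0" using e0 unfolding V0_def by simp
 qed (fact vanish)
 then show False using e0 unfolding V_def by simp
qed

text \<open>A subset \<open>S\<close> of the closure of an irreducible set \<open>T\<close> of dimension at most \<open>d\<close> that itself has dimension at
  least \<open>d\<close> is dense in \<open>T\<close>. If \<open>f\<close> vanished on \<open>S\<close> but not on \<open>T\<close>, then \<open>f\<close> and the \<open>d\<close> functions \<open>q\<close> would
  be algebraically dependent on \<open>T\<close>; after cancelling the largest common power of \<open>f\<close>, which primality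
  permits, the relation restricts to a nontrivial relation between the \<open>q\<close> alone on \<open>S\<close>.\<close>

lemma dense_of_full_dimension:
 fixes C :: "('a => complex) set"
 assumes prime: "zariski_prime C T"
  and D: "D \<in> poly_funs (coord_funs d)"
  and \<sigma>: "!!c. c \<in> C ==> (%z. c (\<sigma> z)) \<in> rational_over (coord_funs d) D"
  and dense: "!!p. p \<in> poly_funs C ==> (!!z. D z ~= 0 ==> p (\<sigma> z) = 0) ==> \<forall>x\<in>T. p x = 0"
  and ST: "!!p. p \<in> poly_funs C ==> \<forall>x\<in>T. p x = 0 ==> \<forall>x\<in>S. p x = 0"
  and q: "!!i. i < d ==> q i \<in> poly_funs C"
  and \<tau>: "!!z. \<forall>\<^sub>F t in at (0::complex). \<tau> z t \<in> S"
  and lim: "!!z i. i < d ==> ((%t. q i (\<tau> z t) / t) \<longlongrightarrow> z i) (at 0)"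
  and f: "f \<in> poly_funs C" "\<forall>x\<in>S. f x = 0"
 shows "\<forall>x\<in>T. f x = 0"
proof (rule ccontr)
 assume nz: "\<not> (\<forall>x\<in>T. f x = 0)"
 define G where "G = q(d := f)"
 have G: "G i \<in> poly_funs C" if "i <= d" for i using that q f unfolding G_def by simp
 obtain n b where b: "\<exists>e \<in> PiE {..d} (%_. {..n::nat}). b e ~= 0"
  "!!z. D z ~= 0 ==> (\<Sum>e \<in> PiE {..d} (%_. {..n}). b e * (\<Prod>i\<le>d. G i (\<sigma> z) ^ e i)) = 0"
  using algebraic_dependence[where \<sigma> = \<sigma> and G = G and C = C, OF D \<sigma> G] by blast
 define V where "V = {e \<in> PiE {..d} (%_. {..n}). b e ~= 0}"
 have finE: "finite (PiE {..d} (%_. {..n}))" by (intro finite_PiE) auto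
 have V: "finite V" "V ~= {}"
  unfolding V_def using b(1) finE by auto
 define k where "k = Min ((%e. e d) ` V)"
 have k: "k <= e d" if "e \<in> V" for e unfolding k_def using V that by simp
 have "k \<in> (%e. e d) ` V" unfolding k_def using V by (intro Min_in) auto
 then obtain e0 where e0: "e0 \<in> V" "e0 d = k" by blast
 define R where "R x = (\<Sum>e\<in>V. b e * (f x ^ (e d - k) * (\<Prod>i<d. q i x ^ e i)))" for x
 have R: "R \<in> poly_funs C" unfolding R_def[abs_def] by (intro poly_funs_intros f(1) q) simp
 have fR: "f x ^ k * R x = (\<Sum>e \<in> PiE {..d} (%_. {..n}). b e * (\<Prod>i\<le>d. G i x ^ e i))" for x
 proof -
  have "f x ^ k * R x = (\<Sum>e\<in>V. b e * (\<Prod>i\<le>d. G i x ^ e i))"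
   unfolding R_def sum_distrib_left
  proof (intro sum.cong refl)
   fix e assume "e \<in> V"
   have "(\<Prod>i\<le>d. G i x ^ e i) = (\<Prod>i<d. q i x ^ e i) * f x ^ e d"
    unfolding lessThan_Suc_atMost[symmetric] by (simp add: G_def)
   also have "f x ^ e d = f x ^ k * f x ^ (e d - k)"
    using k[OF \<open>e \<in> V\<close>] by (simp add: power_add[symmetric])
   finally show "f x ^ k * (b e * (f x ^ (e d - k) * (\<Prod>i<d. q i x ^ e i))) = b e * (\<Prod>i\<le>d. G i x ^ e i)"
    by (simp add: mult_ac)
  qed
  also have "... = (\<Sum>e \<in> PiE {..d} (%_. {..n}). b e * (\<Prod>i\<le>d. G i x ^ e i))"
   unfolding V_def by (intro sum.mono_neutral_left) (auto intro: finE)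
  finally show ?thesis .
 qed
 have "\<forall>x\<in>T. f x ^ k * R x = 0"
  using b(2) by (intro dense poly_funs_intros f R) (simp add: fR)
 then have "(\<forall>x\<in>T. f x ^ k = 0) \<or> (\<forall>x\<in>T. R x = 0)"
  by (intro zariski_primeD[OF prime poly_funs_power[OF f(1)] R]) blast
 then have "\<forall>x\<in>T. R x = 0" using nz by auto
 then have RS: "\<forall>x\<in>S. R x = 0" using ST R by blast
 define V0 where "V0 = {e \<in> V. e d = k}"
 have "(\<Sum>e\<in>V0. b e * (\<Prod>i<d. q i x ^ e i)) = 0" if "x \<in> S" for x
 proof -
  have "R x = (\<Sum>e\<in>V0. b e * (f x ^ (e d - k) * (\<Prod>i<d. q i x ^ e i)))"
   unfolding R_def
  proof (intro sum.mono_neutral_right)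
   show "\<forall>e\<in>V - V0. b e * (f x ^ (e d - k) * (\<Prod>i<d. q i x ^ e i)) = 0"
   proof
    fix e assume "e \<in> V - V0"
    then have "0 < e d - k" using k[of e] unfolding V0_def by auto
    then show "b e * (f x ^ (e d - k) * (\<Prod>i<d. q i x ^ e i)) = 0"
     using f(2) that by (simp add: zero_power)
   qed
  qed (use V(1) in \<open>auto simp: V0_def\<close>)
  also have "... = (\<Sum>e\<in>V0. b e * (\<Prod>i<d. q i x ^ e i))"
   by (intro sum.cong refl) (simp add: V0_def)
  finally show ?thesis using RS that by simp
 qed
 note rel = this
 have "b e0 = 0"
 proof (rule tangent_monomials_independent[where W = V0 and d = d and q = q and \<tau> = \<tau> and S = S and b = b and e = e0])
  show "finite V0" unfolding V0_def using V by simp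
  show "e = e'" if "e \<in> V0" "e' \<in> V0" "\<forall>i<d. e i = e' i" for e e'
  proof (rule PiE_ext[of e "{..d}" "%_. {..n}" e'])
   show "e \<in> PiE {..d} (%_. {..n})" "e' \<in> PiE {..d} (%_. {..n})"
    using that unfolding V0_def V_def by auto
   show "e i = e' i" if "i \<in> {..d}" for i
    using that \<open>e \<in> V0\<close> \<open>e' \<in> V0\<close> \<open>\<forall>i<d. e i = e' i\<close> unfolding V0_def by (cases "i = d") auto
  qed
  show "e0 \<in> V0" unfolding V0_def using e0 by simp
 qed (fact \<tau> lim rel)+
 then show False using e0 unfolding V_def by simp
qed

section \<open>Irreducible components from a finite cover\<close>

lemma irreducible_in_finite_union:
 assumes "irreducible_in X T" "finite I" "!!i. i \<in> I ==> closedin X (F i)" "T \<subseteq> (\<Union>i\<in>I. F i)"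
 shows "\<exists>i\<in>I. T \<subseteq> F i"
 using assms(2-4)
proof (induction I rule: finite_induct)
 case empty
 then show ?case using assms(1) unfolding irreducible_in_def by auto
next
 case (insert i I)
 have "closedin X (\<Union>i\<in>I. F i)" using insert by (intro closedin_Union) auto
 moreover have "closedin X (F i)" "T \<subseteq> F i \<union> (\<Union>i\<in>I. F i)" using insert by auto
 ultimately have "T \<subseteq> F i \<or> T \<subseteq> (\<Union>i\<in>I. F i)"
  using assms(1) unfolding irreducible_in_def by blast
 then show ?case using insert by auto
qed

text \<open>An irreducible set lies in one member of a finite closed cover, so the maximal irreducible sets are exactly
  the members as soon as these are irreducible and no member contains another.\<close>

lemma irreducible_components_eq_cover:
 assumes fin: "finite I" and closed: "!!i. i \<in> I ==> closedin X (F i)"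
  and irr: "!!i. i \<in> I ==> irreducible_in X (F i)"
  and cover: "topspace X \<subseteq> (\<Union>i\<in>I. F i)"
  and incomparable: "!!i j. i \<in> I ==> j \<in> I ==> F i \<subseteq> F j ==> F i = F j"
 shows "irreducible_components X = F ` I"
proof -
 have into: "\<exists>i\<in>I. T \<subseteq> F i" if T: "irreducible_in X T" for T
 proof -
  have "T \<subseteq> topspace X" using T unfolding irreducible_in_def by simp
  then have "T \<subseteq> (\<Union>i\<in>I. F i)" using cover by simp
  from irreducible_in_finite_union[OF T fin closed this] show ?thesis .
 qed
 show ?thesis
 proof (intro equalityI subsetI)
  fix T assume T: "T \<in> irreducible_components X"
  then have irrT: "irreducible_in X T" and maxT: "!!U. irreducible_in X U ==> T \<subseteq> U ==> U = T"
   unfolding irreducible_components_def by simp_all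
  obtain i where i: "i \<in> I" "T \<subseteq> F i" using into[OF irrT] by blast
  then have "F i = T" by (intro maxT irr)
  then show "T \<in> F ` I" using i(1) by blast
 next
  fix T assume "T \<in> F ` I"
  then obtain i where i: "i \<in> I" "T = F i" by blast
  have "U = F i" if U: "irreducible_in X U" "F i \<subseteq> U" for U
  proof -
   obtain j where j: "j \<in> I" "U \<subseteq> F j" using into[OF U(1)] by blast
   then have "F i \<subseteq> F j" using U(2) by simp
   then have "F i = F j" by (rule incomparable[OF i(1) j(1)])
   then show ?thesis using j U(2) by simp
  qed
  then show "T \<in> irreducible_components X"
   using i irr unfolding irreducible_components_def by simp
 qed
qed

section \<open>Maya diagrams\<close>

lemma initial_segment_card:
 fixes S :: "int set"
 assumes "finite S" "!!k. k \<in> S ==> a <= k" "!!k k'. k \<in> S ==> a <= k' ==> k' <= k ==> k' \<in> S"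
 shows "S = {a..<a + int (card S)}"
proof (cases "S = {}")
 case False
 define b where "b = Max S"
 have "b \<in> S" "!!k. k \<in> S ==> k <= b" unfolding b_def using assms(1) False by auto
 then have S: "S = {a..<b + 1}"
 proof (intro equalityI subsetI)
  fix k assume "k \<in> {a..<b + 1}"
  then show "k \<in> S" using assms(3)[OF \<open>b \<in> S\<close>, of k] by simp
 next
  fix k assume "k \<in> S"
  then show "k \<in> {a..<b + 1}" using assms(2)[of k] \<open>!!k. k \<in> S ==> k <= b\<close>[of k] by simp
 qed
 then have "card S = nat (b + 1 - a)" by simp
 moreover have "a <= b" using \<open>b \<in> S\<close> assms(2) by simp
 ultimately show ?thesis using S by simp
qed simp

lemma final_segment_card:
 fixes S :: "int set"
 assumes "finite S" "!!k. k \<in> S ==> k < a" "!!k k'. k \<in> S ==> k' < a ==> k <= k' ==> k' \<in> S"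
 shows "S = {a - int (card S)..<a}"
proof (cases "S = {}")
 case False
 define b where "b = Min S"
 have "b \<in> S" "!!k. k \<in> S ==> b <= k" unfolding b_def using assms(1) False by auto
 then have S: "S = {b..<a}"
 proof (intro equalityI subsetI)
  fix k assume "k \<in> {b..<a}"
  then show "k \<in> S" using assms(3)[OF \<open>b \<in> S\<close>, of k] by simp
 next
  fix k assume "k \<in> S"
  then show "k \<in> {b..<a}" using assms(2)[of k] \<open>!!k. k \<in> S ==> b <= k\<close>[of k] by simp
 qed
 then have "card S = nat (a - b)" by simp
 moreover have "b < a" using \<open>b \<in> S\<close> assms(2) by simp
 ultimately show ?thesis using S by simp
qed simp

lemma maya_diagramsD:
 assumes "m \<in> maya_diagrams \<gamma>"
 shows "bij m" "strict_mono_on {..<0} m" "strict_mono_on {0..} m" "has_charge m \<gamma>"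
 using assms unfolding maya_diagrams_def maya_def by auto

lemma charge_unique:
 assumes "has_charge m \<gamma>" "has_charge m \<gamma>'"
 shows "\<gamma> = \<gamma>'"
proof -
 obtain N N' where N: "\<forall>j. \<bar>j\<bar> \<ge> N --> m j - j = \<gamma>" "\<forall>j. \<bar>j\<bar> \<ge> N' --> m j - j = \<gamma>'"
  using assms unfolding has_charge_def by blast
 have "\<bar>max \<bar>N\<bar> \<bar>N'\<bar>\<bar> \<ge> N" "\<bar>max \<bar>N\<bar> \<bar>N'\<bar>\<bar> \<ge> N'" by linarith+
 with N show ?thesis by metis
qed

lemma charge_eq: "m \<in> maya_diagrams \<gamma> ==> charge m = \<gamma>"
 unfolding charge_def using maya_diagramsD(4) charge_unique by (intro the_equality) blast+

lemma maya_less_iff: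
 assumes m: "m \<in> maya_diagrams \<gamma>"
 shows "i < 0 ==> j < 0 ==> m i < m j \<longleftrightarrow> i < j"
  and "0 <= i ==> 0 <= j ==> m i < m j \<longleftrightarrow> i < j"
 using strict_mono_on_less[OF maya_diagramsD(2)[OF m]] strict_mono_on_less[OF maya_diagramsD(3)[OF m]] by auto

lemma maya_inj: "m \<in> maya_diagrams \<gamma> ==> m i = m j \<longleftrightarrow> i = j"
 using maya_diagramsD(1)[of m \<gamma>] by (auto simp: bij_def dest: injD)

text \<open>A bijection of the integers that is a shift by \<open>\<gamma>\<close> outside a bounded interval sends as many nonnegative
  numbers below a level \<open>n\<close> as the charge prescribes, up to the values that the negative numbers take above
  \<open>n\<close>.\<close>

lemma maya_balance:
 assumes m: "m \<in> maya_diagrams \<gamma>"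
 shows "finite {k. 0 <= k & m k <= n}" and "finite {j. j < 0 & n < m j}"
  and "int (card {k. 0 <= k & m k <= n}) - int (card {j. j < 0 & n < m j}) = n - \<gamma> + 1"
proof -
 obtain N where N: "!!j. \<bar>j\<bar> \<ge> N ==> m j = j + \<gamma>"
  using maya_diagramsD(4)[OF m] unfolding has_charge_def by (metis add.commute diff_eq_eq)
 define R where "R = max \<bar>N\<bar> (\<bar>n - \<gamma>\<bar> + 1)"
 have R: "N <= R" "n - \<gamma> < R" "- R <= n - \<gamma>" "0 <= R" unfolding R_def by linarith+
 have out: "m j = j + \<gamma>" if "j < -R \<or> R <= j" for j using N[of j] that R by linarith
 have "m ` (- {-R..<R}) = - {\<gamma> - R..<\<gamma> + R}"
 proof (intro equalityI subsetI)
  fix x assume "x \<in> - {\<gamma> - R..<\<gamma> + R}"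
  then have "m (x - \<gamma>) = x" "x - \<gamma> \<in> - {-R..<R}" using out[of "x - \<gamma>"] by auto
  then show "x \<in> m ` (- {-R..<R})" by (metis imageI)
 qed (use out in auto)
 then have im: "m ` {-R..<R} = {\<gamma> - R..<\<gamma> + R}"
  using bij_image_Compl_eq[OF maya_diagramsD(1)[OF m], of "{-R..<R}"] by simp
 define A where "A = {k. 0 <= k & m k <= n}"
 define B where "B = {j. j < 0 & n < m j}"
 have A: "A \<subseteq> {0..<R}"
 proof
  fix k assume "k \<in> A"
  then have k: "0 <= k" "m k <= n" unfolding A_def by auto
  then have "k < R" using out[of k] R by linarith
  then show "k \<in> {0..<R}" using k by simp
 qed
 have B: "B \<subseteq> {-R..<0}"
 proof
  fix j assume "j \<in> B"
  then have j: "j < 0" "n < m j" unfolding B_def by auto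
  then have "- R <= j" using out[of j] R by linarith
  then show "j \<in> {-R..<0}" using j by simp
 qed
 show "finite {k. 0 <= k & m k <= n}" "finite {j. j < 0 & n < m j}"
  using finite_subset[OF A] finite_subset[OF B] unfolding A_def B_def by auto
 have fin: "finite A" "finite B" using finite_subset[OF A] finite_subset[OF B] by auto
 have "m ` (A \<union> ({-R..<0} - B)) = {\<gamma> - R..n}"
 proof (intro equalityI subsetI)
  fix x assume "x \<in> {\<gamma> - R..n}"
  then have "x \<in> m ` {-R..<R}" unfolding im using R by auto
  then obtain j where "j \<in> {-R..<R}" "x = m j" by blast
  then show "x \<in> m ` (A \<union> ({-R..<0} - B))" using \<open>x \<in> {\<gamma> - R..n}\<close>
   unfolding A_def B_def by (cases "0 <= j") auto
 next
  fix x assume "x \<in> m ` (A \<union> ({-R..<0} - B))"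
  then obtain j where j: "j \<in> A \<union> ({-R..<0} - B)" "x = m j" by blast
  then have "j \<in> {-R..<R}" using A R by auto
  then have "x \<in> {\<gamma> - R..<\<gamma> + R}" using im j by blast
  moreover have "x <= n" using j unfolding A_def B_def by auto
  ultimately show "x \<in> {\<gamma> - R..n}" by simp
 qed
 moreover have "inj_on m (A \<union> ({-R..<0} - B))" using maya_inj[OF m] by (simp add: inj_on_def)
 ultimately have "card (A \<union> ({-R..<0} - B)) = card {\<gamma> - R..n}" by (metis card_image)
 moreover have "card (A \<union> ({-R..<0} - B)) = card A + card ({-R..<0} - B)"
  by (rule card_Un_disjoint) (use fin in \<open>auto simp: A_def\<close>)
 moreover have "int (card ({-R..<0} - B)) = R - int (card B)"
  using card_Diff_subset[OF fin(2) B] card_mono[OF _ B] R by simp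
 ultimately have "int (card A) - int (card B) = n - \<gamma> + 1" using R by simp
 then show "int (card {k. 0 <= k & m k <= n}) - int (card {j. j < 0 & n < m j}) = n - \<gamma> + 1"
  unfolding A_def B_def .
qed

lemma maya_column:
 assumes m: "m \<in> maya_diagrams \<gamma>" and "0 <= k"
 shows "{j. j < 0 & m k < m j} = {m k - \<gamma> - k..<0}" and "m k <= \<gamma> + k"
proof -
 have "{k'. 0 <= k' & m k' <= m k} = {0..k}"
  using maya_less_iff(2)[OF m \<open>0 <= k\<close>] \<open>0 <= k\<close> by (auto simp: not_less[symmetric])
 then have c: "int (card {j. j < 0 & m k < m j}) = \<gamma> + k - m k"
  using maya_balance(3)[OF m, of "m k"] \<open>0 <= k\<close> by simp
 then show "m k <= \<gamma> + k" by linarith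
 have "{j. j < 0 & m k < m j} = {0 - int (card {j. j < 0 & m k < m j})..<0}"
 proof (rule final_segment_card)
  show "j' \<in> {j. j < 0 & m k < m j}" if "j \<in> {j. j < 0 & m k < m j}" "j' < 0" "j <= j'" for j j'
   using that maya_less_iff(1)[OF m, of j j'] by (cases "j = j'") auto
 qed (use maya_balance(2)[OF m] in auto)
 then show "{j. j < 0 & m k < m j} = {m k - \<gamma> - k..<0}" unfolding c by (simp add: algebra_simps)
qed

text \<open>The values of \<open>m\<close> on negative arguments are the labels of the vertical edges of the boundary path. The
  number of columns crossing the row of \<open>j\<close>, that is the length of this row, is read off from \<open>m j\<close>.\<close>

lemma maya_row:
 assumes m: "m \<in> maya_diagrams \<gamma>" and "j < 0"
 shows "{k. 0 <= k & m k < m j} = {0..<m j - \<gamma> - j}" and "\<gamma> + j <= m j"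
proof -
 have "{j'. j' < 0 & m j < m j'} = {j<..<0}"
  using maya_less_iff(1)[OF m \<open>j < 0\<close>] by auto
 moreover have eq: "{k. 0 <= k & m k <= m j} = {k. 0 <= k & m k < m j}"
  using maya_inj[OF m] \<open>j < 0\<close> by (auto simp: order_less_le)
 ultimately have c: "int (card {k. 0 <= k & m k < m j}) = m j - \<gamma> - j"
  using maya_balance(3)[OF m, of "m j"] \<open>j < 0\<close> by simp
 then show "\<gamma> + j <= m j" by linarith
 have "{k. 0 <= k & m k < m j} = {0..<0 + int (card {k. 0 <= k & m k < m j})}"
 proof (rule initial_segment_card)
  show "finite {k. 0 <= k & m k < m j}" using maya_balance(1)[OF m, of "m j"] eq by simp
  show "k' \<in> {k. 0 <= k & m k < m j}" if "k \<in> {k. 0 <= k & m k < m j}" "0 <= k'" "k' <= k" for k k'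
   using that maya_less_iff(2)[OF m, of k' k] by (cases "k = k'") auto
 qed auto
 then show "{k. 0 <= k & m k < m j} = {0..<m j - \<gamma> - j}" unfolding c by simp
qed

text \<open>A box of the Young diagram is seen equally from its row and from its column; this is conjugation of
  partitions in terms of the two halves of \<open>m\<close>.\<close>

lemma maya_box:
 assumes m: "m \<in> maya_diagrams \<gamma>" and "j < 0" "0 <= k"
 shows "k < m j - \<gamma> - j \<longleftrightarrow> m k - \<gamma> - k <= j"
proof -
 have "k < m j - \<gamma> - j \<longleftrightarrow> m k < m j"
  using maya_row(1)[OF m \<open>j < 0\<close>] \<open>0 <= k\<close> by (auto simp: set_eq_iff)
 also have "... \<longleftrightarrow> m k - \<gamma> - k <= j"
  using maya_column(1)[OF m \<open>0 <= k\<close>] \<open>j < 0\<close> by (auto simp: set_eq_iff)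
 finally show ?thesis .
qed

lemma young_diagram_eqI:
 assumes Y: "young_diagram Y" and Y': "young_diagram Y'"
  and eq: "!!k. card {i. i < length Y & k + 1 <= Y ! i} = card {i. i < length Y' & k + 1 <= Y' ! i}"
 shows "Y = Y'"
proof -
 have initial: "i < length Z & k + 1 <= Z ! i \<longleftrightarrow> i < card {i. i < length Z & k + 1 <= Z ! i}"
  if Z: "young_diagram Z" for Z i k
 proof -
  define S where "S = int ` {i. i < length Z & k + 1 <= Z ! i}"
  have "S = {0..<0 + int (card S)}"
  proof (rule initial_segment_card)
   fix x y assume "x \<in> S" "0 <= y" "y <= x"
   then obtain a where a: "x = int a" "a < length Z" "k + 1 <= Z ! a" unfolding S_def by blast
   have "Z ! a <= Z ! nat y"
    using Z a \<open>y <= x\<close> \<open>0 <= y\<close> unfolding young_diagram_def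
    by (cases "nat y = a") (auto intro: sorted_wrt_nth_less[of "(\<ge>)" Z])
   then have "nat y < length Z & k + 1 <= Z ! nat y" using a \<open>y <= x\<close> \<open>0 <= y\<close> by linarith
   then show "y \<in> S" unfolding S_def using \<open>0 <= y\<close> by (intro image_eqI[of _ _ "nat y"]) auto
  qed (auto simp: S_def)
  from eqset_imp_iff[OF this, of "int i"] have "int i \<in> S \<longleftrightarrow> int i < int (card S)" by simp
  moreover have "card S = card {i. i < length Z & k + 1 <= Z ! i}"
   unfolding S_def by (intro card_image) auto
  ultimately show ?thesis unfolding S_def by auto
 qed
 have iff: "i < length Y & k + 1 <= Y ! i \<longleftrightarrow> i < length Y' & k + 1 <= Y' ! i" for i k
  using initial[OF Y, of i k] initial[OF Y', of i k] eq[of k] by simp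
 have pos: "i < length Z \<longleftrightarrow> i < length Z & 0 + 1 <= Z ! i" if "young_diagram Z" for Z i
 proof -
  have "0 < Z ! i" if "i < length Z"
   using \<open>young_diagram Z\<close> nth_mem[OF that] unfolding young_diagram_def by blast
  then show ?thesis by (auto simp: Suc_le_eq)
 qed
 have len: "i < length Y \<longleftrightarrow> i < length Y'" for i
  using iff[of i 0] pos[OF Y, of i] pos[OF Y', of i] by simp
 then have "length Y = length Y'" by (metis linorder_neqE_nat less_irrefl)
 moreover have "Y ! i = Y' ! i" if "i < length Y" for i
 proof (rule antisym)
  show "Y ! i <= Y' ! i" using iff[of i "Y ! i - 1"] that len[of i] by (cases "Y ! i") auto
  show "Y' ! i <= Y ! i" using iff[of i "Y' ! i - 1"] that len[of i] by (cases "Y' ! i") auto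
 qed
 ultimately show ?thesis by (rule nth_equalityI)
qed

text \<open>The rows of the Young diagram are the excesses \<open>m (- 1 - i) + 1 + i - \<gamma>\<close>, which follows by comparing column
  heights on both sides.\<close>

lemma young_of_maya:
 assumes m: "m \<in> maya_diagrams \<gamma>"
 shows "young_of m = map (%i. nat (m (- 1 - int i) + 1 + int i - \<gamma>)) [0..<nat (\<gamma> - m 0)]"
  (is "_ = ?Y")
proof -
 have len: "length ?Y = nat (\<gamma> - m 0)" by simp
 have nthY: "?Y ! i = nat (m (- 1 - int i) - \<gamma> - (- 1 - int i))" if "i < nat (\<gamma> - m 0)" for i
  using that by (simp add: algebra_simps)
 have "young_diagram ?Y"
  unfolding young_diagram_def
 proof
  show "sorted_wrt (\<ge>) ?Y"
   unfolding sorted_wrt_iff_nth_less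
  proof (intro allI impI)
   fix i j assume ij: "i < j" "j < length ?Y"
   have "m (- 1 - int j) + int j <= m (- 1 - int i) + int i"
    using Suc_leI[OF ij(1)]
   proof (induction j rule: dec_induct)
    case base
    then show ?case using maya_less_iff(1)[OF m, of "- 1 - int (Suc i)" "- 1 - int i"] by simp
   next
    case (step n)
    then show ?case using maya_less_iff(1)[OF m, of "- 1 - int (Suc n)" "- 1 - int n"] by simp
   qed
   then show "?Y ! j <= ?Y ! i" using ij nthY[of i] nthY[of j] by simp
  qed
  show "\<forall>l\<in>set ?Y. 0 < l"
  proof
   fix l assume "l \<in> set ?Y"
   then obtain i where i: "i < nat (\<gamma> - m 0)" "l = ?Y ! i" by (auto simp: in_set_conv_nth)
   then show "0 < l" using nthY[OF i(1)] maya_box[OF m, of "- 1 - int i" 0] by simp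
  qed
 qed
 moreover have "m (int k) = charge m + int k - int (card {i. i < length ?Y & ?Y ! i \<ge> k + 1})" for k :: nat
 proof -
  have "{i. i < length ?Y & ?Y ! i \<ge> k + 1} = {i. int i < \<gamma> + int k - m (int k)}"
  proof (rule Collect_cong)
   fix i
   have box: "int k < m (- 1 - int i) - \<gamma> - (- 1 - int i) \<longleftrightarrow> int i < \<gamma> + int k - m (int k)"
    using maya_box[OF m, of "- 1 - int i" "int k"] by auto
   have "i < nat (\<gamma> - m 0)" if "int i < \<gamma> + int k - m (int k)"
    using that box maya_box[OF m, of "- 1 - int i" 0] by auto
   then show "(i < length ?Y & ?Y ! i \<ge> k + 1) = (int i < \<gamma> + int k - m (int k))"
    unfolding len using nthY[of i] box by (cases "i < nat (\<gamma> - m 0)") auto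
  qed
  also have "... = {..<nat (\<gamma> + int k - m (int k))}" by auto
  finally show ?thesis using maya_column(2)[OF m, of "int k"] charge_eq[OF m] by simp
 qed
 ultimately show ?thesis
  unfolding young_of_def
 proof (intro the_equality conjI allI)
  fix Y
  assume col: "!!k. m (int k) = charge m + int k - int (card {i. i < length ?Y & ?Y ! i \<ge> k + 1})"
   and Y0: "young_diagram ?Y"
  assume Y: "young_diagram Y &
    (\<forall>k. m (int k) = charge m + int k - int (card {i. i < length Y & k + 1 <= Y ! i}))"
  show "Y = ?Y"
  proof (rule young_diagram_eqI)
   fix k
   have "int (card {i. i < length Y & k + 1 <= Y ! i}) = int (card {i. i < length ?Y & k + 1 <= ?Y ! i})"
    using Y[THEN conjunct2, rule_format, of k] col[of k] by linarith
   then show "card {i. i < length Y & k + 1 <= Y ! i} = card {i. i < length ?Y & k + 1 <= ?Y ! i}" by simp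
  qed (use Y Y0 in auto)
 qed auto
qed

text \<open>The segment attached to the row that starts at \<open>k'\<close> ends at the value of \<open>m\<close> at \<open>k' - \<gamma> - 1\<close>. So the
  multisegment of a Maya diagram is the graph of its negative half, restricted to nonempty segments.\<close>

lemma young_segs_maya:
 assumes m: "m \<in> maya_diagrams \<gamma>"
 shows "young_segs (charge m) (young_of m) =
  {(k', k). k' <= \<gamma> & k = m (k' - \<gamma> - 1) & k' <= k}"
proof -
 let ?s = "nat (\<gamma> - m 0)"
 have "young_segs (charge m) (young_of m) = (%i. (\<gamma> + 1 - int i, m (- int i))) ` {1..?s}"
  unfolding young_segs_def charge_eq[OF m] young_of_maya[OF m]
 proof (rule image_cong)
  fix i assume i: "i \<in> {1..?s}"
  have "\<gamma> + (- int i) <= m (- int i)" using maya_row(2)[OF m, of "- int i"] i by simp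
  then show "(\<gamma> + 1 - int i, \<gamma> + int (map (%i. nat (m (- 1 - int i) + 1 + int i - \<gamma>)) [0..<?s] ! (i - 1)) - int i)
    = (\<gamma> + 1 - int i, m (- int i))"
   using i by (cases i) auto
 qed simp
 also have "... = {(k', k). k' <= \<gamma> & k = m (k' - \<gamma> - 1) & k' <= k}"
 proof (intro equalityI subsetI)
  fix z assume "z \<in> (%i. (\<gamma> + 1 - int i, m (- int i))) ` {1..?s}"
  then obtain i where i: "i \<in> {1..?s}" "z = (\<gamma> + 1 - int i, m (- int i))" by blast
  then show "z \<in> {(k', k). k' <= \<gamma> & k = m (k' - \<gamma> - 1) & k' <= k}"
   using maya_box[OF m, of "- int i" 0] by auto
 next
  fix z assume "z \<in> {(k', k). k' <= \<gamma> & k = m (k' - \<gamma> - 1) & k' <= k}"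
  then obtain k' where k': "z = (k', m (k' - \<gamma> - 1))" "k' <= \<gamma>" "k' <= m (k' - \<gamma> - 1)" by auto
  then have "nat (\<gamma> + 1 - k') \<in> {1..?s}" using maya_box[OF m, of "k' - \<gamma> - 1" 0] by auto
  moreover have "z = (\<gamma> + 1 - int (nat (\<gamma> + 1 - k')), m (- int (nat (\<gamma> + 1 - k'))))"
   using k' by (simp add: diff_diff_eq)
  ultimately show "z \<in> (%i. (\<gamma> + 1 - int i, m (- int i))) ` {1..?s}" by blast
 qed
 finally show ?thesis .
qed

lemma maya_eqI:
 assumes m: "m \<in> maya_diagrams \<gamma>" and m': "m' \<in> maya_diagrams \<gamma>"
  and eq: "!!j. j < 0 ==> m j = m' j"
 shows "m = m'"
proof
 fix k
 show "m k = m' k"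
 proof (cases "k < 0")
  case False
  then have k: "0 <= k" by simp
  have "m k - \<gamma> - k <= j \<longleftrightarrow> m' k - \<gamma> - k <= j" if "j < 0" for j
   using maya_box[OF m that k] maya_box[OF m' that k] eq[OF that] by simp
  note iff = this
  have "m k - \<gamma> - k <= 0" "m' k - \<gamma> - k <= 0" using maya_column(2)[OF m k] maya_column(2)[OF m' k] by auto
  then have "m k - \<gamma> - k = m' k - \<gamma> - k"
   using iff[of "m k - \<gamma> - k"] iff[of "m' k - \<gamma> - k"] by linarith
  then show ?thesis by simp
 qed (use eq in simp)
qed

text \<open>Every strictly increasing sequence of row ends that is eventually trivial comes from a Maya diagram; the
  nonnegative half consists of the values that are missed, which the column heights describe.\<close>

lemma maya_exists:
 fixes T :: "int => int"
 assumes step: "!!i. i < \<gamma> ==> T i < T (i + 1)" and ge: "!!i. i <= \<gamma> ==> i - 1 <= T i"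
  and low: "!!i. i <= B ==> T i = i - 1"
 shows "\<exists>m \<in> maya_diagrams \<gamma>. \<forall>i \<le> \<gamma>. m (i - \<gamma> - 1) = T i"
proof -
 define L where "L j = T (\<gamma> + 1 + j) - \<gamma> - j" for j
 have Lstep: "L j <= L (j + 1)" if "j < -1" for j
  using step[of "\<gamma> + 1 + j"] that unfolding L_def by (simp add: algebra_simps)
 have Lmono: "L j <= L j'" if "j <= j'" "j' < 0" for j j'
  using that
 proof (induction j' rule: int_ge_induct)
  case (step i)
  then show ?case using Lstep[of i] by simp
 qed simp
 have L0: "0 <= L j" if "j < 0" for j using ge[of "\<gamma> + 1 + j"] that unfolding L_def by simp
 have Llow: "L j = 0" if "j <= B - \<gamma> - 1" for j using low[of "\<gamma> + 1 + j"] that unfolding L_def by simp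
 define D where "D k = {j. j < 0 & k < L j}" for k
 have D_sub: "D k \<subseteq> {B - \<gamma> - 1..<0}" if "0 <= k" for k
 proof
  fix j assume "j \<in> D k"
  then have j: "j < 0" "k < L j" unfolding D_def by auto
  then have "B - \<gamma> - 1 < j" using Llow[of j] that by linarith
  then show "j \<in> {B - \<gamma> - 1..<0}" using j by simp
 qed
 have finD: "finite (D k)" if "0 <= k" for k using D_sub[OF that] by (rule finite_subset) simp
 have Dseg: "D k = {- int (card (D k))..<0}" if "0 <= k" for k
 proof -
  have "D k = {0 - int (card (D k))..<0}"
   by (rule final_segment_card) (use finD[OF that] Lmono in \<open>auto simp: D_def intro: less_le_trans\<close>)
  then show ?thesis by simp
 qed
 have Diff: "k < L j \<longleftrightarrow> - int (card (D k)) <= j" if "0 <= k" "j < 0" for k j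
  using eqset_imp_iff[OF Dseg[OF that(1)], of j] that(2) unfolding D_def by simp
 define m where "m j = (if j < 0 then T (\<gamma> + 1 + j) else \<gamma> + j - int (card (D j)))" for j
 have mneg: "m j = \<gamma> + j + L j" if "j < 0" for j using that unfolding m_def L_def by simp
 have mpos: "m k = \<gamma> + k - int (card (D k))" if "0 <= k" for k using that unfolding m_def by simp
 have strict1: "strict_mono_on {..<0} m"
 proof (intro strict_mono_onI)
  fix j j' :: int assume "j \<in> {..<0}" "j' \<in> {..<0}" "j < j'"
  then show "m j < m j'" using Lmono[of j j'] by (simp add: mneg)
 qed
 have strict2: "strict_mono_on {0..} m"
 proof (intro strict_mono_onI)
  fix k k' :: int assume k: "k \<in> {0..}" "k' \<in> {0..}" "k < k'"
  then have "D k' \<subseteq> D k" unfolding D_def by auto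
  then have "card (D k') <= card (D k)" using finD k by (intro card_mono) auto
  then show "m k < m k'" using k by (simp add: mpos)
 qed
 have cross: "m j ~= m k" if "j < 0" "0 <= k" for j k
  using Diff[OF that(2,1)] that by (auto simp: mneg mpos)
 have "inj m"
 proof (rule injI)
  fix x y assume eq: "m x = m y"
  show "x = y"
  proof (cases "x < 0"; cases "y < 0")
   assume "x < 0" "y < 0"
   then show ?thesis using strict_mono_on_eqD[OF strict1 eq] by auto
  next
   assume "\<not> x < 0" "\<not> y < 0"
   then show ?thesis using strict_mono_on_eqD[OF strict2 eq] by auto
  qed (use eq cross[of x y] cross[of y x] in auto)
 qed
 moreover have "\<exists>j. m j = n" for n
 proof -
  define S where "S = {j. j < 0 & n <= m j}"
  have "S \<subseteq> {min (B - \<gamma> - 1) (n - \<gamma>)..<0}"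
  proof
   fix j assume j: "j \<in> S"
   then have "j <= B - \<gamma> - 1 ==> n - \<gamma> <= j" using Llow[of j] mneg[of j] unfolding S_def by simp
   then have "min (B - \<gamma> - 1) (n - \<gamma>) <= j" by linarith
   then show "j \<in> {min (B - \<gamma> - 1) (n - \<gamma>)..<0}" using j unfolding S_def by auto
  qed
  then have "finite S" by (rule finite_subset) simp
  then have S: "S = {0 - int (card S)..<0}"
   using strict_mono_on_leD[OF strict1]
   by (intro final_segment_card) (auto simp: S_def intro: order_trans)
  define c where "c = int (card S)"
  have inS: "n <= m j \<longleftrightarrow> - c <= j" if "j < 0" for j
  proof -
   have "j \<in> S \<longleftrightarrow> - c <= j" using eqset_imp_iff[OF S, of j] that unfolding c_def by simp
   then show ?thesis using that unfolding S_def by simp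
  qed
  show ?thesis
  proof (cases "c > 0 & m (- c) = n")
   case False
   define k where "k = n - \<gamma> + c"
   have c0: "0 <= c" unfolding c_def by simp
   have "\<not> n <= m (- c - 1)" using inS[of "- c - 1"] c0 by simp
   then have L1: "L (- c - 1) <= k" using c0 unfolding k_def by (simp add: mneg)
   then have k0: "0 <= k" using L0[of "- c - 1"] c0 by simp
   have "int (card (D k)) <= c" using Diff[OF k0, of "- c - 1"] L1 c0 by simp
   moreover have "c <= int (card (D k))"
   proof (cases "c = 0")
    case False
    then have "c > 0" using c0 by simp
    then have "n < m (- c)" using inS[of "- c"] \<open>\<not> (c > 0 & m (- c) = n)\<close> by simp
    then have "k < L (- c)" using \<open>c > 0\<close> unfolding k_def by (simp add: mneg)
    then show ?thesis using Diff[OF k0, of "- c"] \<open>c > 0\<close> by simp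
   qed simp
   ultimately have "m k = n" using mpos[OF k0] unfolding k_def by simp
   then show ?thesis by blast
  qed blast
 qed
 ultimately have "bij m" unfolding bij_def surj_def by (metis)
 moreover have "has_charge m \<gamma>"
  unfolding has_charge_def
 proof (intro exI allI impI)
  fix j assume j: "max (\<bar>L (-1)\<bar> + 1) (\<bar>B - \<gamma> - 1\<bar> + 1) <= \<bar>j\<bar>"
  show "m j - j = \<gamma>"
  proof (cases "j < 0")
   case True
   then have "j <= B - \<gamma> - 1" using j by linarith
   then show ?thesis using Llow True by (simp add: mneg)
  next
   case False
   then have "L (-1) <= j" "0 <= j" using j by linarith+
   have "\<not> j < L i" if "i < 0" for i
    using Lmono[of i "-1"] \<open>L (-1) <= j\<close> that by simp
   then have "D j = {}" unfolding D_def by blast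
   then show ?thesis using \<open>0 <= j\<close> by (simp add: mpos)
  qed
 qed
 ultimately have "m \<in> maya_diagrams \<gamma>"
  unfolding maya_diagrams_def maya_def using strict1 strict2 by blast
 moreover have "m (i - \<gamma> - 1) = T i" if "i <= \<gamma>" for i using that unfolding m_def by simp
 ultimately show ?thesis by blast
qed

text \<open>Containment of infinite Young diagrams may be tested on rows as well as on columns. The rows between \<open>\<gamma>\<close> and
  \<open>\<gamma>'\<close> are present only on one side, which is why the charges have to be ordered.\<close>

lemma maya_le_iff_rows:
 assumes m: "m \<in> maya_diagrams \<gamma>" and m': "m' \<in> maya_diagrams \<gamma>'" and "\<gamma> <= \<gamma>'"
 shows "maya_le m m' \<longleftrightarrow> (\<forall>i \<le> \<gamma>. m' (i - \<gamma>' - 1) <= m (i - \<gamma> - 1))"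
proof
 assume le: "maya_le m m'"
 show "\<forall>i \<le> \<gamma>. m' (i - \<gamma>' - 1) <= m (i - \<gamma> - 1)"
 proof (intro allI impI, rule ccontr)
  fix i assume i: "i <= \<gamma>" and "\<not> m' (i - \<gamma>' - 1) <= m (i - \<gamma> - 1)"
  define k where "k = m (i - \<gamma> - 1) - i + 1"
  have k: "0 <= k" using maya_row(2)[OF m, of "i - \<gamma> - 1"] i unfolding k_def by simp
  have "\<not> m k - \<gamma> - k <= i - \<gamma> - 1"
   using maya_box[OF m _ k, of "i - \<gamma> - 1"] i by (simp add: k_def)
  moreover have "m' k - \<gamma>' - k <= i - \<gamma>' - 1"
   using maya_box[OF m' _ k, of "i - \<gamma>' - 1"] i \<open>\<gamma> <= \<gamma>'\<close> \<open>\<not> m' (i - \<gamma>' - 1) <= _\<close> by (simp add: k_def)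
  ultimately have "m' k < m k" by simp
  then show False using le k unfolding maya_le_def by (simp add: not_less[symmetric])
 qed
next
 assume rows: "\<forall>i \<le> \<gamma>. m' (i - \<gamma>' - 1) <= m (i - \<gamma> - 1)"
 show "maya_le m m'"
  unfolding maya_le_def
 proof (intro allI impI, rule ccontr)
  fix k :: int assume k: "0 <= k" and "\<not> m k <= m' k"
  define i where "i = m' k - k + 1"
  have i: "i <= \<gamma>" using maya_column(2)[OF m k] \<open>\<not> m k <= m' k\<close> unfolding i_def by simp
  have "k < m' (i - \<gamma>' - 1) - \<gamma>' - (i - \<gamma>' - 1)"
   using maya_box[OF m' _ k, of "i - \<gamma>' - 1"] i \<open>\<gamma> <= \<gamma>'\<close> by (simp add: i_def)
  moreover have "\<not> k < m (i - \<gamma> - 1) - \<gamma> - (i - \<gamma> - 1)"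
   using maya_box[OF m _ k, of "i - \<gamma> - 1"] i \<open>\<not> m k <= m' k\<close> by (simp add: i_def)
  ultimately show False using rows i by fastforce
 qed
qed

section \<open>Tuples of Maya diagrams and multisegments\<close>

text \<open>The last vertex of the segment that starts at \<open>i\<close> in the \<open>a\<close>-th diagram; the segment is empty if the value
  is \<open>i - 1\<close>, and meaningful only for \<open>i \<le> \<gamma>s ! a\<close>.\<close>

definition row_end :: "int list => (int => int) list => nat => int => int" where
 "row_end \<gamma>s M a i = (M ! a) (i - \<gamma>s ! a - 1)"

definition tail_count :: "(int \<times> int => nat) => int => int => nat" where
 "tail_count f i k = (\<Sum>z | f z ~= 0 & fst z = i & k <= snd z. f z)"

text \<open>The combinatorial shape of stability. The segments starting at \<open>i\<close> and reaching at least \<open>k\<close> must be matched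
  injectively either with segments starting at \<open>i + 1\<close> and reaching at least \<open>k + 1\<close> or with the \<open>w i\<close> basis
  vectors of the framing at \<open>i\<close>; the inequality is the corresponding counting condition.\<close>

definition chainable :: "(int => nat) => (int \<times> int => nat) => bool" where
 "chainable w f \<longleftrightarrow> (\<forall>i k. i <= k --> tail_count f i k <= w i + tail_count f (i + 1) (k + 1))"

lemma maya_tuplesD:
 assumes "M \<in> maya_tuples \<gamma>s"
 shows "length M = length \<gamma>s" "!!a. a < length \<gamma>s ==> M ! a \<in> maya_diagrams (\<gamma>s ! a)"
 using assms unfolding maya_tuples_def by (auto simp: list_all2_conv_all_nth)

lemma row_end_facts:
 assumes M: "M \<in> maya_tuples \<gamma>s" and a: "a < length \<gamma>s"
 shows "i < \<gamma>s ! a ==> row_end \<gamma>s M a i < row_end \<gamma>s M a (i + 1)"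
  and "i <= \<gamma>s ! a ==> i - 1 <= row_end \<gamma>s M a i"
 using maya_less_iff(1)[OF maya_tuplesD(2)[OF M a], of "i - \<gamma>s ! a - 1" "i - \<gamma>s ! a"]
  maya_row(2)[OF maya_tuplesD(2)[OF M a], of "i - \<gamma>s ! a - 1"]
 unfolding row_end_def by simp_all

lemma finite_young_segs: "finite (young_segs \<gamma> Y)"
 unfolding young_segs_def by simp

lemma tuple_fun_eq:
 assumes M: "M \<in> maya_tuples \<gamma>s"
 shows "tuple_fun M z =
  card {a. a < length \<gamma>s & fst z <= \<gamma>s ! a & snd z = row_end \<gamma>s M a (fst z) & fst z <= snd z}"
proof -
 let ?S = "%a. young_segs (charge (M ! a)) (young_of (M ! a))"
 have "tuple_segs M = (\<Sum>a<length \<gamma>s. mset_set (?S a))"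
  unfolding tuple_segs_def sum_list_sum_nth using maya_tuplesD(1)[OF M]
  by (simp add: atLeast0LessThan)
 then have "tuple_fun M z = (\<Sum>a<length \<gamma>s. count (mset_set (?S a)) z)"
  unfolding tuple_fun_def by (simp add: count_sum)
 also have "... = (\<Sum>a<length \<gamma>s. if z \<in> ?S a then 1 else 0)"
  by (intro sum.cong refl) (simp add: finite_young_segs)
 also have "... = card {a \<in> {..<length \<gamma>s}. z \<in> ?S a}"
  by (simp add: sum.If_cases Int_def)
 also have "{a \<in> {..<length \<gamma>s}. z \<in> ?S a} =
   {a. a < length \<gamma>s & fst z <= \<gamma>s ! a & snd z = row_end \<gamma>s M a (fst z) & fst z <= snd z}"
  using young_segs_maya[OF maya_tuplesD(2)[OF M]] unfolding row_end_def
  by (cases z) auto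
 finally show ?thesis .
qed

lemma tuple_fun_in_Zt_inf:
 assumes M: "M \<in> maya_tuples \<gamma>s"
 shows "tuple_fun M \<in> Zt_inf"
proof -
 have "finite {z. tuple_fun M z ~= 0}"
 proof -
  have "{z. tuple_fun M z ~= 0} = set_mset (tuple_segs M)"
   unfolding tuple_fun_def by (auto simp: not_in_iff)
  then show ?thesis by simp
 qed
 moreover have "{z. tuple_fun M z ~= 0} \<subseteq> Z_inf"
 proof
  fix z assume "z \<in> {z. tuple_fun M z ~= 0}"
  then have "{a. a < length \<gamma>s & fst z <= \<gamma>s ! a & snd z = row_end \<gamma>s M a (fst z) & fst z <= snd z} ~= {}"
   unfolding tuple_fun_eq[OF M] mem_Collect_eq by (intro notI) simp
  then show "z \<in> Z_inf" unfolding Z_inf_def by (cases z) auto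
 qed
 ultimately show ?thesis unfolding Zt_inf_def by blast
qed

lemma tail_count_tuple_fun:
 assumes M: "M \<in> maya_tuples \<gamma>s" and "i <= k"
 shows "tail_count (tuple_fun M) i k =
  card {a. a < length \<gamma>s & i <= \<gamma>s ! a & k <= row_end \<gamma>s M a i}"
proof -
 let ?A = "%z. {a. a < length \<gamma>s & fst z <= \<gamma>s ! a & snd z = row_end \<gamma>s M a (fst z) & fst z <= snd z}"
 let ?Z = "{z. tuple_fun M z ~= 0 & fst z = i & k <= snd z}"
 have "finite ?Z" using tuple_fun_in_Zt_inf[OF M] unfolding Zt_inf_def by simp
 then have "card (\<Union>z\<in>?Z. ?A z) = (\<Sum>z\<in>?Z. card (?A z))"
  by (intro card_UN_disjoint) (auto simp: prod_eq_iff)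
 then have "tail_count (tuple_fun M) i k = card (\<Union>z\<in>?Z. ?A z)"
  unfolding tail_count_def tuple_fun_eq[OF M] by simp
 also have "(\<Union>z\<in>?Z. ?A z) = {a. a < length \<gamma>s & i <= \<gamma>s ! a & k <= row_end \<gamma>s M a i}"
 proof (intro equalityI subsetI)
  fix a assume a: "a \<in> {a. a < length \<gamma>s & i <= \<gamma>s ! a & k <= row_end \<gamma>s M a i}"
  define z where "z = (i, row_end \<gamma>s M a i)"
  have "a \<in> ?A z" using a \<open>i <= k\<close> unfolding z_def by auto
  moreover have "finite (?A z)" by simp
  ultimately have "card (?A z) ~= 0" using card_0_eq by blast
  then have "z \<in> ?Z" using a unfolding tuple_fun_eq[OF M] z_def by simp
  then show "a \<in> (\<Union>z\<in>?Z. ?A z)" using \<open>a \<in> ?A z\<close> by blast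
 qed auto
 finally show ?thesis .
qed

text \<open>Within one diagram the segment starting at \<open>i < \<gamma>\<close> is followed by a strictly longer-reaching one starting at
  \<open>i + 1\<close>, and the last one, starting at \<open>\<gamma>\<close>, uses up one unit of the framing.\<close>

lemma tuple_fun_chainable:
 assumes M: "M \<in> maya_tuples \<gamma>s"
 shows "chainable (weight_vec \<gamma>s) (tuple_fun M)"
 unfolding chainable_def
proof (intro allI impI)
 fix i k :: int assume "i <= k"
 let ?A = "{a. a < length \<gamma>s & i <= \<gamma>s ! a & k <= row_end \<gamma>s M a i}"
 let ?B = "{a. a < length \<gamma>s & \<gamma>s ! a = i}"
 let ?C = "{a. a < length \<gamma>s & i + 1 <= \<gamma>s ! a & k + 1 <= row_end \<gamma>s M a (i + 1)}"
 have "?A \<subseteq> ?B \<union> ?C"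
 proof
  fix a assume a: "a \<in> ?A"
  then show "a \<in> ?B \<union> ?C" using row_end_facts(1)[OF M, of a i] by (cases "\<gamma>s ! a = i") auto
 qed
 then have "card ?A <= card (?B \<union> ?C)" by (intro card_mono) auto
 also have "... <= card ?B + card ?C" by (rule card_Un_le)
 finally show "tail_count (tuple_fun M) i k
   <= weight_vec \<gamma>s i + tail_count (tuple_fun M) (i + 1) (k + 1)"
  unfolding weight_vec_def using tail_count_tuple_fun[OF M \<open>i <= k\<close>] tail_count_tuple_fun[OF M, of "i + 1" "k + 1"] \<open>i <= k\<close>
  by simp
qed

lemma tail_count_step:
 assumes "f \<in> Zt_inf"
 shows "tail_count f i k = f (i, k) + tail_count f i (k + 1)"
proof -
 have fin: "finite {z. f z ~= 0}" using assms unfolding Zt_inf_def by simp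
 let ?A = "%k. {z. f z ~= 0 & fst z = i & k <= snd z}"
 have finA: "finite (?A k)" for k using fin by (rule rev_finite_subset) auto
 show ?thesis
 proof (cases "f (i, k) = 0")
  case True
  have "?A k = ?A (k + 1)"
  proof (rule Collect_cong)
   fix z :: "int \<times> int"
   show "(f z ~= 0 & fst z = i & k <= snd z) = (f z ~= 0 & fst z = i & k + 1 <= snd z)"
    using True by (cases z) (auto simp: zless_add1_eq order_le_less add1_zle_eq)
  qed
  then show ?thesis using True unfolding tail_count_def by simp
 next
  case False
  have "?A k = insert (i, k) (?A (k + 1))"
  proof (intro equalityI subsetI)
   fix z assume "z \<in> ?A k"
   then show "z \<in> insert (i, k) (?A (k + 1))" by (cases z) auto
  qed (use False in auto)
  moreover have "(i, k) \<notin> ?A (k + 1)" by simp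
  ultimately show ?thesis unfolding tail_count_def using finA[of "k + 1"] by simp
 qed
qed

lemma tail_count_antimono:
 assumes "f \<in> Zt_inf" "k <= k'"
 shows "tail_count f i k' <= tail_count f i k"
 using assms(2)
proof (induction k' rule: int_ge_induct)
 case (step k')
 then show ?case using tail_count_step[OF assms(1), of i k'] by simp
qed simp

lemma tail_count_bounded_support:
 assumes "f \<in> Zt_inf"
 obtains B where "0 <= B" "!!i k. B < \<bar>i\<bar> ==> tail_count f i k = 0" "!!i k. B < k ==> tail_count f i k = 0"
proof -
 have fin: "finite {z. f z ~= 0}" using assms unfolding Zt_inf_def by simp
 define B where "B = (\<Sum>z | f z ~= 0. \<bar>fst z\<bar> + \<bar>snd z\<bar>)"
 have B: "\<bar>fst z\<bar> + \<bar>snd z\<bar> <= B" if "f z ~= 0" for z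
  unfolding B_def using fin that by (intro member_le_sum[of z _ "%z. \<bar>fst z\<bar> + \<bar>snd z\<bar>"]) auto
 show ?thesis
 proof (rule that[of B])
  show "0 <= B" unfolding B_def by (intro sum_nonneg) auto
  show "tail_count f i k = 0" if "B < \<bar>i\<bar>" for i k
  proof -
   have "\<not> (f z ~= 0 & fst z = i & k <= snd z)" for z using B[of z] that by linarith
   then have "{z. f z ~= 0 & fst z = i & k <= snd z} = {}" by blast
   then show ?thesis unfolding tail_count_def by (simp only: sum.empty)
  qed
  show "tail_count f i k = 0" if "B < k" for i k
  proof -
   have "\<not> (f z ~= 0 & fst z = i & k <= snd z)" for z using B[of z] that by linarith
   then have "{z. f z ~= 0 & fst z = i & k <= snd z} = {}" by blast
   then show ?thesis unfolding tail_count_def by (simp only: sum.empty)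
  qed
 qed
qed

lemma Zt_inf_eqI:
 assumes f: "f \<in> Zt_inf" and g: "g \<in> Zt_inf"
  and eq: "!!i k. i <= k ==> tail_count f i k = tail_count g i k"
 shows "f = g"
proof
 fix z :: "int \<times> int"
 obtain i k where z: "z = (i, k)" by (cases z)
 show "f z = g z"
 proof (cases "i <= k")
  case True
  then show ?thesis using tail_count_step[OF f, of i k] tail_count_step[OF g, of i k] eq[of i k] eq[of i "k + 1"] z by simp
 next
  case False
  then have "z \<notin> Z_inf" unfolding Z_inf_def z by simp
  then show ?thesis using f g unfolding Zt_inf_def by (metis (mono_tags, lifting) CollectD mem_Collect_eq subsetD)
 qed
qed

definition charges_below :: "int list => int => nat" where
 "charges_below \<gamma>s i = card {a. a < length \<gamma>s & \<gamma>s ! a < i}"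

lemma charges_below_iff:
 assumes "sorted \<gamma>s" "a < length \<gamma>s"
 shows "i <= \<gamma>s ! a \<longleftrightarrow> charges_below \<gamma>s i <= a"
proof -
 let ?S = "{a. a < length \<gamma>s & \<gamma>s ! a < i}"
 show ?thesis
 proof
  assume "i <= \<gamma>s ! a"
  then have "?S \<subseteq> {..<a}" using sorted_nth_mono[OF assms(1), of a] by (force simp: not_less[symmetric])
  from card_mono[OF _ this] show "charges_below \<gamma>s i <= a" unfolding charges_below_def by simp
 next
  assume le: "charges_below \<gamma>s i <= a"
  show "i <= \<gamma>s ! a"
  proof (rule ccontr)
   assume "\<not> i <= \<gamma>s ! a"
   then have "{..a} \<subseteq> ?S" using sorted_nth_mono[OF assms(1) _ assms(2)] assms(2) by force
   from card_mono[OF _ this] show False using le unfolding charges_below_def by simp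
  qed
 qed
qed

lemma charges_below_step: "charges_below \<gamma>s (i + 1) = charges_below \<gamma>s i + weight_vec \<gamma>s i"
proof -
 have "{a. a < length \<gamma>s & \<gamma>s ! a < i + 1} =
   {a. a < length \<gamma>s & \<gamma>s ! a < i} \<union> {a. a < length \<gamma>s & \<gamma>s ! a = i}" by auto
 then show ?thesis unfolding charges_below_def weight_vec_def
  by (simp add: card_Un_disjoint disjoint_iff)
qed

lemma charges_below_le: "charges_below \<gamma>s i <= length \<gamma>s"
proof -
 have "charges_below \<gamma>s i <= card {..<length \<gamma>s}" unfolding charges_below_def by (intro card_mono) auto
 then show ?thesis by simp
qed

text \<open>Iterating the counting condition upwards from \<open>i\<close> until the support ends shows that the tails are bounded by
  the number of charges at or above \<open>i\<close>.\<close>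

lemma tail_count_le_charges:
 assumes f: "f \<in> Zt_inf" and c: "chainable (weight_vec \<gamma>s) f" and "i <= k"
 shows "tail_count f i k + charges_below \<gamma>s i <= length \<gamma>s"
proof -
 obtain B where B: "0 <= B" "!!i k. B < \<bar>i\<bar> ==> tail_count f i k = 0"
  using tail_count_bounded_support[OF f] by metis
 have "tail_count f i k + charges_below \<gamma>s i <= length \<gamma>s" if "B + 1 - int n <= i" "i <= k" for n i k
  using that
 proof (induction n arbitrary: i k)
  case 0
  then show ?case using B(2)[of i k] B(1) charges_below_le[of \<gamma>s i] by simp
 next
  case (Suc n)
  have "tail_count f i k <= weight_vec \<gamma>s i + tail_count f (i + 1) (k + 1)"
   using c Suc.prems unfolding chainable_def by simp
  then show ?case using Suc.IH[of "i + 1" "k + 1"] Suc.prems charges_below_step[of \<gamma>s i] by simp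
 qed
 from this[of "nat (B + 1 - i)" i k] show ?thesis using \<open>i <= k\<close> by simp
qed

text \<open>For each start \<open>i\<close> the segments of \<open>f\<close> are handed out in decreasing order of length to the diagrams \<open>a \<ge>
  charges_below \<gamma>s i\<close>, the ones whose charge is at least \<open>i\<close>. The counting condition makes the row ends of
  each diagram increase, and the ordering makes the tuple nested.\<close>

lemma nested_maya_tuple_exists:
 assumes sorted: "sorted \<gamma>s" and f: "f \<in> Zt_inf" and c: "chainable (weight_vec \<gamma>s) f"
 shows "\<exists>M \<in> maya_tuples \<gamma>s. successively maya_le M & tuple_fun M = f"
proof -
 define J where "J = charges_below \<gamma>s"
 define T where "T a i = i - 1 + int (card {k. i <= k & a - J i < tail_count f i k})" for a i
 obtain B where B: "0 <= B" "!!i k. B < \<bar>i\<bar> ==> tail_count f i k = 0" "!!i k. B < k ==> tail_count f i k = 0"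
  using tail_count_bounded_support[OF f] by metis
 have fin: "finite {k. i <= k & t < tail_count f i k}" for i t
 proof (rule finite_subset)
  show "{k. i <= k & t < tail_count f i k} \<subseteq> {i..B}" using B(3) by (force simp: not_less[symmetric])
 qed simp
 have T: "k <= T a i \<longleftrightarrow> a - J i < tail_count f i k" if "i <= k" for a i k
 proof -
  let ?S = "{k. i <= k & a - J i < tail_count f i k}"
  have "?S = {i..<i + int (card ?S)}"
  proof (rule initial_segment_card)
   show "k' \<in> ?S" if "k \<in> ?S" "i <= k'" "k' <= k" for k k'
    using that tail_count_antimono[OF f \<open>k' <= k\<close>, of i] by simp
  qed (use fin in auto)
  from eqset_imp_iff[OF this, of k] show ?thesis using that unfolding T_def by auto
 qed
 have step: "T a i < T a (i + 1)" if "J (i + 1) <= a" for a i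
 proof (cases "i <= T a i")
  case True
  then have "a - J i < tail_count f i (T a i)" using T[OF True, of a] by simp
  moreover have "tail_count f i (T a i) <= weight_vec \<gamma>s i + tail_count f (i + 1) (T a i + 1)"
   using c True unfolding chainable_def by simp
  ultimately have "a - J (i + 1) < tail_count f (i + 1) (T a i + 1)"
   using that charges_below_step[of \<gamma>s i] unfolding J_def by simp
  then show ?thesis using T[of "i + 1" "T a i + 1" a] True by simp
 next
  case False
  then show ?thesis unfolding T_def[of a "i + 1"] by simp
 qed
 have low: "T a i = i - 1" if "i <= - B - 1" for a i
 proof -
  have "{k. i <= k & a - J i < tail_count f i k} = {}" using B(1) B(2)[of i] that by auto
  then show ?thesis unfolding T_def by (simp only: card.empty)
 qed
 have "\<exists>m \<in> maya_diagrams (\<gamma>s ! a). \<forall>i \<le> \<gamma>s ! a. m (i - \<gamma>s ! a - 1) = T a i" if "a < length \<gamma>s" for a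
 proof (rule maya_exists)
  show "T a i < T a (i + 1)" if "i < \<gamma>s ! a" for i
   using step charges_below_iff[OF sorted \<open>a < length \<gamma>s\<close>, of "i + 1"] that unfolding J_def by simp
  show "i - 1 <= T a i" for i unfolding T_def by simp
  show "T a i = i - 1" if "i <= - B - 1" for i using low[OF that] .
 qed
 then have "\<forall>a. \<exists>m. a < length \<gamma>s --> m \<in> maya_diagrams (\<gamma>s ! a) & (\<forall>i \<le> \<gamma>s ! a. m (i - \<gamma>s ! a - 1) = T a i)"
  by blast
 then obtain \<mu> where "\<forall>a. a < length \<gamma>s --> \<mu> a \<in> maya_diagrams (\<gamma>s ! a) & (\<forall>i \<le> \<gamma>s ! a. \<mu> a (i - \<gamma>s ! a - 1) = T a i)"
  by (rule choice[THEN exE])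
 then have \<mu>: "!!a. a < length \<gamma>s ==> \<mu> a \<in> maya_diagrams (\<gamma>s ! a)"
  "!!a i. a < length \<gamma>s ==> i <= \<gamma>s ! a ==> \<mu> a (i - \<gamma>s ! a - 1) = T a i" by blast+
 define M where "M = map \<mu> [0..<length \<gamma>s]"
 have len: "length M = length \<gamma>s" unfolding M_def by simp
 have nth: "M ! a = \<mu> a" if "a < length \<gamma>s" for a using that unfolding M_def by simp
 have M: "M \<in> maya_tuples \<gamma>s"
  unfolding maya_tuples_def using \<mu>(1) by (simp add: list_all2_conv_all_nth len nth)
 have row: "row_end \<gamma>s M a i = T a i" if "a < length \<gamma>s" "i <= \<gamma>s ! a" for a i
  unfolding row_end_def using \<mu>(2)[OF that] nth that by simp
 have "successively maya_le M"
  unfolding successively_conv_nth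
 proof (intro allI impI)
  fix a assume a: "Suc a < length M"
  have "T (Suc a) i <= T a i" for i
   unfolding T_def using fin by (auto intro!: card_mono)
  moreover have "\<gamma>s ! a <= \<gamma>s ! Suc a" using sorted_nth_mono[OF sorted] a len by simp
  ultimately show "maya_le (M ! a) (M ! Suc a)"
   using a len maya_le_iff_rows[OF \<mu>(1)[of a] \<mu>(1)[of "Suc a"]] \<mu>(2)[of a] \<mu>(2)[of "Suc a"] by (simp add: nth)
 qed
 moreover have "tuple_fun M = f"
 proof (rule Zt_inf_eqI[OF tuple_fun_in_Zt_inf[OF M] f])
  fix i k :: int assume "i <= k"
  have "{a. a < length \<gamma>s & i <= \<gamma>s ! a & k <= row_end \<gamma>s M a i} = {J i..<J i + tail_count f i k}"
  proof (intro equalityI subsetI)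
   fix a assume "a \<in> {a. a < length \<gamma>s & i <= \<gamma>s ! a & k <= row_end \<gamma>s M a i}"
   then show "a \<in> {J i..<J i + tail_count f i k}"
    using charges_below_iff[OF sorted, of a i] row[of a i] T[OF \<open>i <= k\<close>, of a] unfolding J_def by auto
  next
   fix a assume a: "a \<in> {J i..<J i + tail_count f i k}"
   then have "a < length \<gamma>s" using tail_count_le_charges[OF f c \<open>i <= k\<close>] unfolding J_def by simp
   then show "a \<in> {a. a < length \<gamma>s & i <= \<gamma>s ! a & k <= row_end \<gamma>s M a i}"
    using a charges_below_iff[OF sorted, of a i] row[of a i] T[OF \<open>i <= k\<close>, of a] unfolding J_def by auto
  qed
  then show "tail_count (tuple_fun M) i k = tail_count f i k"
   unfolding tail_count_tuple_fun[OF M \<open>i <= k\<close>] by simp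
 qed
 ultimately show ?thesis using M by blast
qed

text \<open>In a nested tuple the row ends at a fixed start decrease with \<open>a\<close>, hence the diagrams reaching \<open>k\<close> form an
  initial segment of the admissible ones and are determined by their number.\<close>

lemma nested_row_end:
 assumes sorted: "sorted \<gamma>s" and M: "M \<in> maya_tuples \<gamma>s" and nested: "successively maya_le M"
  and a: "a < length \<gamma>s" and i: "i <= \<gamma>s ! a" and k: "i <= k"
 shows "k <= row_end \<gamma>s M a i \<longleftrightarrow> a < charges_below \<gamma>s i + tail_count (tuple_fun M) i k"
proof -
 have trans: "transp maya_le" unfolding transp_def maya_le_def by force
 have nest: "row_end \<gamma>s M b i <= row_end \<gamma>s M a i" if "a < b" "b < length \<gamma>s" "i <= \<gamma>s ! a" for a b
 proof -
  have "sorted_wrt maya_le M" using nested trans by (simp add: successively_conv_sorted_wrt)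
  then have "maya_le (M ! a) (M ! b)"
   using that maya_tuplesD(1)[OF M] by (simp add: sorted_wrt_iff_nth_less)
  moreover have "\<gamma>s ! a <= \<gamma>s ! b" using sorted_nth_mono[OF sorted] that by simp
  ultimately show ?thesis
   using maya_le_iff_rows[OF maya_tuplesD(2)[OF M, of a] maya_tuplesD(2)[OF M, of b]] that
   unfolding row_end_def by simp
 qed
 define S where "S = {a. a < length \<gamma>s & i <= \<gamma>s ! a & k <= row_end \<gamma>s M a i}"
 define J where "J = charges_below \<gamma>s i"
 have "int ` S = {int J..<int J + int (card (int ` S))}"
 proof (rule initial_segment_card)
  show "finite (int ` S)" unfolding S_def by simp
  show "int J <= x" if "x \<in> int ` S" for x
   using that charges_below_iff[OF sorted, of _ i] unfolding S_def J_def by auto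
  fix x y assume "x \<in> int ` S" "int J <= y" "y <= x"
  then obtain b where b: "b \<in> S" "x = int b" by blast
  define c where "c = nat y"
  have y: "y = int c" using \<open>int J <= y\<close> unfolding c_def by simp
  have c: "J <= c" "c <= b" using \<open>int J <= y\<close> \<open>y <= x\<close> b unfolding y by simp_all
  have cl: "c < length \<gamma>s" using c b unfolding S_def by simp
  then have "i <= \<gamma>s ! c" using charges_below_iff[OF sorted cl, of i] c unfolding J_def by simp
  then have "c \<in> S" using nest[of c b] b c cl unfolding S_def by (cases "c = b") auto
  then show "y \<in> int ` S" unfolding y by blast
 qed
 moreover have "card (int ` S) = card S" by (intro card_image) simp
 moreover have "card S = tail_count (tuple_fun M) i k"
  unfolding S_def tail_count_tuple_fun[OF M k] ..
 ultimately have "int a \<in> int ` S \<longleftrightarrow> int a \<in> {int J..<int J + int (tail_count (tuple_fun M) i k)}" by simp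
 moreover have "J <= a" using charges_below_iff[OF sorted a, of i] i unfolding J_def by simp
 moreover have "int a \<in> int ` S \<longleftrightarrow> k <= row_end \<gamma>s M a i" using a i unfolding S_def by auto
 ultimately show ?thesis unfolding J_def by auto
qed

lemma nested_maya_tuple_unique:
 assumes sorted: "sorted \<gamma>s"
  and M: "M \<in> maya_tuples \<gamma>s" "successively maya_le M"
  and M': "M' \<in> maya_tuples \<gamma>s" "successively maya_le M'"
  and eq: "tuple_fun M = tuple_fun M'"
 shows "M = M'"
proof (rule nth_equalityI)
 show "length M = length M'" using maya_tuplesD(1) M(1) M'(1) by metis
 fix a assume "a < length M"
 then have a: "a < length \<gamma>s" using maya_tuplesD(1)[OF M(1)] by simp
 have row: "row_end \<gamma>s M a i = row_end \<gamma>s M' a i" if i: "i <= \<gamma>s ! a" for i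
 proof -
  have iff: "k <= row_end \<gamma>s M a i \<longleftrightarrow> k <= row_end \<gamma>s M' a i" if "i <= k" for k
   using nested_row_end[OF sorted M a i that] nested_row_end[OF sorted M' a i that] eq by simp
  show ?thesis
   using iff[of "row_end \<gamma>s M a i"] iff[of "row_end \<gamma>s M' a i"]
    row_end_facts(2)[OF M(1) a i] row_end_facts(2)[OF M'(1) a i] by linarith
 qed
 show "M ! a = M' ! a"
 proof (rule maya_eqI[OF maya_tuplesD(2)[OF M(1) a] maya_tuplesD(2)[OF M'(1) a]])
  fix j :: int assume "j < 0"
  then show "(M ! a) j = (M' ! a) j" using row[of "j + \<gamma>s ! a + 1"] unfolding row_end_def by simp
 qed
qed

text \<open>The combinatorial half of the theorem.\<close>

lemma tuple_fun_bij:
 assumes "sorted \<gamma>s"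
 shows "bij_betw tuple_fun {M \<in> maya_tuples \<gamma>s. successively maya_le M}
  {f \<in> Zt_inf. chainable (weight_vec \<gamma>s) f}"
 unfolding bij_betw_def
proof
 show "inj_on tuple_fun {M \<in> maya_tuples \<gamma>s. successively maya_le M}"
  using nested_maya_tuple_unique[OF assms] by (auto intro!: inj_onI)
 show "tuple_fun ` {M \<in> maya_tuples \<gamma>s. successively maya_le M} = {f \<in> Zt_inf. chainable (weight_vec \<gamma>s) f}"
  using tuple_fun_in_Zt_inf tuple_fun_chainable nested_maya_tuple_exists[OF assms] by blast
qed

section \<open>The gauge group\<close>

lemma mat_mult_entry:
 assumes "A \<in> carrier_mat n k" "B \<in> carrier_mat k m" "a < n" "b < m"
 shows "(A * B) $$ (a, b) = (\<Sum>c<k. A $$ (a, c) * B $$ (c, b))"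
 using assms by (auto simp: scalar_prod_def atLeast0LessThan intro!: sum.cong)

lemma gauge_group_iff:
 "g \<in> gauge_group v \<longleftrightarrow> (\<forall>i. g i \<in> carrier_mat (v i) (v i) & det (g i) ~= 0)"
proof
 assume "g \<in> gauge_group v"
 then have u: "g i \<in> Units (ring_mat TYPE(complex) (v i) ())" for i unfolding gauge_group_def by simp
 then have "g i \<in> carrier (ring_mat TYPE(complex) (v i) ())" for i unfolding Units_def by blast
 then have "g i \<in> carrier_mat (v i) (v i)" for i by (simp add: ring_mat_simps)
 then show "\<forall>i. g i \<in> carrier_mat (v i) (v i) & det (g i) ~= 0" using unit_imp_det_non_zero[OF u] by simp
next
 assume "\<forall>i. g i \<in> carrier_mat (v i) (v i) & det (g i) ~= 0"
 then have "g i \<in> Units (ring_mat TYPE(complex) (v i) ())" for i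
  by (intro det_non_zero_imp_unit) simp_all
 then show "g \<in> gauge_group v" unfolding gauge_group_def by simp
qed

lemma gauge_carrier: "g \<in> gauge_group v ==> g i \<in> carrier_mat (v i) (v i)"
 by (simp add: gauge_group_iff)

lemma gauge_inv_unique:
 assumes g: "g i \<in> carrier_mat (v i) (v i)" and h: "h \<in> carrier_mat (v i) (v i)" and gh: "g i * h = 1\<^sub>m (v i)"
 shows "gauge_inv v g i = h"
proof -
 let ?R = "ring_mat TYPE(complex) (v i) ()"
 interpret ring ?R by (rule ring_mat)
 have hg: "h * g i = 1\<^sub>m (v i)" by (rule mat_mult_left_right_inverse[OF g h gh])
 have "inv\<^bsub>?R\<^esub> (g i) = h"
  by (rule inv_char) (use g h gh hg in \<open>auto simp: ring_mat_simps\<close>)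
 then show ?thesis unfolding gauge_inv_def .
qed

lemma gauge_inv:
 assumes g: "g i \<in> carrier_mat (v i) (v i)" and d: "det (g i) ~= 0"
 shows "gauge_inv v g i \<in> carrier_mat (v i) (v i)" "g i * gauge_inv v g i = 1\<^sub>m (v i)"
  "gauge_inv v g i * g i = 1\<^sub>m (v i)"
proof -
 from det_non_zero_imp_unit[OF g d, of "()"] obtain h
  where h: "h \<in> carrier_mat (v i) (v i)" "h * g i = 1\<^sub>m (v i)" "g i * h = 1\<^sub>m (v i)"
  unfolding Units_def by (auto simp: ring_mat_simps)
 then have "gauge_inv v g i = h" by (intro gauge_inv_unique g)
 then show "gauge_inv v g i \<in> carrier_mat (v i) (v i)" "g i * gauge_inv v g i = 1\<^sub>m (v i)"
  "gauge_inv v g i * g i = 1\<^sub>m (v i)" using h by auto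
qed

lemma gauge_groupI_inverse:
 assumes "!!i. g i \<in> carrier_mat (v i) (v i)" "!!i. h i \<in> carrier_mat (v i) (v i)"
  "!!i. g i * h i = 1\<^sub>m (v i)"
 shows "g \<in> gauge_group v"
proof -
 have "det (g i) * det (h i) = 1" for i
  using det_mult[OF assms(1,2)[of i]] assms(3)[of i] by simp
 then have "det (g i) ~= 0" for i by (metis mult_zero_left zero_neq_one)
 then show ?thesis using assms(1) by (simp add: gauge_group_iff)
qed

lemma gauge_inv_group:
 assumes "g \<in> gauge_group v"
 shows "gauge_inv v g i \<in> carrier_mat (v i) (v i)" "g i * gauge_inv v g i = 1\<^sub>m (v i)"
  "gauge_inv v g i * g i = 1\<^sub>m (v i)" "gauge_inv v g \<in> gauge_group v"
proof -
 have g: "g i \<in> carrier_mat (v i) (v i)" "det (g i) ~= 0" for i using assms by (auto simp: gauge_group_iff)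
 have inv: "gauge_inv v g i \<in> carrier_mat (v i) (v i)" "g i * gauge_inv v g i = 1\<^sub>m (v i)"
  "gauge_inv v g i * g i = 1\<^sub>m (v i)" for i using gauge_inv[of g i v, OF g] .
 show "gauge_inv v g \<in> gauge_group v"
  by (rule gauge_groupI_inverse[of _ _ g]) (use inv g in auto)
 show "gauge_inv v g i \<in> carrier_mat (v i) (v i)" "g i * gauge_inv v g i = 1\<^sub>m (v i)"
  "gauge_inv v g i * g i = 1\<^sub>m (v i)" by (fact inv)+
qed

lemma gauge_mult:
 assumes "g \<in> gauge_group v" "h \<in> gauge_group v"
 shows "(%i. g i * h i) \<in> gauge_group v"
 unfolding gauge_group_iff
proof
 fix i
 have c: "g i \<in> carrier_mat (v i) (v i)" "h i \<in> carrier_mat (v i) (v i)" "det (g i) ~= 0" "det (h i) ~= 0"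
  using assms by (auto simp: gauge_group_iff)
 then show "g i * h i \<in> carrier_mat (v i) (v i) & det (g i * h i) ~= 0"
  using det_mult[OF c(1,2)] by simp
qed

lemma gauge_one: "(%i. 1\<^sub>m (v i)) \<in> gauge_group v"
 by (simp add: gauge_group_iff)

lemma rep_spaceD: "x \<in> rep_space v ==> x h \<in> carrier_mat (v (in_v h)) (v (out_v h))"
 unfolding rep_space_def by simp

lemma gauge_act_rep_space:
 assumes "g \<in> gauge_group v" "x \<in> rep_space v"
 shows "gauge_act v g x \<in> rep_space v"
 unfolding rep_space_def gauge_act_def
 using gauge_carrier[OF assms(1)] gauge_inv_group(1)[OF assms(1)] rep_spaceD[OF assms(2)]
 by (auto intro!: mult_carrier_mat)

lemma gauge_act_iff:
 assumes g: "g \<in> gauge_group v" and x: "x \<in> rep_space v" and z: "z \<in> rep_space v"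
 shows "z = gauge_act v g x \<longleftrightarrow> (\<forall>h. z h * g (out_v h) = g (in_v h) * x h)"
proof
 note c = gauge_carrier[OF g] gauge_inv_group(1)[OF g] rep_spaceD[OF x] rep_spaceD[OF z]
 show "\<forall>h. z h * g (out_v h) = g (in_v h) * x h" if "z = gauge_act v g x"
 proof
  fix h
  have "g (in_v h) * x h * gauge_inv v g (out_v h) * g (out_v h)
   = g (in_v h) * x h * (gauge_inv v g (out_v h) * g (out_v h))"
   by (rule assoc_mult_mat[OF mult_carrier_mat[OF c(1) c(3)] c(2) c(1)])
  then show "z h * g (out_v h) = g (in_v h) * x h"
   unfolding that gauge_act_def gauge_inv_group(3)[OF g]
   by (simp only: right_mult_one_mat[OF mult_carrier_mat[OF c(1) c(3)]])
 qed
 show "z = gauge_act v g x" if "\<forall>h. z h * g (out_v h) = g (in_v h) * x h"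
 proof
  fix h
  have "z h = z h * (g (out_v h) * gauge_inv v g (out_v h))"
   using gauge_inv_group(2)[OF g] right_mult_one_mat[OF c(4)] by simp
  also have "... = z h * g (out_v h) * gauge_inv v g (out_v h)"
   by (rule assoc_mult_mat[symmetric, OF c(4) c(1) c(2)])
  finally show "z h = gauge_act v g x h" using that unfolding gauge_act_def by simp
 qed
qed

lemma gauge_act_one: "x \<in> rep_space v ==> gauge_act v (%i. 1\<^sub>m (v i)) x = x"
 using gauge_act_iff[OF gauge_one, of x v x] left_mult_one_mat[OF rep_spaceD] right_mult_one_mat[OF rep_spaceD]
 by metis

lemma gauge_act_mult:
 assumes g: "g \<in> gauge_group v" and h: "h \<in> gauge_group v" and x: "x \<in> rep_space v"
 shows "gauge_act v g (gauge_act v h x) = gauge_act v (%i. g i * h i) x"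
proof -
 let ?y = "gauge_act v h x" and ?z = "gauge_act v g (gauge_act v h x)"
 have y: "?y \<in> rep_space v" by (rule gauge_act_rep_space[OF h x])
 have z: "?z \<in> rep_space v" by (rule gauge_act_rep_space[OF g y])
 note c = gauge_carrier[OF g] gauge_carrier[OF h] rep_spaceD[OF x] rep_spaceD[OF y] rep_spaceD[OF z]
 have "?z a * (g (out_v a) * h (out_v a)) = (g (in_v a) * h (in_v a)) * x a" for a
 proof -
  have "?z a * (g (out_v a) * h (out_v a)) = ?z a * g (out_v a) * h (out_v a)"
   by (rule assoc_mult_mat[symmetric, OF c(5) c(1) c(2)])
  also have "?z a * g (out_v a) = g (in_v a) * ?y a"
   using gauge_act_iff[OF g y z] by blast
  also have "g (in_v a) * ?y a * h (out_v a) = g (in_v a) * (?y a * h (out_v a))"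
   by (rule assoc_mult_mat[OF c(1) c(4) c(2)])
  also have "?y a * h (out_v a) = h (in_v a) * x a"
   using gauge_act_iff[OF h x y] by blast
  also have "g (in_v a) * (h (in_v a) * x a) = (g (in_v a) * h (in_v a)) * x a"
   by (rule assoc_mult_mat[symmetric, OF c(1) c(2) c(3)])
  finally show ?thesis .
 qed
 then show ?thesis using gauge_act_iff[OF gauge_mult[OF g h] x z] by blast
qed

lemma gauge_act_inverse:
 assumes g: "g \<in> gauge_group v" and x: "x \<in> rep_space v"
 shows "gauge_act v (gauge_inv v g) (gauge_act v g x) = x"
 unfolding gauge_act_mult[OF gauge_inv_group(4)[OF g] g x] gauge_inv_group(3)[OF g]
 by (rule gauge_act_one[OF x])

section \<open>The moment map\<close>

lemma moment_eq:
 assumes x: "x \<in> rep_space v"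
 shows "moment v x i = x (Om (i + 1)) * x (OmBar (i + 1)) - x (OmBar i) * x (Om i)"
proof -
 have *: "{h. in_v h = i} = {Om (i + 1), OmBar i}"
 proof (intro equalityI subsetI)
  fix h assume "h \<in> {h. in_v h = i}"
  then show "h \<in> {Om (i + 1), OmBar i}" by (cases h) auto
 qed auto
 have c: "x (Om (i + 1)) \<in> carrier_mat (v i) (v (i + 1))" "x (OmBar (i + 1)) \<in> carrier_mat (v (i + 1)) (v i)"
  "x (Om i) \<in> carrier_mat (v (i - 1)) (v i)" "x (OmBar i) \<in> carrier_mat (v i) (v (i - 1))"
  using rep_spaceD[OF x, of "Om (i + 1)"] rep_spaceD[OF x, of "OmBar (i + 1)"]
   rep_spaceD[OF x, of "Om i"] rep_spaceD[OF x, of "OmBar i"] by auto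
 show ?thesis unfolding moment_def * by (rule eq_matI) (use c in auto)
qed

lemma moment_carrier: "moment v x i \<in> carrier_mat (v i) (v i)"
 unfolding moment_def by simp

lemma moment_zero_iff:
 assumes x: "x \<in> rep_space v"
 shows "moment_zero v x i \<longleftrightarrow> x (Om (i + 1)) * x (OmBar (i + 1)) = x (OmBar i) * x (Om i)"
proof -
 have c: "x (Om (i + 1)) * x (OmBar (i + 1)) \<in> carrier_mat (v i) (v i)" "x (OmBar i) * x (Om i) \<in> carrier_mat (v i) (v i)"
  using rep_spaceD[OF x, of "Om (i + 1)"] rep_spaceD[OF x, of "OmBar (i + 1)"]
   rep_spaceD[OF x, of "Om i"] rep_spaceD[OF x, of "OmBar i"] by (auto intro!: mult_carrier_mat)
 have r: "dim_row (x (Om (i + 1))) = v i" "dim_col (x (OmBar (i + 1))) = v i"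
  "dim_row (x (OmBar i)) = v i" "dim_col (x (Om i)) = v i"
  using rep_spaceD[OF x, of "Om (i + 1)"] rep_spaceD[OF x, of "OmBar (i + 1)"]
   rep_spaceD[OF x, of "Om i"] rep_spaceD[OF x, of "OmBar i"] by auto
 show ?thesis unfolding moment_eq[OF x]
 proof
  assume eq: "x (Om (i + 1)) * x (OmBar (i + 1)) - x (OmBar i) * x (Om i) = 0\<^sub>m (v i) (v i)"
  show "x (Om (i + 1)) * x (OmBar (i + 1)) = x (OmBar i) * x (Om i)"
  proof (rule eq_matI)
   fix a b assume "a < dim_row (x (OmBar i) * x (Om i))" "b < dim_col (x (OmBar i) * x (Om i))"
   then have ab: "a < v i" "b < v i" using c by auto
   have "(x (Om (i + 1)) * x (OmBar (i + 1)) - x (OmBar i) * x (Om i)) $$ (a, b) = 0"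
    unfolding eq using ab by simp
   then show "(x (Om (i + 1)) * x (OmBar (i + 1))) $$ (a, b) = (x (OmBar i) * x (Om i)) $$ (a, b)"
    using ab c by (simp del: index_mult_mat add: carrier_matD[OF c(2)])
  qed (simp_all add: r)
 qed (use c in auto)
qed

lemma moment_zero_gauge_act:
 assumes g: "g \<in> gauge_group v" and x: "x \<in> rep_space v" and m: "moment_zero v x i"
 shows "moment_zero v (gauge_act v g x) i"
proof -
 let ?z = "gauge_act v g x"
 have z: "?z \<in> rep_space v" by (rule gauge_act_rep_space[OF g x])
 note gc = gauge_carrier[OF g]
 have zx: "?z h * g (out_v h) = g (in_v h) * x h" for h using gauge_act_iff[OF g x z] by blast
 have step: "?z h * ?z h' * g (out_v h') = g (in_v h) * (x h * x h')" if "out_v h = in_v h'" for h h'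
 proof -
  have c: "?z h \<in> carrier_mat (v (in_v h)) (v (in_v h'))" "?z h' \<in> carrier_mat (v (in_v h')) (v (out_v h'))"
   "x h \<in> carrier_mat (v (in_v h)) (v (in_v h'))" "x h' \<in> carrier_mat (v (in_v h')) (v (out_v h'))"
   using rep_spaceD[OF z] rep_spaceD[OF x] that by metis+
  have "?z h * ?z h' * g (out_v h') = ?z h * (?z h' * g (out_v h'))"
   by (rule assoc_mult_mat[OF c(1,2) gc])
  also have "... = ?z h * (g (in_v h') * x h')" by (simp only: zx)
  also have "... = ?z h * g (in_v h') * x h'" by (rule assoc_mult_mat[symmetric, OF c(1) gc c(4)])
  also have "?z h * g (in_v h') = g (in_v h) * x h" using zx[of h] that by simp
  also have "g (in_v h) * x h * x h' = g (in_v h) * (x h * x h')" by (rule assoc_mult_mat[OF gc c(3,4)])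
  finally show ?thesis .
 qed
 have "?z (Om (i + 1)) * ?z (OmBar (i + 1)) * g i = ?z (OmBar i) * ?z (Om i) * g i"
  using step[of "Om (i + 1)" "OmBar (i + 1)"] step[of "OmBar i" "Om i"] m[unfolded moment_zero_iff[OF x]] by simp
 then have eq: "?z (Om (i + 1)) * ?z (OmBar (i + 1)) * g i * gauge_inv v g i = ?z (OmBar i) * ?z (Om i) * g i * gauge_inv v g i"
  by simp
 have "A * g i * gauge_inv v g i = A" if A: "A \<in> carrier_mat (v i) (v i)" for A
  using assoc_mult_mat[OF A gc[of i] gauge_inv_group(1)[OF g, of i]] gauge_inv_group(2)[OF g, of i] A by simp
 moreover have "?z (Om (i + 1)) * ?z (OmBar (i + 1)) \<in> carrier_mat (v i) (v i)" "?z (OmBar i) * ?z (Om i) \<in> carrier_mat (v i) (v i)"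
  using rep_spaceD[OF z, of "Om (i + 1)"] rep_spaceD[OF z, of "OmBar (i + 1)"]
   rep_spaceD[OF z, of "Om i"] rep_spaceD[OF z, of "OmBar i"] by (auto intro!: mult_carrier_mat)
 ultimately show ?thesis using eq unfolding moment_zero_iff[OF z] by simp
qed

section \<open>Rational dependence of the gauge action\<close>

text \<open>A single polynomial whose nonvanishing expresses invertibility in all degrees at once.\<close>

definition gauge_det :: "(int => nat) => (int => complex mat) => complex" where
 "gauge_det v g = (\<Prod>i | v i ~= 0. det (g i))"

lemma gauge_det_nonzero:
 assumes "fin_supp v" "!!i. g i \<in> carrier_mat (v i) (v i)"
 shows "gauge_det v g ~= 0 \<longleftrightarrow> g \<in> gauge_group v"
proof -
 have "det (g i) = 1" if "v i = 0" for i using assms(2)[of i] that by (simp add: det_dim_zero)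
 then have "(\<forall>i. det (g i) ~= 0) \<longleftrightarrow> (\<forall>i. v i ~= 0 --> det (g i) ~= 0)" by (metis zero_neq_one)
 moreover have "gauge_det v g ~= 0 \<longleftrightarrow> (\<forall>i. v i ~= 0 --> det (g i) ~= 0)"
  unfolding gauge_det_def prod_zero_iff[OF assms(1)] by blast
 ultimately show ?thesis unfolding gauge_group_iff using assms(2) by simp
qed

lemma poly_funs_gauge_det:
 assumes "!!s i. g s i \<in> carrier_mat (v i) (v i)"
  and "!!i a b. a < v i ==> b < v i ==> (%s. g s i $$ (a, b)) \<in> poly_funs C"
 shows "(%s. gauge_det v (g s)) \<in> poly_funs C"
 unfolding gauge_det_def
proof (rule poly_funs_prod)
 fix i show "(%s. det (g s i)) \<in> poly_funs C"
  by (rule poly_funs_det[where n = "v i"]) (use assms in auto)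
qed

lemma rational_gauge_inv:
 fixes g :: "'s => int => complex mat"
 assumes fin: "fin_supp v"
  and g: "!!s i. g s i \<in> carrier_mat (v i) (v i)"
  and gC: "!!i a b. a < v i ==> b < v i ==> (%s. g s i $$ (a, b)) \<in> poly_funs C"
  and ab: "a < v i" "b < v i"
 shows "(%s. gauge_inv v (g s) i $$ (a, b)) \<in> rational_over C (%s. gauge_det v (g s))"
proof (rule rational_overI[where K = 1])
 let ?I = "{i. v i ~= 0} - {i}"
 have "(%s. det (g s k)) \<in> poly_funs C" for k
  by (rule poly_funs_det[where n = "v k"]) (use g gC in auto)
 moreover have "(%s. adj_mat (g s i) $$ (a, b)) \<in> poly_funs C"
  by (rule poly_funs_adj_mat[where n = "v i"]) (use g gC ab in auto)
 ultimately show "(%s. adj_mat (g s i) $$ (a, b) * (\<Prod>k\<in>?I. det (g s k))) \<in> poly_funs C"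
  by (intro poly_funs.mult poly_funs_prod)
 fix s assume "gauge_det v (g s) ~= 0"
 then have grp: "g s \<in> gauge_group v" using gauge_det_nonzero[where g = "g s", OF fin g] by blast
 have "gauge_det v (g s) = det (g s i) * (\<Prod>k\<in>?I. det (g s k))"
  unfolding gauge_det_def using fin ab by (intro prod.remove) auto
 then show "gauge_inv v (g s) i $$ (a, b) * gauge_det v (g s) ^ 1
   = adj_mat (g s i) $$ (a, b) * (\<Prod>k\<in>?I. det (g s k))"
  using inverse_entry_times_det[OF g gauge_inv_group(1,2)[OF grp] ab] by (simp add: mult.assoc[symmetric])
qed

lemma gauge_act_entry:
 assumes "g (in_v h) \<in> carrier_mat (v (in_v h)) (v (in_v h))" "x \<in> rep_space v"
  "gauge_inv v g (out_v h) \<in> carrier_mat (v (out_v h)) (v (out_v h))" "a < v (in_v h)" "b < v (out_v h)"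
 shows "gauge_act v g x h $$ (a, b) =
  (\<Sum>d<v (out_v h). (\<Sum>c<v (in_v h). g (in_v h) $$ (a, c) * x h $$ (c, d)) * gauge_inv v g (out_v h) $$ (d, b))"
 unfolding gauge_act_def
 using mat_mult_entry[OF mult_carrier_mat[OF assms(1) rep_spaceD[OF assms(2)]] assms(3) assms(4,5)]
  mat_mult_entry[OF assms(1) rep_spaceD[OF assms(2)] assms(4)] by simp

text \<open>Multiplying the inverse by the determinants of all degrees turns it into an adjugate times the remaining
  determinants, so one common denominator serves every entry.\<close>

lemma rational_gauge_act:
 fixes g :: "'s => int => complex mat" and x :: "'s => rep"
 assumes fin: "fin_supp v"
  and g: "!!s i. g s i \<in> carrier_mat (v i) (v i)"
  and gC: "!!i a b. a < v i ==> b < v i ==> (%s. g s i $$ (a, b)) \<in> poly_funs C"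
  and x: "!!s. x s \<in> rep_space v"
  and xC: "!!c. c \<in> rep_coords v ==> (%s. c (x s)) \<in> poly_funs C"
  and c: "c \<in> rep_coords v"
 shows "(%s. c (gauge_act v (g s) (x s))) \<in> rational_over C (%s. gauge_det v (g s))"
proof -
 from c obtain h a b where h: "c = (%x. x h $$ (a, b))" "a < v (in_v h)" "b < v (out_v h)"
  unfolding rep_coords_def by blast
 let ?D = "%s. gauge_det v (g s)"
 let ?r = "%s. \<Sum>d<v (out_v h). (\<Sum>c<v (in_v h). g s (in_v h) $$ (a, c) * x s h $$ (c, d)) * gauge_inv v (g s) (out_v h) $$ (d, b)"
 have xC': "(%s. x s h $$ (c, d)) \<in> poly_funs C" if "c < v (in_v h)" "d < v (out_v h)" for c d
  using xC[of "%x. x h $$ (c, d)"] that unfolding rep_coords_def by blast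
 have "?r \<in> rational_over C ?D"
 proof (intro rational_over_sum rational_over_mult)
  show "?D \<in> poly_funs C" by (rule poly_funs_gauge_det) (use g gC in auto)
  fix d assume d: "d \<in> {..<v (out_v h)}"
  show "(%s. gauge_inv v (g s) (out_v h) $$ (d, b)) \<in> rational_over C ?D"
   by (rule rational_gauge_inv[OF fin]) (use g gC d h in auto)
  fix c assume "c \<in> {..<v (in_v h)}"
  then show "(%s. g s (in_v h) $$ (a, c)) \<in> rational_over C ?D" "(%s. x s h $$ (c, d)) \<in> rational_over C ?D"
   using gC[of a "in_v h" c] xC'[of c d] h d by (auto intro: rational_over_poly)
 next
  show "?D \<in> poly_funs C" by (rule poly_funs_gauge_det) (use g gC in auto)
 qed
 then obtain K P where P: "P \<in> poly_funs C" "!!s. ?D s ~= 0 ==> ?r s * ?D s ^ K = P s"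
  by (rule rational_overE) blast
 show ?thesis
 proof (rule rational_overI[OF P(1)])
  fix s assume D: "?D s ~= 0"
  then have grp: "g s \<in> gauge_group v" using gauge_det_nonzero[where g = "g s", OF fin g] by blast
  then show "c (gauge_act v (g s) (x s)) * ?D s ^ K = P s"
   unfolding h(1) P(2)[OF D, symmetric]
   by (subst gauge_act_entry[OF g x gauge_inv_group(1)[OF grp] h(2,3)]) simp
 qed
qed

section \<open>The infinitesimal gauge action\<close>

definition comm_rep :: "(int => complex mat) => rep => rep" where
 "comm_rep \<xi> x = (%h. \<xi> (in_v h) * x h - x h * \<xi> (out_v h))"

lemma comm_rep_space:
 assumes "!!i. \<xi> i \<in> carrier_mat (v i) (v i)" "x \<in> rep_space v"
 shows "comm_rep \<xi> x \<in> rep_space v"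
 unfolding rep_space_def comm_rep_def using assms(1) rep_spaceD[OF assms(2)]
 by (auto intro!: minus_carrier_mat mult_carrier_mat)

lemma rep_add_space: "x \<in> rep_space v ==> y \<in> rep_space v ==> rep_add x y \<in> rep_space v"
 unfolding rep_space_def rep_add_def by (auto intro!: add_carrier_mat)

lemma rep_smult_space: "x \<in> rep_space v ==> rep_smult c x \<in> rep_space v"
 unfolding rep_space_def rep_smult_def by auto

text \<open>The derivative of the action at the identity. The quotient is rewritten by the intertwining relation \<open>z * (1
  + t \<xi>) = (1 + t \<xi>) * (x + t y)\<close>, which leaves only the continuity of \<open>z\<close> in \<open>t\<close>.\<close>

lemma infinitesimal_action:
 fixes v :: "int => nat"
 assumes fin: "fin_supp v" and \<xi>: "!!i. \<xi> i \<in> carrier_mat (v i) (v i)"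
  and x: "x \<in> rep_space v" and y: "y \<in> rep_space v"
 defines "G \<equiv> %t i. 1\<^sub>m (v i) + t \<cdot>\<^sub>m \<xi> i"
 shows "\<forall>\<^sub>F t in at (0::complex). G t \<in> gauge_group v"
  and "!!h a b. a < v (in_v h) ==> b < v (out_v h) ==>
   ((%t. (gauge_act v (G t) (rep_add x (rep_smult t y)) h $$ (a, b) - x h $$ (a, b)) / t)
     \<longlongrightarrow> comm_rep \<xi> x h $$ (a, b) + y h $$ (a, b)) (at 0)"
proof -
 have G: "G t i \<in> carrier_mat (v i) (v i)" for t i unfolding G_def using \<xi> by auto
 have entry: "G t i $$ (a, b) = (1\<^sub>m (v i) :: complex mat) $$ (a, b) + t * \<xi> i $$ (a, b)"
  if "a < v i" "b < v i" for t i a b unfolding G_def using that \<xi>[of i] by simp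
 have lim: "((%t. G t i $$ (a, b)) \<longlongrightarrow> (1\<^sub>m (v i) :: complex mat) $$ (a, b)) (at 0)"
  if "a < v i" "b < v i" for i a b
  unfolding entry[OF that] by (rule tendsto_eq_intros refl | simp)+
 have "((%t. gauge_det v (G t)) \<longlongrightarrow> (\<Prod>i | v i ~= 0. det (1\<^sub>m (v i)))) (at 0)"
  unfolding gauge_det_def
 proof (rule tendsto_prod)
  fix i show "((%t. det (G t i)) \<longlongrightarrow> det (1\<^sub>m (v i))) (at 0)"
   by (rule tendsto_det[where n = "v i"]) (use G lim in auto)
 qed
 then have "((%t. gauge_det v (G t)) \<longlongrightarrow> 1) (at 0)" by simp
 from tendsto_imp_eventually_ne[OF this, of 0] have ev: "\<forall>\<^sub>F t in at 0. gauge_det v (G t) ~= 0" by simp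
 then show grp: "\<forall>\<^sub>F t in at (0::complex). G t \<in> gauge_group v"
  by (rule eventually_mono) (use gauge_det_nonzero[where g = "G _", OF fin G] in blast)
 fix h a b assume a: "a < v (in_v h)" and b: "b < v (out_v h)"
 let ?w = "%t. rep_add x (rep_smult t y)"
 let ?Z = "%t. gauge_act v (G t) (?w t)"
 have w: "?w t \<in> rep_space v" for t by (intro rep_add_space rep_smult_space x y)
 have wentry: "?w t h $$ (c, d) = x h $$ (c, d) + t * y h $$ (c, d)" if "c < v (in_v h)" "d < v (out_v h)" for t c d
  using rep_spaceD[OF x, of h] rep_spaceD[OF y, of h] that unfolding rep_add_def rep_smult_def by simp
 have inv: "((%t. gauge_inv v (G t) i $$ (c, d)) \<longlongrightarrow> (1\<^sub>m (v i) :: complex mat) $$ (c, d)) (at 0)"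
  if "c < v i" "d < v i" for i c d
 proof (rule tendsto_inverse_near_one[where M = "%t. G t i" and n = "v i"])
  show "\<forall>\<^sub>F t in at 0. gauge_inv v (G t) i \<in> carrier_mat (v i) (v i) & G t i * gauge_inv v (G t) i = 1\<^sub>m (v i)"
   using grp by eventually_elim (simp add: gauge_inv_group)
 qed (use that G lim in auto)
 have Zlim: "((%t. ?Z t h $$ (c, b)) \<longlongrightarrow> x h $$ (c, b)) (at 0)" if "c < v (in_v h)" "b < v (out_v h)" for c b
 proof -
  let ?S = "%K t L. \<Sum>d<v (out_v h). (\<Sum>e<v (in_v h). K e * (x h $$ (e, d) + t * y h $$ (e, d))) * L d"
  let ?K = "%t e. G t (in_v h) $$ (c, e)" and ?L = "%t d. gauge_inv v (G t) (out_v h) $$ (d, b)"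
  have "((%t. ?S (?K t) t (?L t)) \<longlongrightarrow> ?S (%e. 1\<^sub>m (v (in_v h)) $$ (c, e)) 0 (%d. 1\<^sub>m (v (out_v h)) $$ (d, b))) (at 0)"
   by (intro tendsto_intros lim inv) (use that in auto)
  also have "?S (%e. 1\<^sub>m (v (in_v h)) $$ (c, e)) 0 (%d. 1\<^sub>m (v (out_v h)) $$ (d, b))
    = (\<Sum>d<v (out_v h). (\<Sum>e<v (in_v h). (if c = e then 1 else 0) * x h $$ (e, d)) * (if d = b then 1 else 0))"
   using that by (intro sum.cong arg_cong2[where f = "(*)"] refl) auto
  also have "... = x h $$ (c, b)"
   using that by (simp only: sum_mult_delta(1,4)[OF finite_lessThan] lessThan_iff)
  finally show ?thesis
  proof (rule Lim_transform_eventually)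
   show "\<forall>\<^sub>F t in at 0. ?S (?K t) t (?L t) = ?Z t h $$ (c, b)"
    using grp
   proof eventually_elim
    case (elim t)
    show ?case
     unfolding gauge_act_entry[OF G w gauge_inv_group(1)[OF elim] that]
     by (intro sum.cong arg_cong2[where f = "(*)"] refl) (auto simp: wentry)
   qed
  qed
 qed
 let ?lim = "%t. y h $$ (a, b) + (\<Sum>c<v (in_v h). \<xi> (in_v h) $$ (a, c) * (x h $$ (c, b) + t * y h $$ (c, b)))
    - (\<Sum>c<v (out_v h). ?Z t h $$ (a, c) * \<xi> (out_v h) $$ (c, b))"
 have "(?lim \<longlongrightarrow> y h $$ (a, b) + (\<Sum>c<v (in_v h). \<xi> (in_v h) $$ (a, c) * (x h $$ (c, b) + 0 * y h $$ (c, b)))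
    - (\<Sum>c<v (out_v h). x h $$ (a, c) * \<xi> (out_v h) $$ (c, b))) (at 0)"
  by (intro tendsto_intros Zlim a) auto
 moreover have "comm_rep \<xi> x h $$ (a, b) = (\<Sum>c<v (in_v h). \<xi> (in_v h) $$ (a, c) * x h $$ (c, b))
    - (\<Sum>c<v (out_v h). x h $$ (a, c) * \<xi> (out_v h) $$ (c, b))"
  unfolding comm_rep_def mat_mult_entry[OF \<xi> rep_spaceD[OF x] a b, symmetric]
   mat_mult_entry[OF rep_spaceD[OF x] \<xi> a b, symmetric]
  using a b rep_spaceD[OF x, of h] \<xi>[of "out_v h"] by (simp del: index_mult_mat(1))
 then have "y h $$ (a, b) + (\<Sum>c<v (in_v h). \<xi> (in_v h) $$ (a, c) * (x h $$ (c, b) + 0 * y h $$ (c, b)))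
    - (\<Sum>c<v (out_v h). x h $$ (a, c) * \<xi> (out_v h) $$ (c, b)) = comm_rep \<xi> x h $$ (a, b) + y h $$ (a, b)"
  by simp
 ultimately have lim1: "(?lim \<longlongrightarrow> comm_rep \<xi> x h $$ (a, b) + y h $$ (a, b)) (at 0)"
  by (simp only:)
 show "((%t. (?Z t h $$ (a, b) - x h $$ (a, b)) / t) \<longlongrightarrow> comm_rep \<xi> x h $$ (a, b) + y h $$ (a, b)) (at 0)"
 proof (rule Lim_transform_eventually[OF lim1])
  show "\<forall>\<^sub>F t in at 0. ?lim t = (?Z t h $$ (a, b) - x h $$ (a, b)) / t"
   using grp eventually_neq_at_within[of 0 0 UNIV]
  proof eventually_elim
   case (elim t)
   have Z: "?Z t \<in> rep_space v" by (rule gauge_act_rep_space[OF elim(1) w])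
   have "\<forall>h. ?Z t h * G t (out_v h) = G t (in_v h) * ?w t h"
    by (rule gauge_act_iff[OF elim(1) w[of t] Z, THEN iffD1, OF refl])
   then have "(?Z t h * G t (out_v h)) $$ (a, b) = (G t (in_v h) * ?w t h) $$ (a, b)"
    by (simp only:)
   then have "(\<Sum>c<v (out_v h). ?Z t h $$ (a, c) * G t (out_v h) $$ (c, b))
     = (\<Sum>c<v (in_v h). G t (in_v h) $$ (a, c) * ?w t h $$ (c, b))"
    unfolding mat_mult_entry[OF rep_spaceD[OF Z] G a b] mat_mult_entry[OF G rep_spaceD[OF w] a b] .
   also have "(\<Sum>c<v (out_v h). ?Z t h $$ (a, c) * G t (out_v h) $$ (c, b))
     = (\<Sum>c<v (out_v h). ?Z t h $$ (a, c) * (if c = b then 1 else 0) + t * (?Z t h $$ (a, c) * \<xi> (out_v h) $$ (c, b)))"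
    using b by (intro sum.cong) (auto simp: entry algebra_simps)
   also have "... = ?Z t h $$ (a, b) + t * (\<Sum>c<v (out_v h). ?Z t h $$ (a, c) * \<xi> (out_v h) $$ (c, b))"
    using b by (simp only: sum.distrib sum_distrib_left sum_mult_delta(1)[OF finite_lessThan] lessThan_iff)
   also have "(\<Sum>c<v (in_v h). G t (in_v h) $$ (a, c) * ?w t h $$ (c, b))
     = (\<Sum>c<v (in_v h). (if a = c then 1 else 0) * ?w t h $$ (c, b) + t * (\<xi> (in_v h) $$ (a, c) * (x h $$ (c, b) + t * y h $$ (c, b))))"
    using a b by (intro sum.cong) (auto simp: entry wentry algebra_simps)
   also have "... = ?w t h $$ (a, b) + t * (\<Sum>c<v (in_v h). \<xi> (in_v h) $$ (a, c) * (x h $$ (c, b) + t * y h $$ (c, b)))"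
    using a by (simp only: sum.distrib sum_distrib_left sum_mult_delta(4)[OF finite_lessThan] lessThan_iff)
   finally have "?Z t h $$ (a, b) - x h $$ (a, b) = t * ?lim t"
    using wentry[OF a b, of t] by (simp add: algebra_simps)
   then show ?case using elim(2) by simp
  qed
 qed
qed

section \<open>Direct sums of segments and orbits\<close>

definition seg_on :: "int \<times> int => int => nat" where
 "seg_on z i = (if fst z <= i & i <= snd z then 1 else 0)"

definition seg_total :: "(int \<times> int) list => int => nat" where
 "seg_total zs i = sum_list (map (%z. seg_on z i) zs)"

text \<open>The index of the basis vector that the \<open>p\<close>-th segment contributes in degree \<open>i\<close>, for block-diagonal sums.\<close>

definition seg_pos :: "(int \<times> int) list => int => nat => nat" where
 "seg_pos zs i p = seg_total (take p zs) i"

definition seg_active :: "(int \<times> int) list => int => nat set" where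
 "seg_active zs i = {p. p < length zs & seg_on (zs ! p) i = 1}"

abbreviation seg_sum :: "(int \<times> int) list => rep" where
 "seg_sum zs \<equiv> rep_dsum (map seg_rep zs)"

lemma seg_on_eq_1: "seg_on z i = 1 \<longleftrightarrow> fst z <= i & i <= snd z"
 unfolding seg_on_def by simp

lemma seg_rep_eq:
 "seg_rep z h = mat (seg_on z (in_v h)) (seg_on z (out_v h)) (%_. case h of Om _ => 1 | OmBar _ => 0)"
 unfolding seg_rep_def Let_def seg_on_def ..

lemma seg_sum_Cons:
 "seg_sum (z # zs) h = four_block_mat (seg_rep z h)
   (0\<^sub>m (seg_on z (in_v h)) (seg_total zs (out_v h)))
   (0\<^sub>m (seg_total zs (in_v h)) (seg_on z (out_v h))) (seg_sum zs h)"
 unfolding rep_dsum_def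
 by (simp add: Let_def dim_diag_block_mat seg_rep_eq seg_total_def o_def)

lemma seg_sum_carrier: "seg_sum zs h \<in> carrier_mat (seg_total zs (in_v h)) (seg_total zs (out_v h))"
 unfolding rep_dsum_def
 by (intro carrier_matI) (simp_all add: dim_diag_block_mat seg_rep_eq seg_total_def o_def)

lemma seg_active_Cons:
 "seg_active (z # zs) i = (if seg_on z i = 1 then {0} else {}) \<union> Suc ` seg_active zs i"
proof (intro equalityI subsetI)
 fix p assume "p \<in> seg_active (z # zs) i"
 then show "p \<in> (if seg_on z i = 1 then {0} else {}) \<union> Suc ` seg_active zs i"
  unfolding seg_active_def by (cases p) auto
qed (auto simp: seg_active_def split: if_splits)

lemma seg_pos_Cons: "seg_pos (z # zs) i 0 = 0" "seg_pos (z # zs) i (Suc p) = seg_on z i + seg_pos zs i p"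
 unfolding seg_pos_def seg_total_def by simp_all

lemma seg_pos_bij: "bij_betw (seg_pos zs i) (seg_active zs i) {..<seg_total zs i}"
proof (induction zs)
 case Nil
 then show ?case by (simp add: seg_active_def seg_total_def bij_betw_def)
next
 case (Cons z zs)
 let ?n = "seg_on z i"
 have tot: "seg_total (z # zs) i = ?n + seg_total zs i" unfolding seg_total_def by simp
 have shift: "bij_betw (%k. ?n + k) {..<seg_total zs i} {?n..<?n + seg_total zs i}"
  by (intro bij_betw_byWitness[where f' = "%k. k - ?n"]) auto
 have 1: "bij_betw (%p. ?n + seg_pos zs i p) (seg_active zs i) {?n..<?n + seg_total zs i}"
  using bij_betw_trans[OF Cons shift] by (simp only: o_def)
 have "bij_betw (%p. p - 1) (Suc ` seg_active zs i) (seg_active zs i)"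
  by (intro bij_betw_byWitness[where f' = Suc]) auto
 from bij_betw_trans[OF this 1]
 have "bij_betw ((%p. ?n + seg_pos zs i p) \<circ> (%p. p - 1)) (Suc ` seg_active zs i) {?n..<?n + seg_total zs i}" .
 moreover have "((%p. ?n + seg_pos zs i p) \<circ> (%p. p - 1)) p = seg_pos (z # zs) i p" if "p \<in> Suc ` seg_active zs i" for p
  using that by (auto simp: seg_pos_Cons)
 ultimately have 2: "bij_betw (seg_pos (z # zs) i) (Suc ` seg_active zs i) {?n..<?n + seg_total zs i}"
  using bij_betw_cong by blast
 show ?case
 proof (cases "?n = 1")
  case True
  have "bij_betw (seg_pos (z # zs) i) {0} {0}" by (simp add: bij_betw_def seg_pos_Cons)
  from bij_betw_combine[OF this 2] have "bij_betw (seg_pos (z # zs) i) ({0} \<union> Suc ` seg_active zs i) ({0} \<union> {?n..<?n + seg_total zs i})"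
   using True by auto
  moreover have "{0} \<union> {?n..<?n + seg_total zs i} = {..<seg_total (z # zs) i}" using True tot by auto
  ultimately show ?thesis using True by (simp add: seg_active_Cons)
 next
  case False
  then have "?n = 0" unfolding seg_on_def by (simp split: if_splits)
  then have "{?n..<?n + seg_total zs i} = {..<seg_total (z # zs) i}" using tot by auto
  with 2 show ?thesis using False by (simp add: seg_active_Cons)
 qed
qed

lemma seg_pos_less: "p \<in> seg_active zs i ==> seg_pos zs i p < seg_total zs i"
 using bij_betwE[OF seg_pos_bij] by blast

lemma seg_pos_inj: "p \<in> seg_active zs i ==> q \<in> seg_active zs i ==> seg_pos zs i p = seg_pos zs i q \<longleftrightarrow> p = q"
 using seg_pos_bij[of zs i] by (auto simp: bij_betw_def inj_on_def)

lemma seg_pos_surj: "a < seg_total zs i ==> \<exists>p \<in> seg_active zs i. a = seg_pos zs i p"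
 using seg_pos_bij[of zs i] by (auto simp: bij_betw_def)

lemma seg_sum_entry:
 assumes "q \<in> seg_active zs (in_v h)" "p \<in> seg_active zs (out_v h)"
 shows "seg_sum zs h $$ (seg_pos zs (in_v h) q, seg_pos zs (out_v h) p) =
  (if q = p then case h of Om _ => 1 | OmBar _ => 0 else 0)"
 using assms
proof (induction zs arbitrary: p q)
 case Nil
 then show ?case by (simp add: seg_active_def)
next
 case (Cons z zs)
 let ?A = "seg_rep z h" and ?D = "seg_sum zs h"
 have A: "?A \<in> carrier_mat (seg_on z (in_v h)) (seg_on z (out_v h))" unfolding seg_rep_eq by simp
 note D = seg_sum_carrier[of zs h]
 have entry: "seg_sum (z # zs) h $$ (a, b) =
   (if a < seg_on z (in_v h) then if b < seg_on z (out_v h) then ?A $$ (a, b)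
     else 0\<^sub>m (seg_on z (in_v h)) (seg_total zs (out_v h)) $$ (a, b - seg_on z (out_v h))
    else if b < seg_on z (out_v h) then 0\<^sub>m (seg_total zs (in_v h)) (seg_on z (out_v h)) $$ (a - seg_on z (in_v h), b)
    else ?D $$ (a - seg_on z (in_v h), b - seg_on z (out_v h)))"
  if "a < seg_on z (in_v h) + seg_total zs (in_v h)" "b < seg_on z (out_v h) + seg_total zs (out_v h)" for a b
  unfolding seg_sum_Cons using that A D by (subst index_mat_four_block) auto
 have tot: "seg_total (z # zs) i = seg_on z i + seg_total zs i" for i unfolding seg_total_def by simp
 have bounds: "seg_pos (z # zs) (in_v h) q < seg_on z (in_v h) + seg_total zs (in_v h)"
  "seg_pos (z # zs) (out_v h) p < seg_on z (out_v h) + seg_total zs (out_v h)"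
  using seg_pos_less[OF Cons.prems(1)] seg_pos_less[OF Cons.prems(2)] by (simp_all add: tot)
 note e = entry[OF bounds]
 show ?case
 proof (cases q)
  case 0
  then have on: "seg_on z (in_v h) = 1" using Cons.prems(1) by (simp add: seg_active_def)
  show ?thesis
  proof (cases p)
   case 0
   then have on': "seg_on z (out_v h) = 1" using Cons.prems(2) by (simp add: seg_active_def)
   show ?thesis unfolding e using \<open>q = 0\<close> \<open>p = 0\<close> on on' by (simp add: seg_pos_Cons seg_rep_eq)
  next
   case (Suc p')
   then have "p' \<in> seg_active zs (out_v h)" using Cons.prems(2) by (auto simp: seg_active_def)
   from seg_pos_less[OF this] show ?thesis unfolding e using \<open>q = 0\<close> Suc on by (simp add: seg_pos_Cons)
  qed
 next
  case (Suc q')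
  then have q': "q' \<in> seg_active zs (in_v h)" using Cons.prems(1) by (auto simp: seg_active_def)
  show ?thesis
  proof (cases p)
   case 0
   then have on': "seg_on z (out_v h) = 1" using Cons.prems(2) by (simp add: seg_active_def)
   from seg_pos_less[OF q'] show ?thesis unfolding e using \<open>q = Suc q'\<close> \<open>p = 0\<close> on' by (simp add: seg_pos_Cons)
  next
   case (Suc p')
   then have p': "p' \<in> seg_active zs (out_v h)" using Cons.prems(2) by (auto simp: seg_active_def)
   from Cons.IH[OF q' p'] show ?thesis unfolding e using \<open>q = Suc q'\<close> Suc by (simp add: seg_pos_Cons)
  qed
 qed
qed

lemma seg_sum_OmBar: "seg_sum zs (OmBar i) = 0\<^sub>m (seg_total zs i) (seg_total zs (i - 1))"
proof (rule eq_matI)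
 fix a b assume "a < dim_row (0\<^sub>m (seg_total zs i) (seg_total zs (i - 1)) :: complex mat)"
  "b < dim_col (0\<^sub>m (seg_total zs i) (seg_total zs (i - 1)) :: complex mat)"
 then have ab: "a < seg_total zs i" "b < seg_total zs (i - 1)" by simp_all
 from seg_pos_surj[OF ab(1)] seg_pos_surj[OF ab(2)] obtain q p
  where "q \<in> seg_active zs i" "a = seg_pos zs i q" "p \<in> seg_active zs (i - 1)" "b = seg_pos zs (i - 1) p" by blast
 then show "seg_sum zs (OmBar i) $$ (a, b) = 0\<^sub>m (seg_total zs i) (seg_total zs (i - 1)) $$ (a, b)"
  using seg_sum_entry[of q zs "OmBar i" p] ab by simp
qed (use seg_sum_carrier[of zs "OmBar i"] in auto)

lemma seg_total_eq_seg_dim: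
 assumes "!!z. count_list zs z = f z"
 shows "seg_total zs i = seg_dim f i"
proof -
 have "seg_total zs i = (\<Sum>z\<in>set zs. f z * seg_on z i)"
  unfolding seg_total_def sum_list_map_eq_sum_count by (simp add: assms)
 also have supp: "set zs = {z. f z ~= 0}"
 proof (intro equalityI subsetI)
  fix z assume "z \<in> set zs"
  then show "z \<in> {z. f z ~= 0}" using count_list_0_iff[of zs z] assms[of z] by simp
 next
  fix z assume "z \<in> {z. f z ~= 0}"
  then show "z \<in> set zs" using count_list_0_iff[of zs z] assms[of z] by simp
 qed
 also have "(\<Sum>z | f z ~= 0. f z * seg_on z i) = (\<Sum>z | f z ~= 0. if fst z <= i & i <= snd z then f z else 0)"
  by (intro sum.cong) (auto simp: seg_on_def)
 also have "... = seg_dim f i"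
 proof -
  have "finite {z. f z ~= 0}" unfolding supp[symmetric] by simp
  from sum.inter_filter[OF this, of f "%z. fst z <= i & i <= snd z"]
  show ?thesis unfolding seg_dim_def by simp
 qed
 finally show ?thesis .
qed

lemma seg_sum_rep_space:
 assumes "!!i. seg_total zs i = v i"
 shows "seg_sum zs \<in> rep_space_Om v"
 unfolding rep_space_Om_def rep_space_def using seg_sum_carrier[of zs] seg_sum_OmBar[of zs] assms by simp

definition om_part :: "(int => nat) => rep => rep" where
 "om_part v x = (%h. case h of Om i => x (Om i) | OmBar i => 0\<^sub>m (v i) (v (i - 1)))"

lemma rep_space_OmD: "x \<in> rep_space_Om v ==> x \<in> rep_space v"
 "x \<in> rep_space_Om v ==> x (OmBar i) = 0\<^sub>m (v i) (v (i - 1))"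
 unfolding rep_space_Om_def by auto

lemma gauge_act_rep_space_Om:
 assumes g: "g \<in> gauge_group v" and x: "x \<in> rep_space_Om v"
 shows "gauge_act v g x \<in> rep_space_Om v"
proof -
 have "gauge_act v g x (OmBar i) = 0\<^sub>m (v i) (v (i - 1))" for i
  unfolding gauge_act_def using rep_space_OmD(2)[OF x, of i] gauge_carrier[OF g, of i] gauge_inv_group(1)[OF g, of "i - 1"]
  by simp
 then show ?thesis using gauge_act_rep_space[OF g rep_space_OmD(1)[OF x]] unfolding rep_space_Om_def by simp
qed

lemma orbitI:
 assumes "!!z. count_list zs z = f z" "f \<in> Zt_V v" "g \<in> gauge_group v"
 shows "gauge_act v g (seg_sum zs) \<in> orbit v f"
proof -
 have "seg_total zs i = v i" for i using seg_total_eq_seg_dim[OF assms(1)] assms(2) unfolding Zt_V_def by simp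
 from gauge_act_rep_space_Om[OF assms(3) seg_sum_rep_space[OF this]]
 show ?thesis unfolding orbit_def using assms by blast
qed

lemma permutation_mat_inverse:
 fixes \<tau> :: "nat => nat"
 assumes "bij_betw \<tau> {..<n} {..<n}"
 defines "A \<equiv> mat n n (%(a, b). if a = \<tau> b then 1 else 0 :: complex)"
 shows "A * transpose_mat A = 1\<^sub>m n"
proof (rule eq_matI)
 fix a b assume "a < dim_row (1\<^sub>m n :: complex mat)" "b < dim_col (1\<^sub>m n :: complex mat)"
 then have ab: "a < n" "b < n" by auto
 have A: "A \<in> carrier_mat n n" unfolding A_def by simp
 obtain c where c: "c < n" "a = \<tau> c" using assms(1) ab(1) by (auto simp: bij_betw_def)
 have "(A * transpose_mat A) $$ (a, b) = (\<Sum>d<n. A $$ (a, d) * transpose_mat A $$ (d, b))"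
  by (rule mat_mult_entry[OF A _ ab]) (use A in simp)
 also have "... = (\<Sum>d<n. (if d = c then 1 else 0) * (if b = \<tau> d then 1 else 0))"
 proof (intro sum.cong refl)
  fix d assume "d \<in> {..<n}"
  then have "a = \<tau> d \<longleftrightarrow> d = c" using c assms(1) by (auto simp: bij_betw_def inj_on_def)
  then show "A $$ (a, d) * transpose_mat A $$ (d, b) = (if d = c then 1 else 0) * (if b = \<tau> d then 1 else 0)"
   using \<open>d \<in> {..<n}\<close> ab unfolding A_def by simp
 qed
 also have "... = (if b = \<tau> c then 1 else 0)" using c by (intro sum_mult_delta(3)) auto
 finally show "(A * transpose_mat A) $$ (a, b) = 1\<^sub>m n $$ (a, b)" using ab c by auto
qed (simp_all add: A_def)

text \<open>The function \<open>f\<close> records a multiset of segments while a direct sum needs a list; reordering the list is a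
  permutation of the basis in each degree.\<close>

lemma seg_sum_permute:
 assumes eq: "mset zs = mset zs'" and tot: "!!i. seg_total zs i = v i"
 shows "\<exists>g \<in> gauge_group v. seg_sum zs' = gauge_act v g (seg_sum zs)"
proof -
 obtain \<pi> where \<pi>: "\<pi> permutes {..<length zs'}" "permute_list \<pi> zs' = zs" using mset_eq_permutation[OF eq] .
 have len: "length zs = length zs'" using mset_eq_length[OF eq] .
 have \<pi>n: "zs ! p = zs' ! \<pi> p" if "p < length zs'" for p using \<pi>(2) permute_list_nth[OF \<pi>(1) that] by simp
 have \<pi>b: "bij_betw \<pi> (seg_active zs i) (seg_active zs' i)" for i
 proof (rule bij_betw_imageI)
  show "inj_on \<pi> (seg_active zs i)" using permutes_inj[OF \<pi>(1)] by (auto simp: inj_on_def inj_def)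
  show "\<pi> ` seg_active zs i = seg_active zs' i"
  proof (intro equalityI subsetI)
   fix q assume "q \<in> \<pi> ` seg_active zs i"
   then obtain p where p: "p \<in> seg_active zs i" "q = \<pi> p" by blast
   then have "p < length zs'" using len unfolding seg_active_def by simp
   then show "q \<in> seg_active zs' i"
    using p \<pi>n[of p] permutes_in_image[OF \<pi>(1), of p] unfolding seg_active_def by simp
  next
   fix q assume q: "q \<in> seg_active zs' i"
   then have "q \<in> \<pi> ` {..<length zs'}" using permutes_image[OF \<pi>(1)] unfolding seg_active_def by auto
   then obtain p where p: "p < length zs'" "q = \<pi> p" by auto
   then have "p \<in> seg_active zs i" using q \<pi>n[OF p(1)] len unfolding seg_active_def by simp
   then show "q \<in> \<pi> ` seg_active zs i" using p by blast
  qed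
 qed
 have tot': "seg_total zs' i = v i" for i
  using tot[of i] eq unfolding seg_total_def by (metis mset_map sum_mset_sum_list)
 define inv_pos where "inv_pos i = the_inv_into (seg_active zs i) (seg_pos zs i)" for i
 have inv_pos: "inv_pos i (seg_pos zs i p) = p" if "p \<in> seg_active zs i" for i p
  unfolding inv_pos_def using that seg_pos_bij[of zs i] by (intro the_inv_into_f_f) (auto simp: bij_betw_def)
 have inv_bij: "bij_betw (inv_pos i) {..<v i} (seg_active zs i)" for i
  unfolding inv_pos_def using bij_betw_the_inv_into[OF seg_pos_bij[of zs i]] by (simp add: tot)
 define \<tau> where "\<tau> i = seg_pos zs' i \<circ> \<pi> \<circ> inv_pos i" for i
 have \<tau>: "bij_betw (\<tau> i) {..<v i} {..<v i}" for i
  unfolding \<tau>_def using bij_betw_trans[OF bij_betw_trans[OF inv_bij \<pi>b] seg_pos_bij[of zs' i]] by (simp add: tot' o_assoc)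
 have \<tau>p: "\<tau> i (seg_pos zs i p) = seg_pos zs' i (\<pi> p)" if "p \<in> seg_active zs i" for i p
  unfolding \<tau>_def using inv_pos[OF that] by simp
 define g where "g i = mat (v i) (v i) (%(a, b). if a = \<tau> i b then 1 else 0 :: complex)" for i
 have g: "g \<in> gauge_group v"
  by (rule gauge_groupI_inverse[of _ _ "%i. transpose_mat (g i)"])
    (use permutation_mat_inverse[OF \<tau>] in \<open>simp_all add: g_def\<close>)
 note x = rep_space_OmD(1)[OF seg_sum_rep_space[of zs v, OF tot]]
 note z = rep_space_OmD(1)[OF seg_sum_rep_space[of zs' v, OF tot']]
 have "seg_sum zs' h * g (out_v h) = g (in_v h) * seg_sum zs h" for h
 proof (rule eq_matI)
  note gc = gauge_carrier[OF g]
  note c = rep_spaceD[OF x, of h] rep_spaceD[OF z, of h]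
  fix a b assume "a < dim_row (g (in_v h) * seg_sum zs h)" "b < dim_col (g (in_v h) * seg_sum zs h)"
  then have ab: "a < v (in_v h)" "b < v (out_v h)" using c gc[of "in_v h"] by auto
  obtain p where p: "p \<in> seg_active zs (out_v h)" "b = seg_pos zs (out_v h) p"
   using seg_pos_surj[of b zs] ab tot by metis
  obtain q' where q': "q' \<in> seg_active zs' (in_v h)" "a = seg_pos zs' (in_v h) q'"
   using seg_pos_surj[of a zs'] ab tot' by metis
  obtain q where q: "q \<in> seg_active zs (in_v h)" "q' = \<pi> q"
   using \<pi>b[of "in_v h"] q'(1) by (auto simp: bij_betw_def)
  have aq: "a = \<tau> (in_v h) (seg_pos zs (in_v h) q)" using \<tau>p[OF q(1)] q q' by simp
  have ql: "seg_pos zs (in_v h) q < v (in_v h)" using seg_pos_less[OF q(1)] tot by simp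
  have bl: "\<tau> (out_v h) b < v (out_v h)" using \<tau>[of "out_v h"] ab by (auto simp: bij_betw_def)
  have \<pi>p: "\<pi> p \<in> seg_active zs' (out_v h)" using \<pi>b[of "out_v h"] p by (auto simp: bij_betw_def)
  have "(seg_sum zs' h * g (out_v h)) $$ (a, b) = (\<Sum>c<v (out_v h). seg_sum zs' h $$ (a, c) * (if c = \<tau> (out_v h) b then 1 else 0))"
   unfolding mat_mult_entry[OF c(2) gc ab] using ab by (intro sum.cong) (auto simp: g_def)
  also have "... = seg_sum zs' h $$ (a, \<tau> (out_v h) b)" using bl by (intro sum_mult_delta(1)) auto
  also have "... = (if \<pi> q = \<pi> p then case h of Om _ => 1 | OmBar _ => 0 else 0)"
   using seg_sum_entry[OF q'(1) \<pi>p] \<tau>p[OF p(1)] p q q' by simp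
  also have "... = (if q = p then case h of Om _ => 1 | OmBar _ => 0 else 0)"
   using permutes_inj[OF \<pi>(1)] by (auto simp: inj_def)
  also have "... = seg_sum zs h $$ (seg_pos zs (in_v h) q, b)"
   using seg_sum_entry[OF q(1) p(1)] p by simp
  also have "... = (\<Sum>c<v (in_v h). (if c = seg_pos zs (in_v h) q then 1 else 0) * seg_sum zs h $$ (c, b))"
   using ql by (intro sum_mult_delta(3)[symmetric]) auto
  also have "... = (g (in_v h) * seg_sum zs h) $$ (a, b)"
   unfolding mat_mult_entry[OF gc c(1) ab]
  proof (intro sum.cong refl)
   fix c assume "c \<in> {..<v (in_v h)}"
   then have "a = \<tau> (in_v h) c \<longleftrightarrow> c = seg_pos zs (in_v h) q"
    using \<tau>[of "in_v h"] ql unfolding aq by (auto simp: bij_betw_def inj_on_def)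
   then show "(if c = seg_pos zs (in_v h) q then 1 else 0) * seg_sum zs h $$ (c, b) = g (in_v h) $$ (a, c) * seg_sum zs h $$ (c, b)"
    using ab \<open>c \<in> _\<close> unfolding g_def by simp
  qed
  finally show "(seg_sum zs' h * g (out_v h)) $$ (a, b) = (g (in_v h) * seg_sum zs h) $$ (a, b)" .
 qed (use rep_spaceD[OF x, of h] rep_spaceD[OF z, of h] gauge_carrier[OF g, of "in_v h"]
   gauge_carrier[OF g, of "out_v h"] in auto)
 then have "seg_sum zs' = gauge_act v g (seg_sum zs)" using gauge_act_iff[OF g x z] by blast
 then show ?thesis using g by blast
qed

lemma orbit_eq:
 assumes zs: "!!z. count_list zs z = f z" and f: "f \<in> Zt_V v"
 shows "orbit v f = (%g. gauge_act v g (seg_sum zs)) ` gauge_group v"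
proof (intro equalityI subsetI)
 have tot: "seg_total zs i = v i" for i using seg_total_eq_seg_dim[OF zs] f unfolding Zt_V_def by simp
 note sp = rep_space_OmD(1)[OF seg_sum_rep_space[of zs v, OF tot]]
 fix x assume "x \<in> orbit v f"
 then obtain zs' g where x: "\<forall>z. count_list zs' z = f z" "g \<in> gauge_group v" "x = gauge_act v g (seg_sum zs')"
  unfolding orbit_def by blast
 have "mset zs = mset zs'"
  by (rule multiset_eqI) (metis x(1) zs count_mset)
 from seg_sum_permute[OF this tot] obtain h where h: "h \<in> gauge_group v" "seg_sum zs' = gauge_act v h (seg_sum zs)" by blast
 have "x = gauge_act v (%i. g i * h i) (seg_sum zs)"
  unfolding x(3) h(2) by (rule gauge_act_mult[OF x(2) h(1) sp])
 then show "x \<in> (%g. gauge_act v g (seg_sum zs)) ` gauge_group v" using gauge_mult[OF x(2) h(1)] by blast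
qed (use orbitI[OF zs f] in auto)

lemma Zt_list_exists:
 assumes "f \<in> Zt_inf"
 obtains zs where "!!z. count_list zs z = f z"
proof -
 have fin: "finite {z. f z ~= 0}" using assms unfolding Zt_inf_def by simp
 define A where "A = Abs_multiset f"
 have "count A = f" unfolding A_def using fin by (intro Abs_multiset_inverse) simp
 obtain zs where "mset zs = A" using ex_mset by blast
 then have "count_list zs z = f z" for z using \<open>count A = f\<close> by (metis count_mset)
 then show ?thesis by (rule that)
qed

lemma orbit_nonempty:
 assumes "f \<in> Zt_V v"
 obtains x where "x \<in> orbit v f"
proof -
 obtain zs where "!!z. count_list zs z = f z" using Zt_list_exists assms unfolding Zt_V_def by blast
 from orbitI[OF this assms gauge_one] show ?thesis by (rule that)
qed

lemma orbit_gauge: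
 assumes f: "f \<in> Zt_V v" and x: "x \<in> orbit v f"
 shows "orbit v f = (%g. gauge_act v g x) ` gauge_group v"
proof -
 obtain zs where zs: "!!z. count_list zs z = f z" using Zt_list_exists f unfolding Zt_V_def by blast
 have tot: "seg_total zs i = v i" for i using seg_total_eq_seg_dim[OF zs] f unfolding Zt_V_def by simp
 note sp = rep_space_OmD(1)[OF seg_sum_rep_space[of zs v, OF tot]]
 obtain g where g: "g \<in> gauge_group v" "x = gauge_act v g (seg_sum zs)" using x orbit_eq[OF zs f] by blast
 show ?thesis
 proof (intro equalityI subsetI)
  fix y assume "y \<in> orbit v f"
  then obtain h where h: "h \<in> gauge_group v" "y = gauge_act v h (seg_sum zs)" using orbit_eq[OF zs f] by blast
  have xs: "x \<in> rep_space v" using gauge_act_rep_space[OF g(1) sp] g(2) by simp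
  have "seg_sum zs = gauge_act v (gauge_inv v g) x" unfolding g(2) by (rule gauge_act_inverse[OF g(1) sp, symmetric])
  then have "y = gauge_act v (%i. h i * gauge_inv v g i) x"
   unfolding h(2) using gauge_act_mult[OF h(1) gauge_inv_group(4)[OF g(1)] xs] by simp
  then show "y \<in> (%g. gauge_act v g x) ` gauge_group v" using gauge_mult[OF h(1) gauge_inv_group(4)[OF g(1)]] by blast
 next
  fix y assume "y \<in> (%g. gauge_act v g x) ` gauge_group v"
  then obtain h where h: "h \<in> gauge_group v" "y = gauge_act v h x" by blast
  then have "y = gauge_act v (%i. h i * g i) (seg_sum zs)" unfolding g(2) using gauge_act_mult[OF h(1) g(1) sp] by simp
  then show "y \<in> orbit v f" using orbitI[OF zs f gauge_mult[OF h(1) g(1)]] by simp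
 qed
qed

section \<open>The infinitesimal action in coordinates\<close>

text \<open>Matrix positions in the graded endomorphisms and in the representations of the arrows \<open>Om\<close>. Working with
  functions on these finite sets makes the infinitesimal action one single matrix \<open>com_kernel\<close>.\<close>

definition gauge_idx :: "(int => nat) => (int \<times> nat \<times> nat) set" where
 "gauge_idx v = {(i, a, b). a < v i & b < v i}"

definition edge_idx :: "(int => nat) => (int \<times> nat \<times> nat) set" where
 "edge_idx v = {(i, a, b). a < v (i - 1) & b < v i}"

definition gauge_mat :: "(int => nat) => (int \<times> nat \<times> nat => complex) => int => complex mat" where
 "gauge_mat v \<zeta> i = mat (v i) (v i) (%(a, b). \<zeta> (i, a, b))"

definition bar_rep :: "(int => nat) => (int \<times> nat \<times> nat => complex) => rep" where
 "bar_rep v \<psi> h = (case h of Om i => 0\<^sub>m (v (i - 1)) (v i)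
   | OmBar i => mat (v i) (v (i - 1)) (%(b, a). \<psi> (i, a, b)))"

definition om_entry :: "rep => int \<times> nat \<times> nat => complex" where
 "om_entry x = (%(i, a, b). x (Om i) $$ (a, b))"

text \<open>The matrix of \<open>\<zeta> \<mapsto> [\<zeta>, x]\<close> on the \<open>Om\<close> arrows, see \<open>com_kernel_row\<close>.\<close>

fun com_kernel :: "rep => int \<times> nat \<times> nat => int \<times> nat \<times> nat => complex" where
 "com_kernel x (i, a, b) (i', a', b') =
   (if i' = i - 1 & a' = a then x (Om i) $$ (b', b) else 0) -
   (if i' = i & b' = b then x (Om i) $$ (a, a') else 0)"

lemma edge_idx_Sigma: "edge_idx v = (SIGMA i:{i. v i ~= 0}. {..<v (i - 1)} \<times> {..<v i})"
 unfolding edge_idx_def by auto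

lemma finite_edge_idx: "fin_supp v ==> finite (edge_idx v)"
 unfolding edge_idx_Sigma by auto

lemma finite_gauge_idx:
 assumes "fin_supp v"
 shows "finite (gauge_idx v)"
proof -
 have "gauge_idx v = (SIGMA i:{i. v i ~= 0}. {..<v i} \<times> {..<v i})" unfolding gauge_idx_def by auto
 then show ?thesis using assms by auto
qed

lemma gauge_mat_carrier: "gauge_mat v \<zeta> i \<in> carrier_mat (v i) (v i)"
 unfolding gauge_mat_def by simp

lemma bar_rep_space: "bar_rep v \<psi> \<in> rep_space v"
 unfolding rep_space_def
proof (intro CollectI allI)
 fix h show "bar_rep v \<psi> h \<in> carrier_mat (v (in_v h)) (v (out_v h))"
  by (cases h) (simp_all add: bar_rep_def)
qed

lemma sum_fiber:
 assumes "finite P" "inj_on e J" "e ` J \<subseteq> P" "!!p. p \<in> P ==> p \<notin> e ` J ==> F p = 0"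
 shows "(\<Sum>p\<in>P. F p) = (\<Sum>c\<in>J. F (e c))"
proof -
 have "(\<Sum>p\<in>P. F p) = (\<Sum>p\<in>e ` J. F p)"
  using assms by (intro sum.mono_neutral_right) auto
 then show ?thesis using sum.reindex[OF assms(2), of F] by (simp add: o_def)
qed

lemma com_kernel_row:
 assumes fin: "fin_supp v" and x: "x \<in> rep_space v" and q: "q \<in> edge_idx v"
 shows "(\<Sum>p\<in>gauge_idx v. com_kernel x q p * \<zeta> p) = om_entry (comm_rep (gauge_mat v \<zeta>) x) q"
proof -
 obtain i a b where q': "q = (i, a, b)" "a < v (i - 1)" "b < v i" using q unfolding edge_idx_def by blast
 note finP = finite_gauge_idx[OF fin]
 have "(\<Sum>p\<in>gauge_idx v. com_kernel x q p * \<zeta> p) =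
   (\<Sum>p\<in>gauge_idx v. (case p of (i', a', b') => if i' = i - 1 & a' = a then x (Om i) $$ (b', b) else 0) * \<zeta> p)
  - (\<Sum>p\<in>gauge_idx v. (case p of (i', a', b') => if i' = i & b' = b then x (Om i) $$ (a, a') else 0) * \<zeta> p)"
  unfolding q' sum_subtractf[symmetric] by (intro sum.cong refl) (auto simp: left_diff_distrib)
 also have "(\<Sum>p\<in>gauge_idx v. (case p of (i', a', b') => if i' = i - 1 & a' = a then x (Om i) $$ (b', b) else 0) * \<zeta> p)
   = (\<Sum>c<v (i - 1). x (Om i) $$ (c, b) * \<zeta> (i - 1, a, c))"
  by (subst sum_fiber[OF finP, where e = "%c. (i - 1, a, c)" and J = "{..<v (i - 1)}"])
    (use q' in \<open>auto simp: inj_on_def gauge_idx_def\<close>)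
 also have "(\<Sum>p\<in>gauge_idx v. (case p of (i', a', b') => if i' = i & b' = b then x (Om i) $$ (a, a') else 0) * \<zeta> p)
   = (\<Sum>c<v i. x (Om i) $$ (a, c) * \<zeta> (i, c, b))"
  by (subst sum_fiber[OF finP, where e = "%c. (i, c, b)" and J = "{..<v i}"])
    (use q' in \<open>auto simp: inj_on_def gauge_idx_def\<close>)
 also have "(\<Sum>c<v (i - 1). x (Om i) $$ (c, b) * \<zeta> (i - 1, a, c)) - (\<Sum>c<v i. x (Om i) $$ (a, c) * \<zeta> (i, c, b))
   = om_entry (comm_rep (gauge_mat v \<zeta>) x) q"
 proof -
  have X: "x (Om i) \<in> carrier_mat (v (i - 1)) (v i)" using rep_spaceD[OF x, of "Om i"] by simp
  have "om_entry (comm_rep (gauge_mat v \<zeta>) x) q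
    = (gauge_mat v \<zeta> (i - 1) * x (Om i)) $$ (a, b) - (x (Om i) * gauge_mat v \<zeta> i) $$ (a, b)"
   unfolding om_entry_def comm_rep_def q' using q' X by (simp add: gauge_mat_def del: index_mult_mat(1))
  also have "... = (\<Sum>c<v (i - 1). gauge_mat v \<zeta> (i - 1) $$ (a, c) * x (Om i) $$ (c, b))
    - (\<Sum>c<v i. x (Om i) $$ (a, c) * gauge_mat v \<zeta> i $$ (c, b))"
   unfolding mat_mult_entry[OF gauge_mat_carrier[of v \<zeta> "i - 1"] X q'(2,3)] mat_mult_entry[OF X gauge_mat_carrier[of v \<zeta> i] q'(2,3)] ..
  also have "... = (\<Sum>c<v (i - 1). x (Om i) $$ (c, b) * \<zeta> (i - 1, a, c)) - (\<Sum>c<v i. x (Om i) $$ (a, c) * \<zeta> (i, c, b))"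
   using q' by (intro arg_cong2[where f = "(-)"] sum.cong) (auto simp: gauge_mat_def)
  finally show ?thesis by simp
 qed
 finally show ?thesis .
qed

text \<open>The transpose of the infinitesimal action is the moment map; this is where the signs of the symplectic form
  enter.\<close>

lemma com_kernel_column:
 assumes fin: "fin_supp v" and x: "x \<in> rep_space_Om v" and ab: "a < v i" "b < v i"
 shows "(\<Sum>q\<in>edge_idx v. \<psi> q * com_kernel x q (i, a, b)) = moment v (rep_add x (bar_rep v \<psi>)) i $$ (b, a)"
proof -
 note finQ = finite_edge_idx[OF fin]
 note xs = rep_space_OmD(1)[OF x]
 let ?y = "rep_add x (bar_rep v \<psi>)"
 have y: "?y \<in> rep_space v" by (intro rep_add_space xs bar_rep_space)
 have "(\<Sum>q\<in>edge_idx v. \<psi> q * com_kernel x q (i, a, b)) =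
   (\<Sum>q\<in>edge_idx v. \<psi> q * (case q of (i', a', b') => if i = i' - 1 & a = a' then x (Om i') $$ (b, b') else 0))
  - (\<Sum>q\<in>edge_idx v. \<psi> q * (case q of (i', a', b') => if i = i' & b = b' then x (Om i') $$ (a', a) else 0))"
  unfolding sum_subtractf[symmetric] by (intro sum.cong refl) (auto simp: right_diff_distrib)
 also have "(\<Sum>q\<in>edge_idx v. \<psi> q * (case q of (i', a', b') => if i = i' - 1 & a = a' then x (Om i') $$ (b, b') else 0))
   = (\<Sum>c<v (i + 1). \<psi> (i + 1, a, c) * x (Om (i + 1)) $$ (b, c))"
  by (subst sum_fiber[OF finQ, where e = "%c. (i + 1, a, c)" and J = "{..<v (i + 1)}"])
    (use ab in \<open>auto simp: inj_on_def edge_idx_def image_iff split: if_splits\<close>)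
 also have "(\<Sum>q\<in>edge_idx v. \<psi> q * (case q of (i', a', b') => if i = i' & b = b' then x (Om i') $$ (a', a) else 0))
   = (\<Sum>c<v (i - 1). \<psi> (i, c, b) * x (Om i) $$ (c, a))"
  by (subst sum_fiber[OF finQ, where e = "%c. (i, c, b)" and J = "{..<v (i - 1)}"])
    (use ab in \<open>auto simp: inj_on_def edge_idx_def image_iff split: if_splits\<close>)
 also have "(\<Sum>c<v (i + 1). \<psi> (i + 1, a, c) * x (Om (i + 1)) $$ (b, c)) - (\<Sum>c<v (i - 1). \<psi> (i, c, b) * x (Om i) $$ (c, a))
   = moment v ?y i $$ (b, a)"
 proof -
  have X: "x (Om i) \<in> carrier_mat (v (i - 1)) (v i)" for i using rep_spaceD[OF xs, of "Om i"] by simp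
  have Om: "?y (Om i) = x (Om i)" for i
   unfolding rep_add_def bar_rep_def using X[of i] by simp
  have OmB: "?y (OmBar i) = mat (v i) (v (i - 1)) (%(b, a). \<psi> (i, a, b))" for i
   unfolding rep_add_def bar_rep_def using rep_space_OmD(2)[OF x, of i] by simp
  have X': "x (Om (i + 1)) \<in> carrier_mat (v i) (v (i + 1))" using X[of "i + 1"] by simp
  let ?Y = "%i. mat (v i) (v (i - 1)) (%(b, a). \<psi> (i, a, b))"
  have Y: "?Y i \<in> carrier_mat (v i) (v (i - 1))" "?Y (i + 1) \<in> carrier_mat (v (i + 1)) (v i)" by simp_all
  have "moment v ?y i $$ (b, a) = (x (Om (i + 1)) * ?Y (i + 1)) $$ (b, a) - (?Y i * x (Om i)) $$ (b, a)"
   unfolding moment_eq[OF y] Om OmB using ab X[of i] by (simp del: index_mult_mat(1))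
  also have "... = (\<Sum>c<v (i + 1). x (Om (i + 1)) $$ (b, c) * ?Y (i + 1) $$ (c, a)) - (\<Sum>c<v (i - 1). ?Y i $$ (b, c) * x (Om i) $$ (c, a))"
   unfolding mat_mult_entry[OF X' Y(2) ab(2,1)] mat_mult_entry[OF Y(1) X ab(2,1)] ..
  also have "... = (\<Sum>c<v (i + 1). \<psi> (i + 1, a, c) * x (Om (i + 1)) $$ (b, c)) - (\<Sum>c<v (i - 1). \<psi> (i, c, b) * x (Om i) $$ (c, a))"
   using ab by (intro arg_cong2[where f = "(-)"] sum.cong) auto
  finally show ?thesis by simp
 qed
 finally show ?thesis .
qed

lemma com_kernel_moment:
 assumes fin: "fin_supp v" and x: "x \<in> rep_space_Om v"
 shows "(\<forall>p\<in>gauge_idx v. (\<Sum>q\<in>edge_idx v. \<psi> q * com_kernel x q p) = 0) \<longleftrightarrow>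
  (\<forall>i. moment_zero v (rep_add x (bar_rep v \<psi>)) i)"
proof
 assume *: "\<forall>p\<in>gauge_idx v. (\<Sum>q\<in>edge_idx v. \<psi> q * com_kernel x q p) = 0"
 show "\<forall>i. moment_zero v (rep_add x (bar_rep v \<psi>)) i"
 proof
  fix i show "moment_zero v (rep_add x (bar_rep v \<psi>)) i"
  proof (rule eq_matI)
   fix b a assume "b < dim_row (0\<^sub>m (v i) (v i) :: complex mat)" "a < dim_col (0\<^sub>m (v i) (v i) :: complex mat)"
   then have ab: "a < v i" "b < v i" by auto
   then have "(i, a, b) \<in> gauge_idx v" unfolding gauge_idx_def by simp
   with * have "(\<Sum>q\<in>edge_idx v. \<psi> q * com_kernel x q (i, a, b)) = 0" by blast
   then show "moment v (rep_add x (bar_rep v \<psi>)) i $$ (b, a) = 0\<^sub>m (v i) (v i) $$ (b, a)"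
    using com_kernel_column[OF fin x ab, of \<psi>] ab by simp
  qed (use moment_carrier[of v "rep_add x (bar_rep v \<psi>)" i] in auto)
 qed
next
 assume *: "\<forall>i. moment_zero v (rep_add x (bar_rep v \<psi>)) i"
 show "\<forall>p\<in>gauge_idx v. (\<Sum>q\<in>edge_idx v. \<psi> q * com_kernel x q p) = 0"
 proof
  fix p assume "p \<in> gauge_idx v"
  then obtain i a b where p: "p = (i, a, b)" "a < v i" "b < v i" unfolding gauge_idx_def by blast
  show "(\<Sum>q\<in>edge_idx v. \<psi> q * com_kernel x q p) = 0"
   unfolding p(1) com_kernel_column[OF fin x p(2,3)] using * p by simp
 qed
qed

lemma pairing_bar_rep:
 assumes fin: "fin_supp v" and y: "y \<in> rep_space v"
 shows "pairing (bar_rep v \<psi>) y = - (\<Sum>q\<in>edge_idx v. \<psi> q * om_entry y q)"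
proof -
 let ?S = "%i. \<Sum>b<v i. \<Sum>a<v (i - 1). \<psi> (i, a, b) * om_entry y (i, a, b)"
 let ?F = "%h. eps h * mat_trace (bar_rep v \<psi> h * y (opp h))"
 have c: "bar_rep v \<psi> h * y (opp h) \<in> carrier_mat (v (in_v h)) (v (in_v h))" for h
  using rep_spaceD[OF bar_rep_space[of v \<psi>], of h] rep_spaceD[OF y, of "opp h"] by (cases h) auto
 have Om: "?F (Om i) = 0" for i
  unfolding mat_trace_def bar_rep_def using rep_spaceD[OF y, of "OmBar i"] by simp
 have bar: "?F (OmBar i) = - (?S i)" for i
 proof -
  have Y: "mat (v i) (v (i - 1)) (%(b, a). \<psi> (i, a, b)) \<in> carrier_mat (v i) (v (i - 1))" by simp
  have X: "y (Om i) \<in> carrier_mat (v (i - 1)) (v i)" using rep_spaceD[OF y, of "Om i"] by simp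
  have "mat_trace (bar_rep v \<psi> (OmBar i) * y (Om i)) = (\<Sum>b<v i. (bar_rep v \<psi> (OmBar i) * y (Om i)) $$ (b, b))"
   unfolding mat_trace_def using c[of "OmBar i"] by auto
  also have "... = (?S i)"
  proof (intro sum.cong refl)
   fix b assume b: "b \<in> {..<v i}"
   then have bb: "b < v i" by simp
   show "(bar_rep v \<psi> (OmBar i) * y (Om i)) $$ (b, b) = (\<Sum>a<v (i - 1). \<psi> (i, a, b) * om_entry y (i, a, b))"
    unfolding bar_rep_def arrow.case mat_mult_entry[OF Y X bb bb] using bb
    by (intro sum.cong) (auto simp: om_entry_def)
  qed
  finally show ?thesis by simp
 qed
 have "{h. ?F h ~= 0} \<subseteq> OmBar ` {i. v i ~= 0}"
 proof
  fix h assume h: "h \<in> {h. ?F h ~= 0}"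
  then obtain i where i: "h = OmBar i" using Om by (cases h) auto
  then have "v i ~= 0" using h unfolding i mem_Collect_eq bar by (cases "v i") simp_all
  then show "h \<in> OmBar ` {i. v i ~= 0}" using i by blast
 qed
 then have "pairing (bar_rep v \<psi>) y = (\<Sum>h\<in>OmBar ` {i. v i ~= 0}. ?F h)"
  unfolding pairing_def using fin by (intro Sum_any.expand_superset) auto
 also have "... = (\<Sum>i | v i ~= 0. ?F (OmBar i))"
  by (subst sum.reindex) (auto simp: inj_on_def)
 also have "... = - (\<Sum>i | v i ~= 0. ?S i)"
  unfolding bar sum_negf ..
 also have "(\<Sum>i | v i ~= 0. ?S i)
   = (\<Sum>i | v i ~= 0. \<Sum>c\<in>{..<v (i - 1)} \<times> {..<v i}. \<psi> (i, c) * om_entry y (i, c))"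
 proof (intro sum.cong refl)
  fix i
  show "(?S i)
    = (\<Sum>c\<in>{..<v (i - 1)} \<times> {..<v i}. \<psi> (i, c) * om_entry y (i, c))"
   unfolding sum.swap[of _ "{..<v (i - 1)}"] by (simp add: sum.cartesian_product case_prod_unfold)
 qed
 also have "... = (\<Sum>q\<in>edge_idx v. \<psi> q * om_entry y q)"
  unfolding edge_idx_Sigma using fin by (subst sum.Sigma) (auto simp: case_prod_unfold)
 finally show ?thesis .
qed

section \<open>Directional derivatives\<close>

abbreviation has_velocity :: "(int => nat) => rep => rep => (complex => rep) => bool" where
 "has_velocity v x y \<gamma> \<equiv> \<forall>h a b. a < v (in_v h) --> b < v (out_v h) -->
   ((%t. (\<gamma> t h $$ (a, b) - x h $$ (a, b)) / t) \<longlongrightarrow> y h $$ (a, b)) (at 0)"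

text \<open>A polynomial function has the same derivative along every curve with a given velocity. This allows the curve
  in the orbit to replace the straight line in the definition of the tangent space.\<close>

lemma poly_fun_directional_derivative:
 assumes p: "p \<in> rep_polys v" and x: "x \<in> rep_space v" and y: "y \<in> rep_space v"
 shows "\<exists>D. ((%t. p (rep_add x (rep_smult t y))) has_field_derivative D) (at 0) &
  (\<forall>\<gamma>. has_velocity v x y \<gamma> -->
   ((%t. (p (\<gamma> t) - p x) / t) \<longlongrightarrow> D) (at 0))"
 using p
proof induction
 case (const c)
 show ?case by (rule exI[of _ 0]) auto
next
 case (coord p)
 then obtain h a b where h: "p = (%x. x h $$ (a, b))" "a < v (in_v h)" "b < v (out_v h)"
  unfolding rep_coords_def by blast
 have "p (rep_add x (rep_smult t y)) = x h $$ (a, b) + t * y h $$ (a, b)" for t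
  unfolding h(1) rep_add_def rep_smult_def using rep_spaceD[OF x, of h] rep_spaceD[OF y, of h] h by simp
 then have "((%t. p (rep_add x (rep_smult t y))) has_field_derivative y h $$ (a, b)) (at 0)"
  by (simp only:) (auto intro!: derivative_eq_intros)
 then show ?case using h by (intro exI[of _ "y h $$ (a, b)"]) auto
next
 case (add p q)
 from add.IH obtain D E where
  D: "((%t. p (rep_add x (rep_smult t y))) has_field_derivative D) (at 0)"
  "!!\<gamma>. has_velocity v x y \<gamma> ==>
   ((%t. (p (\<gamma> t) - p x) / t) \<longlongrightarrow> D) (at 0)" and
  E: "((%t. q (rep_add x (rep_smult t y))) has_field_derivative E) (at 0)"
  "!!\<gamma>. has_velocity v x y \<gamma> ==>
   ((%t. (q (\<gamma> t) - q x) / t) \<longlongrightarrow> E) (at 0)" by blast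
 show ?case
 proof (intro exI[of _ "D + E"] conjI allI impI)
  show "((%t. p (rep_add x (rep_smult t y)) + q (rep_add x (rep_smult t y))) has_field_derivative D + E) (at 0)"
   by (rule DERIV_add[OF D(1) E(1)])
  fix \<gamma> assume "has_velocity v x y \<gamma>"
  from tendsto_add[OF D(2)[OF this] E(2)[OF this]]
  show "((%t. (p (\<gamma> t) + q (\<gamma> t) - (p x + q x)) / t) \<longlongrightarrow> D + E) (at 0)"
   by (simp add: add_divide_distrib[symmetric] algebra_simps)
 qed
next
 case (mult p q)
 from mult.IH obtain D E where
  D: "((%t. p (rep_add x (rep_smult t y))) has_field_derivative D) (at 0)"
  "!!\<gamma>. has_velocity v x y \<gamma> ==>
   ((%t. (p (\<gamma> t) - p x) / t) \<longlongrightarrow> D) (at 0)" and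
  E: "((%t. q (rep_add x (rep_smult t y))) has_field_derivative E) (at 0)"
  "!!\<gamma>. has_velocity v x y \<gamma> ==>
   ((%t. (q (\<gamma> t) - q x) / t) \<longlongrightarrow> E) (at 0)" by blast
 have x0: "rep_add x (rep_smult 0 y) = x"
 proof
  fix h show "rep_add x (rep_smult 0 y) h = x h"
   unfolding rep_add_def rep_smult_def using rep_spaceD[OF x, of h] rep_spaceD[OF y, of h] by (intro eq_matI) auto
 qed
 show ?case
 proof (intro exI[of _ "D * q x + E * p x"] conjI allI impI)
  show "((%t. p (rep_add x (rep_smult t y)) * q (rep_add x (rep_smult t y))) has_field_derivative D * q x + E * p x) (at 0)"
   using DERIV_mult[OF D(1) E(1)] by (simp add: x0)
  fix \<gamma> assume \<gamma>: "has_velocity v x y \<gamma>"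
  have "((%t. (p (\<gamma> t) - p x) / t * q x + (q (\<gamma> t) - q x) / t * (t * ((p (\<gamma> t) - p x) / t) + p x))
    \<longlongrightarrow> D * q x + E * (0 * D + p x)) (at 0)"
   by (intro tendsto_intros D(2)[OF \<gamma>] E(2)[OF \<gamma>])
  then have "((%t. (p (\<gamma> t) - p x) / t * q x + (q (\<gamma> t) - q x) / t * (t * ((p (\<gamma> t) - p x) / t) + p x))
    \<longlongrightarrow> D * q x + E * p x) (at 0)" by simp
  then show "((%t. (p (\<gamma> t) * q (\<gamma> t) - p x * q x) / t) \<longlongrightarrow> D * q x + E * p x) (at 0)"
  proof (rule Lim_transform_eventually)
   show "\<forall>\<^sub>F t in at 0. (p (\<gamma> t) - p x) / t * q x + (q (\<gamma> t) - q x) / t * (t * ((p (\<gamma> t) - p x) / t) + p x)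
     = (p (\<gamma> t) * q (\<gamma> t) - p x * q x) / t"
    using eventually_neq_at_within[of 0 0 UNIV]
   proof eventually_elim
    case (elim t)
    then have "t * ((p (\<gamma> t) - p x) / t) + p x = p (\<gamma> t)" by simp
    then show ?case by (simp add: diff_divide_distrib algebra_simps)
   qed
  qed
 qed
qed

text \<open>At a diagonal matrix with exactly one zero on the diagonal the derivative of the determinant is the
  corresponding entry of the direction.\<close>

lemma det_derivative_rank_one:
 fixes E :: "nat => nat => complex"
 assumes M: "!!t. M t = mat (Suc r) (Suc r) (%(i, j). (if i = j & 0 < i then 1 else 0) + t * E i j)"
 shows "((%t. det (M t)) has_field_derivative E 0 0) (at 0)"
proof -
 define N where "N t = mat (Suc r) (Suc r) (%(i, j). if i = 0 then E 0 j else (if i = j then 1 else 0) + t * E i j)" for t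
 have MN: "M t = multrow 0 t (N t)" for t
  unfolding M N_def by (rule eq_matI) auto
 have det: "det (M t) = t * det (N t)" for t
  unfolding MN by (rule det_multrow[of _ "Suc r"]) (simp_all add: N_def)
 have "((%t. det (N t)) \<longlongrightarrow> det (N 0)) (at 0)"
 proof (rule tendsto_det[where n = "Suc r"])
  fix a b assume ab: "a < Suc r" "b < Suc r"
  show "((%t. N t $$ (a, b)) \<longlongrightarrow> N 0 $$ (a, b)) (at 0)"
  proof (cases "a = 0")
   case True
   then show ?thesis unfolding N_def using ab by simp
  next
   case False
   have "((%t. (if a = b then 1 else 0) + t * E a b) \<longlongrightarrow> (if a = b then 1 else 0) + 0 * E a b) (at 0)"
    by (intro tendsto_intros)
   then show ?thesis unfolding N_def using ab False by simp
  qed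
 qed (simp_all add: N_def)
 moreover have "det (N 0) = E 0 0"
 proof -
  have "upper_triangular (N 0)" unfolding upper_triangular_def N_def by auto
  then have "det (N 0) = prod_list (diag_mat (N 0))" by (rule det_upper_triangular[of _ "Suc r"]) (simp add: N_def)
  also have "... = (\<Prod>i<Suc r. N 0 $$ (i, i))"
   unfolding prod_list_diag_prod by (simp add: N_def atLeast0LessThan)
  also have "... = E 0 0" unfolding prod.lessThan_Suc_shift by (simp add: N_def)
  finally show ?thesis .
 qed
 ultimately have "((%t. det (N t)) \<longlongrightarrow> E 0 0) (at 0)" by simp
 then have "((%t. (det (M t) - det (M 0)) / (t - 0)) \<longlongrightarrow> E 0 0) (at 0)"
  by (rule Lim_transform_eventually)
    (use eventually_neq_at_within[of 0 0 UNIV] in eventually_elim, simp add: det)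
 then show ?thesis by (simp add: has_field_derivative_iff)
qed

section \<open>Kernels and cokernels\<close>

lemma sum_bilinear_swap:
 fixes k :: "'q => 'p => 'k::comm_semiring_0"
 shows "(\<Sum>q\<in>Q. \<psi> q * (\<Sum>p\<in>P. k q p * \<zeta> p)) = (\<Sum>p\<in>P. (\<Sum>q\<in>Q. \<psi> q * k q p) * \<zeta> p)"
 unfolding sum_distrib_left sum_distrib_right by (subst sum.swap) (simp add: mult.assoc)

text \<open>Besides the data of \<open>rank_normal_form\<close>, a basis \<open>\<nu>\<close> of the covectors that annihilate the range, with dual
  coordinates \<open>\<eta>\<close>. The count \<open>r + s = card Q\<close> is what makes every conormal variety have the same dimension.\<close>

lemma kernel_coordinates:
 fixes k :: "'q => 'p => 'k::field_char_0"
 assumes finP: "finite P" and finQ: "finite Q"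
 obtains r s :: nat and \<xi> :: "nat => 'p => 'k" and \<phi> \<nu> \<eta> :: "nat => 'q => 'k" where
  "r + s = card Q"
  "!!i j. i < r ==> j < r ==> (\<Sum>q\<in>Q. \<phi> i q * (\<Sum>p\<in>P. k q p * \<xi> j p)) = (if i = j then 1 else 0)"
  "!!q p. q \<in> Q ==> p \<in> P ==>
    k q p = (\<Sum>i<r. (\<Sum>p'\<in>P. k q p' * \<xi> i p') * (\<Sum>q'\<in>Q. \<phi> i q' * k q' p))"
  "!!i j. i < s ==> j < s ==> (\<Sum>q\<in>Q. \<eta> i q * \<nu> j q) = (if i = j then 1 else 0)"
  "!!j p. j < s ==> p \<in> P ==> (\<Sum>q\<in>Q. \<nu> j q * k q p) = 0"
  "!!\<psi> q. (!!p. p \<in> P ==> (\<Sum>q\<in>Q. \<psi> q * k q p) = 0) ==> q \<in> Q ==>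
    \<psi> q = (\<Sum>j<s. (\<Sum>q\<in>Q. \<eta> j q * \<psi> q) * \<nu> j q)"
proof -
 obtain r :: nat and \<xi> \<phi> where
  1: "!!i j. i < r ==> j < r ==> (\<Sum>q\<in>Q. \<phi> i q * (\<Sum>p\<in>P. k q p * \<xi> j p)) = (if i = j then 1 else 0)" and
  2: "!!q p. q \<in> Q ==> p \<in> P ==>
    k q p = (\<Sum>i<r. (\<Sum>p'\<in>P. k q p' * \<xi> i p') * (\<Sum>q'\<in>Q. \<phi> i q' * k q' p))"
  by (rule rank_normal_form[OF finP finQ, where k = k]) (rule that; assumption)
 define K where "K i q = (\<Sum>p\<in>P. k q p * \<xi> i p)" for i q
 \<comment> \<open>the projection onto the cokernel covectors along the span of the \<open>\<phi>\<close>\<close>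
 define Pj where "Pj q q' = (if q = q' then 1 else 0) - (\<Sum>i<r. \<phi> i q * K i q')" for q q'
 define pr where "pr \<psi> q = (\<Sum>q'\<in>Q. Pj q q' * \<psi> q')" for \<psi> q
 have pr: "pr \<psi> q = \<psi> q - (\<Sum>i<r. (\<Sum>q'\<in>Q. \<psi> q' * K i q') * \<phi> i q)" if "q \<in> Q" for \<psi> q
 proof -
  have "pr \<psi> q = (\<Sum>q'\<in>Q. (if q = q' then 1 else 0) * \<psi> q') - (\<Sum>q'\<in>Q. \<Sum>i<r. (\<psi> q' * K i q') * \<phi> i q)"
   unfolding pr_def Pj_def by (simp only: left_diff_distrib sum_subtractf sum_distrib_right) (simp add: mult_ac)
  also have "(\<Sum>q'\<in>Q. (if q = q' then 1 else 0) * \<psi> q') = \<psi> q" by (rule sum_mult_delta(4)[OF finQ that])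
  also have "(\<Sum>q'\<in>Q. \<Sum>i<r. (\<psi> q' * K i q') * \<phi> i q) = (\<Sum>i<r. (\<Sum>q'\<in>Q. \<psi> q' * K i q') * \<phi> i q)"
   by (subst sum.swap) (simp add: sum_distrib_right)
  finally show ?thesis .
 qed
 have orth: "(\<Sum>q\<in>Q. pr \<psi> q * K j q) = 0" if "j < r" for \<psi> j
 proof -
  have "(\<Sum>q\<in>Q. pr \<psi> q * K j q) = (\<Sum>q\<in>Q. \<psi> q * K j q - (\<Sum>i<r. (\<Sum>q'\<in>Q. \<psi> q' * K i q') * (\<phi> i q * K j q)))"
   by (intro sum.cong refl) (simp add: pr left_diff_distrib sum_distrib_right mult.assoc)
  also have "... = (\<Sum>q\<in>Q. \<psi> q * K j q) - (\<Sum>i<r. (\<Sum>q'\<in>Q. \<psi> q' * K i q') * (\<Sum>q\<in>Q. \<phi> i q * K j q))"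
  proof -
   have "(\<Sum>q\<in>Q. \<Sum>i<r. x i * (\<phi> i q * K j q)) = (\<Sum>i<r. x i * (\<Sum>q\<in>Q. \<phi> i q * K j q))" for x
    by (subst sum.swap) (simp only: sum_distrib_left)
   then show ?thesis unfolding sum_subtractf by simp
  qed
  also have "(\<Sum>i<r. (\<Sum>q'\<in>Q. \<psi> q' * K i q') * (\<Sum>q\<in>Q. \<phi> i q * K j q))
    = (\<Sum>i<r. (\<Sum>q'\<in>Q. \<psi> q' * K i q') * (if i = j then 1 else 0))"
   using 1 that unfolding K_def by (intro sum.cong) auto
  also have "... = (\<Sum>q'\<in>Q. \<psi> q' * K j q')" using that by (intro sum_mult_delta(1)) auto
  finally show ?thesis by simp
 qed
 have pr_id: "pr \<psi> q = \<psi> q" if "!!j. j < r ==> (\<Sum>q\<in>Q. \<psi> q * K j q) = 0" "q \<in> Q" for \<psi> q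
  unfolding pr[OF that(2)] using that(1) by simp
 have pr_cong: "pr \<psi> q = pr \<psi>' q" if "!!q. q \<in> Q ==> \<psi> q = \<psi>' q" for \<psi> \<psi>' q
  unfolding pr_def using that by (intro sum.cong) auto
 obtain s :: nat and \<alpha> \<beta> where
  3: "!!i j. i < s ==> j < s ==> (\<Sum>q\<in>Q. \<beta> i q * (\<Sum>p\<in>Q. Pj q p * \<alpha> j p)) = (if i = j then 1 else 0)" and
  4: "!!q p. q \<in> Q ==> p \<in> Q ==>
    Pj q p = (\<Sum>i<s. (\<Sum>p'\<in>Q. Pj q p' * \<alpha> i p') * (\<Sum>q'\<in>Q. \<beta> i q' * Pj q' p))"
  by (rule rank_normal_form[OF finQ finQ, where k = Pj]) (rule that; assumption)
 define \<nu> where "\<nu> j = pr (\<alpha> j)" for j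
 define \<eta> where "\<eta> i p = (\<Sum>q\<in>Q. \<beta> i q * Pj q p)" for i p
 have \<eta>: "(\<Sum>q\<in>Q. \<eta> i q * \<psi> q) = (\<Sum>q\<in>Q. \<beta> i q * pr \<psi> q)" for i \<psi>
  unfolding \<eta>_def pr_def sum_bilinear_swap ..
 have \<nu>K: "(\<Sum>q\<in>Q. \<nu> j q * K i q) = 0" if "i < r" for i j unfolding \<nu>_def by (rule orth[OF that])
 have dual: "(\<Sum>q\<in>Q. \<eta> i q * \<nu> j q) = (if i = j then 1 else 0)" if "i < s" "j < s" for i j
 proof -
  have "(\<Sum>q\<in>Q. \<eta> i q * \<nu> j q) = (\<Sum>q\<in>Q. \<beta> i q * \<nu> j q)"
   unfolding \<eta> using pr_id[of "\<nu> j"] \<nu>K by (intro sum.cong) auto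
  also have "... = (if i = j then 1 else 0)" using 3[OF that] unfolding \<nu>_def pr_def .
  finally show ?thesis .
 qed
 have Pj: "Pj q p = (\<Sum>i<s. \<nu> i q * \<eta> i p)" if "q \<in> Q" "p \<in> Q" for q p
  using 4[OF that] unfolding \<nu>_def pr_def \<eta>_def .
 have trace: "r + s = card Q"
 proof -
  have "(\<Sum>q\<in>Q. Pj q q) = (\<Sum>q\<in>Q. 1 :: 'k) - (\<Sum>q\<in>Q. \<Sum>i<r. \<phi> i q * K i q)"
   unfolding Pj_def by (simp add: sum_subtractf)
  also have "(\<Sum>q\<in>Q. \<Sum>i<r. \<phi> i q * K i q) = (\<Sum>i<r. \<Sum>q\<in>Q. \<phi> i q * K i q)" by (rule sum.swap)
  also have "... = (\<Sum>i<r. 1)" unfolding K_def using 1 by (intro sum.cong) auto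
  finally have "(\<Sum>q\<in>Q. Pj q q) = of_nat (card Q) - of_nat r" by simp
  moreover have "(\<Sum>q\<in>Q. Pj q q) = (\<Sum>q\<in>Q. \<Sum>i<s. \<eta> i q * \<nu> i q)"
   by (intro sum.cong refl) (simp add: Pj mult.commute)
  moreover have "... = (\<Sum>i<s. \<Sum>q\<in>Q. \<eta> i q * \<nu> i q)" by (rule sum.swap)
  moreover have "... = (\<Sum>i<s. 1)" using dual by (intro sum.cong) auto
  ultimately have "of_nat (r + s) = (of_nat (card Q) :: 'k)" by simp
  then show ?thesis by (simp only: of_nat_eq_iff)
 qed
 have left: "(\<Sum>q\<in>Q. \<nu> j q * k q p) = 0" if "p \<in> P" for j p
 proof -
  have "(\<Sum>q\<in>Q. \<nu> j q * k q p) = (\<Sum>q\<in>Q. \<nu> j q * (\<Sum>i<r. K i q * (\<Sum>q'\<in>Q. \<phi> i q' * k q' p)))"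
   unfolding K_def by (intro sum_times_cong 2 that)
  also have "... = (\<Sum>i<r. (\<Sum>q\<in>Q. \<nu> j q * K i q) * (\<Sum>q'\<in>Q. \<phi> i q' * k q' p))"
   by (rule sum_bilinear_swap)
  also have "... = 0" using \<nu>K by simp
  finally show ?thesis .
 qed
 have expand: "\<psi> q = (\<Sum>j<s. (\<Sum>q\<in>Q. \<eta> j q * \<psi> q) * \<nu> j q)"
  if \<psi>: "!!p. p \<in> P ==> (\<Sum>q\<in>Q. \<psi> q * k q p) = 0" and q: "q \<in> Q" for \<psi> q
 proof -
  have "(\<Sum>q\<in>Q. \<psi> q * K j q) = 0" for j
   unfolding K_def sum_bilinear_swap using \<psi> by simp
  then have "\<psi> q = pr \<psi> q" using pr_id[of \<psi>, OF _ q] by simp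
  also have "... = (\<Sum>q'\<in>Q. (\<Sum>i<s. \<nu> i q * \<eta> i q') * \<psi> q')"
   unfolding pr_def using Pj q by (intro sum.cong) auto
  also have "... = (\<Sum>i<s. \<nu> i q * (\<Sum>q'\<in>Q. \<eta> i q' * \<psi> q'))"
   by (rule sum_bilinear_swap[symmetric])
  finally show ?thesis by (simp add: mult.commute)
 qed
 show ?thesis
  by (rule that[of r s \<phi> \<xi> \<eta> \<nu>]) ((fact trace 1 2 dual) | (rule left, assumption) | (rule expand; assumption))+
qed

lemma near_identity_solution:
 fixes b :: "'p => 'p => complex"
 assumes fin: "finite P"
 obtains \<zeta> :: "complex => 'p => complex" where
  "\<forall>\<^sub>F t in at 0. \<forall>p\<in>P. \<zeta> t p + t * (\<Sum>p'\<in>P. b p p' * \<zeta> t p') = c p"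
  "!!p. p \<in> P ==> ((%t. \<zeta> t p) \<longlongrightarrow> c p) (at 0)"
proof -
 define n where "n = card P"
 obtain h where h: "bij_betw h {..<n} P"
  using ex_bij_betw_nat_finite[OF fin] unfolding n_def atLeast0LessThan by blast
 define h' where "h' = the_inv_into {..<n} h"
 have h': "h' p < n" "h (h' p) = p" if "p \<in> P" for p
  unfolding h'_def using h that f_the_inv_into_f_bij_betw[OF h] bij_betwE[OF bij_betw_the_inv_into[OF h]] by auto
 have hP: "h i \<in> P" "h' (h i) = i" if "i < n" for i
  unfolding h'_def using h that by (auto simp: bij_betw_def the_inv_into_f_f)
 define M where "M t = mat n n (%(i, j). (if i = j then 1 else 0) + t * b (h i) (h j))" for t :: complex
 have M: "M t \<in> carrier_mat n n" for t unfolding M_def by simp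
 have Mlim: "((%t. M t $$ (i, j)) \<longlongrightarrow> (1\<^sub>m n :: complex mat) $$ (i, j)) (at 0)" if "i < n" "j < n" for i j
 proof -
  have "((%t. (if i = j then 1 else 0) + t * b (h i) (h j)) \<longlongrightarrow> (if i = j then 1 else 0) + 0 * b (h i) (h j)) (at 0)"
   by (intro tendsto_intros)
  then show ?thesis unfolding M_def using that by simp
 qed
 define \<zeta> where "\<zeta> t p = (\<Sum>j<n. adj_mat (M t) $$ (h' p, j) * c (h j)) / det (M t)" for t p
 have detlim: "((%t. det (M t)) \<longlongrightarrow> 1) (at 0)"
  using tendsto_det[where M = M and n = n and N = "1\<^sub>m n", OF M _ Mlim] by simp
 have "((%t. \<zeta> t p) \<longlongrightarrow> c p) (at 0)" if p: "p \<in> P" for p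
 proof -
  have "((%t. (\<Sum>j<n. adj_mat (M t) $$ (h' p, j) * c (h j)) / det (M t))
    \<longlongrightarrow> (\<Sum>j<n. adj_mat (1\<^sub>m n) $$ (h' p, j) * c (h j)) / 1) (at 0)"
   by (intro tendsto_intros detlim tendsto_adj_mat[where n = n] M Mlim) (use h' p in auto)
  moreover have "(\<Sum>j<n. adj_mat (1\<^sub>m n) $$ (h' p, j) * c (h j)) = c p"
  proof -
   have "(\<Sum>j<n. adj_mat (1\<^sub>m n) $$ (h' p, j) * c (h j)) = (\<Sum>j<n. (if h' p = j then 1 else 0) * c (h j))"
    unfolding adj_mat_one using h'(1)[OF p] by (intro sum.cong) auto
   also have "... = c (h (h' p))" using h'(1)[OF p] by (intro sum_mult_delta(4)) auto
   finally show ?thesis using h'(2)[OF p] by simp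
  qed
  ultimately show ?thesis unfolding \<zeta>_def by simp
 qed
 moreover have "\<forall>\<^sub>F t in at 0. \<forall>p\<in>P. \<zeta> t p + t * (\<Sum>p'\<in>P. b p p' * \<zeta> t p') = c p"
  using tendsto_imp_eventually_ne[OF detlim one_neq_zero]
 proof eventually_elim
  case (elim t)
  show ?case
  proof
   fix p assume p: "p \<in> P"
   have "(\<Sum>p'\<in>P. b p p' * \<zeta> t p') = (\<Sum>j<n. b p (h j) * \<zeta> t (h j))"
    by (rule sum.reindex_bij_betw[OF h, symmetric])
   then have "\<zeta> t p + t * (\<Sum>p'\<in>P. b p p' * \<zeta> t p') = (\<Sum>j<n. (if h' p = j then 1 else 0) * \<zeta> t (h j)) + (\<Sum>j<n. t * b p (h j) * \<zeta> t (h j))"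
    using sum_mult_delta(4)[of "{..<n}" "h' p" "%j. \<zeta> t (h j)"] h'[OF p] by (simp add: sum_distrib_left mult.assoc)
   also have "... = (\<Sum>j<n. M t $$ (h' p, j) * \<zeta> t (h j))"
    unfolding sum.distrib[symmetric] using h'[OF p] by (intro sum.cong) (auto simp: M_def algebra_simps)
   also have "... = (\<Sum>j<n. M t $$ (h' p, j) * (\<Sum>l<n. adj_mat (M t) $$ (j, l) * c (h l))) / det (M t)"
    by (subst sum_divide_distrib, intro sum.cong refl) (simp add: \<zeta>_def hP)
   also have "(\<Sum>j<n. M t $$ (h' p, j) * (\<Sum>l<n. adj_mat (M t) $$ (j, l) * c (h l)))
     = (\<Sum>l<n. (\<Sum>j<n. M t $$ (h' p, j) * adj_mat (M t) $$ (j, l)) * c (h l))"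
    by (rule sum_bilinear_swap)
   also have "... = (\<Sum>l<n. (if h' p = l then 1 else 0) * (det (M t) * c (h l)))"
   proof (intro sum.cong refl)
    fix l assume l: "l \<in> {..<n}"
    have "(\<Sum>j<n. M t $$ (h' p, j) * adj_mat (M t) $$ (j, l)) = (M t * adj_mat (M t)) $$ (h' p, l)"
     by (rule mat_mult_entry[symmetric, OF M adj_mat(1)[OF M]]) (use h'[OF p] l in auto)
    also have "... = (det (M t) \<cdot>\<^sub>m 1\<^sub>m n) $$ (h' p, l)" by (simp only: adj_mat(2)[OF M])
    also have "... = (if h' p = l then det (M t) else 0)" using h'[OF p] l by simp
    finally show "(\<Sum>j<n. M t $$ (h' p, j) * adj_mat (M t) $$ (j, l)) * c (h l)
      = (if h' p = l then 1 else 0) * (det (M t) * c (h l))" by simp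
   qed
   also have "... = det (M t) * c p"
    using sum_mult_delta(4)[of "{..<n}" "h' p" "%l. det (M t) * c (h l)"] h'[OF p] by simp
   finally show "\<zeta> t p + t * (\<Sum>p'\<in>P. b p p' * \<zeta> t p') = c p" using elim by simp
  qed
 qed
 ultimately show ?thesis using that by blast
qed

text \<open>For small \<open>t\<close> the condition that \<open>(1 + t G) a\<close> lie in \<open>e + span \<xi>\<close> can be solved with \<open>a\<close> in the kernel of
  \<open>k\<close> near \<open>e\<close>. Let \<open>A\<close> be the projection onto the kernel along the span of the \<open>\<xi>\<close>; the equation \<open>a + t A G A
  a = e\<close> is a perturbation of the identity, and its solution automatically lies in the kernel.\<close>

lemma kernel_perturbation:
 fixes k :: "'q => 'p => complex" and G :: "'p => 'p => complex" and r :: nat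
 assumes finP: "finite P" and finQ: "finite Q"
  and 1: "!!i j. i < r ==> j < r ==> (\<Sum>q\<in>Q. \<phi> i q * (\<Sum>p\<in>P. k q p * \<xi> j p)) = (if i = j then 1 else 0)"
  and 2: "!!q p. q \<in> Q ==> p \<in> P ==>
    k q p = (\<Sum>i<r. (\<Sum>p'\<in>P. k q p' * \<xi> i p') * (\<Sum>q'\<in>Q. \<phi> i q' * k q' p))"
  and e: "!!q. q \<in> Q ==> (\<Sum>p\<in>P. k q p * e p) = 0"
 obtains a :: "complex => 'p => complex" where
  "!!p. p \<in> P ==> ((%t. a t p) \<longlongrightarrow> e p) (at 0)"
  "\<forall>\<^sub>F t in at 0. (\<forall>q\<in>Q. (\<Sum>p\<in>P. k q p * a t p) = 0) &
    (\<exists>c. \<forall>p\<in>P. a t p + t * (\<Sum>p'\<in>P. G p p' * a t p') = e p + (\<Sum>i<r. c i * \<xi> i p))"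
proof -
 define \<kappa> where "\<kappa> i \<zeta> = (\<Sum>q\<in>Q. \<phi> i q * (\<Sum>p\<in>P. k q p * \<zeta> p))" for i \<zeta>
 \<comment> \<open>the projection onto the kernel along the span of the \<open>\<xi>\<close>\<close>
 define A where "A \<zeta> p = \<zeta> p - (\<Sum>i<r. \<kappa> i \<zeta> * \<xi> i p)" for \<zeta> p
 define Am where "Am p p' = (if p = p' then 1 else 0) - (\<Sum>i<r. (\<Sum>q\<in>Q. \<phi> i q * k q p') * \<xi> i p)" for p p'
 have \<kappa>_lin: "\<kappa> i (%p. \<zeta> p + x * \<zeta>' p) = \<kappa> i \<zeta> + x * \<kappa> i \<zeta>'" for i \<zeta> \<zeta>' x
  unfolding \<kappa>_def by (simp add: algebra_simps sum.distrib sum_distrib_left)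
 have \<kappa>_alt: "\<kappa> i \<zeta> = (\<Sum>p\<in>P. (\<Sum>q\<in>Q. \<phi> i q * k q p) * \<zeta> p)" for i \<zeta>
  unfolding \<kappa>_def by (rule sum_bilinear_swap)
 have \<kappa>_cong: "\<kappa> i \<zeta> = \<kappa> i \<zeta>'" if "!!p. p \<in> P ==> \<zeta> p = \<zeta>' p" for i \<zeta> \<zeta>'
  unfolding \<kappa>_def using that by (intro sum_times_cong) auto
 have \<kappa>_sum: "\<kappa> i (%p. \<Sum>j<r. x j * \<xi> j p) = x i" if "i < r" for i and x :: "nat => complex"
 proof -
  have "\<kappa> i (%p. \<Sum>j<r. x j * \<xi> j p) = (\<Sum>p\<in>P. (\<Sum>q\<in>Q. \<phi> i q * k q p) * (\<Sum>j<r. \<xi> j p * x j))"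
  proof -
   have "\<kappa> i (%p. \<Sum>j<r. x j * \<xi> j p) = (\<Sum>p\<in>P. (\<Sum>q\<in>Q. \<phi> i q * k q p) * (\<Sum>j<r. x j * \<xi> j p))"
    unfolding \<kappa>_def by (rule sum_bilinear_swap)
   also have "... = (\<Sum>p\<in>P. (\<Sum>q\<in>Q. \<phi> i q * k q p) * (\<Sum>j<r. \<xi> j p * x j))"
    by (intro sum_times_cong mult.commute)
   finally show ?thesis .
  qed
  also have "... = (\<Sum>j<r. (\<Sum>p\<in>P. (\<Sum>q\<in>Q. \<phi> i q * k q p) * \<xi> j p) * x j)" by (rule sum_bilinear_swap)
  also have "... = (\<Sum>j<r. (if i = j then 1 else 0) * x j)"
  proof (intro sum_times_cong)
   fix j assume "j \<in> {..<r}"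
   then show "(\<Sum>p\<in>P. (\<Sum>q\<in>Q. \<phi> i q * k q p) * \<xi> j p) = (if i = j then 1 else 0)"
    using 1[of i j] that unfolding sum_bilinear_swap by simp
  qed
  also have "... = x i" using that by (intro sum_mult_delta(4)) auto
  finally show ?thesis .
 qed
 have \<kappa>A: "\<kappa> i (A \<zeta>) = 0" if "i < r" for i \<zeta>
 proof -
  have "\<kappa> i (A \<zeta>) = \<kappa> i (%p. \<zeta> p + (-1) * (\<Sum>j<r. \<kappa> j \<zeta> * \<xi> j p))" unfolding A_def by simp
  then show ?thesis unfolding \<kappa>_lin \<kappa>_sum[OF that] by simp
 qed
 have Ker: "(\<Sum>p\<in>P. k q p * \<zeta> p) = 0" if "!!i. i < r ==> \<kappa> i \<zeta> = 0" "q \<in> Q" for q \<zeta>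
 proof -
  have "(\<Sum>p\<in>P. k q p * \<zeta> p) = (\<Sum>p\<in>P. (\<Sum>i<r. (\<Sum>p'\<in>P. k q p' * \<xi> i p') * (\<Sum>q'\<in>Q. \<phi> i q' * k q' p)) * \<zeta> p)"
   by (intro sum_times_cong 2[OF that(2)])
  also have "... = (\<Sum>i<r. (\<Sum>p'\<in>P. k q p' * \<xi> i p') * (\<Sum>p\<in>P. (\<Sum>q'\<in>Q. \<phi> i q' * k q' p) * \<zeta> p))"
   by (rule sum_bilinear_swap[symmetric])
  also have "... = (\<Sum>i<r. (\<Sum>p'\<in>P. k q p' * \<xi> i p') * \<kappa> i \<zeta>)"
   unfolding \<kappa>_def sum_bilinear_swap ..
  also have "... = 0" using that by simp
  finally show ?thesis .
 qed
 have A_id: "A \<zeta> p = \<zeta> p" if "!!i. i < r ==> \<kappa> i \<zeta> = 0" for \<zeta> p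
  unfolding A_def using that by simp
 have Am: "(\<Sum>p'\<in>P. Am p p' * \<zeta> p') = A \<zeta> p" if "p \<in> P" for p \<zeta>
 proof -
  have "(\<Sum>p'\<in>P. Am p p' * \<zeta> p') = (\<Sum>p'\<in>P. (if p = p' then 1 else 0) * \<zeta> p')
    - (\<Sum>p'\<in>P. (\<Sum>i<r. \<xi> i p * (\<Sum>q\<in>Q. \<phi> i q * k q p')) * \<zeta> p')"
   unfolding Am_def left_diff_distrib sum_subtractf by (simp add: mult.commute)
  also have "(\<Sum>p'\<in>P. (if p = p' then 1 else 0) * \<zeta> p') = \<zeta> p" by (rule sum_mult_delta(4)[OF finP that])
  also have "(\<Sum>p'\<in>P. (\<Sum>i<r. \<xi> i p * (\<Sum>q\<in>Q. \<phi> i q * k q p')) * \<zeta> p')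
    = (\<Sum>i<r. \<xi> i p * (\<Sum>p'\<in>P. (\<Sum>q\<in>Q. \<phi> i q * k q p') * \<zeta> p'))"
   by (rule sum_bilinear_swap[symmetric])
  also have "... = (\<Sum>i<r. \<kappa> i \<zeta> * \<xi> i p)" unfolding \<kappa>_alt
   by (intro sum.cong refl mult.commute)
  finally show ?thesis unfolding A_def .
 qed
 define b where "b p p' = (\<Sum>p1\<in>P. Am p p1 * (\<Sum>p2\<in>P. G p1 p2 * Am p2 p'))" for p p'
 have b: "(\<Sum>p'\<in>P. b p p' * \<zeta> p') = A (%p1. \<Sum>p2\<in>P. G p1 p2 * A \<zeta> p2) p" if "p \<in> P" for p \<zeta>
 proof -
  have "(\<Sum>p'\<in>P. b p p' * \<zeta> p') = (\<Sum>p1\<in>P. Am p p1 * (\<Sum>p'\<in>P. (\<Sum>p2\<in>P. G p1 p2 * Am p2 p') * \<zeta> p'))"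
   unfolding b_def by (rule sum_bilinear_swap[symmetric])
  also have "... = (\<Sum>p1\<in>P. Am p p1 * (\<Sum>p2\<in>P. G p1 p2 * (\<Sum>p'\<in>P. Am p2 p' * \<zeta> p')))"
   by (simp only: sum_bilinear_swap[symmetric])
  also have "... = (\<Sum>p1\<in>P. Am p p1 * (\<Sum>p2\<in>P. G p1 p2 * A \<zeta> p2))"
   using Am by (intro sum_times_cong) auto
  also have "... = A (%p1. \<Sum>p2\<in>P. G p1 p2 * A \<zeta> p2) p" by (rule Am[OF that])
  finally show ?thesis .
 qed
 obtain \<zeta> where \<zeta>: "\<forall>\<^sub>F t in at 0. \<forall>p\<in>P. \<zeta> t p + t * (\<Sum>p'\<in>P. b p p' * \<zeta> t p') = e p"
  "!!p. p \<in> P ==> ((%t. \<zeta> t p) \<longlongrightarrow> e p) (at 0)"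
  using near_identity_solution[OF finP, of b e] by blast
 have \<kappa>e: "\<kappa> i e = 0" for i unfolding \<kappa>_def using e by simp
 show ?thesis
 proof (rule that[of \<zeta>])
  show "\<forall>\<^sub>F t in at 0. (\<forall>q\<in>Q. (\<Sum>p\<in>P. k q p * \<zeta> t p) = 0) &
    (\<exists>c. \<forall>p\<in>P. \<zeta> t p + t * (\<Sum>p'\<in>P. G p p' * \<zeta> t p') = e p + (\<Sum>i<r. c i * \<xi> i p))"
   using \<zeta>(1)
  proof eventually_elim
   case (elim t)
   define w where "w p1 = (\<Sum>p2\<in>P. G p1 p2 * A (\<zeta> t) p2)" for p1
   have eq: "\<zeta> t p = e p + (- t) * A w p" if "p \<in> P" for p
    using elim that b[OF that, of "\<zeta> t"] unfolding w_def by (auto simp: algebra_simps eq_diff_eq)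
   have \<kappa>\<zeta>: "\<kappa> i (\<zeta> t) = 0" if "i < r" for i
   proof -
    have "\<kappa> i (\<zeta> t) = \<kappa> i (%p. e p + (- t) * A w p)" by (rule \<kappa>_cong) (rule eq)
    then show ?thesis unfolding \<kappa>_lin \<kappa>e \<kappa>A[OF that] by simp
   qed
   have w: "w p = (\<Sum>p'\<in>P. G p p' * \<zeta> t p')" for p
    unfolding w_def using A_id[of "\<zeta> t", OF \<kappa>\<zeta>] by simp
   have "\<zeta> t p + t * (\<Sum>p'\<in>P. G p p' * \<zeta> t p') = e p + (\<Sum>i<r. (t * \<kappa> i w) * \<xi> i p)" if "p \<in> P" for p
    using eq[OF that] unfolding w[symmetric] A_def by (simp add: algebra_simps sum_distrib_left sum_negf)
   moreover have "\<forall>q\<in>Q. (\<Sum>p\<in>P. k q p * \<zeta> t p) = 0" using Ker \<kappa>\<zeta> by blast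
   ultimately show ?case by (intro conjI exI[of _ "%i. t * \<kappa> i w"]) auto
  qed
 qed (fact \<zeta>(2))
qed

lemma det_low_rank:
 fixes B C :: "nat => nat => complex"
 assumes "r < n"
 shows "det (mat n n (%(i, j). \<Sum>l<r. B i l * C l j)) = 0"
proof -
 obtain c where c: "\<exists>j\<in>{..<n}. c j ~= 0" "\<forall>l\<in>{..<r}. (\<Sum>j\<in>{..<n}. C l j * c j) = 0"
  using homogeneous_system_nontrivial[of "{..<r}" "{..<n}" C] assms by auto
 let ?M = "mat n n (%(i, j). \<Sum>l<r. B i l * C l j)"
 have "?M *\<^sub>v vec n c = 0\<^sub>v n"
 proof (rule eq_vecI)
  fix i assume "i < dim_vec (0\<^sub>v n :: complex vec)"
  then have i: "i < n" by simp
  have "(?M *\<^sub>v vec n c) $ i = (\<Sum>j<n. (\<Sum>l<r. B i l * C l j) * c j)"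
   using i by (simp add: scalar_prod_def atLeast0LessThan)
  also have "... = (\<Sum>l<r. B i l * (\<Sum>j<n. C l j * c j))" by (rule sum_bilinear_swap[symmetric])
  also have "... = 0" using c(2) by simp
  finally show "(?M *\<^sub>v vec n c) $ i = 0\<^sub>v n $ i" using i by simp
 qed simp
 moreover have "vec n c \<in> carrier_vec n" by simp
 moreover have "vec n c ~= 0\<^sub>v n"
 proof
  assume "vec n c = 0\<^sub>v n"
  then have "\<forall>j<n. c j = 0" by (metis index_vec index_zero_vec(1))
  then show False using c(1) by auto
 qed
 ultimately have "\<exists>u. u \<in> carrier_vec n & u ~= 0\<^sub>v n & ?M *\<^sub>v u = 0\<^sub>v n" by blast
 then show ?thesis by (simp only: det_0_iff_vec_prod_zero_field[OF mat_carrier])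
qed

section \<open>The Zariski tangent space of an orbit\<close>

lemma rep_add_zero:
 assumes "x \<in> rep_space v"
 shows "rep_add x (rep_smult t (bar_rep v (%_. 0))) = x"
proof
 fix h
 show "rep_add x (rep_smult t (bar_rep v (%_. 0))) h = x h"
  using rep_spaceD[OF assms, of h] unfolding rep_add_def rep_smult_def bar_rep_def
  by (cases h) (auto intro!: eq_matI)
qed

text \<open>Move the point by \<open>1 + t \<zeta>\<close>, which stays in the orbit for small \<open>t\<close>.\<close>

lemma comm_in_tangent_space:
 assumes fin: "fin_supp v" and f: "f \<in> Zt_V v" and x: "x \<in> orbit v f"
 shows "comm_rep (gauge_mat v \<zeta>) x \<in> tangent_space v (orbit v f) x"
proof -
 have xs: "x \<in> rep_space v" using x rep_space_OmD(1) unfolding orbit_def by blast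
 let ?y = "comm_rep (gauge_mat v \<zeta>) x"
 have y: "?y \<in> rep_space v" by (rule comm_rep_space[where \<xi> = "gauge_mat v \<zeta>", OF gauge_mat_carrier xs])
 let ?G = "%t i. 1\<^sub>m (v i) + t \<cdot>\<^sub>m gauge_mat v \<zeta> i"
 let ?\<gamma> = "%t. gauge_act v (?G t) x"
 have lim: "((%t. (?\<gamma> t h $$ (a, b) - x h $$ (a, b)) / t) \<longlongrightarrow> ?y h $$ (a, b)) (at 0)"
  if "a < v (in_v h)" "b < v (out_v h)" for h a b
 proof -
  have "bar_rep v (%_. 0) h $$ (a, b) = 0" using that unfolding bar_rep_def by (cases h) auto
  then show ?thesis
   using infinitesimal_action(2)[where \<xi> = "gauge_mat v \<zeta>" and y = "bar_rep v (%_. 0)", OF fin gauge_mat_carrier xs bar_rep_space that]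
   by (simp add: rep_add_zero[OF xs])
 qed
 show ?thesis
  unfolding tangent_space_def
 proof (intro CollectI conjI ballI impI y)
  fix p assume p: "p \<in> rep_polys v" and van: "\<forall>s\<in>orbit v f. p s = 0"
  from poly_fun_directional_derivative[OF p xs y]
  obtain D where D0: "((%t. p (rep_add x (rep_smult t ?y))) has_field_derivative D) (at 0)"
   and D1: "\<forall>\<gamma>. (\<forall>h a b. a < v (in_v h) --> b < v (out_v h) -->
     ((%t. (\<gamma> t h $$ (a, b) - x h $$ (a, b)) / t) \<longlongrightarrow> ?y h $$ (a, b)) (at (0::complex))) -->
   ((%t. (p (\<gamma> t) - p x) / t) \<longlongrightarrow> D) (at 0)" by (elim exE conjE) (rule that)
  have D: "((%t. p (rep_add x (rep_smult t ?y))) has_field_derivative D) (at 0)"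
   "((%t. (p (?\<gamma> t) - p x) / t) \<longlongrightarrow> D) (at 0)"
   using D0 D1[rule_format, of ?\<gamma>] lim by simp_all
  have "\<forall>\<^sub>F t in at 0. (p (?\<gamma> t) - p x) / t = 0"
   using infinitesimal_action(1)[where \<xi> = "gauge_mat v \<zeta>" and y = "bar_rep v (%_. 0)", OF fin gauge_mat_carrier xs bar_rep_space]
  proof eventually_elim
   case (elim t)
   then have "?\<gamma> t \<in> orbit v f" using orbit_gauge[OF f x] by blast
   then show ?case using van x by simp
  qed
  then have "((%t. 0) \<longlongrightarrow> D) (at (0::complex))"
   using D(2) by (rule Lim_transform_eventually[rotated])
  then have "D = 0" by (simp add: tendsto_const_iff)
  then show "((%t. p (rep_add x (rep_smult t ?y))) has_field_derivative 0) (at 0)" using D(1) by simp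
 qed
qed

text \<open>The Zariski tangent space is no larger than the image of the infinitesimal action. For \<open>x\<close> in the orbit of
  \<open>x0\<close> consider \<open>tw x : \<zeta> \<mapsto> \<zeta> x0 - x \<zeta>\<close>. For \<open>x = g x0\<close> it equals \<open>g\<close> composed with \<open>\<zeta> \<mapsto> [g\<inverse> \<zeta>, x0]\<close>, so its
  rank is the constant \<open>r\<close> on the orbit and its minors of size \<open>r + 1\<close> vanish there. Take the minor bordered
  by the identity \<open>\<zeta> = 1\<close>, which lies in the kernel at \<open>x0\<close>, and by the covector \<open>\<psi>\<close>. Its derivative in
  direction \<open>y\<close> is minus the value of \<open>\<psi>\<close> at \<open>y\<close>, so a tangent vector \<open>y\<close> is orthogonal to \<open>\<psi>\<close>.\<close>

lemma tangent_space_orthogonal: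
 assumes fin: "fin_supp v" and f: "f \<in> Zt_V v" and x0: "x0 \<in> orbit v f"
  and \<psi>: "!!p. p \<in> gauge_idx v ==> (\<Sum>q\<in>edge_idx v. \<psi> q * com_kernel x0 q p) = 0"
  and y: "y \<in> tangent_space v (orbit v f) x0"
 shows "(\<Sum>q\<in>edge_idx v. \<psi> q * om_entry y q) = 0"
proof -
 define P where "P = gauge_idx v"
 define Q where "Q = edge_idx v"
 have finP: "finite P" and finQ: "finite Q"
  unfolding P_def Q_def using finite_gauge_idx[OF fin] finite_edge_idx[OF fin] .
 have xs: "x0 \<in> rep_space v" using x0 rep_space_OmD(1) unfolding orbit_def by blast
 have ys: "y \<in> rep_space v" using y unfolding tangent_space_def by simp
 obtain r :: nat and \<xi> \<phi> where
  1: "!!i j. i < r ==> j < r ==> (\<Sum>q\<in>Q. \<phi> i q * (\<Sum>p\<in>P. com_kernel x0 q p * \<xi> j p)) = (if i = j then 1 else 0)" and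
  2: "!!q p. q \<in> Q ==> p \<in> P ==>
    com_kernel x0 q p = (\<Sum>i<r. (\<Sum>p'\<in>P. com_kernel x0 q p' * \<xi> i p') * (\<Sum>q'\<in>Q. \<phi> i q' * com_kernel x0 q' p))"
  by (rule rank_normal_form[OF finP finQ, where k = "com_kernel x0"]) (rule that; assumption)
 define K where "K \<zeta> q = (\<Sum>p\<in>P. com_kernel x0 q p * \<zeta> p)" for \<zeta> q
 define tw where "tw x \<zeta> = (%(i, a, b). (\<Sum>c<v (i - 1). \<zeta> (i - 1, a, c) * x0 (Om i) $$ (c, b))
   - (\<Sum>c<v i. x (Om i) $$ (a, c) * \<zeta> (i, c, b)))" for x and \<zeta> :: "int \<times> nat \<times> nat => complex"
 have K_expand: "K \<zeta> q = (\<Sum>l<r. K (\<xi> l) q * (\<Sum>q'\<in>Q. \<phi> l q' * K \<zeta> q'))" if "q \<in> Q" for \<zeta> q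
 proof -
  have "K \<zeta> q = (\<Sum>p\<in>P. (\<Sum>l<r. K (\<xi> l) q * (\<Sum>q'\<in>Q. \<phi> l q' * com_kernel x0 q' p)) * \<zeta> p)"
   unfolding K_def by (intro sum_times_cong 2[OF that])
  also have "... = (\<Sum>l<r. K (\<xi> l) q * (\<Sum>p\<in>P. (\<Sum>q'\<in>Q. \<phi> l q' * com_kernel x0 q' p) * \<zeta> p))"
   by (rule sum_bilinear_swap[symmetric])
  finally show ?thesis unfolding K_def sum_bilinear_swap .
 qed
 have tw_mat: "tw x \<zeta> (i, a, b) = (gauge_mat v \<zeta> (i - 1) * x0 (Om i) - x (Om i) * gauge_mat v \<zeta> i) $$ (a, b)"
  if "x \<in> rep_space v" "(i, a, b) \<in> Q" for x \<zeta> i a b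
 proof -
  have ab: "a < v (i - 1)" "b < v i" using that(2) unfolding Q_def edge_idx_def by auto
  have c: "x (Om i) \<in> carrier_mat (v (i - 1)) (v i)" "x0 (Om i) \<in> carrier_mat (v (i - 1)) (v i)"
   using rep_spaceD[OF that(1), of "Om i"] rep_spaceD[OF xs, of "Om i"] by auto
  have "(gauge_mat v \<zeta> (i - 1) * x0 (Om i) - x (Om i) * gauge_mat v \<zeta> i) $$ (a, b)
    = (gauge_mat v \<zeta> (i - 1) * x0 (Om i)) $$ (a, b) - (x (Om i) * gauge_mat v \<zeta> i) $$ (a, b)"
   using ab c by (simp add: gauge_mat_def del: index_mult_mat(1))
  also have "... = (\<Sum>d<v (i - 1). gauge_mat v \<zeta> (i - 1) $$ (a, d) * x0 (Om i) $$ (d, b))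
    - (\<Sum>d<v i. x (Om i) $$ (a, d) * gauge_mat v \<zeta> i $$ (d, b))"
   unfolding mat_mult_entry[OF gauge_mat_carrier[of v \<zeta> "i - 1"] c(2) ab] mat_mult_entry[OF c(1) gauge_mat_carrier[of v \<zeta> i] ab] ..
  also have "... = tw x \<zeta> (i, a, b)"
   unfolding tw_def prod.case using ab by (intro arg_cong2[where f = "(-)"] sum.cong) (auto simp: gauge_mat_def)
  finally show ?thesis by simp
 qed
 have tw_x0: "tw x0 \<zeta> q = K \<zeta> q" if "q \<in> Q" for \<zeta> q
 proof -
  obtain i a b where q: "q = (i, a, b)" by (cases q)
  have "tw x0 \<zeta> q = om_entry (comm_rep (gauge_mat v \<zeta>) x0) q"
   unfolding q om_entry_def comm_rep_def using tw_mat[OF xs, of i a b \<zeta>] that q by simp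
  then show ?thesis unfolding K_def P_def using com_kernel_row[OF fin xs, of q \<zeta>] that unfolding Q_def by simp
 qed
 \<comment> \<open>index \<open>0\<close> is the border: the identity and the covector \<open>\<psi>\<close>\<close>
 define Xi where "Xi j = (case j of 0 => (%(i, a, b). if a = b then 1 else 0) | Suc j => \<xi> j)" for j :: nat
 define Phi where "Phi j = (case j of 0 => \<psi> | Suc j => \<phi> j)" for j :: nat
 define M where "M x = mat (Suc r) (Suc r) (%(i, j). \<Sum>q\<in>Q. Phi i q * tw x (Xi j) q)" for x
 have poly: "(%x. det (M x)) \<in> rep_polys v"
 proof (rule poly_funs_det[where n = "Suc r"])
  fix i j assume ij: "i < Suc r" "j < Suc r"
  have "(%x. tw x (Xi j) q) \<in> rep_polys v" if "q \<in> Q" for q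
  proof -
   obtain e a b where q: "q = (e, a, b)" by (cases q)
   have ab: "a < v (e - 1)" "b < v e" using that unfolding q Q_def edge_idx_def by auto
   have "(%x. x (Om e) $$ (a, c)) \<in> rep_polys v" if "c < v e" for c
   proof (rule poly_funs.coord)
    show "(%x. x (Om e) $$ (a, c)) \<in> rep_coords v"
     unfolding rep_coords_def using ab that by (intro CollectI exI[of _ "Om e"] exI[of _ a] exI[of _ c]) simp
   qed
   then show ?thesis unfolding q tw_def prod.case by (intro poly_funs_intros) auto
  qed
  then show "(%x. M x $$ (i, j)) \<in> rep_polys v"
   unfolding M_def using ij by (simp, intro poly_funs_sum poly_funs.mult poly_funs.const)
 qed (simp add: M_def)
 have vanish: "\<forall>x\<in>orbit v f. det (M x) = 0"
 proof
  fix x assume "x \<in> orbit v f"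
  then obtain g where g: "g \<in> gauge_group v" "x = gauge_act v g x0" using orbit_gauge[OF f x0] by blast
  have xsp: "x \<in> rep_space v" unfolding g(2) by (rule gauge_act_rep_space[OF g(1) xs])
  note gc = gauge_carrier[OF g(1)] gauge_inv_group(1)[OF g(1)]
  define sh where "sh \<zeta> = (%(i, a, b). (gauge_inv v g i * gauge_mat v \<zeta> i) $$ (a, b))" for \<zeta>
  have sh: "gauge_mat v (sh \<zeta>) i = gauge_inv v g i * gauge_mat v \<zeta> i" for \<zeta> i
  proof (rule eq_matI)
   fix a b assume "a < dim_row (gauge_inv v g i * gauge_mat v \<zeta> i)" "b < dim_col (gauge_inv v g i * gauge_mat v \<zeta> i)"
   then have "a < v i" "b < v i" using gc(2)[of i] gauge_mat_carrier[of v \<zeta> i] by auto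
   then show "gauge_mat v (sh \<zeta>) i $$ (a, b) = (gauge_inv v g i * gauge_mat v \<zeta> i) $$ (a, b)"
    unfolding gauge_mat_def[of v "sh \<zeta>" i] by (simp add: sh_def del: index_mult_mat(1))
  qed (use gc(2)[of i] gauge_mat_carrier[of v \<zeta> i] gauge_mat_carrier[of v "sh \<zeta>" i] in auto)
  define ga where "ga F = (%(i, a, b). \<Sum>c<v (i - 1). g (i - 1) $$ (a, c) * F (i, c, b))"
   for F :: "int \<times> nat \<times> nat => complex"
  have tw_g: "tw x \<zeta> q = ga (K (sh \<zeta>)) q" if q: "q \<in> Q" for \<zeta> q
  proof -
   obtain i a b where q': "q = (i, a, b)" by (cases q)
   have ab: "a < v (i - 1)" "b < v i" using q unfolding q' Q_def edge_idx_def by auto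
   let ?Z = "gauge_mat v \<zeta>"
   have Z: "?Z j \<in> carrier_mat (v j) (v j)" for j by (rule gauge_mat_carrier)
   have X: "x (Om i) \<in> carrier_mat (v (i - 1)) (v i)" "x0 (Om i) \<in> carrier_mat (v (i - 1)) (v i)"
    using rep_spaceD[OF xsp, of "Om i"] rep_spaceD[OF xs, of "Om i"] by auto
   let ?g = "g (i - 1)" and ?h = "gauge_inv v g (i - 1)" and ?h' = "gauge_inv v g i"
   have c1: "?h * ?Z (i - 1) \<in> carrier_mat (v (i - 1)) (v (i - 1))" "?h' * ?Z i \<in> carrier_mat (v i) (v i)"
    using gc Z by (auto intro!: mult_carrier_mat)
   have "?g * comm_rep (gauge_mat v (sh \<zeta>)) x0 (Om i)
     = ?g * (?h * ?Z (i - 1) * x0 (Om i)) - ?g * (x0 (Om i) * (?h' * ?Z i))"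
    unfolding comm_rep_def sh using gc(1)[of "i - 1"] c1 X(2)
    by (simp add: mult_minus_distrib_mat[where nr = "v (i - 1)" and n = "v (i - 1)" and nc = "v i"])
   also have "?g * (?h * ?Z (i - 1) * x0 (Om i)) = ?g * (?h * ?Z (i - 1)) * x0 (Om i)"
    by (rule assoc_mult_mat[symmetric, OF gc(1) c1(1) X(2)])
   also have "?g * (?h * ?Z (i - 1)) = ?g * ?h * ?Z (i - 1)"
    by (rule assoc_mult_mat[symmetric, OF gc(1) gc(2) Z])
   also have "?g * ?h * ?Z (i - 1) = ?Z (i - 1)"
    unfolding gauge_inv_group(2)[OF g(1)] by (rule left_mult_one_mat[OF Z])
   also have "?g * (x0 (Om i) * (?h' * ?Z i)) = ?g * x0 (Om i) * (?h' * ?Z i)"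
    by (rule assoc_mult_mat[symmetric, OF gc(1) X(2) c1(2)])
   also have "... = ?g * x0 (Om i) * ?h' * ?Z i"
    by (rule assoc_mult_mat[symmetric, OF mult_carrier_mat[OF gc(1) X(2)] gc(2) Z])
   also have "?g * x0 (Om i) * ?h' = x (Om i)" unfolding g(2) gauge_act_def by simp
   finally have eq: "?Z (i - 1) * x0 (Om i) - x (Om i) * ?Z i = ?g * comm_rep (gauge_mat v (sh \<zeta>)) x0 (Om i)" by simp
   have cm: "comm_rep (gauge_mat v (sh \<zeta>)) x0 (Om i) \<in> carrier_mat (v (i - 1)) (v i)"
    using rep_spaceD[OF comm_rep_space[where \<xi> = "gauge_mat v (sh \<zeta>)", OF gauge_mat_carrier xs], of "Om i"] by simp
   have "tw x \<zeta> q = (\<Sum>c<v (i - 1). ?g $$ (a, c) * comm_rep (gauge_mat v (sh \<zeta>)) x0 (Om i) $$ (c, b))"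
    unfolding q' tw_mat[OF xsp q[unfolded q']] eq by (rule mat_mult_entry[OF gc(1) cm ab])
   also have "... = (\<Sum>c<v (i - 1). ?g $$ (a, c) * K (sh \<zeta>) (i, c, b))"
   proof (intro sum_times_cong)
    fix c assume "c \<in> {..<v (i - 1)}"
    then have "(i, c, b) \<in> edge_idx v" using ab unfolding edge_idx_def by simp
    from com_kernel_row[OF fin xs this, of "sh \<zeta>"]
    show "comm_rep (gauge_mat v (sh \<zeta>)) x0 (Om i) $$ (c, b) = K (sh \<zeta>) (i, c, b)"
     unfolding K_def P_def om_entry_def by simp
   qed
   finally show ?thesis unfolding ga_def q' by simp
  qed
  have ga_expand: "ga (K \<zeta>) q = (\<Sum>l<r. ga (K (\<xi> l)) q * (\<Sum>q'\<in>Q. \<phi> l q' * K \<zeta> q'))" if q: "q \<in> Q" for \<zeta> q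
  proof -
   obtain i a b where q': "q = (i, a, b)" by (cases q)
   have ab: "a < v (i - 1)" "b < v i" using q unfolding q' Q_def edge_idx_def by auto
   have "ga (K \<zeta>) q = (\<Sum>c<v (i - 1). g (i - 1) $$ (a, c) * (\<Sum>l<r. K (\<xi> l) (i, c, b) * (\<Sum>q'\<in>Q. \<phi> l q' * K \<zeta> q')))"
    unfolding ga_def q' prod.case
   proof (intro sum_times_cong)
    fix c assume "c \<in> {..<v (i - 1)}"
    then have "(i, c, b) \<in> Q" using ab unfolding edge_idx_def Q_def by simp
    from K_expand[OF this] show "K \<zeta> (i, c, b) = (\<Sum>l<r. K (\<xi> l) (i, c, b) * (\<Sum>q'\<in>Q. \<phi> l q' * K \<zeta> q'))" .
   qed
   also have "... = (\<Sum>l<r. (\<Sum>c<v (i - 1). g (i - 1) $$ (a, c) * K (\<xi> l) (i, c, b)) * (\<Sum>q'\<in>Q. \<phi> l q' * K \<zeta> q'))"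
    by (rule sum_bilinear_swap)
   finally show ?thesis unfolding ga_def q' by simp
  qed
  have "M x = mat (Suc r) (Suc r) (%(i, j). \<Sum>l<r. (\<Sum>q\<in>Q. Phi i q * ga (K (\<xi> l)) q) * (\<Sum>q'\<in>Q. \<phi> l q' * K (sh (Xi j)) q'))"
   unfolding M_def
  proof (intro cong_mat refl)
   fix i j :: nat
   have "(\<Sum>q\<in>Q. Phi i q * tw x (Xi j) q) = (\<Sum>q\<in>Q. Phi i q * (\<Sum>l<r. ga (K (\<xi> l)) q * (\<Sum>q'\<in>Q. \<phi> l q' * K (sh (Xi j)) q')))"
    by (intro sum_times_cong trans[OF tw_g ga_expand])
   also have "... = (\<Sum>l<r. (\<Sum>q\<in>Q. Phi i q * ga (K (\<xi> l)) q) * (\<Sum>q'\<in>Q. \<phi> l q' * K (sh (Xi j)) q'))"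
    by (rule sum_bilinear_swap)
   finally show "(case (i, j) of (i, j) => \<Sum>q\<in>Q. Phi i q * tw x (Xi j) q)
     = (case (i, j) of (i, j) => \<Sum>l<r. (\<Sum>q\<in>Q. Phi i q * ga (K (\<xi> l)) q) * (\<Sum>q'\<in>Q. \<phi> l q' * K (sh (Xi j)) q'))" by simp
  qed
  then show "det (M x) = 0" by (simp only: det_low_rank[OF lessI])
 qed
 let ?l = "%t. rep_add x0 (rep_smult t y)"
 let ?y = "%j q. case q of (e, a, b) => \<Sum>c<v e. y (Om e) $$ (a, c) * Xi j (e, c, b)"
 define E where "E i j = - (\<Sum>q\<in>Q. Phi i q * (?y j q))" for i j
 have Mline: "M (?l t) = mat (Suc r) (Suc r) (%(i, j). (if i = j & 0 < i then 1 else 0) + t * E i j)" for t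
  unfolding M_def
 proof (intro cong_mat refl)
  fix i j assume ij: "i < Suc r" "j < Suc r"
  have "tw (?l t) (Xi j) q = K (Xi j) q + t * (- (?y j q))"
   if q: "q \<in> Q" for q
  proof -
   obtain e a b where q': "q = (e, a, b)" by (cases q)
   have ab: "a < v (e - 1)" "b < v e" using q unfolding q' Q_def edge_idx_def by auto
   have "?l t (Om e) $$ (a, c) = x0 (Om e) $$ (a, c) + t * y (Om e) $$ (a, c)" if "c < v e" for c
    using rep_spaceD[OF xs, of "Om e"] rep_spaceD[OF ys, of "Om e"] ab that unfolding rep_add_def rep_smult_def by simp
   then have "(\<Sum>c<v e. ?l t (Om e) $$ (a, c) * Xi j (e, c, b))
     = (\<Sum>c<v e. x0 (Om e) $$ (a, c) * Xi j (e, c, b)) + t * (\<Sum>c<v e. y (Om e) $$ (a, c) * Xi j (e, c, b))"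
    unfolding sum_distrib_left sum.distrib[symmetric] by (intro sum.cong) (auto simp: algebra_simps)
   then show ?thesis unfolding tw_x0[OF q, symmetric] unfolding q' tw_def prod.case by (simp add: algebra_simps)
  qed
  note line = this
  have "(\<Sum>q\<in>Q. Phi i q * tw (?l t) (Xi j) q)
    = (\<Sum>q\<in>Q. Phi i q * K (Xi j) q + t * (- (Phi i q * (?y j q))))"
   by (intro sum.cong refl, subst line) (simp_all add: algebra_simps)
  also have "... = (\<Sum>q\<in>Q. Phi i q * K (Xi j) q) + t * E i j"
   unfolding E_def by (simp add: sum_subtractf sum_distrib_left)
  also have "(\<Sum>q\<in>Q. Phi i q * K (Xi j) q) = (if i = j & 0 < i then 1 else 0)"
  proof (cases i)
   case 0
   have "(\<Sum>q\<in>Q. \<psi> q * K (Xi j) q) = 0"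
    unfolding K_def sum_bilinear_swap using \<psi> unfolding P_def Q_def by simp
   then show ?thesis using 0 by (simp add: Phi_def)
  next
   case (Suc i')
   show ?thesis
   proof (cases j)
    case 0
    have "K (Xi 0) q = 0" if q: "q \<in> Q" for q
    proof -
     obtain e a b where q': "q = (e, a, b)" by (cases q)
     have ab: "a < v (e - 1)" "b < v e" using q unfolding q' Q_def edge_idx_def by auto
     have "gauge_mat v (Xi 0) e = 1\<^sub>m (v e)" for e
      unfolding gauge_mat_def Xi_def by (rule eq_matI) auto
     then show ?thesis
      using tw_x0[OF q, of "Xi 0"] tw_mat[OF xs q[unfolded q'], of "Xi 0"] rep_spaceD[OF xs, of "Om e"] ab
      unfolding q' by simp
    qed
    then show ?thesis using 0 Suc by simp
   next
    case (Suc j')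
    then show ?thesis using 1[of i' j'] \<open>i = Suc i'\<close> ij by (simp add: Phi_def Xi_def K_def)
   qed
  qed
  finally show "(case (i, j) of (i, j) => \<Sum>q\<in>Q. Phi i q * tw (?l t) (Xi j) q)
    = (case (i, j) of (i, j) => (if i = j & 0 < i then 1 else 0) + t * E i j)" by simp
 qed
 have "((%t. det (M (?l t))) has_field_derivative E 0 0) (at 0)"
  by (rule det_derivative_rank_one[OF Mline])
 moreover have "((%t. det (M (?l t))) has_field_derivative 0) (at 0)"
 proof -
  have "((%t. p (?l t)) has_field_derivative 0) (at 0)"
   if "p \<in> rep_polys v" "\<forall>x\<in>orbit v f. p x = 0" for p
   using y that unfolding tangent_space_def by blast
  from this[OF poly vanish] show ?thesis .
 qed
 ultimately have "E 0 0 = 0" by (rule DERIV_unique)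
 moreover have "E 0 0 = - (\<Sum>q\<in>Q. \<psi> q * om_entry y q)"
  unfolding E_def
 proof (intro arg_cong[where f = uminus] sum.cong refl)
  fix q assume q: "q \<in> Q"
  obtain e a b where q': "q = (e, a, b)" by (cases q)
  have ab: "a < v (e - 1)" "b < v e" using q unfolding q' Q_def edge_idx_def by auto
  have "(\<Sum>c<v e. y (Om e) $$ (a, c) * Xi 0 (e, c, b)) = y (Om e) $$ (a, b)"
   unfolding Xi_def using ab sum_mult_delta(1)[of "{..<v e}" b "%c. y (Om e) $$ (a, c)"] by simp
  then show "Phi 0 q * (?y 0 q) = \<psi> q * om_entry y q"
   unfolding q' om_entry_def Phi_def by simp
 qed
 ultimately show ?thesis unfolding Q_def by simp
qed

section \<open>Conormal varieties and the moment map\<close>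

definition bar_coeff :: "rep => int \<times> nat \<times> nat => complex" where
 "bar_coeff x = (%(i, a, b). x (OmBar i) $$ (b, a))"

lemma om_part_space: "x \<in> rep_space v ==> om_part v x \<in> rep_space_Om v"
 unfolding rep_space_Om_def rep_space_def om_part_def by (auto split: arrow.split dest: spec[where x = "Om _"])

lemma rep_decompose:
 assumes "x \<in> rep_space v"
 shows "rep_add (om_part v x) (bar_rep v (bar_coeff x)) = x"
proof
 fix h
 show "rep_add (om_part v x) (bar_rep v (bar_coeff x)) h = x h"
  using rep_spaceD[OF assms, of h] unfolding rep_add_def om_part_def bar_rep_def bar_coeff_def
  by (cases h) (auto intro!: eq_matI)
qed

lemma om_part_add_bar:
 assumes "x \<in> rep_space_Om v"
 shows "om_part v (rep_add x (bar_rep v \<psi>)) = x"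
proof
 fix h
 show "om_part v (rep_add x (bar_rep v \<psi>)) h = x h"
  using rep_spaceD[OF rep_space_OmD(1)[OF assms], of h] rep_space_OmD(2)[OF assms]
  unfolding rep_add_def om_part_def bar_rep_def by (cases h) (auto intro!: eq_matI)
qed

lemma rep_space_OmBar_bar_rep:
 assumes "x \<in> rep_space_OmBar v"
 shows "x = bar_rep v (bar_coeff x)"
proof
 fix h
 have "x h \<in> carrier_mat (v (in_v h)) (v (out_v h))" using assms unfolding rep_space_OmBar_def rep_space_def by simp
 then show "x h = bar_rep v (bar_coeff x) h"
  using assms unfolding rep_space_OmBar_def bar_rep_def bar_coeff_def by (cases h) (auto intro!: eq_matI)
qed

text \<open>The tangent space of the orbit is the space of commutators, and the vectors orthogonal to commutators are
  those on which the moment map vanishes.\<close>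

lemma conormal_iff:
 assumes fin: "fin_supp v" and f: "f \<in> Zt_V v"
 shows "x \<in> conormal v f \<longleftrightarrow>
  x \<in> rep_space v & om_part v x \<in> orbit v f & (\<forall>i. moment_zero v x i)"
proof
 assume "x \<in> conormal v f"
 then obtain x' x'' where x: "x = rep_add x' x''" "x' \<in> orbit v f" "x'' \<in> rep_space_OmBar v"
  "!!y. y \<in> tangent_space v (orbit v f) x' ==> pairing x'' y = 0" unfolding conormal_def by blast
 have x'O: "x' \<in> rep_space_Om v" using x(2) unfolding orbit_def by blast
 note x's = rep_space_OmD(1)[OF x'O]
 define \<psi> where "\<psi> = bar_coeff x''"
 have bar: "x'' = bar_rep v \<psi>" unfolding \<psi>_def by (rule rep_space_OmBar_bar_rep[OF x(3)])
 have "(\<Sum>q\<in>edge_idx v. \<psi> q * com_kernel x' q p) = 0" if p: "p \<in> gauge_idx v" for p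
 proof -
  define \<delta> where "\<delta> p' = (if p' = p then 1 else 0 :: complex)" for p'
  have y: "comm_rep (gauge_mat v \<delta>) x' \<in> rep_space v" by (rule comm_rep_space[where \<xi> = "gauge_mat v \<delta>", OF gauge_mat_carrier x's])
  have "0 = pairing x'' (comm_rep (gauge_mat v \<delta>) x')"
   using x(4)[OF comm_in_tangent_space[OF fin f x(2)]] by simp
  also have "... = - (\<Sum>q\<in>edge_idx v. \<psi> q * om_entry (comm_rep (gauge_mat v \<delta>) x') q)"
   unfolding bar by (rule pairing_bar_rep[OF fin y])
  also have "(\<Sum>q\<in>edge_idx v. \<psi> q * om_entry (comm_rep (gauge_mat v \<delta>) x') q)
    = (\<Sum>q\<in>edge_idx v. \<psi> q * com_kernel x' q p)"
  proof (intro sum_times_cong)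
   fix q assume "q \<in> edge_idx v"
   from com_kernel_row[OF fin x's this, of \<delta>]
   show "om_entry (comm_rep (gauge_mat v \<delta>) x') q = com_kernel x' q p"
    using sum_mult_delta(1)[OF finite_gauge_idx[OF fin] p, of "com_kernel x' q"] unfolding \<delta>_def by simp
  qed
  finally show ?thesis by simp
 qed
 then have "\<forall>i. moment_zero v x i"
  unfolding x(1) bar using com_kernel_moment[OF fin x'O, of \<psi>] by blast
 moreover have "x \<in> rep_space v" unfolding x(1) bar by (intro rep_add_space x's bar_rep_space)
 moreover have "om_part v x = x'" unfolding x(1) bar by (rule om_part_add_bar[OF x'O])
 ultimately show "x \<in> rep_space v & om_part v x \<in> orbit v f & (\<forall>i. moment_zero v x i)"
  using x(2) by simp
next
 assume x: "x \<in> rep_space v & om_part v x \<in> orbit v f & (\<forall>i. moment_zero v x i)"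
 define \<psi> where "\<psi> = bar_coeff x"
 have dec: "x = rep_add (om_part v x) (bar_rep v \<psi>)" unfolding \<psi>_def using rep_decompose x by metis
 have ker: "(\<Sum>q\<in>edge_idx v. \<psi> q * com_kernel (om_part v x) q p) = 0" if "p \<in> gauge_idx v" for p
  using com_kernel_moment[OF fin om_part_space, of x \<psi>] x dec that by metis
 have "pairing (bar_rep v \<psi>) y = 0" if y: "y \<in> tangent_space v (orbit v f) (om_part v x)" for y
 proof -
  have ys: "y \<in> rep_space v" using y unfolding tangent_space_def by simp
  show ?thesis
   unfolding pairing_bar_rep[OF fin ys]
   using tangent_space_orthogonal[OF fin f _ ker y] x by simp
 qed
 moreover have "bar_rep v \<psi> \<in> rep_space_OmBar v"
  unfolding rep_space_OmBar_def using bar_rep_space[of v \<psi>] by (simp add: bar_rep_def)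
 ultimately show "x \<in> conormal v f"
  unfolding conormal_def using x dec by blast
qed

section \<open>Irreducibility and dimension of conormal varieties\<close>

lemma om_part_gauge:
 assumes g: "g \<in> gauge_group v" and x: "x \<in> rep_space v"
 shows "om_part v (gauge_act v g x) = gauge_act v g (om_part v x)"
proof
 fix h
 show "om_part v (gauge_act v g x) h = gauge_act v g (om_part v x) h"
 proof (cases h)
  case (OmBar i)
  then show ?thesis
   unfolding om_part_def gauge_act_def
   using gauge_carrier[OF g, of i] gauge_inv_group(1)[OF g, of "i - 1"] by simp
 qed (simp add: om_part_def gauge_act_def)
qed

lemma orbit_closed_gauge:
 assumes "f \<in> Zt_V v" "x \<in> orbit v f" "g \<in> gauge_group v"
 shows "gauge_act v g x \<in> orbit v f"
 using orbit_gauge[OF assms(1,2)] assms(3) by blast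

lemma gauge_act_inverse_right:
 assumes g: "g \<in> gauge_group v" and x: "x \<in> rep_space v"
 shows "gauge_act v g (gauge_act v (gauge_inv v g) x) = x"
 unfolding gauge_act_mult[OF g gauge_inv_group(4)[OF g] x] gauge_inv_group(2)[OF g]
 by (rule gauge_act_one[OF x])

lemma conormal_rep_space: "fin_supp v ==> f \<in> Zt_V v ==> x \<in> conormal v f ==> x \<in> rep_space v"
 using conormal_iff by blast

lemma conormal_gauge:
 assumes fin: "fin_supp v" and f: "f \<in> Zt_V v" and x: "x \<in> conormal v f" and g: "g \<in> gauge_group v"
 shows "gauge_act v g x \<in> conormal v f"
 using x orbit_closed_gauge[OF f _ g] gauge_act_rep_space[OF g] moment_zero_gauge_act[OF g] om_part_gauge[OF g]
 unfolding conormal_iff[OF fin f] by simp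

text \<open>Up to the gauge group the part along \<open>Om\<close> may be fixed; the rest is a linear space.\<close>

lemma conormal_param:
 assumes fin: "fin_supp v" and f: "f \<in> Zt_V v" and x0: "x0 \<in> orbit v f"
 shows "x \<in> conormal v f \<longleftrightarrow> (\<exists>g\<in>gauge_group v. \<exists>\<psi>.
  (\<forall>i. moment_zero v (rep_add x0 (bar_rep v \<psi>)) i) &
  x = gauge_act v g (rep_add x0 (bar_rep v \<psi>)))"
proof
 have x0O: "x0 \<in> rep_space_Om v" using x0 unfolding orbit_def by blast
 note x0s = rep_space_OmD(1)[OF x0O]
 {
  assume x: "x \<in> conormal v f"
  then have xs: "x \<in> rep_space v" "om_part v x \<in> orbit v f" "!!i. moment_zero v x i"
   unfolding conormal_iff[OF fin f] by auto
  obtain g where g: "g \<in> gauge_group v" "om_part v x = gauge_act v g x0"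
   using orbit_gauge[OF f x0] xs(2) by blast
  define z where "z = gauge_act v (gauge_inv v g) x"
  have gi: "gauge_inv v g \<in> gauge_group v" by (rule gauge_inv_group(4)[OF g(1)])
  have zs: "z \<in> rep_space v" unfolding z_def by (rule gauge_act_rep_space[OF gi xs(1)])
  have "om_part v z = x0"
   unfolding z_def om_part_gauge[OF gi xs(1)] g(2) by (rule gauge_act_inverse[OF g(1) x0s])
  then have "z = rep_add x0 (bar_rep v (bar_coeff z))" using rep_decompose[OF zs] by simp
  moreover have "!!i. moment_zero v z i"
   unfolding z_def by (rule moment_zero_gauge_act[OF gi xs(1) xs(3)])
  moreover have "x = gauge_act v g z" unfolding z_def by (rule gauge_act_inverse_right[OF g(1) xs(1), symmetric])
  ultimately show "\<exists>g\<in>gauge_group v. \<exists>\<psi>. (\<forall>i. moment_zero v (rep_add x0 (bar_rep v \<psi>)) i) &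
   x = gauge_act v g (rep_add x0 (bar_rep v \<psi>))" using g(1) by metis
 next
  assume "\<exists>g\<in>gauge_group v. \<exists>\<psi>. (\<forall>i. moment_zero v (rep_add x0 (bar_rep v \<psi>)) i) &
   x = gauge_act v g (rep_add x0 (bar_rep v \<psi>))"
  then obtain g \<psi> where g: "g \<in> gauge_group v" "\<forall>i. moment_zero v (rep_add x0 (bar_rep v \<psi>)) i"
   "x = gauge_act v g (rep_add x0 (bar_rep v \<psi>))" by blast
  have "rep_add x0 (bar_rep v \<psi>) \<in> conormal v f"
   unfolding conormal_iff[OF fin f] om_part_add_bar[OF x0O] using x0 g(2) rep_add_space[OF x0s bar_rep_space] by blast
  then show "x \<in> conormal v f" unfolding g(3) by (rule conormal_gauge[OF fin f _ g(1)])
 }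
qed

lemma rep_coordsE:
 assumes "c \<in> rep_coords v"
 obtains h a b where "c = (%x. x h $$ (a, b))" "a < v (in_v h)" "b < v (out_v h)"
 using assms unfolding rep_coords_def by blast

lemma rep_coordsI: "a < v (in_v h) ==> b < v (out_v h) ==> (%x. x h $$ (a, b)) \<in> rep_coords v"
 unfolding rep_coords_def by blast

lemma poly_funs_add_bar:
 assumes x0: "x0 \<in> rep_space v" and \<psi>: "!!q. q \<in> edge_idx v ==> (%s. \<psi> s q) \<in> poly_funs C"
  and c: "c \<in> rep_coords v"
 shows "(%s. c (rep_add x0 (bar_rep v (\<psi> s)))) \<in> poly_funs C"
proof -
 obtain h a b where h: "c = (%x. x h $$ (a, b))" "a < v (in_v h)" "b < v (out_v h)"
  using rep_coordsE[OF c] .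
 have "c (rep_add x0 (bar_rep v (\<psi> s))) = x0 h $$ (a, b) + bar_rep v (\<psi> s) h $$ (a, b)" for s
  unfolding h(1) rep_add_def using rep_spaceD[OF bar_rep_space[of v "\<psi> s"], of h] h by simp
 moreover have "(%s. bar_rep v (\<psi> s) h $$ (a, b)) \<in> poly_funs C"
 proof (cases h)
  case (Om i)
  then show ?thesis using h by (simp add: bar_rep_def poly_funs.const)
 next
  case (OmBar i)
  then show ?thesis using h \<psi>[of "(i, b, a)"] by (simp add: bar_rep_def edge_idx_def)
 qed
 ultimately show ?thesis by (simp add: poly_funs.add poly_funs.const)
qed

lemma framed_coords_fst:
 assumes "p \<in> rep_polys v"
 shows "(%xj. p (fst xj)) \<in> framed_polys v w"
proof (rule poly_funs_compose[OF assms])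
 fix c assume "c \<in> rep_coords v"
 then have "(%(x, j). c x) \<in> framed_coords v w" unfolding framed_coords_def by blast
 then show "(%s. c (fst s)) \<in> framed_polys v w"
  by (simp add: case_prod_unfold poly_funs.coord)
qed

lemma framed_coords_fix:
 assumes "p \<in> framed_polys v w"
 shows "(%x. p (x, j)) \<in> rep_polys v"
proof (rule poly_funs_compose[OF assms])
 fix c assume "c \<in> framed_coords v w"
 then show "(%x. c (x, j)) \<in> rep_polys v"
  unfolding framed_coords_def by (auto intro: poly_funs.coord poly_funs.const)
qed

lemma hom_spaceD: "j \<in> hom_space v w ==> j i \<in> carrier_mat (w i) (v i)"
 unfolding hom_space_def by simp

lemma hom_space_zero: "(%i. 0\<^sub>m (w i) (v i)) \<in> hom_space v w"
 unfolding hom_space_def by simp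

lemma moment_zero_linear:
 assumes fin: "fin_supp v" and x: "x \<in> rep_space_Om v"
  and "!!n i. n \<in> N ==> moment_zero v (rep_add x (bar_rep v (\<nu> n))) i"
 shows "moment_zero v (rep_add x (bar_rep v (%q. \<Sum>n\<in>N. c n * \<nu> n q))) i"
proof -
 have "\<forall>p\<in>gauge_idx v. (\<Sum>q\<in>edge_idx v. (\<Sum>n\<in>N. c n * \<nu> n q) * com_kernel x q p) = 0"
 proof
  fix p assume p: "p \<in> gauge_idx v"
  have "(\<Sum>q\<in>edge_idx v. (\<Sum>n\<in>N. c n * \<nu> n q) * com_kernel x q p)
    = (\<Sum>n\<in>N. c n * (\<Sum>q\<in>edge_idx v. \<nu> n q * com_kernel x q p))"
   by (rule sum_bilinear_swap[symmetric])
  also have "... = 0"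
   using com_kernel_moment[OF fin x] assms(3) p by (intro sum.neutral) auto
  finally show "(\<Sum>q\<in>edge_idx v. (\<Sum>n\<in>N. c n * \<nu> n q) * com_kernel x q p) = 0" .
 qed
 then show ?thesis using com_kernel_moment[OF fin x] by blast
qed

text \<open>The group is an open part of a product of matrix spaces and the fibre is linear, so any two points are
  joined by moving all parameters linearly; the determinant is the denominator.\<close>

lemma conormal_framed_prime:
 assumes fin: "fin_supp v" and f: "f \<in> Zt_V v"
 shows "zariski_prime (framed_coords v w) (conormal v f \<times> hom_space v w)"
proof (rule zariski_primeI_curves)
 obtain x0 where x0: "x0 \<in> orbit v f" using orbit_nonempty[OF f] .
 have x0O: "x0 \<in> rep_space_Om v" using x0 unfolding orbit_def by blast
 note x0s = rep_space_OmD(1)[OF x0O]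
 note param = conormal_param[OF fin f x0]
 have "moment_zero v (rep_add x0 (bar_rep v (%_. 0))) i" for i
  using com_kernel_moment[OF fin x0O, of "%_. 0"] by simp
 then have "gauge_act v (%i. 1\<^sub>m (v i)) (rep_add x0 (bar_rep v (%_. 0))) \<in> conormal v f"
  unfolding param using gauge_one[of v] by blast
 then show "conormal v f \<times> hom_space v w ~= {}" using hom_space_zero[of w v] by blast
 fix X Y assume "X \<in> conormal v f \<times> hom_space v w" "Y \<in> conormal v f \<times> hom_space v w"
 then obtain x j y k where X: "X = (x, j)" "x \<in> conormal v f" "j \<in> hom_space v w"
  and Y: "Y = (y, k)" "y \<in> conormal v f" "k \<in> hom_space v w" by blast
 obtain g \<psi> where g: "g \<in> gauge_group v" "!!i. moment_zero v (rep_add x0 (bar_rep v \<psi>)) i"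
  "x = gauge_act v g (rep_add x0 (bar_rep v \<psi>))" using X(2) unfolding param by blast
 obtain h \<chi> where h: "h \<in> gauge_group v" "!!i. moment_zero v (rep_add x0 (bar_rep v \<chi>)) i"
  "y = gauge_act v h (rep_add x0 (bar_rep v \<chi>))" using Y(2) unfolding param by blast
 define G where "G t i = mat (v i) (v i) (%(a, b). (1 - t) * g i $$ (a, b) + t * h i $$ (a, b))" for t i
 define \<Psi> where "\<Psi> t q = (1 - t) * \<psi> q + t * \<chi> q" for t q
 define J where "J t i = mat (w i) (v i) (%(a, b). (1 - t) * j i $$ (a, b) + t * k i $$ (a, b))" for t i
 define c where "c t = (gauge_act v (G t) (rep_add x0 (bar_rep v (\<Psi> t))), J t)" for t
 define D where "D t = gauge_det v (G t)" for t
 have Gc: "G t i \<in> carrier_mat (v i) (v i)" for t i unfolding G_def by simp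
 have "G 0 i = g i" for i
  unfolding G_def using gauge_carrier[OF g(1), of i] by (intro eq_matI) auto
 then have G0: "G 0 = g" by (rule ext)
 have "G 1 i = h i" for i
  unfolding G_def using gauge_carrier[OF h(1), of i] by (intro eq_matI) auto
 then have G1: "G 1 = h" by (rule ext)
 have "J 0 i = j i" for i
  unfolding J_def using hom_spaceD[OF X(3), of i] by (intro eq_matI) auto
 then have J0: "J 0 = j" by (rule ext)
 have "J 1 i = k i" for i
  unfolding J_def using hom_spaceD[OF Y(3), of i] by (intro eq_matI) auto
 then have J1: "J 1 = k" by (rule ext)
 have Gp: "(%t. G t i $$ (a, b)) \<in> poly_funs {%t. t}" if "a < v i" "b < v i" for i a b
  unfolding G_def using that by (simp, intro poly_funs_intros) (auto intro: poly_funs.coord)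
 have \<Psi>p: "(%t. \<Psi> t q) \<in> poly_funs {%t. t}" for q
  unfolding \<Psi>_def by (intro poly_funs_intros) (auto intro: poly_funs.coord)
 have Dp: "D \<in> poly_funs {%t. t}"
  unfolding D_def[abs_def] by (rule poly_funs_gauge_det) (use Gc Gp in auto)
 have \<Psi>m: "moment_zero v (rep_add x0 (bar_rep v (\<Psi> t))) i" for t i
 proof -
  have "\<Psi> t = (%q. \<Sum>n\<in>{True, False}. (if n then 1 - t else t) * (if n then \<psi> else \<chi>) q)"
   unfolding \<Psi>_def by (rule ext) simp
  then show ?thesis
   using moment_zero_linear[OF fin x0O, of "{True, False}" "%n. if n then \<psi> else \<chi>" "%n. if n then 1 - t else t" i] g(2) h(2)
   by (simp del: sum.insert)
 qed
 have \<Psi>01: "\<Psi> 0 = \<psi>" "\<Psi> 1 = \<chi>" unfolding \<Psi>_def by (rule ext, simp)+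
 show "\<exists>c D. c 0 = X & c 1 = Y & D \<in> poly_funs {%t::complex. t} & D 0 ~= 0 & D 1 ~= 0 &
   (\<forall>t. D t ~= 0 --> c t \<in> conormal v f \<times> hom_space v w) &
   (\<forall>p\<in>framed_coords v w. (%t. p (c t)) \<in> rational_over {%t. t} D)"
 proof (intro exI[of _ c] exI[of _ D] conjI allI impI ballI Dp)
  show "c 0 = X" unfolding c_def X g(3) G0 J0 \<Psi>01 ..
  show "c 1 = Y" unfolding c_def Y h(3) G1 J1 \<Psi>01 ..
  show "D 0 ~= 0" unfolding D_def G0 using gauge_det_nonzero[where g = g, OF fin gauge_carrier[OF g(1)]] g(1) by blast
  show "D 1 ~= 0" unfolding D_def G1 using gauge_det_nonzero[where g = h, OF fin gauge_carrier[OF h(1)]] h(1) by blast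
  fix t assume "D t ~= 0"
  then have "G t \<in> gauge_group v" unfolding D_def using gauge_det_nonzero[where g = "G t", OF fin Gc] by blast
  then have "gauge_act v (G t) (rep_add x0 (bar_rep v (\<Psi> t))) \<in> conormal v f" unfolding param using \<Psi>m by blast
  then show "c t \<in> conormal v f \<times> hom_space v w" unfolding c_def by (simp add: hom_space_def J_def)
 next
  fix p assume "p \<in> framed_coords v w"
  then consider (rep) c' where "c' \<in> rep_coords v" "p = (%(x, j). c' x)"
   | (hom) i a b where "p = (%(x, j). j i $$ (a, b))" "a < w i" "b < v i"
   unfolding framed_coords_def by blast
  then show "(%t. p (c t)) \<in> rational_over {%t. t} D"
  proof cases
   case rep
   have "(%t. c' (gauge_act v (G t) (rep_add x0 (bar_rep v (\<Psi> t))))) \<in> rational_over {%t. t} (%t. gauge_det v (G t))"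
    by (rule rational_gauge_act[where g = G and x = "%t. rep_add x0 (bar_rep v (\<Psi> t))", OF fin Gc Gp])
      (use rep poly_funs_add_bar[OF x0s, where \<psi> = \<Psi>] \<Psi>p rep_add_space[OF x0s bar_rep_space] in auto)
   then show ?thesis unfolding rep c_def D_def[abs_def] by simp
  next
   case hom
   have "(%t. p (c t)) = (%t. (1 - t) * j i $$ (a, b) + t * k i $$ (a, b))"
    unfolding hom(1) c_def J_def using hom by simp
   then show ?thesis by (simp only:) (intro rational_over_poly poly_funs_intros, auto intro: poly_funs.coord)
  qed
 qed
qed

lemma conormal_prime:
 assumes fin: "fin_supp v" and f: "f \<in> Zt_V v"
 shows "zariski_prime (rep_coords v) (conormal v f)"
proof -
 define w where "w = (%_ :: int. 0 :: nat)"
 define j where "j = (%i. 0\<^sub>m (w i) (v i) :: complex mat)"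
 have j: "j \<in> hom_space v w" unfolding j_def by (rule hom_space_zero)
 note prime = conormal_framed_prime[OF fin f, of w]
 have "conormal v f ~= {}" using prime unfolding zariski_prime_def by auto
 moreover have "(\<forall>x\<in>conormal v f. p x = 0) \<or> (\<forall>x\<in>conormal v f. q x = 0)"
  if p: "p \<in> rep_polys v" and q: "q \<in> rep_polys v" and pq: "\<forall>x\<in>conormal v f. p x * q x = 0" for p q
 proof -
  have "(\<forall>x\<in>conormal v f \<times> hom_space v w. p (fst x) = 0) \<or> (\<forall>x\<in>conormal v f \<times> hom_space v w. q (fst x) = 0)"
   using pq by (intro zariski_primeD[OF prime framed_coords_fst[OF p] framed_coords_fst[OF q]]) auto
  then show ?thesis using j by auto
 qed
 ultimately show ?thesis unfolding zariski_prime_def by blast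
qed

lemma infinite_near_zero:
 assumes "\<forall>\<^sub>F t in at (0::complex). P t"
 shows "infinite {t. P t}"
proof -
 obtain e where e: "e > 0" "!!t. t ~= 0 ==> dist t 0 < e ==> P t"
  using assms unfolding eventually_at by auto
 have "inj (%n::nat. complex_of_real (e / (real n + 2)))"
  using e(1) by (intro injI) (simp add: field_simps)
 then have "infinite (range (%n::nat. complex_of_real (e / (real n + 2))))" by (rule range_inj_infinite)
 moreover have "range (%n::nat. complex_of_real (e / (real n + 2))) \<subseteq> {t. P t}"
 proof (intro subsetI, elim rangeE)
  fix t n assume t: "t = complex_of_real (e / (real n + 2))"
  have "e / (real n + 2) < e / 1" by (rule divide_strict_left_mono) (use e(1) in auto)
  then have "e / (real n + 2) < e" by simp
  moreover have "0 < e / (real n + 2)" using e(1) by simp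
  moreover have "P (complex_of_real r)" if "r < e" "0 < r" for r
   using e(2)[of "complex_of_real r"] that by (simp add: dist_norm)
  ultimately show "t \<in> {t. P t}" unfolding t by blast
 qed
 ultimately show ?thesis using infinite_super by blast
qed

text \<open>The conormal variety of every orbit has dimension equal to that of the space of representations of the \<open>Om\<close>
  arrows. The chart \<open>\<sigma>\<close> restricts the group to the slice \<open>1 + span \<xi>\<close>, whose \<open>r\<close> parameters together with the
  \<open>s\<close> parameters of the fibre make \<open>r + s = d\<close>. The functions \<open>q\<close> are coordinates to first order at \<open>z = 0\<close>.
  That the image of the chart is dense is seen along the line from \<open>1\<close> to an arbitrary group element \<open>g\<close>: for
  small \<open>t\<close>, the element \<open>1 + t (g - 1)\<close> multiplied by a suitable element of the stabiliser of \<open>x0\<close> lies in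
  the slice, and infinitely many values of \<open>t\<close> suffice to make a rational function vanish at \<open>t = 1\<close>.\<close>

lemma conormal_chart:
 assumes fin: "fin_supp v" and f: "f \<in> Zt_V v"
 defines "d \<equiv> card (edge_idx v)"
 obtains D \<sigma> q where
  "D \<in> poly_funs (coord_funs d)"
  "!!c. c \<in> rep_coords v ==> (%z. c (\<sigma> z)) \<in> rational_over (coord_funs d) D"
  "!!p. p \<in> rep_polys v ==> (!!z. D z ~= 0 ==> p (\<sigma> z) = 0) ==> \<forall>x\<in>conormal v f. p x = 0"
  "!!i. i < d ==> q i \<in> rep_polys v"
  "!!z. \<forall>\<^sub>F t in at (0::complex). \<sigma> (%i. t * z i) \<in> conormal v f"
  "!!z i. i < d ==> ((%t. q i (\<sigma> (%i. t * z i)) / t) \<longlongrightarrow> z i) (at 0)"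
proof -
 obtain x0 where x0: "x0 \<in> orbit v f" using orbit_nonempty[OF f] .
 have x0O: "x0 \<in> rep_space_Om v" using x0 unfolding orbit_def by blast
 note x0s = rep_space_OmD(1)[OF x0O]
 note param = conormal_param[OF fin f x0]
 define P where "P = gauge_idx v"
 define Q where "Q = edge_idx v"
 have finP: "finite P" and finQ: "finite Q"
  unfolding P_def Q_def using finite_gauge_idx[OF fin] finite_edge_idx[OF fin] .
 show ?thesis
 proof (rule kernel_coordinates[OF finP finQ, where k = "com_kernel x0"])
 fix r s :: nat and \<xi> \<phi> \<nu> \<eta>
 assume
  rs: "r + s = card Q" and
  1: "!!i j. i < r ==> j < r ==> (\<Sum>q\<in>Q. \<phi> i q * (\<Sum>p\<in>P. com_kernel x0 q p * \<xi> j p)) = (if i = j then 1 else 0)" and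
  2: "!!q p. q \<in> Q ==> p \<in> P ==>
    com_kernel x0 q p = (\<Sum>i<r. (\<Sum>p'\<in>P. com_kernel x0 q p' * \<xi> i p') * (\<Sum>q'\<in>Q. \<phi> i q' * com_kernel x0 q' p))" and
  3: "!!i j. i < s ==> j < s ==> (\<Sum>q\<in>Q. \<eta> i q * \<nu> j q) = (if i = j then 1 else 0)" and
  4: "!!j p. j < s ==> p \<in> P ==> (\<Sum>q\<in>Q. \<nu> j q * com_kernel x0 q p) = 0" and
  5: "!!\<psi> q. (!!p. p \<in> P ==> (\<Sum>q\<in>Q. \<psi> q * com_kernel x0 q p) = 0) ==> q \<in> Q ==>
    \<psi> q = (\<Sum>j<s. (\<Sum>q\<in>Q. \<eta> j q * \<psi> q) * \<nu> j q)"
 have d: "r + s = d" using rs unfolding d_def Q_def .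
 define \<zeta> where "\<zeta> z p = (\<Sum>i<r. z i * \<xi> i p)" for z :: "nat => complex" and p
 define \<psi> where "\<psi> z q = (\<Sum>j<s. z (r + j) * \<nu> j q)" for z :: "nat => complex" and q
 define G where "G z i = 1\<^sub>m (v i) + gauge_mat v (\<zeta> z) i" for z i
 define X where "X z = rep_add x0 (bar_rep v (\<psi> z))" for z
 define \<sigma> where "\<sigma> z = gauge_act v (G z) (X z)" for z
 define D where "D z = gauge_det v (G z)" for z
 let ?c = "%z t. \<sigma> (%i. t * z i)"
 have G: "G z i \<in> carrier_mat (v i) (v i)" for z i unfolding G_def using gauge_mat_carrier[of v "\<zeta> z" i] by simp
 have Gentry: "G z i $$ (a, b) = (1\<^sub>m (v i) :: complex mat) $$ (a, b) + \<zeta> z (i, a, b)" if "a < v i" "b < v i" for z i a b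
  unfolding G_def gauge_mat_def using that by simp
 have X: "X z \<in> rep_space v" for z unfolding X_def by (intro rep_add_space x0s bar_rep_space)
 have \<zeta>p: "(%z. \<zeta> z p) \<in> poly_funs (coord_funs d)" for p
  unfolding \<zeta>_def using d by (intro poly_funs_intros poly_funs.coord) auto
 have \<psi>p: "(%z. \<psi> z q) \<in> poly_funs (coord_funs d)" for q
  unfolding \<psi>_def using d by (intro poly_funs_intros poly_funs.coord) auto
 have Gp: "(%z. G z i $$ (a, b)) \<in> poly_funs (coord_funs d)" if "a < v i" "b < v i" for i a b
  unfolding Gentry[OF that] by (intro poly_funs_intros \<zeta>p)
 have Dp: "D \<in> poly_funs (coord_funs d)"
  unfolding D_def[abs_def] by (rule poly_funs_gauge_det) (use G Gp in auto)
 have rat: "(%z. c (\<sigma> z)) \<in> rational_over (coord_funs d) D" if "c \<in> rep_coords v" for c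
  unfolding \<sigma>_def D_def[abs_def]
  by (rule rational_gauge_act[where g = G and x = X, OF fin G Gp X _ that])
    (use poly_funs_add_bar[OF x0s, where \<psi> = \<psi>] \<psi>p in \<open>auto simp: X_def\<close>)
 have mom\<nu>: "moment_zero v (rep_add x0 (bar_rep v (\<nu> j))) i" if "j < s" for i j
  using com_kernel_moment[OF fin x0O, of "\<nu> j"] 4[OF that] unfolding P_def Q_def by blast
 have mom: "moment_zero v (X z) i" for z i
  unfolding X_def \<psi>_def using mom\<nu> by (intro moment_zero_linear[OF fin x0O]) auto
 have Dgrp: "D z ~= 0 \<longleftrightarrow> G z \<in> gauge_group v" for z
  unfolding D_def by (rule gauge_det_nonzero[where g = "G z", OF fin G])
 have in_con: "\<sigma> z \<in> conormal v f" if "G z \<in> gauge_group v" for z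
  unfolding \<sigma>_def param using that mom unfolding X_def by blast
 have scale_G: "G (%i. t * z i) = (%i. 1\<^sub>m (v i) + t \<cdot>\<^sub>m gauge_mat v (\<zeta> z) i)" for t z
 proof -
  have "\<zeta> (%i. t * z i) p = t * \<zeta> z p" for p unfolding \<zeta>_def by (simp add: sum_distrib_left mult.assoc)
  then show ?thesis unfolding G_def[abs_def] gauge_mat_def by (intro ext eq_matI) auto
 qed
 have scale_X: "X (%i. t * z i) = rep_add x0 (rep_smult t (bar_rep v (\<psi> z)))" for t z
 proof
  fix h
  have "\<psi> (%i. t * z i) q = t * \<psi> z q" for q unfolding \<psi>_def by (simp add: sum_distrib_left mult.assoc)
  then have "bar_rep v (\<psi> (%i. t * z i)) h = t \<cdot>\<^sub>m bar_rep v (\<psi> z) h"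
   unfolding bar_rep_def by (cases h) (auto intro!: eq_matI)
  then show "X (%i. t * z i) h = rep_add x0 (rep_smult t (bar_rep v (\<psi> z))) h"
   unfolding X_def rep_add_def rep_smult_def by simp
 qed
 have near: "\<forall>\<^sub>F t in at (0::complex). ?c z t \<in> conormal v f" for z
  using infinitesimal_action(1)[where \<xi> = "gauge_mat v (\<zeta> z)", OF fin gauge_mat_carrier x0s bar_rep_space]
 proof eventually_elim
  case (elim t)
  then show ?case by (intro in_con) (simp add: scale_G)
 qed
 have lim: "((%t. (?c z t h $$ (a, b) - x0 h $$ (a, b)) / t)
   \<longlongrightarrow> comm_rep (gauge_mat v (\<zeta> z)) x0 h $$ (a, b) + bar_rep v (\<psi> z) h $$ (a, b)) (at 0)"
  if "a < v (in_v h)" "b < v (out_v h)" for z h a b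
  using infinitesimal_action(2)[where \<xi> = "gauge_mat v (\<zeta> z)" and y = "bar_rep v (\<psi> z)", OF fin gauge_mat_carrier x0s bar_rep_space that]
  unfolding \<sigma>_def scale_G scale_X .
 have lim_om: "((%t. (om_entry (?c z t) e - om_entry x0 e) / t)
   \<longlongrightarrow> (\<Sum>p\<in>P. com_kernel x0 e p * \<zeta> z p)) (at 0)" if e: "e \<in> Q" for z e
 proof -
  obtain i a b where e': "e = (i, a, b)" by (cases e)
  have ab: "a < v (in_v (Om i))" "b < v (out_v (Om i))" using e unfolding e' Q_def edge_idx_def by auto
  show ?thesis
   unfolding P_def com_kernel_row[OF fin x0s e[unfolded Q_def]] using lim[OF ab, of z] ab
   unfolding e' om_entry_def by (simp add: bar_rep_def)
 qed
 have lim_bar: "((%t. bar_coeff (?c z t) e / t) \<longlongrightarrow> \<psi> z e) (at 0)" if e: "e \<in> Q" for z e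
 proof -
  obtain i a b where e': "e = (i, a, b)" by (cases e)
  have ab: "b < v (in_v (OmBar i))" "a < v (out_v (OmBar i))" using e unfolding e' Q_def edge_idx_def by auto
  have "comm_rep (gauge_mat v (\<zeta> z)) x0 (OmBar i) $$ (b, a) = 0"
   unfolding comm_rep_def using rep_space_OmD(2)[OF x0O, of i] gauge_mat_carrier[of v "\<zeta> z" i] gauge_mat_carrier[of v "\<zeta> z" "i - 1"] ab
   by simp
  then show ?thesis
   using lim[OF ab, of z] ab rep_space_OmD(2)[OF x0O, of i] unfolding e' bar_coeff_def by (simp add: bar_rep_def)
 qed
 define q where "q n x = (if n < r then \<Sum>e\<in>Q. \<phi> n e * (om_entry x e - om_entry x0 e)
   else \<Sum>e\<in>Q. \<eta> (n - r) e * bar_coeff x e)" for n x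
 have qp: "q n \<in> rep_polys v" for n
 proof -
  have "(%x. om_entry x e) \<in> rep_polys v" "(%x. bar_coeff x e) \<in> rep_polys v" if e: "e \<in> Q" for e
  proof -
   obtain i a b where e': "e = (i, a, b)" by (cases e)
   have ab: "a < v (i - 1)" "b < v i" using e unfolding e' Q_def edge_idx_def by auto
   show "(%x. om_entry x e) \<in> rep_polys v"
    unfolding e' om_entry_def prod.case by (rule poly_funs.coord, rule rep_coordsI) (use ab in auto)
   show "(%x. bar_coeff x e) \<in> rep_polys v"
    unfolding e' bar_coeff_def prod.case by (rule poly_funs.coord, rule rep_coordsI) (use ab in auto)
  qed
  note * = this
  show ?thesis
  proof (cases "n < r")
   case True
   then have "q n = (%x. \<Sum>e\<in>Q. \<phi> n e * (om_entry x e - om_entry x0 e))" unfolding q_def by auto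
   then show ?thesis by (simp only:) (intro poly_funs_intros *)
  next
   case False
   then have "q n = (%x. \<Sum>e\<in>Q. \<eta> (n - r) e * bar_coeff x e)" unfolding q_def by auto
   then show ?thesis by (simp only:) (intro poly_funs_intros *)
  qed
 qed
 have qlim: "((%t. q n (?c z t) / t) \<longlongrightarrow> z n) (at 0)" if n: "n < d" for z n
 proof (cases "n < r")
  case True
  have "((%t. \<Sum>e\<in>Q. \<phi> n e * ((om_entry (?c z t) e - om_entry x0 e) / t))
    \<longlongrightarrow> (\<Sum>e\<in>Q. \<phi> n e * (\<Sum>p\<in>P. com_kernel x0 e p * \<zeta> z p))) (at 0)"
   by (intro tendsto_intros lim_om)
  moreover have "(\<Sum>e\<in>Q. \<phi> n e * (\<Sum>p\<in>P. com_kernel x0 e p * \<zeta> z p)) = z n"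
  proof -
   have "(\<Sum>e\<in>Q. \<phi> n e * (\<Sum>p\<in>P. com_kernel x0 e p * \<zeta> z p))
     = (\<Sum>p\<in>P. (\<Sum>e\<in>Q. \<phi> n e * com_kernel x0 e p) * \<zeta> z p)" by (rule sum_bilinear_swap)
   also have "... = (\<Sum>p\<in>P. (\<Sum>e\<in>Q. \<phi> n e * com_kernel x0 e p) * (\<Sum>j<r. \<xi> j p * z j))"
    unfolding \<zeta>_def by (intro sum_times_cong mult.commute)
   also have "... = (\<Sum>j<r. (\<Sum>p\<in>P. (\<Sum>e\<in>Q. \<phi> n e * com_kernel x0 e p) * \<xi> j p) * z j)"
    by (rule sum_bilinear_swap)
   also have "... = (\<Sum>j<r. (if n = j then 1 else 0) * z j)"
   proof (intro sum_times_cong)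
    fix j assume "j \<in> {..<r}"
    then show "(\<Sum>p\<in>P. (\<Sum>e\<in>Q. \<phi> n e * com_kernel x0 e p) * \<xi> j p) = (if n = j then 1 else 0)"
     using 1[OF True, of j] unfolding sum_bilinear_swap by simp
   qed
   also have "... = z n" using True by (intro sum_mult_delta(4)) auto
   finally show ?thesis .
  qed
  moreover have "q n x / t = (\<Sum>e\<in>Q. \<phi> n e * ((om_entry x e - om_entry x0 e) / t))" for x t
   unfolding q_def using True by (simp add: sum_divide_distrib)
  ultimately show ?thesis by simp
 next
  case False
  then have j: "n - r < s" "r + (n - r) = n" using n d by auto
  have "((%t. \<Sum>e\<in>Q. \<eta> (n - r) e * (bar_coeff (?c z t) e / t))
    \<longlongrightarrow> (\<Sum>e\<in>Q. \<eta> (n - r) e * \<psi> z e)) (at 0)"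
   by (intro tendsto_intros lim_bar)
  moreover have "(\<Sum>e\<in>Q. \<eta> (n - r) e * \<psi> z e) = z n"
  proof -
   have "(\<Sum>e\<in>Q. \<eta> (n - r) e * \<psi> z e) = (\<Sum>e\<in>Q. \<eta> (n - r) e * (\<Sum>j<s. \<nu> j e * z (r + j)))"
    unfolding \<psi>_def by (intro sum_times_cong mult.commute)
   also have "... = (\<Sum>j<s. (\<Sum>e\<in>Q. \<eta> (n - r) e * \<nu> j e) * z (r + j))" by (rule sum_bilinear_swap)
   also have "... = (\<Sum>j<s. (if n - r = j then 1 else 0) * z (r + j))"
    by (intro sum_times_cong 3[OF j(1)]) simp
   also have "... = z (r + (n - r))" using j by (intro sum_mult_delta(4)) auto
   finally show ?thesis using j by simp
  qed
  moreover have "q n x / t = (\<Sum>e\<in>Q. \<eta> (n - r) e * (bar_coeff x e / t))" for x t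
   unfolding q_def using False by (simp add: sum_divide_distrib)
  ultimately show ?thesis by simp
 qed
 have dense: "\<forall>x\<in>conormal v f. p x = 0"
  if p: "p \<in> rep_polys v" and van: "!!z. D z ~= 0 ==> p (\<sigma> z) = 0" for p
 proof (intro ballI, rule ccontr)
  fix x assume x: "x \<in> conormal v f" and nz: "p x ~= 0"
  obtain g \<chi> where g: "g \<in> gauge_group v" "!!i. moment_zero v (rep_add x0 (bar_rep v \<chi>)) i"
   "x = gauge_act v g (rep_add x0 (bar_rep v \<chi>))" using x unfolding param by blast
  note gc = gauge_carrier[OF g(1)]
  define Y where "Y = rep_add x0 (bar_rep v \<chi>)"
  have Y: "Y \<in> rep_space v" unfolding Y_def by (intro rep_add_space x0s bar_rep_space)
  define \<gamma> where "\<gamma> t i = 1\<^sub>m (v i) + t \<cdot>\<^sub>m (g i - 1\<^sub>m (v i))" for t i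
  have g1: "g i - 1\<^sub>m (v i) \<in> carrier_mat (v i) (v i)" for i by (rule minus_carrier_mat) simp
  have \<gamma>c: "\<gamma> t i \<in> carrier_mat (v i) (v i)" for t i
   unfolding \<gamma>_def by (intro add_carrier_mat smult_carrier_mat g1)
  have \<gamma>e: "\<gamma> t i $$ (a, b) = (1\<^sub>m (v i) :: complex mat) $$ (a, b) + t * (g i $$ (a, b) - (1\<^sub>m (v i) :: complex mat) $$ (a, b))"
   if "a < v i" "b < v i" for t i a b unfolding \<gamma>_def using that gc[of i] by simp
  have "\<gamma> 1 i = g i" for i unfolding \<gamma>_def using gc[of i] by (intro eq_matI) auto
  then have \<gamma>1: "\<gamma> 1 = g" by (rule ext)
  have \<gamma>p: "(%t. \<gamma> t i $$ (a, b)) \<in> poly_funs {%t. t}" if "a < v i" "b < v i" for i a b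
   unfolding \<gamma>e[OF that] by (intro poly_funs_intros) (auto intro: poly_funs.coord)
  define E where "E t = gauge_det v (\<gamma> t)" for t
  let ?Y = "%t. gauge_act v (\<gamma> t) Y"
  have Ep: "E \<in> poly_funs {%t. t}"
   unfolding E_def[abs_def] by (rule poly_funs_gauge_det) (use \<gamma>c \<gamma>p in auto)
  have "(%t. c (?Y t)) \<in> rational_over {%t. t} E" if "c \<in> rep_coords v" for c
   unfolding E_def[abs_def]
   by (rule rational_gauge_act[where g = \<gamma> and x = "%_. Y", OF fin \<gamma>c \<gamma>p Y poly_funs.const that])
  from rational_over_compose[where \<sigma> = "%t. ?Y t", OF p Ep this]
  have rat: "(%t. p (?Y t)) \<in> rational_over {%t. t} E" .
  have "E 1 ~= 0" unfolding E_def \<gamma>1 using gauge_det_nonzero[where g = g, OF fin gc] g(1) by blast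
  moreover have "p (gauge_act v (\<gamma> 1) Y) ~= 0" unfolding \<gamma>1 Y_def using nz g(3) by simp
  ultimately have finz: "finite {t. E t = 0 \<or> p (?Y t) = 0}"
   by (rule univariate_rational_finite_zeros[OF Ep rat])
  define \<iota> where "\<iota> = (%(i :: int, a :: nat, b). if a = b then 1 else 0 :: complex)"
  have \<iota>m: "gauge_mat v \<iota> i = 1\<^sub>m (v i)" for i unfolding gauge_mat_def \<iota>_def by (rule eq_matI) auto
  have \<iota>k: "(\<Sum>p\<in>P. com_kernel x0 e p * \<iota> p) = 0" if e: "e \<in> Q" for e
  proof -
   obtain i a b where e': "e = (i, a, b)" by (cases e)
   have ab: "a < v (i - 1)" "b < v i" using e unfolding e' Q_def edge_idx_def by auto
   have "(\<Sum>p\<in>P. com_kernel x0 e p * \<iota> p) = om_entry (comm_rep (gauge_mat v \<iota>) x0) e"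
    unfolding P_def by (rule com_kernel_row[OF fin x0s e[unfolded Q_def]])
   also have "... = 0"
    unfolding e' om_entry_def comm_rep_def \<iota>m using rep_spaceD[OF x0s, of "Om i"] ab by simp
   finally show ?thesis .
  qed
  define G' where "G' p p' = (case p of (i, a, b) => case p' of (i', a', b') =>
   if i' = i & b' = b then g i $$ (a, a') - (1\<^sub>m (v i) :: complex mat) $$ (a, a') else 0)"
   for p p' :: "int \<times> nat \<times> nat"
  obtain A where A: "!!p. p \<in> P ==> ((%t. A t p) \<longlongrightarrow> \<iota> p) (at 0)"
   "\<forall>\<^sub>F t in at 0. (\<forall>q\<in>Q. (\<Sum>p\<in>P. com_kernel x0 q p * A t p) = 0) &
    (\<exists>c. \<forall>p\<in>P. A t p + t * (\<Sum>p'\<in>P. G' p p' * A t p') = \<iota> p + (\<Sum>i<r. c i * \<xi> i p))"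
   by (rule kernel_perturbation[OF finP finQ 1 2 \<iota>k, where G = G']) (assumption | rule that)+
  have "((%t. gauge_det v (gauge_mat v (A t))) \<longlongrightarrow> (\<Prod>i | v i ~= 0. det (1\<^sub>m (v i)))) (at 0)"
   unfolding gauge_det_def
  proof (rule tendsto_prod)
   fix i show "((%t. det (gauge_mat v (A t) i)) \<longlongrightarrow> det (1\<^sub>m (v i))) (at 0)"
   proof (rule tendsto_det[where n = "v i"])
    fix a b assume ab: "a < v i" "b < v i"
    then have "(i, a, b) \<in> P" unfolding P_def gauge_idx_def by simp
    from A(1)[OF this] show "((%t. gauge_mat v (A t) i $$ (a, b)) \<longlongrightarrow> 1\<^sub>m (v i) $$ (a, b)) (at 0)"
     using ab unfolding gauge_mat_def \<iota>_def by simp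
   qed (simp_all add: gauge_mat_carrier)
  qed
  then have "((%t. gauge_det v (gauge_mat v (A t))) \<longlongrightarrow> 1) (at 0)" by simp
  from tendsto_imp_eventually_ne[OF this one_neq_zero]
  have Agrp: "\<forall>\<^sub>F t in at 0. gauge_mat v (A t) \<in> gauge_group v"
   by (rule eventually_mono) (use gauge_det_nonzero[where g = "gauge_mat v (A _)", OF fin gauge_mat_carrier] in blast)
  have \<gamma>grp: "\<forall>\<^sub>F t in at 0. \<gamma> t \<in> gauge_group v"
   using infinitesimal_action(1)[where \<xi> = "%i. g i - 1\<^sub>m (v i)", OF fin g1 x0s bar_rep_space] unfolding \<gamma>_def .
  have "\<forall>\<^sub>F t in at 0. p (?Y t) = 0"
   using A(2) Agrp \<gamma>grp
  proof eventually_elim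
   case (elim t)
   let ?A = "gauge_mat v (A t)"
   obtain c where c: "!!p. p \<in> P ==> A t p + t * (\<Sum>p'\<in>P. G' p p' * A t p') = \<iota> p + (\<Sum>i<r. c i * \<xi> i p)"
    using elim(1) by blast
   have Ac: "?A i \<in> carrier_mat (v i) (v i)" for i by (rule gauge_mat_carrier)
   have comm: "?A (i - 1) * x0 (Om i) = x0 (Om i) * ?A i" for i
   proof (rule eq_matI)
    have Xc: "x0 (Om i) \<in> carrier_mat (v (i - 1)) (v i)" using rep_spaceD[OF x0s, of "Om i"] by simp
    fix a b assume "a < dim_row (x0 (Om i) * ?A i)" "b < dim_col (x0 (Om i) * ?A i)"
    then have ab: "a < v (i - 1)" "b < v i" using Xc Ac[of i] by auto
    then have e: "(i, a, b) \<in> edge_idx v" unfolding edge_idx_def by simp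
    have "om_entry (comm_rep ?A x0) (i, a, b) = 0"
     using elim(1) e unfolding com_kernel_row[OF fin x0s e, symmetric] P_def Q_def by blast
    then show "(?A (i - 1) * x0 (Om i)) $$ (a, b) = (x0 (Om i) * ?A i) $$ (a, b)"
     unfolding om_entry_def comm_rep_def using ab Xc Ac[of i] by (simp del: index_mult_mat(1))
   qed (use rep_spaceD[OF x0s, of "Om i"] Ac[of i] Ac[of "i - 1"] in auto)
   have "x0 h * ?A (out_v h) = ?A (in_v h) * x0 h" for h
   proof (cases h)
    case (Om i)
    then show ?thesis using comm[of i] by simp
   next
    case (OmBar i)
    then show ?thesis using rep_space_OmD(2)[OF x0O, of i] Ac[of i] Ac[of "i - 1"] by simp
   qed
   then have fix0: "x0 = gauge_act v ?A x0" using gauge_act_iff[OF elim(2) x0s x0s] by blast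
   define Y' where "Y' = gauge_act v (gauge_inv v ?A) Y"
   note Ai = gauge_inv_group(4)[OF elim(2)]
   have Y's: "Y' \<in> rep_space v" unfolding Y'_def by (rule gauge_act_rep_space[OF Ai Y])
   have "om_part v Y' = gauge_act v (gauge_inv v ?A) x0"
    unfolding Y'_def om_part_gauge[OF Ai Y] unfolding Y_def om_part_add_bar[OF x0O] ..
   also have "... = x0" using gauge_act_inverse[OF elim(2) x0s] fix0 by simp
   finally have Y'dec: "Y' = rep_add x0 (bar_rep v (bar_coeff Y'))" using rep_decompose[OF Y's] by simp
   have "\<forall>i. moment_zero v Y' i"
    unfolding Y'_def using moment_zero_gauge_act[OF Ai Y] g(2) unfolding Y_def by blast
   then have ker: "(\<Sum>q\<in>Q. bar_coeff Y' q * com_kernel x0 q p) = 0" if "p \<in> P" for p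
    using com_kernel_moment[OF fin x0O, of "bar_coeff Y'"] Y'dec that unfolding P_def Q_def by simp
   define z where "z n = (if n < r then c n else \<Sum>q\<in>Q. \<eta> (n - r) q * bar_coeff Y' q)" for n
   have \<zeta>z: "\<zeta> z p = (\<Sum>i<r. c i * \<xi> i p)" for p unfolding \<zeta>_def z_def by (intro sum.cong) auto
   have \<psi>z: "\<psi> z e = bar_coeff Y' e" if "e \<in> Q" for e
    unfolding \<psi>_def using 5[OF ker that] by (simp add: z_def)
   have "bar_rep v (\<psi> z) = bar_rep v (bar_coeff Y')"
   proof
    fix h show "bar_rep v (\<psi> z) h = bar_rep v (bar_coeff Y') h"
     unfolding bar_rep_def by (cases h) (auto intro!: eq_matI \<psi>z simp: Q_def edge_idx_def)
   qed
   then have Xz: "X z = Y'" unfolding X_def using Y'dec by simp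
   have Gz: "\<gamma> t i * ?A i = G z i" for i
   proof (rule eq_matI)
    fix a b assume "a < dim_row (G z i)" "b < dim_col (G z i)"
    then have ab: "a < v i" "b < v i" using G[of z i] by auto
    then have p: "(i, a, b) \<in> P" unfolding P_def gauge_idx_def by simp
    have sumG: "(\<Sum>p'\<in>P. G' (i, a, b) p' * A t p')
      = (\<Sum>e<v i. (g i $$ (a, e) - (1\<^sub>m (v i) :: complex mat) $$ (a, e)) * A t (i, e, b))"
     by (subst sum_fiber[OF finP, where e = "%e. (i, e, b)" and J = "{..<v i}"])
       (use ab in \<open>auto simp: inj_on_def P_def gauge_idx_def G'_def image_iff split: if_splits\<close>)
    have "(\<gamma> t i * ?A i) $$ (a, b) = (\<Sum>e<v i. \<gamma> t i $$ (a, e) * ?A i $$ (e, b))"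
     by (rule mat_mult_entry[OF \<gamma>c Ac ab])
    also have "... = (\<Sum>e<v i. (if a = e then 1 else 0) * A t (i, e, b) + t * ((g i $$ (a, e) - (1\<^sub>m (v i) :: complex mat) $$ (a, e)) * A t (i, e, b)))"
     using ab by (intro sum.cong) (auto simp: \<gamma>e gauge_mat_def algebra_simps)
    also have "... = A t (i, a, b) + t * (\<Sum>p'\<in>P. G' (i, a, b) p' * A t p')"
     unfolding sumG sum.distrib sum_distrib_left using sum_mult_delta(4)[of "{..<v i}" a "%e. A t (i, e, b)"] ab by simp
    also have "... = \<iota> (i, a, b) + \<zeta> z (i, a, b)" unfolding c[OF p] \<zeta>z ..
    also have "... = G z i $$ (a, b)" unfolding Gentry[OF ab] \<iota>_def using ab by simp
    finally show "(\<gamma> t i * ?A i) $$ (a, b) = G z i $$ (a, b)" .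
   qed (use \<gamma>c[of t i] Ac[of i] G[of z i] in auto)
   have "?Y t = gauge_act v (\<gamma> t) (gauge_act v ?A Y')"
    unfolding Y'_def gauge_act_inverse_right[OF elim(2) Y] ..
   also have "... = gauge_act v (%i. \<gamma> t i * ?A i) Y'" by (rule gauge_act_mult[OF elim(3,2) Y's])
   also have "... = \<sigma> z" unfolding \<sigma>_def Gz Xz ..
   finally have eq: "?Y t = \<sigma> z" .
   have "(%i. \<gamma> t i * ?A i) \<in> gauge_group v" by (rule gauge_mult[OF elim(3,2)])
   then have "D z ~= 0" unfolding Dgrp Gz .
   then show ?case unfolding eq by (rule van)
  qed
  then have "infinite {t. p (?Y t) = 0}" by (rule infinite_near_zero)
  moreover have "{t. p (?Y t) = 0} \<subseteq> {t. E t = 0 \<or> p (?Y t) = 0}" by blast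
  ultimately show False using finz finite_subset by blast
 qed
 show thesis by (rule that[of D \<sigma> q]) (fact Dp | rule rat; assumption | rule dense; assumption | rule qp | rule near | rule qlim; assumption)+
 qed
qed

text \<open>Irreducible varieties of the same dimension, one contained in the closure of the other.\<close>

lemma conormal_closure_symmetric:
 assumes fin: "fin_supp v" and f: "f \<in> Zt_V v" and g: "g \<in> Zt_V v"
  and sub: "!!p. p \<in> rep_polys v ==> \<forall>x\<in>conormal v g. p x = 0 ==> \<forall>x\<in>conormal v f. p x = 0"
  and p: "p \<in> rep_polys v" "\<forall>x\<in>conormal v f. p x = 0"
 shows "\<forall>x\<in>conormal v g. p x = 0"
proof -
 let ?d = "card (edge_idx v)"
 show ?thesis
 proof (rule conormal_chart[OF fin g])
  fix D \<sigma>
  assume T: "D \<in> poly_funs (coord_funs ?d)"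
   "!!c. c \<in> rep_coords v ==> (%z. c (\<sigma> z)) \<in> rational_over (coord_funs ?d) D"
   "!!p. p \<in> rep_polys v ==> (!!z. D z ~= 0 ==> p (\<sigma> z) = 0) ==> \<forall>x\<in>conormal v g. p x = 0"
  show ?thesis
  proof (rule conormal_chart[OF fin f])
   fix \<tau> q
   assume S: "!!i. i < ?d ==> q i \<in> rep_polys v"
    "!!z. \<forall>\<^sub>F t in at (0::complex). \<tau> (%i. t * z i) \<in> conormal v f"
    "!!z i. i < ?d ==> ((%t. q i (\<tau> (%i. t * z i)) / t) \<longlongrightarrow> z i) (at 0)"
   show ?thesis
    by (rule dense_of_full_dimension[where \<sigma> = \<sigma> and D = D and q = q and \<tau> = "%z t. \<tau> (%i. t * z i)" and S = "conormal v f",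
       OF conormal_prime[OF fin g] T sub S p])
  qed
 qed
qed

section \<open>Paths and the classification of representations\<close>

text \<open>Entries of the composition of the \<open>n\<close> arrows \<open>Om k, \<dots>, Om (k - n + 1)\<close>.\<close>

fun path_entry :: "(int => nat) => rep => int => nat => nat => nat => complex" where
 "path_entry v x k 0 a b = (if a = b then 1 else 0)"
| "path_entry v x k (Suc n) a b =
  (\<Sum>c<v (k - int n). x (Om (k - int n)) $$ (a, c) * path_entry v x k n c b)"

lemma path_entry_right:
 assumes "b < v k" "a < v (k - 1 - int n)"
 shows "path_entry v x k (Suc n) a b = (\<Sum>c<v (k - 1). path_entry v x (k - 1) n a c * x (Om k) $$ (c, b))"
 using assms(2)
proof (induction n arbitrary: a)
 case 0
 have "path_entry v x k (Suc 0) a b = (\<Sum>c<v k. x (Om k) $$ (a, c) * (if c = b then 1 else 0))" by simp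
 also have "... = x (Om k) $$ (a, b)" using assms(1) by (intro sum_mult_delta(1)) auto
 also have "... = (\<Sum>c<v (k - 1). (if a = c then 1 else 0) * x (Om k) $$ (c, b))"
  using 0 by (intro sum_mult_delta(4)[symmetric]) auto
 finally show ?case by simp
next
 case (Suc n)
 have e: "k - int (Suc n) = k - 1 - int n" by simp
 have "path_entry v x k (Suc (Suc n)) a b
   = (\<Sum>d<v (k - 1 - int n). x (Om (k - 1 - int n)) $$ (a, d) * path_entry v x k (Suc n) d b)"
  by (simp only: path_entry.simps(2)[of v x k "Suc n"] e)
 also have "... = (\<Sum>d<v (k - 1 - int n). x (Om (k - 1 - int n)) $$ (a, d) * (\<Sum>c<v (k - 1). path_entry v x (k - 1) n d c * x (Om k) $$ (c, b)))"
  using Suc.IH by (intro sum_times_cong) simp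
 also have "... = (\<Sum>c<v (k - 1). (\<Sum>d<v (k - 1 - int n). x (Om (k - 1 - int n)) $$ (a, d) * path_entry v x (k - 1) n d c) * x (Om k) $$ (c, b))"
  by (rule sum_bilinear_swap)
 finally show ?case by simp
qed

lemma path_entry_compose:
 assumes "b < v k" "a < v (k - int n - int m)"
 shows "path_entry v x k (n + m) a b = (\<Sum>c<v (k - int n). path_entry v x (k - int n) m a c * path_entry v x k n c b)"
 using assms(2)
proof (induction m arbitrary: a)
 case 0
 then show ?case using sum_mult_delta(4)[of "{..<v (k - int n)}" a "%c. path_entry v x k n c b"] by simp
next
 case (Suc m)
 have e: "k - int (n + m) = k - int n - int m" by simp
 have "path_entry v x k (n + Suc m) a b
   = (\<Sum>d<v (k - int n - int m). x (Om (k - int n - int m)) $$ (a, d) * path_entry v x k (n + m) d b)"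
  by (simp only: add_Suc_right path_entry.simps(2)[of v x k "n + m"] e)
 also have "... = (\<Sum>d<v (k - int n - int m). x (Om (k - int n - int m)) $$ (a, d) *
   (\<Sum>c<v (k - int n). path_entry v x (k - int n) m d c * path_entry v x k n c b))"
  using Suc.IH by (intro sum_times_cong) simp
 also have "... = (\<Sum>c<v (k - int n). (\<Sum>d<v (k - int n - int m). x (Om (k - int n - int m)) $$ (a, d) * path_entry v x (k - int n) m d c) * path_entry v x k n c b)"
  by (rule sum_bilinear_swap)
 finally show ?case by simp
qed

lemma path_entry_poly:
 assumes "a < v (k - int n)" "b < v k"
 shows "(%x. path_entry v x k n a b) \<in> rep_polys v"
 using assms(1)
proof (induction n arbitrary: a)
 case 0
 then show ?case by (simp add: poly_funs.const)
next
 case (Suc n)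
 have "(%x. x (Om (k - int n)) $$ (a, c)) \<in> rep_polys v" if "c < v (k - int n)" for c
  using that Suc.prems by (intro poly_funs.coord rep_coordsI) (auto simp: algebra_simps)
 then show ?case using Suc.IH by (auto intro!: poly_funs_sum poly_funs.mult)
qed

lemma path_entry_gauge:
 assumes g: "g \<in> gauge_group v" and x: "x \<in> rep_space v" and ab: "a < v (k - int n)" "b < v k"
 shows "(\<Sum>c<v k. path_entry v (gauge_act v g x) k n a c * g k $$ (c, b))
  = (\<Sum>c<v (k - int n). g (k - int n) $$ (a, c) * path_entry v x k n c b)"
 using ab(1)
proof (induction n arbitrary: a)
 case 0
 then show ?case
  using ab(2) sum_mult_delta(4)[of "{..<v k}" a "%c. g k $$ (c, b)"] sum_mult_delta(1)[of "{..<v k}" b "%c. g k $$ (a, c)"] by simp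
next
 case (Suc n)
 let ?z = "gauge_act v g x" and ?i = "k - int n"
 have z: "?z \<in> rep_space v" by (rule gauge_act_rep_space[OF g x])
 have e: "k - int (Suc n) = ?i - 1" by simp
 have a: "a < v (?i - 1)" using Suc.prems by (simp only: e)
 have zx: "(\<Sum>d<v ?i. ?z (Om ?i) $$ (a, d) * g ?i $$ (d, c)) = (\<Sum>d<v (?i - 1). g (?i - 1) $$ (a, d) * x (Om ?i) $$ (d, c))"
  if "c < v ?i" for c
 proof -
  have "?z (Om ?i) * g (out_v (Om ?i)) = g (in_v (Om ?i)) * x (Om ?i)"
   using gauge_act_iff[OF g x z] by blast
  then have "(?z (Om ?i) * g ?i) $$ (a, c) = (g (?i - 1) * x (Om ?i)) $$ (a, c)" by simp
  moreover have zc: "?z (Om ?i) \<in> carrier_mat (v (?i - 1)) (v ?i)" and xc: "x (Om ?i) \<in> carrier_mat (v (?i - 1)) (v ?i)"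
   using rep_spaceD[OF z, of "Om ?i"] rep_spaceD[OF x, of "Om ?i"] by auto
  ultimately show ?thesis
   unfolding mat_mult_entry[OF zc gauge_carrier[OF g] a that] mat_mult_entry[OF gauge_carrier[OF g] xc a that] by simp
 qed
 have "(\<Sum>c<v k. path_entry v ?z k (Suc n) a c * g k $$ (c, b))
   = (\<Sum>d<v ?i. ?z (Om ?i) $$ (a, d) * (\<Sum>c<v k. path_entry v ?z k n d c * g k $$ (c, b)))"
  unfolding path_entry.simps by (rule sum_bilinear_swap[symmetric])
 also have "... = (\<Sum>d<v ?i. ?z (Om ?i) $$ (a, d) * (\<Sum>c<v ?i. g ?i $$ (d, c) * path_entry v x k n c b))"
  by (rule sum_right_cong) (use Suc.IH in simp)
 also have "... = (\<Sum>c<v ?i. (\<Sum>d<v ?i. ?z (Om ?i) $$ (a, d) * g ?i $$ (d, c)) * path_entry v x k n c b)"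
  by (rule sum_bilinear_swap)
 also have "... = (\<Sum>c<v ?i. (\<Sum>d<v (?i - 1). g (?i - 1) $$ (a, d) * x (Om ?i) $$ (d, c)) * path_entry v x k n c b)"
  by (rule sum_left_cong) (use zx in simp)
 also have "... = (\<Sum>d<v (?i - 1). g (?i - 1) $$ (a, d) * (\<Sum>c<v ?i. x (Om ?i) $$ (d, c) * path_entry v x k n c b))"
  by (rule sum_bilinear_swap[symmetric])
 finally show ?case by (simp only: e path_entry.simps(2))
qed

text \<open>Completes \<open>c\<close> to a basis whose remaining members span the kernel of \<open>\<psi>\<close>.\<close>

lemma split_off_line:
 fixes c \<psi> :: "nat => complex"
 assumes "(\<Sum>a<N. \<psi> a * c a) = 1"
 obtains P Q where "P \<in> carrier_mat N N" "Q \<in> carrier_mat N N" "Q * P = 1\<^sub>m N" "P * Q = 1\<^sub>m N"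
  "!!a. a < N ==> P $$ (a, 0) = c a" "!!a. a < N ==> Q $$ (0, a) = \<psi> a" "0 < N"
proof -
 have "\<exists>p<N. c p ~= 0"
 proof (rule ccontr)
  assume "\<not> ?thesis"
  then have "(\<Sum>a<N. \<psi> a * c a) = 0" by (intro sum.neutral) auto
  then show False using assms by simp
 qed
 then obtain p where p: "p < N" "c p ~= 0" by blast
 define \<tau> where "\<tau> l = (if l = 0 then p else if l = p then 0 else l)" for l :: nat
 have \<tau>: "\<tau> l < N" "\<tau> l = \<tau> m \<longleftrightarrow> l = m" "\<tau> l = p \<longleftrightarrow> l = 0" if "l < N" "m < N" for l m
  using that p by (auto simp: \<tau>_def split: if_splits)
 define P where "P = mat N N (%(a, l). if l = 0 then c a else (if a = \<tau> l then 1 else 0) - \<psi> (\<tau> l) * c a)"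
 define Q where "Q = mat N N (%(l, a). if l = 0 then \<psi> a else (if a = \<tau> l then 1 else 0) - c (\<tau> l) / c p * (if a = p then 1 else 0))"
 have PQ: "P \<in> carrier_mat N N" "Q \<in> carrier_mat N N" unfolding P_def Q_def by auto
 have delta: "(\<Sum>a<N. (if a = d then 1 else 0) * F a) = F d" if "d < N" for d and F :: "nat => complex"
  using that by (intro sum_mult_delta(3)) auto
 have one: "Q * P = 1\<^sub>m N"
 proof (rule eq_matI)
  fix l m assume "l < dim_row (1\<^sub>m N :: complex mat)" "m < dim_col (1\<^sub>m N :: complex mat)"
  then have lm: "l < N" "m < N" by auto
  have "(Q * P) $$ (l, m) = (\<Sum>a<N. Q $$ (l, a) * P $$ (a, m))" by (rule mat_mult_entry[OF PQ(2,1) lm])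
  also have "... = (if l = m then 1 else 0)"
  proof (cases "l = 0")
   case True
   show ?thesis
   proof (cases "m = 0")
    case True
    have "(\<Sum>a<N. Q $$ (l, a) * P $$ (a, m)) = (\<Sum>a<N. \<psi> a * c a)"
     unfolding Q_def P_def using lm \<open>l = 0\<close> True by (intro sum.cong) auto
    then show ?thesis using True \<open>l = 0\<close> assms by simp
   next
    case False
    have "(\<Sum>a<N. Q $$ (l, a) * P $$ (a, m)) = (\<Sum>a<N. (if a = \<tau> m then 1 else 0) * \<psi> a) - \<psi> (\<tau> m) * (\<Sum>a<N. \<psi> a * c a)"
     unfolding sum_distrib_left sum_subtractf[symmetric]
     using lm \<open>l = 0\<close> False by (intro sum.cong) (auto simp: Q_def P_def algebra_simps)
    then show ?thesis using delta[OF \<tau>(1)[OF lm(2,2)]] assms False \<open>l = 0\<close> by simp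
   qed
  next
   case False
   have Q: "(\<Sum>a<N. Q $$ (l, a) * F a) = F (\<tau> l) - c (\<tau> l) / c p * F p" for F
   proof -
    have "(\<Sum>a<N. Q $$ (l, a) * F a) = (\<Sum>a<N. (if a = \<tau> l then 1 else 0) * F a) - c (\<tau> l) / c p * (\<Sum>a<N. (if a = p then 1 else 0) * F a)"
     unfolding sum_distrib_left sum_subtractf[symmetric]
     using lm False by (intro sum.cong) (auto simp: Q_def algebra_simps)
    then show ?thesis using delta[OF \<tau>(1)[OF lm(1,1)]] delta[OF p(1)] by simp
   qed
   show ?thesis
    unfolding Q using lm p \<tau>[OF lm(1,2)] \<tau>[OF lm(2,2)] \<tau>[OF lm(1,1)] False
    by (cases "m = 0") (auto simp: P_def)
  qed
  finally show "(Q * P) $$ (l, m) = 1\<^sub>m N $$ (l, m)" using lm by simp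
 qed (use PQ in auto)
 show ?thesis
 proof (rule that[OF PQ one])
  show "P * Q = 1\<^sub>m N" by (rule mat_mult_left_right_inverse[OF PQ(2,1) one])
 qed (use p in \<open>auto simp: P_def Q_def\<close>)
qed

lemma nonzero_path_bounded:
 fixes v :: "int => nat"
 assumes fin: "fin_supp v"
 obtains B where "!!k n a b. a < v (k - int n) ==> b < v k ==> n <= B"
proof -
 define S where "S = (%(i, j). nat (j - i)) ` ({i. v i ~= 0} \<times> {i. v i ~= 0})"
 have "finite S" unfolding S_def using fin by simp
 have "n <= Max S" if "a < v (k - int n)" "b < v k" for k n a b
 proof -
  have "n \<in> S" unfolding S_def using that by (intro image_eqI[of _ _ "(k - int n, k)"]) auto
  then show ?thesis using \<open>finite S\<close> by simp
 qed
 then show ?thesis by (rule that)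
qed

lemma longest_path:
 assumes fin: "fin_supp v" and "v i0 ~= 0"
 obtains k n a b where "a < v (k - int n)" "b < v k" "path_entry v x k n a b ~= 0"
  "\<forall>k a b. a < v (k - int (Suc n)) --> b < v k --> path_entry v x k (Suc n) a b = 0"
proof -
 obtain B where B: "!!k n a b. a < v (k - int n) ==> b < v k ==> n <= B"
  using nonzero_path_bounded[OF fin] by blast
 define R where "R n \<longleftrightarrow> (\<exists>k a b. a < v (k - int n) & b < v k & path_entry v x k n a b ~= 0)" for n
 have "R 0" unfolding R_def using assms(2) by (intro exI[of _ i0] exI[of _ 0]) simp
 moreover have "n <= B" if "R n" for n using that B unfolding R_def by blast
 ultimately obtain n where n: "R n" "!!m. R m ==> m <= n"
  using ex_has_greatest_nat[of R 0 "%x. x" "Suc B"] by (meson le_imp_less_Suc)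
 from n(1) obtain k a b where "a < v (k - int n)" "b < v k" "path_entry v x k n a b ~= 0"
  unfolding R_def by blast
 moreover have "\<forall>k a b. a < v (k - int (Suc n)) --> b < v k --> path_entry v x k (Suc n) a b = 0"
 proof (intro allI impI, rule ccontr)
  fix k a b assume "a < v (k - int (Suc n))" "b < v k" and
 "path_entry v x k (Suc n) a b ~= 0"
  then have "R (Suc n)" unfolding R_def by blast
  then show False using n(2)[of "Suc n"] by simp
 qed
 ultimately show ?thesis by (rule that)
qed

abbreviation seg_block :: "int \<times> int => (int => nat) => rep => rep" where
 "seg_block z v y h \<equiv> four_block_mat (seg_rep z h) (0\<^sub>m (seg_on z (in_v h)) (v (out_v h)))
   (0\<^sub>m (v (in_v h)) (seg_on z (out_v h))) (y h)"

text \<open>Along a path of maximal length with nonzero composition choose a vector at the start and a covector at the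
  end with nonzero pairing. The images of the vector span a copy of a segment; the common kernels of the
  pulled back covectors are a complement that is stable because no longer path is nonzero.\<close>

lemma split_off_segment:
 assumes fin: "fin_supp v" and x: "x \<in> rep_space_Om v" and "v i0 ~= 0"
 obtains z g v' y where "fst z <= snd z" "g \<in> gauge_group v" "!!i. v i = seg_on z i + v' i"
  "y \<in> rep_space_Om v'"
  "!!h. x h * g (out_v h) = g (in_v h) * seg_block z v' y h"
proof -
 note xs = rep_space_OmD(1)[OF x]
 obtain k n a0 b0 where ab: "a0 < v (k - int n)" "b0 < v k" "path_entry v x k n a0 b0 ~= 0"
  and "\<forall>k a b. a < v (k - int (Suc n)) --> b < v k --> path_entry v x k (Suc n) a b = 0"
  by (rule longest_path[OF fin assms(3), of x]) (rule that; assumption)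
 then have long: "path_entry v x k (Suc n) a b = 0" if "a < v (k - int (Suc n))" "b < v k" for k a b
  using that by blast
 define z where "z = (k - int n, k)"
 define act where "act i \<longleftrightarrow> k - int n <= i & i <= k" for i
 have on: "seg_on z i = (if act i then 1 else 0)" for i unfolding seg_on_def z_def act_def by simp
 define c where "c i a = path_entry v x k (nat (k - i)) a b0" for i a
 define \<psi> where "\<psi> i a = path_entry v x i (nat (i - (k - int n))) a0 a / path_entry v x k n a0 b0" for i a
 have X: "x (Om i) \<in> carrier_mat (v (i - 1)) (v i)" for i using rep_spaceD[OF xs, of "Om i"] by simp
 have dual: "(\<Sum>a<v i. \<psi> i a * c i a) = 1" if "act i" for i
 proof -
  define p where "p = nat (k - i)"
  define q where "q = nat (i - (k - int n))"
  have pq: "i = k - int p" "p + q = n" using that unfolding act_def p_def q_def by auto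
  have "a0 < v (k - int p - int q)" using ab(1) pq(2) by (simp add: diff_diff_eq flip: of_nat_add)
  from path_entry_compose[OF ab(2) this, of x]
  have "path_entry v x k n a0 b0 = (\<Sum>a<v i. path_entry v x i q a0 a * path_entry v x k p a b0)"
   unfolding pq(2) pq(1)[symmetric] .
  then have "(\<Sum>a<v i. \<psi> i a * c i a) * path_entry v x k n a0 b0 = path_entry v x k n a0 b0"
   unfolding \<psi>_def c_def p_def[symmetric] q_def[symmetric] sum_distrib_right using ab(3) by simp
  then show ?thesis using ab(3) by simp
 qed
 have "\<forall>i. \<exists>PQ. act i --> (case PQ of (P, Q) => P \<in> carrier_mat (v i) (v i) & Q \<in> carrier_mat (v i) (v i) &
   Q * P = 1\<^sub>m (v i) & P * Q = 1\<^sub>m (v i) & (\<forall>a<v i. P $$ (a, 0) = c i a) & (\<forall>a<v i. Q $$ (0, a) = \<psi> i a) & 0 < v i)"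
 proof
  fix i
  show "\<exists>PQ. act i --> (case PQ of (P, Q) => P \<in> carrier_mat (v i) (v i) & Q \<in> carrier_mat (v i) (v i) &
   Q * P = 1\<^sub>m (v i) & P * Q = 1\<^sub>m (v i) & (\<forall>a<v i. P $$ (a, 0) = c i a) & (\<forall>a<v i. Q $$ (0, a) = \<psi> i a) & 0 < v i)"
  proof (cases "act i")
   case True
   obtain P Q where "P \<in> carrier_mat (v i) (v i)" "Q \<in> carrier_mat (v i) (v i)" "Q * P = 1\<^sub>m (v i)" "P * Q = 1\<^sub>m (v i)"
    "!!a. a < v i ==> P $$ (a, 0) = c i a" "!!a. a < v i ==> Q $$ (0, a) = \<psi> i a" "0 < v i"
    using split_off_line[OF dual[OF True]] by metis
   then show ?thesis by (intro exI[of _ "(P, Q)"]) simp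
  qed simp
 qed
 then obtain PQ where PQ': "\<forall>i. act i --> (case PQ i of (P, Q) => P \<in> carrier_mat (v i) (v i) & Q \<in> carrier_mat (v i) (v i) &
   Q * P = 1\<^sub>m (v i) & P * Q = 1\<^sub>m (v i) & (\<forall>a<v i. P $$ (a, 0) = c i a) & (\<forall>a<v i. Q $$ (0, a) = \<psi> i a) & 0 < v i)"
  by (rule choice[THEN exE])
 define P where "P i = (if act i then fst (PQ i) else 1\<^sub>m (v i))" for i
 define Q where "Q i = (if act i then snd (PQ i) else 1\<^sub>m (v i))" for i
 have P: "P i \<in> carrier_mat (v i) (v i)" and Q: "Q i \<in> carrier_mat (v i) (v i)"
  and QP: "Q i * P i = 1\<^sub>m (v i)" and PQ: "P i * Q i = 1\<^sub>m (v i)" for i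
  using PQ'[rule_format, of i] unfolding P_def Q_def by (auto split: prod.splits)
 have P0: "P i $$ (a, 0) = c i a" and Q0: "Q i $$ (0, a) = \<psi> i a" if "act i" "a < v i" for i a
  using PQ'[rule_format, OF that(1)] that unfolding P_def Q_def by (auto split: prod.splits)
 have v0: "0 < v i" if "act i" for i using PQ'[rule_format, OF that] by (auto split: prod.splits)
 have Pg: "P \<in> gauge_group v" by (rule gauge_groupI_inverse[OF P Q PQ])
 define v' where "v' i = v i - seg_on z i" for i
 have vv': "v i = seg_on z i + v' i" for i unfolding v'_def on using v0[of i] by auto
 define x' where "x' h = Q (in_v h) * x h * P (out_v h)" for h
 have x'c: "x' h \<in> carrier_mat (v (in_v h)) (v (out_v h))" for h
  unfolding x'_def using P Q rep_spaceD[OF xs] by (auto intro!: mult_carrier_mat)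
 have Px': "P (in_v h) * x' h = x h * P (out_v h)" for h
 proof -
  have "P (in_v h) * x' h = P (in_v h) * (Q (in_v h) * x h) * P (out_v h)"
   unfolding x'_def by (rule assoc_mult_mat[symmetric, OF P mult_carrier_mat[OF Q rep_spaceD[OF xs]] P])
  also have "P (in_v h) * (Q (in_v h) * x h) = P (in_v h) * Q (in_v h) * x h"
   by (rule assoc_mult_mat[symmetric, OF P Q rep_spaceD[OF xs]])
  also have "... = x h" unfolding PQ by (rule left_mult_one_mat[OF rep_spaceD[OF xs]])
  finally show ?thesis .
 qed
 \<comment> \<open>the path vectors and covectors are carried along by \<open>x\<close>\<close>
 have cstep: "(\<Sum>b<v i. x (Om i) $$ (a, b) * c i b) = (if act (i - 1) then c (i - 1) a else 0)"
  if "act i" "a < v (i - 1)" for i a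
 proof -
  define p where "p = nat (k - i)"
  have ip: "i = k - int p" using that unfolding act_def p_def by simp
  have "(\<Sum>b<v i. x (Om i) $$ (a, b) * c i b) = path_entry v x k (Suc p) a b0"
   unfolding c_def p_def[symmetric] using ip by simp
  also have "... = (if act (i - 1) then c (i - 1) a else 0)"
  proof (cases "act (i - 1)")
   case True
   have "nat (k - (i - 1)) = Suc p" using ip by simp
   then show ?thesis using True unfolding c_def by simp
  next
   case False
   then have "p = n" using that(1) ip unfolding act_def by simp
   have e: "k - int (Suc n) = i - 1" using ip \<open>p = n\<close> by simp
   have "a < v (k - int (Suc n))" using that(2) by (simp only: e)
   from long[OF this ab(2)] show ?thesis using False \<open>p = n\<close> by (simp only: if_False)
  qed
  finally show ?thesis .
 qed
 have \<psi>step: "(\<Sum>a<v (i - 1). \<psi> (i - 1) a * x (Om i) $$ (a, b)) = (if act i then \<psi> i b else 0)"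
  if "act (i - 1)" "b < v i" for i b
 proof -
  define q where "q = nat (i - 1 - (k - int n))"
  have iq: "k - int n = i - 1 - int q" using that unfolding act_def q_def by simp
  have "a0 < v (i - 1 - int q)" using ab(1) iq by simp
  from path_entry_right[OF that(2) this, of x]
  have eq: "(\<Sum>a<v (i - 1). \<psi> (i - 1) a * x (Om i) $$ (a, b)) = path_entry v x i (Suc q) a0 b / path_entry v x k n a0 b0"
   unfolding \<psi>_def q_def[symmetric] by (simp add: sum_divide_distrib)
  show ?thesis
  proof (cases "act i")
   case True
   have "nat (i - (k - int n)) = Suc q" using iq by simp
   then show ?thesis unfolding eq using True unfolding \<psi>_def by simp
  next
   case False
   then have "q = n" using that(1) iq unfolding act_def by simp
   moreover have "a0 < v (i - int (Suc n))" using ab(1) iq \<open>q = n\<close> by (simp add: algebra_simps)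
   ultimately show ?thesis unfolding eq using long[of a0 i b] that(2) False by simp
  qed
 qed
 have row0: "x' (Om i) $$ (0, l) = (if act i & l = 0 then 1 else 0)" if "act (i - 1)" "l < v i" for i l
 proof -
  have "x' (Om i) $$ (0, l) = (\<Sum>b<v i. (Q (i - 1) * x (Om i)) $$ (0, b) * P i $$ (b, l))"
   unfolding x'_def in_v.simps out_v.simps
   by (rule mat_mult_entry[OF mult_carrier_mat[OF Q X] P v0[OF that(1)] that(2)])
  also have "... = (\<Sum>b<v i. (if act i then \<psi> i b else 0) * P i $$ (b, l))"
  proof (intro sum_times_cong)
   fix b assume b: "b \<in> {..<v i}"
   have "(Q (i - 1) * x (Om i)) $$ (0, b) = (\<Sum>a<v (i - 1). Q (i - 1) $$ (0, a) * x (Om i) $$ (a, b))"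
    by (rule mat_mult_entry[OF Q X v0[OF that(1)]]) (use b in simp)
   also have "... = (\<Sum>a<v (i - 1). \<psi> (i - 1) a * x (Om i) $$ (a, b))" using Q0[OF that(1)] by simp
   finally show "(Q (i - 1) * x (Om i)) $$ (0, b) = (if act i then \<psi> i b else 0)" using \<psi>step[OF that(1)] b by simp
  qed
  also have "... = (if act i & l = 0 then 1 else 0)"
  proof (cases "act i")
   case True
   have "(\<Sum>b<v i. \<psi> i b * P i $$ (b, l)) = (\<Sum>b<v i. Q i $$ (0, b) * P i $$ (b, l))" using Q0[OF True] by simp
   also have "... = (Q i * P i) $$ (0, l)" by (rule mat_mult_entry[symmetric, OF Q P v0[OF True] that(2)])
   finally show ?thesis unfolding QP using that v0[OF True] True by auto
  qed simp
  finally show ?thesis .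
 qed
 have col0: "x' (Om i) $$ (m, 0) = (if act (i - 1) & m = 0 then 1 else 0)" if "act i" "m < v (i - 1)" for i m
 proof -
  have "x' (Om i) = Q (i - 1) * (x (Om i) * P i)"
   unfolding x'_def in_v.simps out_v.simps by (rule assoc_mult_mat[OF Q X P])
  then have "x' (Om i) $$ (m, 0) = (\<Sum>a<v (i - 1). Q (i - 1) $$ (m, a) * (x (Om i) * P i) $$ (a, 0))"
   using mat_mult_entry[OF Q mult_carrier_mat[OF X P] that(2) v0[OF that(1)]] by simp
  also have "... = (\<Sum>a<v (i - 1). Q (i - 1) $$ (m, a) * (if act (i - 1) then c (i - 1) a else 0))"
  proof (intro sum_times_cong)
   fix a assume a: "a \<in> {..<v (i - 1)}"
   have "(x (Om i) * P i) $$ (a, 0) = (\<Sum>b<v i. x (Om i) $$ (a, b) * P i $$ (b, 0))"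
    by (rule mat_mult_entry[OF X P _ v0[OF that(1)]]) (use a in simp)
   also have "... = (\<Sum>b<v i. x (Om i) $$ (a, b) * c i b)" using P0[OF that(1)] by simp
   finally show "(x (Om i) * P i) $$ (a, 0) = (if act (i - 1) then c (i - 1) a else 0)" using cstep[OF that(1)] a by simp
  qed
  also have "... = (if act (i - 1) & m = 0 then 1 else 0)"
  proof (cases "act (i - 1)")
   case True
   have "(\<Sum>a<v (i - 1). Q (i - 1) $$ (m, a) * c (i - 1) a) = (\<Sum>a<v (i - 1). Q (i - 1) $$ (m, a) * P (i - 1) $$ (a, 0))"
    using P0[OF True] by simp
   also have "... = (Q (i - 1) * P (i - 1)) $$ (m, 0)" by (rule mat_mult_entry[symmetric, OF Q P that(2) v0[OF True]])
   finally show ?thesis unfolding QP using that v0[OF True] True by auto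
  qed simp
  finally show ?thesis .
 qed
 define y where "y h = (case h of Om i => mat (v' (i - 1)) (v' i) (%(a, b). x' (Om i) $$ (seg_on z (i - 1) + a, seg_on z i + b))
  | OmBar i => 0\<^sub>m (v' i) (v' (i - 1)))" for h
 have y: "y \<in> rep_space_Om v'"
  unfolding rep_space_Om_def rep_space_def y_def by (auto split: arrow.split)
 have blocks: "x' h = seg_block z v' y h" for h
 proof (cases h)
  case (Om i)
  show ?thesis
  proof (rule eq_matI)
   let ?F = "seg_block z v' y h"
   have dr: "dim_row (seg_rep z h) = seg_on z (i - 1)" "dim_col (seg_rep z h) = seg_on z i"
    "dim_row (y h) = v' (i - 1)" "dim_col (y h) = v' i" unfolding seg_rep_eq y_def Om by auto
   show "dim_row (x' h) = dim_row ?F" "dim_col (x' h) = dim_col ?F"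
    using x'c[of h] dr vv'[of i] vv'[of "i - 1"] Om by auto
   fix a b assume ab: "a < dim_row ?F" "b < dim_col ?F"
   then have ab': "a < seg_on z (i - 1) + v' (i - 1)" "b < seg_on z i + v' i" using dr by auto
   then have abv: "a < v (i - 1)" "b < v i" using vv' by auto
   have F: "?F $$ (a, b) = (if a < seg_on z (i - 1) then if b < seg_on z i then seg_rep z h $$ (a, b)
     else 0\<^sub>m (seg_on z (in_v h)) (v' (out_v h)) $$ (a, b - seg_on z i)
    else if b < seg_on z i then 0\<^sub>m (v' (in_v h)) (seg_on z (out_v h)) $$ (a - seg_on z (i - 1), b)
    else y h $$ (a - seg_on z (i - 1), b - seg_on z i))"
    using ab' dr by (subst index_mat_four_block) auto
   show "x' h $$ (a, b) = ?F $$ (a, b)"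
   proof (cases "a < seg_on z (i - 1)")
    case True
    then have act: "act (i - 1)" "a = 0" by (auto simp: on split: if_splits)
    show ?thesis unfolding F using True act row0[OF act(1) abv(2)] ab' Om
     by (auto simp: on seg_rep_eq)
   next
    case False
    show ?thesis
    proof (cases "b < seg_on z i")
     case True
     then have act: "act i" "b = 0" by (auto simp: on split: if_splits)
     show ?thesis unfolding F using True False act col0[OF act(1) abv(1)] ab' Om
      by (auto simp: on split: if_splits)
    next
     case b: False
     show ?thesis unfolding F using False b ab' Om by (simp add: y_def)
    qed
   qed
  qed
 next
  case (OmBar i)
  have "x' h = 0\<^sub>m (v i) (v (i - 1))"
   unfolding x'_def OmBar using rep_space_OmD(2)[OF x, of i] P[of "i - 1"] Q[of i] by simp
  moreover have "seg_rep z h = 0\<^sub>m (seg_on z i) (seg_on z (i - 1))"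
   unfolding seg_rep_eq OmBar by (intro eq_matI) auto
  ultimately show ?thesis unfolding OmBar y_def using vv' by (simp add: OmBar)
 qed
 show ?thesis
 proof (rule that[of z P v' y])
  show "fst z <= snd z" unfolding z_def by simp
  show "x h * P (out_v h) = P (in_v h) * seg_block z v' y h" for h
   unfolding blocks[symmetric] Px' ..
 qed (fact Pg vv' y)+
qed

lemma representation_decomposes:
 assumes "fin_supp v" "x \<in> rep_space_Om v"
 shows "\<exists>zs. \<exists>g\<in>gauge_group v. (\<forall>z\<in>set zs. fst z <= snd z) & (\<forall>i. seg_total zs i = v i) &
  x = gauge_act v g (seg_sum zs)"
 using assms
proof (induction "\<Sum>i | v i ~= 0. v i" arbitrary: v x rule: less_induct)
 case less
 note fin = less.prems(1) and x = less.prems(2)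
 show ?case
 proof (cases "\<exists>i. v i ~= 0")
  case False
  then have v: "v i = 0" for i by simp
  have tot: "seg_total [] i = v i" for i unfolding seg_total_def v by simp
  have "x = seg_sum []"
  proof
   fix h
   show "x h = seg_sum [] h"
    using rep_spaceD[OF rep_space_OmD(1)[OF x], of h] seg_sum_carrier[of "[]" h] tot v by (intro eq_matI) auto
  qed
  then have "x = gauge_act v (%i. 1\<^sub>m (v i)) (seg_sum [])"
   using gauge_act_one[OF rep_space_OmD(1)[OF x]] by simp
  then show ?thesis using gauge_one tot by (intro exI[of _ "[]"] bexI[of _ "%i. 1\<^sub>m (v i)"]) auto
 next
  case True
  then obtain i0 where i0: "v i0 ~= 0" by blast
  obtain z g v' y where z: "fst z <= snd z" and g: "g \<in> gauge_group v" and vv': "!!i. v i = seg_on z i + v' i"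
   and y: "y \<in> rep_space_Om v'"
   and xg: "!!h. x h * g (out_v h) = g (in_v h) * seg_block z v' y h"
   using split_off_segment[OF fin x i0] by blast
  have sub: "{i. v' i ~= 0} \<subseteq> {i. v i ~= 0}" using vv' by auto
  then have fin': "finite {i. v' i ~= 0}" using fin finite_subset by blast
  have "(\<Sum>i | v' i ~= 0. v' i) = (\<Sum>i | v i ~= 0. v' i)"
   using fin sub by (intro sum.mono_neutral_left) auto
  also have "... < (\<Sum>i | v i ~= 0. v i)"
  proof (rule sum_strict_mono_ex1[OF fin])
   have "seg_on z (fst z) = 1" using z unfolding seg_on_def by simp
   then show "\<exists>a\<in>{i. v i ~= 0}. v' a < v a" using vv'[of "fst z"] by (intro bexI[of _ "fst z"]) auto
  qed (use vv' in simp)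
  finally have "(\<Sum>i | v' i ~= 0. v' i) < (\<Sum>i | v i ~= 0. v i)" .
  from less.hyps[OF this fin' y] obtain zs g' where zs: "g' \<in> gauge_group v'" "\<forall>z\<in>set zs. fst z <= snd z"
   "\<forall>i. seg_total zs i = v' i" "y = gauge_act v' g' (seg_sum zs)" by blast
  have tot: "seg_total (z # zs) i = v i" for i using vv'[of i] zs(3) unfolding seg_total_def by simp
  define G where "G i = four_block_mat (1\<^sub>m (seg_on z i)) (0\<^sub>m (seg_on z i) (v' i)) (0\<^sub>m (v' i) (seg_on z i)) (g' i)" for i
  define H where "H i = four_block_mat (1\<^sub>m (seg_on z i)) (0\<^sub>m (seg_on z i) (v' i)) (0\<^sub>m (v' i) (seg_on z i)) (gauge_inv v' g' i)" for i
  note g'c = gauge_carrier[OF zs(1)] gauge_inv_group(1)[OF zs(1)]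
  have G: "G \<in> gauge_group v"
  proof (rule gauge_groupI_inverse[of _ _ H])
   show "G i \<in> carrier_mat (v i) (v i)" "H i \<in> carrier_mat (v i) (v i)" for i
    unfolding G_def H_def vv'[of i] using g'c[of i] by auto
   show "G i * H i = 1\<^sub>m (v i)" for i
    unfolding G_def H_def
    by (subst mult_four_block_mat[where ?nr1.0 = "seg_on z i" and ?n1.0 = "seg_on z i" and ?n2.0 = "v' i" and ?nr2.0 = "v' i" and ?nc1.0 = "seg_on z i" and ?nc2.0 = "v' i"])
      (use g'c[of i] gauge_inv_group(2)[OF zs(1), of i] in \<open>auto simp: vv'[of i]\<close>)
  qed
  have sp: "seg_sum zs \<in> rep_space v'" using rep_space_OmD(1)[OF seg_sum_rep_space] zs(3) by metis
  have yg: "y h * g' (out_v h) = g' (in_v h) * seg_sum zs h" for h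
   using gauge_act_iff[OF zs(1) sp rep_space_OmD(1)[OF y]] zs(4) by blast
  have step: "seg_block z v' y h * G (out_v h)
    = G (in_v h) * seg_sum (z # zs) h" for h
  proof -
   have s: "seg_rep z h \<in> carrier_mat (seg_on z (in_v h)) (seg_on z (out_v h))" unfolding seg_rep_eq by simp
   have yc: "y h \<in> carrier_mat (v' (in_v h)) (v' (out_v h))" by (rule rep_spaceD[OF rep_space_OmD(1)[OF y]])
   have sc: "seg_sum zs h \<in> carrier_mat (v' (in_v h)) (v' (out_v h))" by (rule rep_spaceD[OF sp])
   have tt: "seg_total zs i = v' i" for i using zs(3) by blast
   have "seg_block z v' y h * G (out_v h)
     = four_block_mat (seg_rep z h) (0\<^sub>m (seg_on z (in_v h)) (v' (out_v h))) (0\<^sub>m (v' (in_v h)) (seg_on z (out_v h))) (y h * g' (out_v h))"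
    unfolding G_def
    by (subst mult_four_block_mat[where ?nr1.0 = "seg_on z (in_v h)" and ?n1.0 = "seg_on z (out_v h)" and ?n2.0 = "v' (out_v h)" and ?nr2.0 = "v' (in_v h)" and ?nc1.0 = "seg_on z (out_v h)" and ?nc2.0 = "v' (out_v h)"])
      (use s yc g'c(1)[of "out_v h"] in auto)
   also have "... = G (in_v h) * seg_sum (z # zs) h"
    unfolding G_def seg_sum_Cons yg tt
    by (subst mult_four_block_mat[where ?nr1.0 = "seg_on z (in_v h)" and ?n1.0 = "seg_on z (in_v h)" and ?n2.0 = "v' (in_v h)" and ?nr2.0 = "v' (in_v h)" and ?nc1.0 = "seg_on z (out_v h)" and ?nc2.0 = "v' (out_v h)"])
      (use s sc g'c(1)[of "in_v h"] in auto)
   finally show ?thesis .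
  qed
  have sp': "seg_sum (z # zs) \<in> rep_space v" using rep_space_OmD(1)[OF seg_sum_rep_space] tot by metis
  have gG: "(%i. g i * G i) \<in> gauge_group v" by (rule gauge_mult[OF g G])
  have "x h * (g (out_v h) * G (out_v h)) = (g (in_v h) * G (in_v h)) * seg_sum (z # zs) h" for h
  proof -
   note c = gauge_carrier[OF g] gauge_carrier[OF G] rep_spaceD[OF rep_space_OmD(1)[OF x]] rep_spaceD[OF sp']
   let ?F = "seg_block z v' y h"
   have F: "?F \<in> carrier_mat (v (in_v h)) (v (out_v h))"
    unfolding vv'[of "in_v h"] vv'[of "out_v h"]
    using rep_spaceD[OF rep_space_OmD(1)[OF y], of h] by (intro four_block_carrier_mat) (auto simp: seg_rep_eq)
   have "x h * (g (out_v h) * G (out_v h)) = x h * g (out_v h) * G (out_v h)"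
    by (rule assoc_mult_mat[symmetric, OF c(3) c(1) c(2)])
   also have "... = g (in_v h) * (?F * G (out_v h))" unfolding xg by (rule assoc_mult_mat[OF c(1) F c(2)])
   also have "... = g (in_v h) * G (in_v h) * seg_sum (z # zs) h"
    unfolding step by (rule assoc_mult_mat[symmetric, OF c(1) c(2) c(4)])
   finally show ?thesis .
  qed
  then have "x = gauge_act v (%i. g i * G i) (seg_sum (z # zs))"
   using gauge_act_iff[OF gG sp' rep_space_OmD(1)[OF x]] by blast
  then show ?thesis using gG z zs(2) tot by (intro exI[of _ "z # zs"] bexI[of _ "%i. g i * G i"]) auto
 qed
qed

lemma orbits_cover:
 assumes "fin_supp v" "x \<in> rep_space_Om v"
 shows "\<exists>f\<in>Zt_V v. x \<in> orbit v f"
proof -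
 obtain zs g where zs: "g \<in> gauge_group v" "\<forall>z\<in>set zs. fst z <= snd z" "\<forall>i. seg_total zs i = v i" "x = gauge_act v g (seg_sum zs)"
  using representation_decomposes[OF assms] by blast
 define f where "f = count_list zs"
 have supp: "{z. f z ~= 0} = set zs"
  unfolding f_def by (simp add: count_list_0_iff)
 have "f \<in> Zt_inf" unfolding Zt_inf_def using zs(2) supp unfolding Z_inf_def by (auto simp: case_prod_unfold)
 moreover have "seg_dim f i = v i" for i
  using seg_total_eq_seg_dim[of zs f i] zs(3) unfolding f_def by simp
 ultimately have f: "f \<in> Zt_V v" unfolding Zt_V_def by simp
 moreover have "x \<in> orbit v f" unfolding zs(4) by (rule orbitI[OF _ f zs(1)]) (simp add: f_def)
 ultimately show ?thesis by blast
qed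

lemma finite_Zt_V:
 assumes fin: "fin_supp v"
 shows "finite (Zt_V v)"
proof -
 define Z0 where "Z0 = {i. v i ~= 0} \<times> {i. v i ~= 0}"
 define B where "B = (\<Sum>i | v i ~= 0. v i)"
 have le: "f z <= v (fst z)" "f z <= v (snd z)" if f: "f \<in> Zt_V v" for f z
 proof -
  have f': "f \<in> Zt_inf" "!!i. seg_dim f i = v i" using f unfolding Zt_V_def by auto
  have finf: "finite {z. f z ~= 0}" and sub: "{z. f z ~= 0} \<subseteq> Z_inf" using f'(1) unfolding Zt_inf_def by auto
  have "f z <= seg_dim f i" if "fst z <= i" "i <= snd z" for i
  proof (cases "f z = 0")
   case False
   have "finite {z. f z ~= 0 & fst z <= i & i <= snd z}" using finf by (rule rev_finite_subset) auto
   then show ?thesis unfolding seg_dim_def using that False by (intro member_le_sum) auto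
  qed simp
  note * = this
  have "f z = 0 \<or> fst z <= snd z" using sub unfolding Z_inf_def by (cases z) auto
  then show "f z <= v (fst z)" "f z <= v (snd z)" using *[of "fst z"] *[of "snd z"] f'(2) by auto
 qed
 have out: "f z = 0" if f: "f \<in> Zt_V v" and "z \<notin> Z0" for f z
  using le[OF f, of z] that(2) unfolding Z0_def by (cases z) auto
 have "inj_on (%f. restrict f Z0) (Zt_V v)"
 proof (rule inj_onI, rule ext)
  fix f g z assume fg: "f \<in> Zt_V v" "g \<in> Zt_V v" "restrict f Z0 = restrict g Z0"
  show "f z = g z"
  proof (cases "z \<in> Z0")
   case True
   then show ?thesis using fun_cong[OF fg(3), of z] by simp
  next
   case False
   then show ?thesis using out[OF fg(1), of z] out[OF fg(2), of z] by simp
  qed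
 qed
 moreover have "(%f. restrict f Z0) ` Zt_V v \<subseteq> PiE Z0 (%_. {..B})"
 proof (intro image_subsetI restrict_PiE_iff[THEN iffD2] ballI)
  fix f z assume f: "f \<in> Zt_V v" and z: "z \<in> Z0"
  have "v (fst z) <= B" unfolding B_def using z fin unfolding Z0_def by (intro member_le_sum) auto
  then show "f z \<in> {..B}" using le(1)[OF f, of z] by simp
 qed
 moreover have "finite (PiE Z0 (%_. {..B}))" using fin unfolding Z0_def by (intro finite_PiE) auto
 ultimately show ?thesis using finite_imageD finite_subset by blast
qed

section \<open>Ranks along paths\<close>

lemma path_entry_seg_sum:
 assumes tot: "!!i. seg_total zs i = v i"
  and q: "q \<in> seg_active zs (k - int n)" and p: "p \<in> seg_active zs k"
 shows "path_entry v (seg_sum zs) k n (seg_pos zs (k - int n) q) (seg_pos zs k p) = (if q = p then 1 else 0)"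
 using q
proof (induction n arbitrary: q)
 case 0
 then show ?case using seg_pos_inj[of q zs k p] p by simp
next
 case (Suc n)
 let ?i = "k - int n"
 have e: "k - int (Suc n) = ?i - 1" by simp
 have q: "q \<in> seg_active zs (?i - 1)" using Suc.prems by (simp only: e)
 have "path_entry v (seg_sum zs) k (Suc n) (seg_pos zs (?i - 1) q) (seg_pos zs k p)
   = (\<Sum>c<v ?i. seg_sum zs (Om ?i) $$ (seg_pos zs (?i - 1) q, c) * path_entry v (seg_sum zs) k n c (seg_pos zs k p))"
  by simp
 also have "... = (\<Sum>p'\<in>seg_active zs ?i. seg_sum zs (Om ?i) $$ (seg_pos zs (?i - 1) q, seg_pos zs ?i p')
   * path_entry v (seg_sum zs) k n (seg_pos zs ?i p') (seg_pos zs k p))"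
  unfolding tot[symmetric] by (rule sum.reindex_bij_betw[OF seg_pos_bij, symmetric])
 also have "... = (\<Sum>p'\<in>seg_active zs ?i. (if q = p' then 1 else 0) * (if p' = p then 1 else 0))"
 proof (intro sum_times_cong)
  fix p' assume p': "p' \<in> seg_active zs ?i"
  show "seg_sum zs (Om ?i) $$ (seg_pos zs (?i - 1) q, seg_pos zs ?i p') = (if q = p' then 1 else 0)"
   using seg_sum_entry[of q zs "Om ?i" p'] q p' by simp
  show "path_entry v (seg_sum zs) k n (seg_pos zs ?i p') (seg_pos zs k p) = (if p' = p then 1 else 0)"
   by (rule Suc.IH[OF p'])
 qed
 also have "... = (if q = p then 1 else 0)"
 proof (cases "q = p")
  case True
  have "p \<in> seg_active zs ?i" using q p True unfolding seg_active_def seg_on_eq_1 mem_Collect_eq by auto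
  moreover have "finite (seg_active zs ?i)" unfolding seg_active_def by simp
  ultimately show ?thesis using True sum_mult_delta(1)[of "seg_active zs ?i" p "%p'. if q = p' then 1 else 0"] by simp
 next
  case False
  then show ?thesis by (intro trans[OF sum.neutral]) auto
 qed
 finally show ?case by (simp only: e)
qed

definition seg_rank :: "(int \<times> int) list => int => int => nat" where
 "seg_rank zs i k = card {p. p < length zs & fst (zs ! p) <= i & k <= snd (zs ! p)}"

lemma seg_active_both:
 "seg_active zs (k - int n) \<inter> seg_active zs k = {p. p < length zs & fst (zs ! p) <= k - int n & k <= snd (zs ! p)}"
 unfolding seg_active_def seg_on_eq_1 by auto

text \<open>In degrees \<open>k - n\<close> and \<open>k\<close> exactly the segments covering both contribute to the composition, so its rank is
  their number.\<close>

lemma path_minor_bound: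
 assumes tot: "!!i. seg_total zs i = v i" and g: "g \<in> gauge_group v"
  and A: "!!i. i < r ==> A i < v (k - int n)" and B: "!!i. i < r ==> B i < v k"
  and nz: "det (mat r r (%(i, j). path_entry v (gauge_act v g (seg_sum zs)) k n (A i) (B j))) ~= 0"
 shows "r <= seg_rank zs (k - int n) k"
proof (rule ccontr)
 let ?z = "gauge_act v g (seg_sum zs)" and ?i = "k - int n"
 define S where "S = seg_active zs ?i \<inter> seg_active zs k"
 assume "\<not> ?thesis"
 then have less: "card S < r" unfolding seg_rank_def S_def seg_active_both by simp
 have finS: "finite S" unfolding S_def seg_active_def by simp
 have x: "seg_sum zs \<in> rep_space v" by (rule rep_space_OmD(1)[OF seg_sum_rep_space[of zs v, OF tot]])
 obtain e where e: "bij_betw e {..<card S} S"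
  using ex_bij_betw_nat_finite[OF finS] unfolding atLeast0LessThan by blast
 let ?h = "gauge_inv v g k"
 note hc = gauge_inv_group(1)[OF g] gauge_carrier[OF g]
 have M: "path_entry v (seg_sum zs) k n c d = (\<Sum>q\<in>S. (if c = seg_pos zs ?i q then 1 else 0) * (if d = seg_pos zs k q then 1 else 0))"
  if cd: "c < v ?i" "d < v k" for c d
 proof -
  obtain q where q: "q \<in> seg_active zs ?i" "c = seg_pos zs ?i q" using seg_pos_surj[of c zs ?i] cd tot by auto
  obtain p where p: "p \<in> seg_active zs k" "d = seg_pos zs k p" using seg_pos_surj[of d zs k] cd tot by auto
  have "(\<Sum>q'\<in>S. (if c = seg_pos zs ?i q' then 1 else 0) * (if d = seg_pos zs k q' then 1 else 0 :: complex))
    = (\<Sum>q'\<in>S. (if q = q' then 1 else 0) * (if p = q' then 1 else 0))"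
   using q p seg_pos_inj unfolding S_def by (intro sum.cong refl) auto
  also have "... = (if q = p then 1 else 0)"
  proof (cases "q = p")
   case True
   then have "p \<in> S" using q p unfolding S_def by simp
   from sum_mult_delta(2)[OF finS this, of "%q'. if q = q' then 1 else 0"] show ?thesis using True by simp
  next
   case False
   then show ?thesis by (intro trans[OF sum.neutral]) auto
  qed
  finally show ?thesis using path_entry_seg_sum[OF tot q(1) p(1)] q p by simp
 qed
 have entry: "path_entry v ?z k n a b = (\<Sum>l<card S. g ?i $$ (a, seg_pos zs ?i (e l)) * ?h $$ (seg_pos zs k (e l), b))"
  if ab: "a < v ?i" "b < v k" for a b
 proof -
  have "path_entry v ?z k n a b = (\<Sum>c<v k. path_entry v ?z k n a c * (if c = b then 1 else 0))"
   using ab by (intro sum_mult_delta(1)[symmetric]) auto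
  also have "... = (\<Sum>c<v k. path_entry v ?z k n a c * (\<Sum>d<v k. g k $$ (c, d) * ?h $$ (d, b)))"
  proof (rule sum_right_cong)
   fix c assume "c \<in> {..<v k}"
   then show "(if c = b then 1 else 0) = (\<Sum>d<v k. g k $$ (c, d) * ?h $$ (d, b))"
    using mat_mult_entry[OF hc(2,1), of c k b] gauge_inv_group(2)[OF g, of k] ab by simp
  qed
  also have "... = (\<Sum>d<v k. (\<Sum>c<v k. path_entry v ?z k n a c * g k $$ (c, d)) * ?h $$ (d, b))"
   by (rule sum_bilinear_swap)
  also have "... = (\<Sum>d<v k. (\<Sum>c<v ?i. g ?i $$ (a, c) * path_entry v (seg_sum zs) k n c d) * ?h $$ (d, b))"
   by (rule sum_left_cong) (use path_entry_gauge[OF g x ab(1)] in simp)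
  also have "... = (\<Sum>d<v k. (\<Sum>q\<in>S. g ?i $$ (a, seg_pos zs ?i q) * (if d = seg_pos zs k q then 1 else 0)) * ?h $$ (d, b))"
  proof (rule sum_left_cong)
   fix d assume d: "d \<in> {..<v k}"
   have "(\<Sum>c<v ?i. g ?i $$ (a, c) * path_entry v (seg_sum zs) k n c d)
     = (\<Sum>c<v ?i. g ?i $$ (a, c) * (\<Sum>q\<in>S. (if c = seg_pos zs ?i q then 1 else 0) * (if d = seg_pos zs k q then 1 else 0)))"
    by (rule sum_right_cong) (use M d in simp)
   also have "... = (\<Sum>q\<in>S. (\<Sum>c<v ?i. g ?i $$ (a, c) * (if c = seg_pos zs ?i q then 1 else 0)) * (if d = seg_pos zs k q then 1 else 0))"
    by (rule sum_bilinear_swap)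
   also have "... = (\<Sum>q\<in>S. g ?i $$ (a, seg_pos zs ?i q) * (if d = seg_pos zs k q then 1 else 0))"
   proof (rule sum_left_cong)
    fix q assume "q \<in> S"
    then have "seg_pos zs ?i q < v ?i" using seg_pos_less[of q zs ?i] tot unfolding S_def by simp
    then show "(\<Sum>c<v ?i. g ?i $$ (a, c) * (if c = seg_pos zs ?i q then 1 else 0)) = g ?i $$ (a, seg_pos zs ?i q)"
     by (intro sum_mult_delta(1)) auto
   qed
   finally show "(\<Sum>c<v ?i. g ?i $$ (a, c) * path_entry v (seg_sum zs) k n c d)
     = (\<Sum>q\<in>S. g ?i $$ (a, seg_pos zs ?i q) * (if d = seg_pos zs k q then 1 else 0))" .
  qed
  also have "... = (\<Sum>q\<in>S. g ?i $$ (a, seg_pos zs ?i q) * (\<Sum>d<v k. (if d = seg_pos zs k q then 1 else 0) * ?h $$ (d, b)))"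
   by (rule sum_bilinear_swap[symmetric])
  also have "... = (\<Sum>q\<in>S. g ?i $$ (a, seg_pos zs ?i q) * ?h $$ (seg_pos zs k q, b))"
  proof (rule sum_right_cong)
   fix q assume "q \<in> S"
   then have "seg_pos zs k q < v k" using seg_pos_less[of q zs k] tot unfolding S_def by simp
   then show "(\<Sum>d<v k. (if d = seg_pos zs k q then 1 else 0) * ?h $$ (d, b)) = ?h $$ (seg_pos zs k q, b)"
    by (intro sum_mult_delta(3)) auto
  qed
  also have "... = (\<Sum>l<card S. g ?i $$ (a, seg_pos zs ?i (e l)) * ?h $$ (seg_pos zs k (e l), b))"
   by (rule sum.reindex_bij_betw[OF e, symmetric])
  finally show ?thesis .
 qed
 have "mat r r (%(i, j). path_entry v ?z k n (A i) (B j))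
   = mat r r (%(i, j). \<Sum>l<card S. g ?i $$ (A i, seg_pos zs ?i (e l)) * ?h $$ (seg_pos zs k (e l), B j))"
  using entry A B by (intro cong_mat refl) simp
 then show False using nz det_low_rank[OF less] by simp
qed

lemma path_entry_om_part: "path_entry v (om_part v x) k n a b = path_entry v x k n a b"
 by (induction n arbitrary: a) (simp_all add: om_part_def)

lemma seg_sum_conormal:
 assumes fin: "fin_supp v" and f: "f \<in> Zt_V v" and zs: "!!z. count_list zs z = f z"
 shows "seg_sum zs \<in> conormal v f"
proof -
 have tot: "seg_total zs i = v i" for i using seg_total_eq_seg_dim[OF zs] f unfolding Zt_V_def by simp
 have sO: "seg_sum zs \<in> rep_space_Om v" by (rule seg_sum_rep_space[of zs v, OF tot])
 note sp = rep_space_OmD(1)[OF sO]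
 have "gauge_act v (%i. 1\<^sub>m (v i)) (seg_sum zs) \<in> orbit v f" by (rule orbitI[OF zs f gauge_one])
 then have "seg_sum zs \<in> orbit v f" by (simp only: gauge_act_one[OF sp])
 moreover have "om_part v (seg_sum zs) = seg_sum zs"
 proof
  fix h show "om_part v (seg_sum zs) h = seg_sum zs h"
   unfolding om_part_def using rep_space_OmD(2)[OF sO] by (cases h) auto
 qed
 moreover have "moment_zero v (seg_sum zs) i" for i
  unfolding moment_zero_iff[OF sp]
  using rep_space_OmD(2)[OF sO, of i] rep_space_OmD(2)[OF sO, of "i + 1"]
   rep_spaceD[OF sp, of "Om i"] rep_spaceD[OF sp, of "Om (i + 1)"] by simp
 ultimately show ?thesis unfolding conormal_iff[OF fin f] using sp by simp
qed

text \<open>Lower semicontinuity of the rank: a minor that does not vanish on one conormal variety cannot vanish on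
  another one whose closure contains it.\<close>

lemma seg_rank_mono_closure:
 assumes fin: "fin_supp v" and f: "f \<in> Zt_V v" and g: "g \<in> Zt_V v"
  and zf: "!!z. count_list zf z = f z" and zg: "!!z. count_list zg z = g z"
  and sub: "!!p. p \<in> rep_polys v ==> \<forall>x\<in>conormal v g. p x = 0 ==> \<forall>x\<in>conormal v f. p x = 0"
  and "i <= k"
 shows "seg_rank zf i k <= seg_rank zg i k"
proof -
 define n where "n = nat (k - i)"
 have i: "i = k - int n" unfolding n_def using \<open>i <= k\<close> by simp
 define S where "S = seg_active zf i \<inter> seg_active zf k"
 have finS: "finite S" unfolding S_def seg_active_def by simp
 have cardS: "card S = seg_rank zf i k" unfolding S_def seg_rank_def i seg_active_both ..
 obtain e where e: "bij_betw e {..<card S} S"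
  using ex_bij_betw_nat_finite[OF finS] unfolding atLeast0LessThan by blast
 have totf: "seg_total zf i = v i" for i using seg_total_eq_seg_dim[OF zf] f unfolding Zt_V_def by simp
 have totg: "seg_total zg i = v i" for i using seg_total_eq_seg_dim[OF zg] g unfolding Zt_V_def by simp
 have eS: "e l \<in> seg_active zf i" "e l \<in> seg_active zf k" if "l < card S" for l
  using bij_betwE[OF e] that unfolding S_def by auto
 define p where "p x = det (mat (card S) (card S) (%(a, b). path_entry v x k n (seg_pos zf i (e a)) (seg_pos zf k (e b))))" for x
 have A: "seg_pos zf i (e a) < v i" "seg_pos zf k (e a) < v k" if "a < card S" for a
  using seg_pos_less[OF eS(1)[OF that]] seg_pos_less[OF eS(2)[OF that]] totf by auto
 have p: "p \<in> rep_polys v"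
  unfolding p_def[abs_def]
  by (rule poly_funs_det[where n = "card S"]) (use path_entry_poly A i in auto)
 have "mat (card S) (card S) (%(a, b). path_entry v (seg_sum zf) k n (seg_pos zf i (e a)) (seg_pos zf k (e b))) = 1\<^sub>m (card S)"
 proof (rule eq_matI)
  fix a b assume "a < dim_row (1\<^sub>m (card S) :: complex mat)" "b < dim_col (1\<^sub>m (card S) :: complex mat)"
  then have ab: "a < card S" "b < card S" by auto
  have "e a = e b \<longleftrightarrow> a = b" using e ab by (auto simp: bij_betw_def inj_on_def)
  then show "mat (card S) (card S) (%(a, b). path_entry v (seg_sum zf) k n (seg_pos zf i (e a)) (seg_pos zf k (e b))) $$ (a, b) = 1\<^sub>m (card S) $$ (a, b)"
   using path_entry_seg_sum[of zf v "e a" k n "e b", OF totf] eS[OF ab(1)] eS[OF ab(2)] ab i by simp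
 qed auto
 then have "p (seg_sum zf) ~= 0" unfolding p_def by simp
 moreover have "seg_sum zf \<in> conormal v f" by (rule seg_sum_conormal[OF fin f zf])
 ultimately have "\<not> (\<forall>x\<in>conormal v g. p x = 0)" using sub[OF p] by blast
 then obtain y where y: "y \<in> conormal v g" "p y ~= 0" by blast
 then have "om_part v y \<in> orbit v g" unfolding conormal_iff[OF fin g] by blast
 then obtain h where h: "h \<in> gauge_group v" "om_part v y = gauge_act v h (seg_sum zg)"
  using orbit_eq[OF zg g] by blast
 have "card S <= seg_rank zg (k - int n) k"
 proof (rule path_minor_bound[OF totg h(1)])
  show "det (mat (card S) (card S) (%(a, b). path_entry v (gauge_act v h (seg_sum zg)) k n (seg_pos zf i (e a)) (seg_pos zf k (e b)))) ~= 0"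
   using y(2) unfolding p_def h(2)[symmetric] path_entry_om_part .
 qed (use A i in auto)
 then show ?thesis unfolding cardS i .
qed

lemma sum_count_list:
 assumes "!!z. count_list zs z = f z"
 shows "(\<Sum>z | f z ~= 0 & R z. f z) = card {p. p < length zs & R (zs ! p)}"
proof -
 have supp: "{z. f z ~= 0 & R z} = {z \<in> set zs. R z}"
  using count_list_0_iff[of zs] assms by auto
 have "(\<Sum>z | f z ~= 0 & R z. f z) = (\<Sum>z\<in>set zs. if R z then f z else 0)"
  unfolding supp by (rule sum.inter_filter) simp
 also have "... = (\<Sum>z\<in>set zs. count_list zs z * (if R z then 1 else 0))"
  by (intro sum.cong) (auto simp: assms)
 also have "... = sum_list (map (%z. if R z then 1 else 0) zs)" by (rule sum_list_map_eq_sum_count[symmetric])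
 also have "... = length (filter R zs)" by (induction zs) auto
 also have "... = card {p. p < length zs & R (zs ! p)}" by (rule length_filter_conv_card)
 finally show ?thesis .
qed

lemma tail_count_seg_rank:
 assumes "!!z. count_list zs z = f z"
 shows "seg_rank zs i k = seg_rank zs (i - 1) k + tail_count f i k"
proof -
 have "tail_count f i k = card {p. p < length zs & fst (zs ! p) = i & k <= snd (zs ! p)}"
  unfolding tail_count_def by (rule sum_count_list[OF assms])
 moreover have "{p. p < length zs & fst (zs ! p) <= i & k <= snd (zs ! p)} =
  {p. p < length zs & fst (zs ! p) <= i - 1 & k <= snd (zs ! p)} \<union> {p. p < length zs & fst (zs ! p) = i & k <= snd (zs ! p)}"
  by auto
 ultimately show ?thesis unfolding seg_rank_def by (simp add: card_Un_disjoint disjoint_iff)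
qed

text \<open>By symmetry of the inclusion the ranks of all paths agree, and these determine the multisegment.\<close>

lemma conormal_in_closure_eq:
 assumes fin: "fin_supp v" and f: "f \<in> Zt_V v" and g: "g \<in> Zt_V v"
  and sub: "!!p. p \<in> rep_polys v ==> \<forall>x\<in>conormal v g. p x = 0 ==> \<forall>x\<in>conormal v f. p x = 0"
 shows "f = g"
proof -
 have inf: "f \<in> Zt_inf" "g \<in> Zt_inf" using f g unfolding Zt_V_def by auto
 obtain zf where zf: "!!z. count_list zf z = f z" using Zt_list_exists[OF inf(1)] by blast
 obtain zg where zg: "!!z. count_list zg z = g z" using Zt_list_exists[OF inf(2)] by blast
 have sub': "\<forall>x\<in>conormal v g. p x = 0" if "p \<in> rep_polys v" "\<forall>x\<in>conormal v f. p x = 0" for p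
  using conormal_closure_symmetric[OF fin f g sub that] by blast
 have rank: "seg_rank zf i k = seg_rank zg i k" if "i <= k" for i k
  using seg_rank_mono_closure[OF fin f g zf zg sub that] seg_rank_mono_closure[OF fin g f zg zf sub' that]
  by (intro antisym) auto
 show ?thesis
 proof (rule Zt_inf_eqI[OF inf])
  fix i k :: int assume "i <= k"
  then show "tail_count f i k = tail_count g i k"
   using rank[of i k] rank[of "i - 1" k] tail_count_seg_rank[OF zf, of i k] tail_count_seg_rank[OF zg, of i k] by simp
 qed
qed

section \<open>Nilpotency\<close>

lemma mult_vec_zero_iff:
 assumes "A \<in> carrier_mat n m" "s \<in> carrier_vec m"
 shows "A *\<^sub>v s = 0\<^sub>v n \<longleftrightarrow> (\<forall>c<n. (\<Sum>b<m. A $$ (c, b) * s $ b) = 0)"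
proof -
 have e: "(A *\<^sub>v s) $ c = (\<Sum>b<m. A $$ (c, b) * s $ b)" if "c < n" for c
  using assms that by (auto simp: scalar_prod_def atLeast0LessThan intro!: sum.cong)
 show ?thesis
 proof
  assume "A *\<^sub>v s = 0\<^sub>v n"
  then show "\<forall>c<n. (\<Sum>b<m. A $$ (c, b) * s $ b) = 0" using e by (metis index_zero_vec(1))
 next
  assume *: "\<forall>c<n. (\<Sum>b<m. A $$ (c, b) * s $ b) = 0"
  show "A *\<^sub>v s = 0\<^sub>v n" by (rule eq_vecI) (use * e assms in auto)
 qed
qed

lemma mat_zeroI_vec:
 fixes A :: "complex mat"
 assumes A: "A \<in> carrier_mat n m" and "!!s. s \<in> carrier_vec m ==> A *\<^sub>v s = 0\<^sub>v n"
 shows "A = 0\<^sub>m n m"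
proof (rule eq_matI)
 fix c b assume "c < dim_row (0\<^sub>m n m :: complex mat)" "b < dim_col (0\<^sub>m n m :: complex mat)"
 then have cb: "c < n" "b < m" by auto
 have "(\<Sum>b'<m. A $$ (c, b') * unit_vec m b $ b') = 0"
  using assms(2)[of "unit_vec m b"] cb(1) unfolding mult_vec_zero_iff[OF A unit_vec_carrier] by auto
 moreover have "(\<Sum>b'<m. A $$ (c, b') * unit_vec m b $ b') = (\<Sum>b'<m. A $$ (c, b') * (if b' = b then 1 else 0))"
  using cb by (intro sum.cong refl) auto
 ultimately show "A $$ (c, b) = 0\<^sub>m n m $$ (c, b)" using sum_mult_delta(1)[of "{..<m}" b "%b'. A $$ (c, b')"] cb by simp
qed (use A in auto)

lemma carrier_vec_trivial: "s \<in> carrier_vec n ==> n = 0 ==> s = 0\<^sub>v n"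
 by (rule eq_vecI) auto

text \<open>The image in degree \<open>i\<close> of the composition of \<open>n\<close> arrows \<open>Om\<close>.\<close>

fun path_image :: "(int => nat) => rep => nat => int => complex vec set" where
 "path_image v x 0 i = carrier_vec (v i)"
| "path_image v x (Suc n) i = (%s. x (Om (i + 1)) *\<^sub>v s) ` path_image v x n (i + 1)"

lemma path_image_carrier:
 assumes "x \<in> rep_space v"
 shows "path_image v x n i \<subseteq> carrier_vec (v i)"
proof (induction n arbitrary: i)
 case (Suc n)
 show ?case using Suc[of "i + 1"] mult_mat_vec_carrier[OF rep_spaceD[OF assms, of "Om (i + 1)"]] by auto
qed simp

lemma path_image_step:
 assumes "s \<in> path_image v x n i"
 shows "x (Om i) *\<^sub>v s \<in> path_image v x (Suc n) (i - 1)"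
 using assms by simp

lemma moment_zero_vec:
 assumes x: "x \<in> rep_space v" and m: "moment_zero v x i" and s: "s \<in> carrier_vec (v i)"
 shows "x (Om (i + 1)) *\<^sub>v (x (OmBar (i + 1)) *\<^sub>v s) = x (OmBar i) *\<^sub>v (x (Om i) *\<^sub>v s)"
proof -
 have c: "x (Om (i + 1)) \<in> carrier_mat (v i) (v (i + 1))" "x (OmBar (i + 1)) \<in> carrier_mat (v (i + 1)) (v i)"
  "x (Om i) \<in> carrier_mat (v (i - 1)) (v i)" "x (OmBar i) \<in> carrier_mat (v i) (v (i - 1))"
  using rep_spaceD[OF x, of "Om (i + 1)"] rep_spaceD[OF x, of "OmBar (i + 1)"] rep_spaceD[OF x, of "Om i"]
   rep_spaceD[OF x, of "OmBar i"] by auto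
 show ?thesis
  using assoc_mult_mat_vec[OF c(1,2) s] assoc_mult_mat_vec[OF c(4,3) s] m
  unfolding moment_zero_iff[OF x] by simp
qed

text \<open>The vanishing of the moment map lets an opposite arrow be moved past the others.\<close>

lemma path_image_opposite:
 assumes x: "x \<in> rep_space v" and m: "!!i. moment_zero v x i"
  and "s \<in> path_image v x n i"
 shows "x (OmBar (i + 1)) *\<^sub>v s \<in> path_image v x n (i + 1)"
 using assms(3)
proof (induction n arbitrary: i s)
 case 0
 then show ?case using mult_mat_vec_carrier[OF rep_spaceD[OF x, of "OmBar (i + 1)"]] by simp
next
 case (Suc n)
 then obtain t where t: "t \<in> path_image v x n (i + 1)" "s = x (Om (i + 1)) *\<^sub>v t" by auto
 have "t \<in> carrier_vec (v (i + 1))" using t(1) path_image_carrier[OF x] by blast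
 from moment_zero_vec[OF x m this]
 have "x (OmBar (i + 1)) *\<^sub>v s = x (Om (i + 1 + 1)) *\<^sub>v (x (OmBar (i + 1 + 1)) *\<^sub>v t)" unfolding t(2) by simp
 then show ?case using Suc.IH[OF t(1)] by simp
qed

lemma path_image_trivial:
 assumes x: "x \<in> rep_space v" and "v (i + int n) = 0"
 shows "path_image v x n i \<subseteq> {0\<^sub>v (v i)}"
 using assms(2)
proof (induction n arbitrary: i)
 case 0
 then show ?case using carrier_vec_trivial[of _ "v i"] by auto
next
 case (Suc n)
 have "path_image v x n (i + 1) \<subseteq> {0\<^sub>v (v (i + 1))}" using Suc.prems by (intro Suc.IH) (simp add: algebra_simps)
 moreover have "x (Om (i + 1)) *\<^sub>v 0\<^sub>v (v (i + 1)) = 0\<^sub>v (v i)"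
  using rep_spaceD[OF x, of "Om (i + 1)"] by (intro eq_vecI) (auto simp: scalar_prod_def)
 ultimately show ?case by auto
qed

text \<open>The number \<open>n\<close> of \<open>Om\<close> arrows in a path is determined by its length and its end points. The images of
  compositions of \<open>n\<close> such arrows are stable under opposite arrows, so the path maps into them.\<close>

lemma path_comp_image:
 assumes x: "x \<in> rep_space v" and m: "!!i. moment_zero v x i"
  and "hs ~= []" "successively (%h h'. out_v h = in_v h') hs"
 shows "path_comp x hs \<in> carrier_mat (v (in_v (hd hs))) (v (out_v (last hs))) &
  (\<exists>n. 2 * int n = int (length hs) + out_v (last hs) - in_v (hd hs) &
   (\<forall>s \<in> carrier_vec (v (out_v (last hs))). path_comp x hs *\<^sub>v s \<in> path_image v x n (in_v (hd hs))))"
 using assms(3,4)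
proof (induction hs)
 case Nil
 then show ?case by simp
next
 case (Cons h hs)
 have step: "\<exists>k. 2 * int k = 2 * int n + 1 + out_v h - in_v h & (\<forall>s \<in> path_image v x n (out_v h). x h *\<^sub>v s \<in> path_image v x k (in_v h))" for n
 proof (cases h)
  case (Om i)
  then show ?thesis using path_image_step[of _ v x n i] by (intro exI[of _ "Suc n"]) auto
 next
  case (OmBar i)
  then show ?thesis using path_image_opposite[OF x m, of _ n "i - 1"] by (intro exI[of _ n]) auto
 qed
 show ?case
 proof (cases hs)
  case Nil
  then show ?thesis using rep_spaceD[OF x, of h] step[of 0] by auto
 next
  case (Cons h' hs')
  then have hs: "hs ~= []" "out_v h = in_v (hd hs)" "successively (%h h'. out_v h = in_v h') hs"
   using Cons.prems by auto
  have pc: "path_comp x (h # hs) = x h * path_comp x hs" using Cons by simp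
  from Cons.IH[OF hs(1,3)] obtain n where
   c: "path_comp x hs \<in> carrier_mat (v (in_v (hd hs))) (v (out_v (last hs)))"
   and n: "2 * int n = int (length hs) + out_v (last hs) - in_v (hd hs)"
    "!!s. s \<in> carrier_vec (v (out_v (last hs))) ==> path_comp x hs *\<^sub>v s \<in> path_image v x n (in_v (hd hs))"
   by blast
  obtain k where k: "2 * int k = 2 * int n + 1 + out_v h - in_v h"
   "!!s. s \<in> path_image v x n (out_v h) ==> x h *\<^sub>v s \<in> path_image v x k (in_v h)" using step[of n] by blast
  have xh: "x h \<in> carrier_mat (v (in_v h)) (v (in_v (hd hs)))" using rep_spaceD[OF x, of h] hs(2) by simp
  have "x h * path_comp x hs *\<^sub>v s \<in> path_image v x k (in_v h)" if "s \<in> carrier_vec (v (out_v (last hs)))" for s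
   unfolding assoc_mult_mat_vec[OF xh c that] using k(2) n(2)[OF that] hs(2) by simp
  moreover have "x h * path_comp x hs \<in> carrier_mat (v (in_v h)) (v (out_v (last hs)))"
   by (rule mult_carrier_mat[OF xh c])
  ultimately show ?thesis unfolding pc using hs(1,2) k(1) n(1) by (auto intro!: exI[of _ k])
 qed
qed

text \<open>A long path between vertices of the support contains many \<open>Om\<close> arrows, more than the width of the support,
  and the composition of so many vanishes.\<close>

lemma nilpotent_of_moment_zero:
 assumes fin: "fin_supp v" and x: "x \<in> rep_space v" and m: "!!i. moment_zero v x i"
 shows "nilpotent_rep v x"
proof -
 have "finite ((%i. nat \<bar>i\<bar>) ` {i. v i ~= 0})" using fin by simp
 then obtain B where B: "!!i. v i ~= 0 ==> nat \<bar>i\<bar> <= B" unfolding finite_nat_set_iff_bounded_le by blast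
 show ?thesis
  \<comment> \<open>a path of length \<open>6 * B + 4\<close> between degrees of size at most \<open>B\<close> has more than \<open>2 * B\<close> arrows \<open>Om\<close>\<close>
 unfolding nilpotent_rep_def
 proof (intro exI[of _ "6 * B + 4"] conjI allI impI)
  fix hs :: "arrow list"
  assume len: "length hs = 6 * B + 4" and succ: "successively (%h h'. out_v h = in_v h') hs"
  then have "hs ~= []" by auto
  from path_comp_image[OF x m this succ] obtain n where
   c: "path_comp x hs \<in> carrier_mat (v (in_v (hd hs))) (v (out_v (last hs)))"
   and n: "2 * int n = int (length hs) + out_v (last hs) - in_v (hd hs)"
    "!!s. s \<in> carrier_vec (v (out_v (last hs))) ==> path_comp x hs *\<^sub>v s \<in> path_image v x n (in_v (hd hs))"
   by blast
  show "path_comp x hs = 0\<^sub>m (v (in_v (hd hs))) (v (out_v (last hs)))"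
  proof (cases "v (in_v (hd hs)) = 0 \<or> v (out_v (last hs)) = 0")
   case True
   then show ?thesis using c by (intro eq_matI) auto
  next
   case False
   then have "nat \<bar>in_v (hd hs)\<bar> <= B" "nat \<bar>out_v (last hs)\<bar> <= B" using B by auto
   then have "in_v (hd hs) + int n > int B" using n(1) len by linarith
   then have "v (in_v (hd hs) + int n) = 0" using B[of "in_v (hd hs) + int n"] by linarith
   from path_image_trivial[OF x this] n(2) show ?thesis by (intro mat_zeroI_vec[OF c]) auto
  qed
 qed simp
qed

lemma Lambda_V_iff:
 assumes "fin_supp v"
 shows "x \<in> Lambda_V v \<longleftrightarrow> x \<in> rep_space v & (\<forall>i. moment_zero v x i)"
 unfolding Lambda_V_def using nilpotent_of_moment_zero[OF assms] by blast

lemma conormal_Lambda: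
 assumes "fin_supp v" "f \<in> Zt_V v"
 shows "conormal v f \<subseteq> Lambda_V v"
 using conormal_iff[OF assms] Lambda_V_iff[OF assms(1)] by blast

lemma Lambda_V_cover:
 assumes fin: "fin_supp v" and x: "x \<in> Lambda_V v"
 shows "\<exists>f\<in>Zt_V v. x \<in> conormal v f"
proof -
 have x': "x \<in> rep_space v" "\<forall>i. moment_zero v x i" using x unfolding Lambda_V_iff[OF fin] by auto
 obtain f where f: "f \<in> Zt_V v" "om_part v x \<in> orbit v f" using orbits_cover[OF fin om_part_space[OF x'(1)]] by blast
 then show ?thesis using x' conormal_iff[OF fin f(1)] by blast
qed

section \<open>Stability\<close>

definition jointly_injective :: "(int => nat) => (int => nat) => framed => bool" where
 "jointly_injective v w = (%(x, j). \<forall>i. \<forall>s \<in> carrier_vec (v i). x (Om i) *\<^sub>v s = 0\<^sub>v (v (i - 1)) -->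
   x (OmBar (i + 1)) *\<^sub>v s = 0\<^sub>v (v (i + 1)) --> j i *\<^sub>v s = 0\<^sub>v (w i) --> s = 0\<^sub>v (v i))"

lemma subspace_iff:
 "subspace class_ring W (module_vec TYPE(complex) n) \<longleftrightarrow>
  W \<subseteq> carrier_vec n & 0\<^sub>v n \<in> W & (\<forall>s\<in>W. \<forall>t\<in>W. s + t \<in> W) & (\<forall>c. \<forall>s\<in>W. c \<cdot>\<^sub>v s \<in> W)"
 using vec_vs[where 'a = complex, of n] vec_module[where 'a = complex, of n]
 unfolding subspace_def submodule_def module_vec_simps
 by (auto simp: class_ring_simps)

lemma line_subspace:
 assumes "s0 \<in> carrier_vec n"
 shows "subspace class_ring (range (%c. c \<cdot>\<^sub>v s0)) (module_vec TYPE(complex) n)"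
 unfolding subspace_iff
proof (intro conjI ballI allI)
 show "range (%c. c \<cdot>\<^sub>v s0) \<subseteq> carrier_vec n" using assms by auto
 show "0\<^sub>v n \<in> range (%c. c \<cdot>\<^sub>v s0)" using assms by (intro image_eqI[of _ _ 0]) auto
 show "s + t \<in> range (%c. c \<cdot>\<^sub>v s0)" if "s \<in> range (%c. c \<cdot>\<^sub>v s0)" "t \<in> range (%c. c \<cdot>\<^sub>v s0)" for s t
 proof -
  obtain c d where "s = c \<cdot>\<^sub>v s0" "t = d \<cdot>\<^sub>v s0" using \<open>s \<in> _\<close> \<open>t \<in> _\<close> by blast
  then have "s + t = (c + d) \<cdot>\<^sub>v s0" by (simp add: add_smult_distrib_vec)
  then show ?thesis by blast
 qed
 show "c \<cdot>\<^sub>v s \<in> range (%c. c \<cdot>\<^sub>v s0)" if "s \<in> range (%c. c \<cdot>\<^sub>v s0)" for c s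
 proof -
  obtain d where "s = d \<cdot>\<^sub>v s0" using \<open>s \<in> _\<close> by blast
  then have "c \<cdot>\<^sub>v s = (c * d) \<cdot>\<^sub>v s0" by (simp add: smult_smult_assoc)
  then show ?thesis by blast
 qed
qed

lemma mult_vec_smult_zero:
 fixes A :: "complex mat"
 assumes "A \<in> carrier_mat n m" "s \<in> carrier_vec m" "A *\<^sub>v s = 0\<^sub>v n"
 shows "A *\<^sub>v (c \<cdot>\<^sub>v s) = 0\<^sub>v n"
 using mult_mat_vec[OF assms(1,2), of c] assms(3) by auto

text \<open>A common kernel vector spans a destabilising line in a single degree.\<close>

lemma stable_jointly_injective:
 assumes x: "x \<in> rep_space v" and j: "j \<in> hom_space v w" and stable: "stable v w (x, j)"
 shows "jointly_injective v w (x, j)"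
 unfolding jointly_injective_def prod.case
proof (intro allI ballI impI)
 fix i0 s0 assume s0: "s0 \<in> carrier_vec (v i0)" "x (Om i0) *\<^sub>v s0 = 0\<^sub>v (v (i0 - 1))"
  "x (OmBar (i0 + 1)) *\<^sub>v s0 = 0\<^sub>v (v (i0 + 1))" "j i0 *\<^sub>v s0 = 0\<^sub>v (w i0)"
 define s where "s i = (if i = i0 then s0 else 0\<^sub>v (v i))" for i
 define S where "S i = range (%c. c \<cdot>\<^sub>v s i)" for i
 have s: "s i \<in> carrier_vec (v i)" for i unfolding s_def using s0(1) by simp
 have xs: "x h *\<^sub>v s (out_v h) = 0\<^sub>v (v (in_v h))" for h
 proof (cases "out_v h = i0")
  case True
  then show ?thesis using s0(2,3) unfolding s_def by (cases h) auto
 next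
  case False
  then show ?thesis unfolding s_def using rep_spaceD[OF x, of h] by (intro eq_vecI) (auto simp: scalar_prod_def)
 qed
 have js: "j i *\<^sub>v s i = 0\<^sub>v (w i)" for i
  using s0(4) hom_spaceD[OF j, of i] unfolding s_def by (auto intro!: eq_vecI simp: scalar_prod_def)
 have zero: "0\<^sub>v (v i) \<in> S i" for i unfolding S_def using s[of i] by (intro image_eqI[of _ _ 0]) auto
 have "\<forall>i. subspace class_ring (S i) (module_vec TYPE(complex) (v i))"
  unfolding S_def using line_subspace[OF s] by blast
 moreover have "\<forall>h. \<forall>t \<in> S (out_v h). x h *\<^sub>v t \<in> S (in_v h)"
  using mult_vec_smult_zero[OF rep_spaceD[OF x] s xs] zero unfolding S_def by force
 moreover have "\<forall>i. \<forall>t \<in> S i. j i *\<^sub>v t = 0\<^sub>v (w i)"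
  using mult_vec_smult_zero[OF hom_spaceD[OF j] s js] unfolding S_def by blast
 ultimately have "S i0 = {0\<^sub>v (v i0)}" using stable unfolding stable_def by blast
 moreover have "s0 \<in> S i0" unfolding S_def s_def by (rule image_eqI[of _ _ 1]) auto
 ultimately show "s0 = 0\<^sub>v (v i0)" by simp
qed

text \<open>In a destabilising family, vectors killed by \<open>Om\<close> are shown to vanish from the highest degree downwards: the
  opposite arrow sends such a vector to one of the same kind. Then all vectors vanish from the lowest degree
  upwards, because \<open>Om\<close> sends them to the zero space.\<close>

lemma jointly_injective_stable:
 assumes fin: "fin_supp v" and x: "x \<in> rep_space v" and m: "!!i. moment_zero v x i"
  and inj: "jointly_injective v w (x, j)"
 shows "stable v w (x, j)"
 unfolding stable_def prod.case
proof (intro allI impI)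
 fix S :: "int => complex vec set" and i
 assume "\<forall>i. subspace class_ring (S i) (module_vec TYPE(complex) (v i))"
  and inv: "\<forall>h. \<forall>s \<in> S (out_v h). x h *\<^sub>v s \<in> S (in_v h)" and j: "\<forall>i. \<forall>s \<in> S i. j i *\<^sub>v s = 0\<^sub>v (w i)"
 then have S: "S i \<subseteq> carrier_vec (v i)" "0\<^sub>v (v i) \<in> S i" for i unfolding subspace_iff by auto
 have "finite ((%i. nat \<bar>i\<bar>) ` {i. v i ~= 0})" using fin by simp
 then obtain B where B: "!!i. v i ~= 0 ==> nat \<bar>i\<bar> <= B" unfolding finite_nat_set_iff_bounded_le by blast
 have outside: "s = 0\<^sub>v (v i)" if "s \<in> S i" "\<bar>i\<bar> > int B" for s i
 proof -
  have "v i = 0" using B[of i] that(2) by linarith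
  then show ?thesis using S(1)[of i] that(1) by (intro carrier_vec_trivial) auto
 qed
 have zero: "x h *\<^sub>v 0\<^sub>v (v (out_v h)) = 0\<^sub>v (v (in_v h))" for h
  using rep_spaceD[OF x, of h] by (intro eq_vecI) (auto simp: scalar_prod_def)
 have kernel: "s = 0\<^sub>v (v i)" if "s \<in> S i" "x (Om i) *\<^sub>v s = 0\<^sub>v (v (i - 1))" "i + int n > int B" for n i s
  using that
 proof (induction n arbitrary: i s)
  case 0
  then show ?case using outside by simp
 next
  case (Suc n)
  let ?t = "x (OmBar (i + 1)) *\<^sub>v s"
  have s: "s \<in> carrier_vec (v i)" using S(1) Suc.prems(1) by blast
  have "?t \<in> S (i + 1)" using inv[rule_format, of s "OmBar (i + 1)"] Suc.prems(1) by simp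
  moreover have "x (Om (i + 1)) *\<^sub>v ?t = 0\<^sub>v (v (i + 1 - 1))"
   using moment_zero_vec[OF x m s] Suc.prems(2) zero[of "OmBar i"] by simp
  ultimately have "?t = 0\<^sub>v (v (i + 1))" using Suc.IH[of ?t "i + 1"] Suc.prems(3) by simp
  then show ?case using inj Suc.prems(1,2) s j unfolding jointly_injective_def by blast
 qed
 have "s = 0\<^sub>v (v i)" if "s \<in> S i" "i < int n - int B" for n i s
  using that
 proof (induction n arbitrary: i s)
  case 0
  then show ?case using outside by simp
 next
  case (Suc n)
  have "x (Om i) *\<^sub>v s \<in> S (i - 1)" using inv[rule_format, of s "Om i"] Suc.prems(1) by simp
  then have "x (Om i) *\<^sub>v s = 0\<^sub>v (v (i - 1))" using Suc.IH[of _ "i - 1"] Suc.prems(2) by simp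
  then show ?case using kernel[OF Suc.prems(1), of "nat (int B + 1 - i)"] by simp
 qed
 from this[of _ i "nat (i + int B + 1)"] have "s = 0\<^sub>v (v i)" if "s \<in> S i" for s using that by simp
 then show "S i = {0\<^sub>v (v i)}" using S(2)[of i] by blast
qed

lemma Lambda_st_iff:
 assumes "fin_supp v"
 shows "(x, j) \<in> Lambda_st v w \<longleftrightarrow> x \<in> Lambda_V v & j \<in> hom_space v w & jointly_injective v w (x, j)"
 unfolding Lambda_st_def
 using stable_jointly_injective[of x v j w] jointly_injective_stable[OF assms, of x w j] Lambda_V_iff[OF assms, of x] by auto

lemma Lambda_st_subset: "Lambda_st v w \<subseteq> rep_space v \<times> hom_space v w"
 unfolding Lambda_st_def Lambda_V_def by auto

text \<open>The matrix \<open>A\<^sub>p\<^sup>* A\<^sub>q\<close>, where \<open>A\<^sub>p\<close> stacks the three maps out of \<open>V\<^sub>i\<close>. For fixed \<open>p\<close> it is polynomial in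
  \<open>q\<close>, and at \<open>q = p\<close> it is invertible exactly when the stacked map is injective.\<close>

definition gram :: "(int => nat) => (int => nat) => framed => framed => int => complex mat" where
 "gram v w p q i = mat (v i) (v i) (%(a, b).
   (\<Sum>c<v (i - 1). cnj (fst p (Om i) $$ (c, a)) * fst q (Om i) $$ (c, b)) +
   (\<Sum>c<v (i + 1). cnj (fst p (OmBar (i + 1)) $$ (c, a)) * fst q (OmBar (i + 1)) $$ (c, b)) +
   (\<Sum>c<w i. cnj (snd p i $$ (c, a)) * snd q i $$ (c, b)))"

lemma gram_block:
 fixes A B :: "complex mat" and t :: "nat => complex"
 shows "(\<Sum>b<m. (\<Sum>c<n. cnj (A $$ (c, a)) * B $$ (c, b)) * t b) = (\<Sum>c<n. cnj (A $$ (c, a)) * (\<Sum>b<m. B $$ (c, b) * t b))"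
 by (rule sum_bilinear_swap[symmetric])

lemma gram_square:
 fixes A :: "complex mat" and t :: "nat => complex"
 shows "(\<Sum>a<m. cnj (t a) * (\<Sum>c<n. cnj (A $$ (c, a)) * (\<Sum>b<m. A $$ (c, b) * t b)))
  = of_real (\<Sum>c<n. (cmod (\<Sum>b<m. A $$ (c, b) * t b))\<^sup>2)"
proof -
 have "(\<Sum>a<m. cnj (t a) * (\<Sum>c<n. cnj (A $$ (c, a)) * (\<Sum>b<m. A $$ (c, b) * t b)))
   = (\<Sum>c<n. (\<Sum>a<m. cnj (t a) * cnj (A $$ (c, a))) * (\<Sum>b<m. A $$ (c, b) * t b))"
  by (rule sum_bilinear_swap)
 also have "... = (\<Sum>c<n. cnj (\<Sum>b<m. A $$ (c, b) * t b) * (\<Sum>b<m. A $$ (c, b) * t b))"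
  by (simp add: mult.commute)
 also have "... = of_real (\<Sum>c<n. (cmod (\<Sum>b<m. A $$ (c, b) * t b))\<^sup>2)"
  unfolding of_real_sum by (intro sum.cong refl) (simp only: complex_norm_square mult.commute)
 finally show ?thesis .
qed

lemma gram_mult:
 assumes "t \<in> carrier_vec (v i)" "a < v i"
 shows "(gram v w p q i *\<^sub>v t) $ a =
   (\<Sum>c<v (i - 1). cnj (fst p (Om i) $$ (c, a)) * (\<Sum>b<v i. fst q (Om i) $$ (c, b) * t $ b)) +
   (\<Sum>c<v (i + 1). cnj (fst p (OmBar (i + 1)) $$ (c, a)) * (\<Sum>b<v i. fst q (OmBar (i + 1)) $$ (c, b) * t $ b)) +
   (\<Sum>c<w i. cnj (snd p i $$ (c, a)) * (\<Sum>b<v i. snd q i $$ (c, b) * t $ b))"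
proof -
 have "(gram v w p q i *\<^sub>v t) $ a = (\<Sum>b<v i. gram v w p q i $$ (a, b) * t $ b)"
  using assms by (auto simp: gram_def scalar_prod_def atLeast0LessThan intro!: sum.cong)
 also have "... = (\<Sum>b<v i. ((\<Sum>c<v (i - 1). cnj (fst p (Om i) $$ (c, a)) * fst q (Om i) $$ (c, b)) +
   (\<Sum>c<v (i + 1). cnj (fst p (OmBar (i + 1)) $$ (c, a)) * fst q (OmBar (i + 1)) $$ (c, b)) +
   (\<Sum>c<w i. cnj (snd p i $$ (c, a)) * snd q i $$ (c, b))) * t $ b)"
  using assms(2) by (intro sum.cong refl) (simp add: gram_def)
 finally show ?thesis unfolding distrib_right sum.distrib gram_block .
qed

lemma jointly_injective_gram:
 assumes p: "p \<in> rep_space v \<times> hom_space v w" and inj: "jointly_injective v w p"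
 shows "det (gram v w p p i) ~= 0"
proof
 obtain x j where pj: "p = (x, j)" by (cases p)
 have x: "x \<in> rep_space v" and j: "j \<in> hom_space v w" using p pj by auto
 have c: "x (Om i) \<in> carrier_mat (v (i - 1)) (v i)" "x (OmBar (i + 1)) \<in> carrier_mat (v (i + 1)) (v i)"
  "j i \<in> carrier_mat (w i) (v i)"
  using rep_spaceD[OF x, of "Om i"] rep_spaceD[OF x, of "OmBar (i + 1)"] hom_spaceD[OF j, of i] by auto
 assume "det (gram v w p p i) = 0"
 moreover have "gram v w p p i \<in> carrier_mat (v i) (v i)" by (simp add: gram_def)
 ultimately obtain s where s: "s \<in> carrier_vec (v i)" "s ~= 0\<^sub>v (v i)" "gram v w p p i *\<^sub>v s = 0\<^sub>v (v i)"
  using det_0_iff_vec_prod_zero by blast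
 let ?q = "%n A. \<Sum>c<n. (cmod (\<Sum>b<v i. A $$ (c, b) * s $ b))\<^sup>2"
 let ?e = "%n A a. cnj (s $ a) * (\<Sum>c<n. cnj (A $$ (c, a)) * (\<Sum>b<v i. A $$ (c, b) * s $ b))"
 have e: "cnj (s $ a) * (gram v w p p i *\<^sub>v s) $ a
   = ?e (v (i - 1)) (x (Om i)) a + ?e (v (i + 1)) (x (OmBar (i + 1))) a + ?e (w i) (j i) a" if "a < v i" for a
  using gram_mult[where v = v and i = i, OF s(1) that, of w p p] by (simp only: distrib_left pj fst_conv snd_conv)
 have "0 = (\<Sum>a<v i. cnj (s $ a) * (gram v w p p i *\<^sub>v s) $ a)" using s(3) by simp
 also have "... = (\<Sum>a<v i. ?e (v (i - 1)) (x (Om i)) a + ?e (v (i + 1)) (x (OmBar (i + 1))) a + ?e (w i) (j i) a)"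
  by (intro sum.cong refl e) simp
 also have "... = of_real (?q (v (i - 1)) (x (Om i))) + of_real (?q (v (i + 1)) (x (OmBar (i + 1)))) + of_real (?q (w i) (j i))"
  unfolding sum.distrib gram_square ..
 finally have "complex_of_real (?q (v (i - 1)) (x (Om i)) + ?q (v (i + 1)) (x (OmBar (i + 1))) + ?q (w i) (j i)) = 0" unfolding of_real_add by (rule sym)
 then have "?q (v (i - 1)) (x (Om i)) + ?q (v (i + 1)) (x (OmBar (i + 1))) + ?q (w i) (j i) = 0" by (simp only: of_real_eq_0_iff)
 moreover have "0 <= ?q (v (i - 1)) (x (Om i))" "0 <= ?q (v (i + 1)) (x (OmBar (i + 1)))" "0 <= ?q (w i) (j i)"
  by (intro sum_nonneg zero_le_power2)+
 ultimately have "?q (v (i - 1)) (x (Om i)) = 0" "?q (v (i + 1)) (x (OmBar (i + 1))) = 0" "?q (w i) (j i) = 0"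
  by linarith+
 then have "x (Om i) *\<^sub>v s = 0\<^sub>v (v (i - 1))" "x (OmBar (i + 1)) *\<^sub>v s = 0\<^sub>v (v (i + 1))" "j i *\<^sub>v s = 0\<^sub>v (w i)"
  unfolding mult_vec_zero_iff[OF c(1) s(1)] mult_vec_zero_iff[OF c(2) s(1)] mult_vec_zero_iff[OF c(3) s(1)]
  by (simp_all add: sum_nonneg_eq_0_iff)
 then show False using inj s(1,2) unfolding jointly_injective_def pj by blast
qed

lemma gram_jointly_injective:
 assumes q: "q \<in> rep_space v \<times> hom_space v w" and nz: "!!i. v i ~= 0 ==> det (gram v w p q i) ~= 0"
 shows "jointly_injective v w q"
proof -
 obtain x j where qj: "q = (x, j)" by (cases q)
 have x: "x \<in> rep_space v" and j: "j \<in> hom_space v w" using q qj by auto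
 show ?thesis
  unfolding jointly_injective_def qj prod.case
 proof (intro allI ballI impI)
  fix i s assume s: "s \<in> carrier_vec (v i)" and ker: "x (Om i) *\<^sub>v s = 0\<^sub>v (v (i - 1))"
   "x (OmBar (i + 1)) *\<^sub>v s = 0\<^sub>v (v (i + 1))" "j i *\<^sub>v s = 0\<^sub>v (w i)"
  have c: "x (Om i) \<in> carrier_mat (v (i - 1)) (v i)" "x (OmBar (i + 1)) \<in> carrier_mat (v (i + 1)) (v i)"
   "j i \<in> carrier_mat (w i) (v i)"
   using rep_spaceD[OF x, of "Om i"] rep_spaceD[OF x, of "OmBar (i + 1)"] hom_spaceD[OF j, of i] by auto
  have "gram v w p q i *\<^sub>v s = 0\<^sub>v (v i)"
  proof (rule eq_vecI)
   fix a assume "a < dim_vec (0\<^sub>v (v i) :: complex vec)"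
   then show "(gram v w p q i *\<^sub>v s) $ a = 0\<^sub>v (v i) $ a"
    using gram_mult[where v = v and i = i, OF s, of a w p q] ker
    unfolding mult_vec_zero_iff[OF c(1) s] mult_vec_zero_iff[OF c(2) s] mult_vec_zero_iff[OF c(3) s] qj by simp
  qed (simp add: gram_def)
  moreover have "gram v w p q i \<in> carrier_mat (v i) (v i)" by (simp add: gram_def)
  ultimately show "s = 0\<^sub>v (v i)"
  proof (cases "v i = 0")
   case True
   then show ?thesis by (rule carrier_vec_trivial[OF s])
  next
   case False
   from nz[OF this] show ?thesis
    using \<open>gram v w p q i *\<^sub>v s = 0\<^sub>v (v i)\<close> \<open>gram v w p q i \<in> _\<close> s det_0_iff_vec_prod_zero by blast
  qed
 qed
qed

text \<open>The product of the determinants of the matrices \<open>gram v w p q i\<close> is the required function of \<open>q\<close>.\<close>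

lemma jointly_injective_open:
 assumes fin: "fin_supp v" and p: "p \<in> rep_space v \<times> hom_space v w" and inj: "jointly_injective v w p"
 obtains P where "P \<in> framed_polys v w" "P p ~= 0"
  "!!q. q \<in> rep_space v \<times> hom_space v w ==> P q ~= 0 ==> jointly_injective v w q"
proof -
 define P where "P q = (\<Prod>i | v i ~= 0. det (gram v w p q i))" for q
 have xc: "(%q. fst q h $$ (a, b)) \<in> framed_polys v w" if "a < v (in_v h)" "b < v (out_v h)" for h a b
  by (rule framed_coords_fst[OF poly_funs.coord[OF rep_coordsI[OF that]]])
 have jc: "(%q. snd q i $$ (a, b)) \<in> framed_polys v w" if "a < w i" "b < v i" for i a b
 proof (rule poly_funs.coord)
  have "(%(x :: rep, j :: int => complex mat). j i $$ (a, b)) \<in> framed_coords v w" unfolding framed_coords_def using that by blast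
  then show "(%q. snd q i $$ (a, b)) \<in> framed_coords v w" by (simp add: case_prod_unfold)
 qed
 have "P \<in> framed_polys v w"
  unfolding P_def[abs_def]
 proof (intro poly_funs_prod)
  fix i
  show "(%q. det (gram v w p q i)) \<in> framed_polys v w"
  proof (rule poly_funs_det[where n = "v i"])
   fix a b assume ab: "a < v i" "b < v i"
   have "(%q. (\<Sum>c<v (i - 1). cnj (fst p (Om i) $$ (c, a)) * fst q (Om i) $$ (c, b)) +
     (\<Sum>c<v (i + 1). cnj (fst p (OmBar (i + 1)) $$ (c, a)) * fst q (OmBar (i + 1)) $$ (c, b)) +
     (\<Sum>c<w i. cnj (snd p i $$ (c, a)) * snd q i $$ (c, b))) \<in> framed_polys v w"
    by (intro poly_funs.add poly_funs_sum poly_funs.mult poly_funs.const xc jc) (use ab in auto)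
   then show "(%q. gram v w p q i $$ (a, b)) \<in> framed_polys v w"
    using ab by (simp add: gram_def)
  qed (simp add: gram_def)
 qed
 moreover have "P p ~= 0" unfolding P_def using jointly_injective_gram[OF p inj] fin by simp
 moreover have "jointly_injective v w q" if "q \<in> rep_space v \<times> hom_space v w" "P q ~= 0" for q
 proof (rule gram_jointly_injective[OF that(1)])
  fix i assume "v i ~= 0"
  then show "det (gram v w p q i) ~= 0" using that(2) unfolding P_def prod_zero_iff[OF fin] by blast
 qed
 ultimately show ?thesis by (rule that)
qed

section \<open>Stable points on conormal varieties\<close>

lemma sum_delta_if:
 fixes g :: "'a => 'k::semiring_1"
 assumes "finite A"
 shows "(\<Sum>r\<in>A. (if q = r then 1 else 0) * g r) = (if q \<in> A then g q else 0)"
  and "(\<Sum>r\<in>A. g r * (if r = q then 1 else 0)) = (if q \<in> A then g q else 0)"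
 using sum_mult_delta(1,4)[OF assms, of q g] by (auto intro!: sum.neutral)

lemma finite_seg_active: "finite (seg_active zs i)"
 unfolding seg_active_def by simp

lemma seg_active_iff: "p \<in> seg_active zs i \<longleftrightarrow> p < length zs & fst (zs ! p) <= i & i <= snd (zs ! p)"
 unfolding seg_active_def seg_on_eq_1 by simp

lemma sum_seg_pos:
 assumes "seg_total zs i = n"
 shows "(\<Sum>c<n. F c) = (\<Sum>p\<in>seg_active zs i. F (seg_pos zs i p))"
 unfolding assms[symmetric] by (rule sum.reindex_bij_betw[OF seg_pos_bij, symmetric])

definition bar_entry :: "(int \<times> int) list => rep => int => nat => nat => complex" where
 "bar_entry zs x i q p = x (OmBar (i + 1)) $$ (seg_pos zs (i + 1) q, seg_pos zs i p)"

text \<open>In the basis of segments, the equation says that the entry of the opposite arrow between two segments is the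
  same in all degrees in which it can be read off, and zero if one of the segments blocks it.\<close>

lemma canonical_moment:
 assumes tot: "!!i. seg_total zs i = v i" and x: "x \<in> rep_space v" and om: "!!i. x (Om i) = seg_sum zs (Om i)"
 shows "moment_zero v x i \<longleftrightarrow> (\<forall>q\<in>seg_active zs i. \<forall>p\<in>seg_active zs i.
  (if q \<in> seg_active zs (i + 1) then bar_entry zs x i q p else 0) =
  (if p \<in> seg_active zs (i - 1) then bar_entry zs x (i - 1) q p else 0))"
proof -
 have c: "x (Om (i + 1)) \<in> carrier_mat (v i) (v (i + 1))" "x (OmBar (i + 1)) \<in> carrier_mat (v (i + 1)) (v i)"
  "x (Om i) \<in> carrier_mat (v (i - 1)) (v i)" "x (OmBar i) \<in> carrier_mat (v i) (v (i - 1))"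
  using rep_spaceD[OF x, of "Om (i + 1)"] rep_spaceD[OF x, of "OmBar (i + 1)"] rep_spaceD[OF x, of "Om i"]
   rep_spaceD[OF x, of "OmBar i"] by auto
 let ?L = "x (Om (i + 1)) * x (OmBar (i + 1))" and ?R = "x (OmBar i) * x (Om i)"
 have less: "seg_pos zs i q < v i" if "q \<in> seg_active zs i" for q i using seg_pos_less[OF that] tot by simp
 have L: "?L $$ (seg_pos zs i q, seg_pos zs i p) = (if q \<in> seg_active zs (i + 1) then bar_entry zs x i q p else 0)"
  if "q \<in> seg_active zs i" "p \<in> seg_active zs i" for q p
 proof -
  have "?L $$ (seg_pos zs i q, seg_pos zs i p)
    = (\<Sum>r\<in>seg_active zs (i + 1). x (Om (i + 1)) $$ (seg_pos zs i q, seg_pos zs (i + 1) r) * bar_entry zs x i r p)"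
   unfolding mat_mult_entry[OF c(1,2) less[OF that(1)] less[OF that(2)]] sum_seg_pos[OF tot] bar_entry_def ..
  also have "... = (\<Sum>r\<in>seg_active zs (i + 1). (if q = r then 1 else 0) * bar_entry zs x i r p)"
   by (rule sum_left_cong)
    (use om seg_sum_entry[of q zs "Om (i + 1)"] that in simp)
  finally show ?thesis unfolding sum_delta_if(1)[OF finite_seg_active] .
 qed
 have R: "?R $$ (seg_pos zs i q, seg_pos zs i p) = (if p \<in> seg_active zs (i - 1) then bar_entry zs x (i - 1) q p else 0)"
  if "q \<in> seg_active zs i" "p \<in> seg_active zs i" for q p
 proof -
  have "?R $$ (seg_pos zs i q, seg_pos zs i p)
    = (\<Sum>r\<in>seg_active zs (i - 1). bar_entry zs x (i - 1) q r * x (Om i) $$ (seg_pos zs (i - 1) r, seg_pos zs i p))"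
   unfolding mat_mult_entry[OF c(4,3) less[OF that(1)] less[OF that(2)]] sum_seg_pos[OF tot] bar_entry_def by simp
  also have "... = (\<Sum>r\<in>seg_active zs (i - 1). bar_entry zs x (i - 1) q r * (if r = p then 1 else 0))"
   by (rule sum_right_cong)
    (use om seg_sum_entry[of _ zs "Om i" p] that in simp)
  finally show ?thesis unfolding sum_delta_if(2)[OF finite_seg_active] .
 qed
 have "?L = ?R \<longleftrightarrow> (\<forall>q\<in>seg_active zs i. \<forall>p\<in>seg_active zs i.
   ?L $$ (seg_pos zs i q, seg_pos zs i p) = ?R $$ (seg_pos zs i q, seg_pos zs i p))"
 proof
  assume *: "\<forall>q\<in>seg_active zs i. \<forall>p\<in>seg_active zs i.
   ?L $$ (seg_pos zs i q, seg_pos zs i p) = ?R $$ (seg_pos zs i q, seg_pos zs i p)"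
  show "?L = ?R"
  proof (rule eq_matI)
   fix a b assume "a < dim_row ?R" "b < dim_col ?R"
   then have "a < seg_total zs i" "b < seg_total zs i" using c tot by auto
   then show "?L $$ (a, b) = ?R $$ (a, b)" using * seg_pos_surj[of a zs i] seg_pos_surj[of b zs i] by blast
  qed (use c in auto)
 qed simp
 then show ?thesis unfolding moment_zero_iff[OF x] using L R by (metis (no_types, lifting))
qed

text \<open>Consider the bottom vectors of the segments that start at \<open>i\<close> and reach \<open>k\<close>. The arrow \<open>Om\<close> kills them, and
  the moment map equation forces the opposite arrow to send them into the span of the segments that start at
  \<open>i + 1\<close> and reach \<open>k + 1\<close>. Injectivity bounds their number by the dimension of this span plus that of the
  framing.\<close>

lemma canonical_chainable:
 assumes f: "f \<in> Zt_V v" and zs: "!!z. count_list zs z = f z"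
  and x: "x \<in> rep_space v" and om: "!!i. x (Om i) = seg_sum zs (Om i)"
  and m: "!!i. moment_zero v x i"
  and j: "j \<in> hom_space v w" and inj: "jointly_injective v w (x, j)"
 shows "chainable w f"
 unfolding chainable_def
proof (intro allI impI, rule ccontr)
 fix i k :: int assume "i <= k" and less: "\<not> tail_count f i k <= w i + tail_count f (i + 1) (k + 1)"
 have tot: "seg_total zs i = v i" for i using seg_total_eq_seg_dim[OF zs] f unfolding Zt_V_def by simp
 define F where "F = {p. p < length zs & fst (zs ! p) = i & k <= snd (zs ! p)}"
 define F' where "F' = {p. p < length zs & fst (zs ! p) = i + 1 & k + 1 <= snd (zs ! p)}"
 have card: "card F = tail_count f i k" "card F' = tail_count f (i + 1) (k + 1)"
  unfolding F_def F'_def tail_count_def using sum_count_list[OF zs] by auto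
 have fin: "finite F" "finite F'" unfolding F_def F'_def by auto
 have Fact: "p \<in> seg_active zs i" if "p \<in> F" for p using that \<open>i <= k\<close> unfolding F_def seg_active_iff by simp
 have shift: "(if q \<in> seg_active zs (i + 1) then bar_entry zs x i q p else 0) =
  (if p \<in> seg_active zs (i - 1) then bar_entry zs x (i - 1) q p else 0)"
  if "q \<in> seg_active zs i" "p \<in> seg_active zs i" for q p i
  using m[of i] that unfolding canonical_moment[OF tot x om] by blast
 have short: "bar_entry zs x i q p = 0"
  if "q \<in> seg_active zs (i + 1)" "p \<in> seg_active zs i" "snd (zs ! q) <= snd (zs ! p)" "i + int n = snd (zs ! q)" for i n q p
  using that
 proof (induction n arbitrary: i)
  case 0
  then show ?case unfolding seg_active_iff by simp
 next
  case (Suc n)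
  have act: "q \<in> seg_active zs (i + 1)" "p \<in> seg_active zs (i + 1)"
   using Suc.prems unfolding seg_active_iff by auto
  have "(if q \<in> seg_active zs (i + 1 + 1) then bar_entry zs x (i + 1) q p else 0) = bar_entry zs x i q p"
   using shift[OF act] Suc.prems(2) by simp
  moreover have "bar_entry zs x (i + 1) q p = 0" if "q \<in> seg_active zs (i + 1 + 1)"
   using Suc.IH[OF that act(2) Suc.prems(3)] Suc.prems(4) by simp
  ultimately show ?case by (metis (full_types))
 qed
 have Yzero: "bar_entry zs x i q p = 0" if "p \<in> F" "q \<in> seg_active zs (i + 1)" "q \<notin> F'" for p q
 proof (cases "fst (zs ! q) <= i")
  case True
  then have "q \<in> seg_active zs i" using that(2) unfolding seg_active_iff by simp
  moreover have "p \<notin> seg_active zs (i - 1)" using that(1) unfolding F_def seg_active_iff by simp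
  ultimately show ?thesis using shift[OF _ Fact[OF that(1)], of q] that(2) by simp
 next
  case False
  then have q: "fst (zs ! q) = i + 1" "i + 1 <= snd (zs ! q)" "q < length zs" using that(2) unfolding seg_active_iff by auto
  then have "snd (zs ! q) <= k" using that(3) unfolding F'_def by auto
  then have "snd (zs ! q) <= snd (zs ! p)" using that(1) unfolding F_def by auto
  from short[OF that(2) Fact[OF that(1)] this, of "nat (snd (zs ! q) - i)"] q(2) show ?thesis by simp
 qed
 define A where "A r p = (case r of Inl q => bar_entry zs x i q p | Inr b => j i $$ (b, seg_pos zs i p))" for r p
 have "card (F' <+> {..<w i}) < card F" using less fin unfolding card_Plus[OF fin(2) finite_lessThan] card by simp
 from homogeneous_system_nontrivial[OF _ fin(1) this, of A] obtain c where
  c: "\<exists>p\<in>F. c p ~= 0" "\<forall>r\<in>F' <+> {..<w i}. (\<Sum>p\<in>F. A r p * c p) = 0"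
  using fin by auto
 define s where "s = vec (v i) (%a. \<Sum>p\<in>F. (if a = seg_pos zs i p then 1 else 0) * c p)"
 have s: "s \<in> carrier_vec (v i)" unfolding s_def by simp
 have apply_s: "(\<Sum>b<v i. B b * s $ b) = (\<Sum>p\<in>F. B (seg_pos zs i p) * c p)" for B :: "nat => complex"
 proof -
  have "(\<Sum>b<v i. B b * s $ b) = (\<Sum>b<v i. B b * (\<Sum>p\<in>F. (if b = seg_pos zs i p then 1 else 0) * c p))"
   by (intro sum.cong refl) (simp add: s_def)
  also have "... = (\<Sum>p\<in>F. (\<Sum>b<v i. B b * (if b = seg_pos zs i p then 1 else 0)) * c p)"
   by (rule sum_bilinear_swap)
  also have "... = (\<Sum>p\<in>F. B (seg_pos zs i p) * c p)"
  proof (rule sum_left_cong)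
   fix p assume "p \<in> F"
   then have "seg_pos zs i p < v i" using seg_pos_less[OF Fact] tot by simp
   then show "(\<Sum>b<v i. B b * (if b = seg_pos zs i p then 1 else 0)) = B (seg_pos zs i p)"
    by (intro sum_mult_delta(1)) auto
  qed
  finally show ?thesis .
 qed
 have X: "x (Om i) *\<^sub>v s = 0\<^sub>v (v (i - 1))"
 proof -
  have "(\<Sum>b<v i. x (Om i) $$ (a, b) * s $ b) = 0" if a: "a < v (i - 1)" for a
  proof -
   obtain r where r: "r \<in> seg_active zs (i - 1)" "a = seg_pos zs (i - 1) r" using seg_pos_surj[of a zs "i - 1"] a tot by auto
   have "x (Om i) $$ (a, seg_pos zs i p) = 0" if "p \<in> F" for p
   proof -
    have "r ~= p" using r(1) that unfolding F_def seg_active_iff by auto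
    then show ?thesis using seg_sum_entry[of r zs "Om i" p] r Fact[OF that] om by simp
   qed
   then show ?thesis unfolding apply_s by (intro sum.neutral) simp
  qed
  then show ?thesis using mult_vec_zero_iff[OF _ s, of "x (Om i)" "v (i - 1)"] rep_spaceD[OF x, of "Om i"] by simp
 qed
 have Y: "x (OmBar (i + 1)) *\<^sub>v s = 0\<^sub>v (v (i + 1))"
 proof -
  have "(\<Sum>b<v i. x (OmBar (i + 1)) $$ (a, b) * s $ b) = 0" if a: "a < v (i + 1)" for a
  proof -
   obtain q where q: "q \<in> seg_active zs (i + 1)" "a = seg_pos zs (i + 1) q" using seg_pos_surj[of a zs "i + 1"] a tot by auto
   have e: "x (OmBar (i + 1)) $$ (a, seg_pos zs i p) = bar_entry zs x i q p" for p unfolding bar_entry_def q(2) ..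
   show ?thesis
   proof (cases "q \<in> F'")
    case True
    then have "Inl q \<in> F' <+> {..<w i}" by (rule InlI)
    from bspec[OF c(2) this] show ?thesis unfolding apply_s e A_def by simp
   next
    case False
    then show ?thesis unfolding apply_s e using Yzero q(1) by (intro sum.neutral) simp
   qed
  qed
  then show ?thesis using mult_vec_zero_iff[OF _ s, of "x (OmBar (i + 1))" "v (i + 1)"] rep_spaceD[OF x, of "OmBar (i + 1)"] by simp
 qed
 have J: "j i *\<^sub>v s = 0\<^sub>v (w i)"
 proof -
  have "(\<Sum>b<v i. j i $$ (a, b) * s $ b) = 0" if "a < w i" for a
  proof -
   from that have "Inr a \<in> F' <+> {..<w i}" by (intro InrI) simp
   from bspec[OF c(2) this] show ?thesis unfolding apply_s A_def by simp
  qed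
  then show ?thesis using mult_vec_zero_iff[OF hom_spaceD[OF j] s] by simp
 qed
 have "s = 0\<^sub>v (v i)" using inj s X Y J unfolding jointly_injective_def by blast
 moreover obtain p where p: "p \<in> F" "c p ~= 0" using c(1) by blast
 moreover have "s $ seg_pos zs i p = c p"
 proof -
  have "s $ seg_pos zs i p = (\<Sum>p'\<in>F. (if p = p' then 1 else 0) * c p')"
   using seg_pos_less[OF Fact[OF p(1)]] tot seg_pos_inj[OF Fact[OF p(1)] Fact] unfolding s_def
   by (auto intro!: sum.cong)
  then show ?thesis using sum_mult_delta(4)[OF fin(1) p(1), of c] by simp
 qed
 ultimately show False using seg_pos_less[OF Fact[OF p(1)]] tot by simp
qed

lemma stable_conormal_chainable:
 assumes fin: "fin_supp v" and f: "f \<in> Zt_V v" and x: "x \<in> conormal v f"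
  and j: "j \<in> hom_space v w" and inj: "jointly_injective v w (x, j)"
 shows "chainable w f"
proof -
 have xs: "x \<in> rep_space v" and xo: "om_part v x \<in> orbit v f" and m: "!!i. moment_zero v x i"
  using x unfolding conormal_iff[OF fin f] by auto
 have "f \<in> Zt_inf" using f unfolding Zt_V_def by simp
 then obtain zs where zs: "!!z. count_list zs z = f z" using Zt_list_exists by blast
 have tot: "seg_total zs i = v i" for i using seg_total_eq_seg_dim[OF zs] f unfolding Zt_V_def by simp
 obtain g where g: "g \<in> gauge_group v" "om_part v x = gauge_act v g (seg_sum zs)"
  using xo unfolding orbit_eq[OF zs f] by blast
 note ginv = gauge_inv_group[OF g(1)]
 define x' where "x' = gauge_act v (gauge_inv v g) x"
 define j' where "j' i = j i * g i" for i
 have x': "x' \<in> rep_space v" unfolding x'_def by (rule gauge_act_rep_space[OF ginv(4) xs])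
 have xx': "x = gauge_act v g x'" unfolding x'_def using gauge_act_inverse_right[OF g(1) xs] by simp
 have "om_part v x' = seg_sum zs"
  unfolding x'_def om_part_gauge[OF ginv(4) xs] g(2)
  by (rule gauge_act_inverse[OF g(1) rep_space_OmD(1)[OF seg_sum_rep_space[OF tot]]])
 then have om: "x' (Om i) = seg_sum zs (Om i)" for i by (auto simp: om_part_def dest: fun_cong[where x = "Om i"])
 have m': "moment_zero v x' i" for i unfolding x'_def by (rule moment_zero_gauge_act[OF ginv(4) xs m])
 have j': "j' \<in> hom_space v w" unfolding j'_def hom_space_def using mult_carrier_mat[OF hom_spaceD[OF j] gauge_carrier[OF g(1)]] by simp
 have "jointly_injective v w (x', j')"
  unfolding jointly_injective_def prod.case
 proof (intro allI ballI impI)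
  fix i s assume s: "s \<in> carrier_vec (v i)" and ker: "x' (Om i) *\<^sub>v s = 0\<^sub>v (v (i - 1))"
   "x' (OmBar (i + 1)) *\<^sub>v s = 0\<^sub>v (v (i + 1))" "j' i *\<^sub>v s = 0\<^sub>v (w i)"
  let ?t = "g i *\<^sub>v s"
  have move: "x h *\<^sub>v ?t = 0\<^sub>v (v (in_v h))" if "out_v h = i" "x' h *\<^sub>v s = 0\<^sub>v (v (in_v h))" for h
  proof -
   have c: "x h \<in> carrier_mat (v (in_v h)) (v i)" "x' h \<in> carrier_mat (v (in_v h)) (v i)"
    using rep_spaceD[OF xs, of h] rep_spaceD[OF x', of h] that(1) by auto
   have "x h *\<^sub>v ?t = x h * g i *\<^sub>v s" by (rule assoc_mult_mat_vec[OF c(1) gauge_carrier[OF g(1)] s, symmetric])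
   also have "x h * g i = g (in_v h) * x' h" using gauge_act_iff[OF g(1) x' xs] xx' that(1) by blast
   also have "... *\<^sub>v s = g (in_v h) *\<^sub>v (x' h *\<^sub>v s)" by (rule assoc_mult_mat_vec[OF gauge_carrier[OF g(1)] c(2) s])
   also have "... = 0\<^sub>v (v (in_v h))"
    unfolding that(2) using gauge_carrier[OF g(1), of "in_v h"] by (intro eq_vecI) (auto simp: scalar_prod_def)
   finally show ?thesis .
  qed
  have "j i *\<^sub>v ?t = 0\<^sub>v (w i)"
   using ker(3) assoc_mult_mat_vec[OF hom_spaceD[OF j] gauge_carrier[OF g(1)] s] unfolding j'_def by simp
  moreover have "?t \<in> carrier_vec (v i)" using mult_mat_vec_carrier[OF gauge_carrier[OF g(1)] s] .
  ultimately have t: "?t = 0\<^sub>v (v i)"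
   using inj move[of "Om i"] move[of "OmBar (i + 1)"] ker unfolding jointly_injective_def by simp
  have "s = gauge_inv v g i * g i *\<^sub>v s" unfolding ginv(3) using s by simp
  also have "... = gauge_inv v g i *\<^sub>v ?t" by (rule assoc_mult_mat_vec[OF ginv(1) gauge_carrier[OF g(1)] s])
  also have "... = 0\<^sub>v (v i)" unfolding t using ginv(1)[of i] by (intro eq_vecI) (auto simp: scalar_prod_def)
  finally show "s = 0\<^sub>v (v i)" .
 qed
 then show ?thesis by (rule canonical_chainable[OF f zs x' om m' j'])
qed

definition seg_idx :: "(int \<times> int) list => int => nat => nat" where
 "seg_idx zs i = inv_into (seg_active zs i) (seg_pos zs i)"

lemma seg_idx_pos: "p \<in> seg_active zs i ==> seg_idx zs i (seg_pos zs i p) = p"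
 unfolding seg_idx_def using seg_pos_bij[of zs i] by (intro inv_into_f_f) (auto simp: bij_betw_def)

text \<open>A stable point from a matching. The opposite arrow shifts a segment \<open>p\<close> onto the linked segment \<open>q\<close>, which
  starts one step later and reaches further, and the bottom vectors without a link are sent to distinct basis
  vectors of the framing. A common kernel vector involves only bottom vectors, as \<open>Om\<close> is injective on the
  others, and each of its coordinates is then isolated by one row of the remaining two maps.\<close>

lemma linked_segments_stable:
 fixes link :: "nat => nat => bool" and slot :: "nat => nat"
 assumes fin: "fin_supp v" and f: "f \<in> Zt_V v" and zs: "!!z. count_list zs z = f z"
  and link: "!!q p. link q p ==> q < length zs & fst (zs ! q) = fst (zs ! p) + 1 & snd (zs ! p) < snd (zs ! q)"
  and link_inj: "!!q p p'. link q p ==> link q p' ==> p = p'"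
  and slot: "!!p. p < length zs ==> \<forall>q. \<not> link q p ==> slot p < w (fst (zs ! p))"
  and slot_inj: "!!p p'. p < length zs ==> p' < length zs ==> \<forall>q. \<not> link q p ==> \<forall>q. \<not> link q p' ==>
   fst (zs ! p) = fst (zs ! p') ==> slot p = slot p' ==> p = p'"
 obtains x j where "x \<in> conormal v f" "j \<in> hom_space v w" "jointly_injective v w (x, j)"
proof -
 have tot: "seg_total zs i = v i" for i using seg_total_eq_seg_dim[OF zs] f unfolding Zt_V_def by simp
 define x where "x = (%h. case h of Om i => seg_sum zs (Om i)
  | OmBar i => mat (v i) (v (i - 1)) (%(a, b). if link (seg_idx zs i a) (seg_idx zs (i - 1) b) then 1 else 0))"
 define free where "free i b p \<longleftrightarrow> fst (zs ! p) = i & (\<forall>q. \<not> link q p) & slot p = b" for i b p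
 define j :: "int => complex mat" where
  "j i = mat (w i) (v i) (%(a, b). if free i a (seg_idx zs i b) then 1 else 0)" for i
 have om: "x (Om i) = seg_sum zs (Om i)" for i by (simp add: x_def)
 have x: "x \<in> rep_space v"
  unfolding rep_space_def
 proof (intro CollectI allI)
  fix h show "x h \<in> carrier_mat (v (in_v h)) (v (out_v h))"
   using seg_sum_carrier[of zs h] unfolding tot by (cases h) (auto simp: x_def)
 qed
 have j: "j \<in> hom_space v w" unfolding hom_space_def j_def by auto
 have less: "seg_pos zs i p < v i" if "p \<in> seg_active zs i" for i p using seg_pos_less[OF that] tot by simp
 have bar: "bar_entry zs x i q p = (if link q p then 1 else 0)" if "q \<in> seg_active zs (i + 1)" "p \<in> seg_active zs i" for i q p
  using less[OF that(1)] less[OF that(2)] seg_idx_pos[OF that(1)] seg_idx_pos[OF that(2)] unfolding bar_entry_def x_def by simp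
 have "moment_zero v x i" for i
  unfolding canonical_moment[OF tot x om]
 proof (intro ballI)
  fix q p assume qp: "q \<in> seg_active zs i" "p \<in> seg_active zs i"
  have "(if q \<in> seg_active zs (i + 1) then bar_entry zs x i q p else 0) = (if link q p then 1 else 0)"
   using bar[of q i p] qp link[of q p] unfolding seg_active_iff by auto
  moreover have "(if p \<in> seg_active zs (i - 1) then bar_entry zs x (i - 1) q p else 0) = (if link q p then 1 else 0)"
   using bar[of q "i - 1" p] qp link[of q p] unfolding seg_active_iff by auto
  ultimately show "(if q \<in> seg_active zs (i + 1) then bar_entry zs x i q p else 0) =
   (if p \<in> seg_active zs (i - 1) then bar_entry zs x (i - 1) q p else 0)" by simp
 qed
 moreover have "om_part v x = om_part v (seg_sum zs)"
  unfolding om_part_def x_def by (auto split: arrow.split)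
 moreover have "om_part v (seg_sum zs) \<in> orbit v f"
  using seg_sum_conormal[OF fin f zs] unfolding conormal_iff[OF fin f] by blast
 ultimately have conormal: "x \<in> conormal v f" unfolding conormal_iff[OF fin f] using x by simp
 have "jointly_injective v w (x, j)"
  unfolding jointly_injective_def prod.case
 proof (intro allI ballI impI)
  fix i s assume s: "s \<in> carrier_vec (v i)" and ker: "x (Om i) *\<^sub>v s = 0\<^sub>v (v (i - 1))"
   "x (OmBar (i + 1)) *\<^sub>v s = 0\<^sub>v (v (i + 1))" "j i *\<^sub>v s = 0\<^sub>v (w i)"
  have c: "x (Om i) \<in> carrier_mat (v (i - 1)) (v i)" "x (OmBar (i + 1)) \<in> carrier_mat (v (i + 1)) (v i)"
   using rep_spaceD[OF x, of "Om i"] rep_spaceD[OF x, of "OmBar (i + 1)"] by auto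
  have coeff: "s $ seg_pos zs i p = 0"
   if p: "p \<in> seg_active zs i" and B: "(\<Sum>b<v i. B b * s $ b) = 0"
    and d: "!!r. r \<in> seg_active zs i ==> B (seg_pos zs i r) = (if p = r then 1 else 0)" for p B
  proof -
   have "(\<Sum>b<v i. B b * s $ b) = (\<Sum>r\<in>seg_active zs i. (if p = r then 1 else 0) * s $ seg_pos zs i r)"
    unfolding sum_seg_pos[OF tot] using d by (intro sum.cong refl) simp
   then show ?thesis using B p unfolding sum_delta_if(1)[OF finite_seg_active] by simp
  qed
  have "s $ seg_pos zs i p = 0" if p: "p \<in> seg_active zs i" for p
  proof (cases "fst (zs ! p) < i")
   case True
   then have p': "p \<in> seg_active zs (i - 1)" using p unfolding seg_active_iff by simp
   show ?thesis
   proof (rule coeff[OF p])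
    show "(\<Sum>b<v i. x (Om i) $$ (seg_pos zs (i - 1) p, b) * s $ b) = 0"
     using ker(1) less[OF p'] unfolding mult_vec_zero_iff[OF c(1) s] by blast
    show "x (Om i) $$ (seg_pos zs (i - 1) p, seg_pos zs i r) = (if p = r then 1 else 0)" if "r \<in> seg_active zs i" for r
     using seg_sum_entry[of p zs "Om i" r] p' that om by simp
   qed
  next
   case False
   then have p_start: "fst (zs ! p) = i" "p < length zs" "i <= snd (zs ! p)" using p unfolding seg_active_iff by auto
   show ?thesis
   proof (cases "\<exists>q. link q p")
    case True
    then obtain q where q: "link q p" by blast
    have q': "q \<in> seg_active zs (i + 1)" using link[OF q] p_start unfolding seg_active_iff by auto
    show ?thesis
    proof (rule coeff[OF p])
     show "(\<Sum>b<v i. x (OmBar (i + 1)) $$ (seg_pos zs (i + 1) q, b) * s $ b) = 0"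
      using ker(2) less[OF q'] unfolding mult_vec_zero_iff[OF c(2) s] by blast
     show "x (OmBar (i + 1)) $$ (seg_pos zs (i + 1) q, seg_pos zs i r) = (if p = r then 1 else 0)" if "r \<in> seg_active zs i" for r
      using bar[OF q' that] q link_inj[OF q, of r] unfolding bar_entry_def by auto
    qed
   next
    case False
    then have b: "slot p < w i" using slot[OF p_start(2)] p_start(1) by blast
    show ?thesis
    proof (rule coeff[OF p])
     show "(\<Sum>b<v i. j i $$ (slot p, b) * s $ b) = 0"
      using ker(3) b unfolding mult_vec_zero_iff[OF hom_spaceD[OF j] s] by blast
     show "j i $$ (slot p, seg_pos zs i r) = (if p = r then 1 else 0)" if r: "r \<in> seg_active zs i" for r
     proof -
      have "j i $$ (slot p, seg_pos zs i r) = (if free i (slot p) r then 1 else 0)"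
       using b less[OF r] seg_idx_pos[OF r] unfolding j_def by simp
      moreover have "free i (slot p) r \<longleftrightarrow> p = r"
      proof
       assume "free i (slot p) r"
       then have "fst (zs ! r) = i" "\<forall>q. \<not> link q r" "slot p = slot r" unfolding free_def by auto
       moreover have "r < length zs" using r unfolding seg_active_iff by blast
       ultimately show "p = r" using slot_inj[of p r] False p_start by blast
      next
       assume "p = r"
       then show "free i (slot p) r" using False p_start unfolding free_def by blast
      qed
      ultimately show ?thesis by simp
     qed
    qed
   qed
  qed
  then have "s $ a = 0" if "a < v i" for a using seg_pos_surj[of a zs i] that tot by auto
  then show "s = 0\<^sub>v (v i)" using s by (intro eq_vecI) auto
 qed
 then show ?thesis using that conormal j by blast
qed

text \<open>The segments are indexed by a diagram and a row. Within one diagram consecutive rows are linked, and the row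
  that starts at the charge \<open>\<gamma>\<close> is sent to the framing, numbered by the preceding diagrams of the same charge.\<close>

lemma maya_conormal_stable:
 assumes fin: "fin_supp v" and M: "M \<in> maya_tuples \<gamma>s" and f: "tuple_fun M \<in> Zt_V v"
 obtains x j where "x \<in> conormal v (tuple_fun M)" "j \<in> hom_space v (weight_vec \<gamma>s)"
  "jointly_injective v (weight_vec \<gamma>s) (x, j)"
proof -
 let ?R = "row_end \<gamma>s M"
 define P where "P = {(a, i). a < length \<gamma>s & i <= \<gamma>s ! a & i <= ?R a i}"
 have "P \<subseteq> {..<length \<gamma>s} \<times> fst ` {z. tuple_fun M z ~= 0}"
 proof
  fix z assume "z \<in> P"
  then obtain a i where z: "z = (a, i)" "a < length \<gamma>s" "i <= \<gamma>s ! a" "i <= ?R a i" unfolding P_def by blast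
  then have "a \<in> {a'. a' < length \<gamma>s & i <= \<gamma>s ! a' & ?R a i = ?R a' i & i <= ?R a i}" by simp
  then have "tuple_fun M (i, ?R a i) ~= 0" unfolding tuple_fun_eq[OF M] by (auto simp: card_eq_0_iff)
  then show "z \<in> {..<length \<gamma>s} \<times> fst ` {z. tuple_fun M z ~= 0}" using z by (force intro: image_eqI[of _ _ "(i, ?R a i)"])
 qed
 moreover have "finite {z. tuple_fun M z ~= 0}" using tuple_fun_in_Zt_inf[OF M] unfolding Zt_inf_def by simp
 ultimately have "finite P" by (rule finite_subset[OF _ finite_cartesian_product[OF finite_lessThan finite_imageI]])
 then obtain ps where ps: "set ps = P" "distinct ps" using finite_distinct_list by blast
 define seg where "seg = (%(a, i). (i, ?R a i))"
 define zs where "zs = map seg ps"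
 have len: "length zs = length ps" unfolding zs_def by simp
 have nth: "\<exists>a i. ps ! p = (a, i) & zs ! p = (i, ?R a i) & a < length \<gamma>s & i <= \<gamma>s ! a & i <= ?R a i" if "p < length zs" for p
 proof -
  obtain a i where ai: "ps ! p = (a, i)" by (cases "ps ! p")
  have "ps ! p \<in> P" using that ps(1) len nth_mem by metis
  then show ?thesis using ai that len unfolding P_def zs_def seg_def by auto
 qed
 have count: "count_list zs z = tuple_fun M z" for z
 proof -
  have "count_list zs z = length (filter (%ai. z = seg ai) ps)"
   unfolding zs_def count_list_eq_length_filter filter_map by (simp add: o_def)
  also have "... = card {ai \<in> P. z = seg ai}"
   using distinct_card[of "filter (%ai. z = seg ai) ps"] ps by simp
  also have "{ai \<in> P. z = seg ai} = (%a. (a, fst z)) `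
    {a. a < length \<gamma>s & fst z <= \<gamma>s ! a & snd z = ?R a (fst z) & fst z <= snd z}"
   unfolding P_def seg_def by (cases z) auto
  also have "card ... = tuple_fun M z" unfolding tuple_fun_eq[OF M] by (rule card_image) (simp add: inj_on_def)
  finally show ?thesis .
 qed
 define link where "link q p \<longleftrightarrow> q < length zs & p < length zs & ps ! q = (fst (ps ! p), snd (ps ! p) + 1)" for q p
 define slot where "slot p = card {a. a < fst (ps ! p) & \<gamma>s ! a = \<gamma>s ! fst (ps ! p)}" for p
 have unlinked: "\<exists>a. ps ! p = (a, \<gamma>s ! a) & a < length \<gamma>s & fst (zs ! p) = \<gamma>s ! a"
  if p: "p < length zs" and no: "\<forall>q. \<not> link q p" for p
 proof -
  obtain a i where ai: "ps ! p = (a, i)" "zs ! p = (i, ?R a i)" "a < length \<gamma>s" "i <= \<gamma>s ! a" "i <= ?R a i"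
   using nth[OF p] by blast
  have "\<not> i < \<gamma>s ! a"
  proof
   assume "i < \<gamma>s ! a"
   then have "(a, i + 1) \<in> P" using row_end_facts(1)[OF M ai(3), of i] ai unfolding P_def by auto
   then obtain q where "q < length ps" "ps ! q = (a, i + 1)" using ps(1) by (auto simp: in_set_conv_nth)
   then show False using no p ai(1) len unfolding link_def by simp
  qed
  then show ?thesis using ai by auto
 qed
 have slot_less: "slot p < card {a'. a' < length \<gamma>s & \<gamma>s ! a' = \<gamma>s ! a}" if "ps ! p = (a, i)" "a < length \<gamma>s" for p a i
  unfolding slot_def that(1) by (intro psubset_card_mono) (use that(2) in auto)
 show ?thesis
 proof (rule linked_segments_stable[where zs = zs and link = link and slot = slot and w = "weight_vec \<gamma>s", OF fin f])
  show "count_list zs z = tuple_fun M z" for z by (rule count)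
  show "q < length zs & fst (zs ! q) = fst (zs ! p) + 1 & snd (zs ! p) < snd (zs ! q)" if l: "link q p" for q p
  proof -
   have qp: "q < length zs" "p < length zs" using l unfolding link_def by auto
   obtain a i where ai: "ps ! p = (a, i)" "zs ! p = (i, ?R a i)" using nth[OF qp(2)] by blast
   obtain a' i' where ai': "ps ! q = (a', i')" "zs ! q = (i', ?R a' i')" "a' < length \<gamma>s" "i' <= \<gamma>s ! a'" using nth[OF qp(1)] by blast
   have "a' = a" "i' = i + 1" using l ai(1) ai'(1) unfolding link_def by auto
   then show ?thesis using row_end_facts(1)[OF M, of a i] ai ai' qp by simp
  qed
  show "p = p'" if "link q p" "link q p'" for q p p'
  proof -
   have "ps ! p = ps ! p'" using that unfolding link_def by (auto simp: prod_eq_iff)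
   then show ?thesis using that ps(2) len unfolding link_def by (simp add: nth_eq_iff_index_eq)
  qed
  show "slot p < weight_vec \<gamma>s (fst (zs ! p))" if p: "p < length zs" "\<forall>q. \<not> link q p" for p
  proof -
   obtain a where a: "ps ! p = (a, \<gamma>s ! a)" "a < length \<gamma>s" "fst (zs ! p) = \<gamma>s ! a" using unlinked[OF p] by blast
   show ?thesis unfolding a(3) weight_vec_def by (rule slot_less[OF a(1,2)])
  qed
  show "p = p'" if p: "p < length zs" "p' < length zs" "\<forall>q. \<not> link q p" "\<forall>q. \<not> link q p'"
   "fst (zs ! p) = fst (zs ! p')" "slot p = slot p'" for p p'
  proof -
   obtain a where a: "ps ! p = (a, \<gamma>s ! a)" "fst (zs ! p) = \<gamma>s ! a" using unlinked[OF p(1,3)] by blast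
   obtain a' where a': "ps ! p' = (a', \<gamma>s ! a')" "fst (zs ! p') = \<gamma>s ! a'" using unlinked[OF p(2,4)] by blast
   have e: "\<gamma>s ! a = \<gamma>s ! a'" using a(2) a'(2) p(5) by simp
   have neq: "card {c. c < a & \<gamma>s ! c = \<gamma>s ! a} < card {c. c < b & \<gamma>s ! c = \<gamma>s ! b}" if "a < b" "\<gamma>s ! a = \<gamma>s ! b" for a b
    by (intro psubset_card_mono) (use that in auto)
   have "a = a'" using neq[of a a'] neq[of a' a] e p(6) a(1) a'(1) unfolding slot_def by (cases a a' rule: linorder_cases) auto
   then have "ps ! p = ps ! p'" using a(1) a'(1) by simp
   then show ?thesis using p(1,2) ps(2) len by (simp add: nth_eq_iff_index_eq)
  qed
 next
  fix x j assume "x \<in> conormal v (tuple_fun M)" "j \<in> hom_space v (weight_vec \<gamma>s)" "jointly_injective v (weight_vec \<gamma>s) (x, j)"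
  then show thesis by (rule that)
 qed
qed

section \<open>Irreducible components\<close>

lemma closedin_zariski:
 "closedin (zariski C S) A \<longleftrightarrow> (\<exists>F \<subseteq> poly_funs C. A = {x \<in> S. \<forall>p\<in>F. p x = 0})"
 unfolding closedin_def topspace_zariski openin_zariski
proof (intro iffI conjI)
 assume "A \<subseteq> S & (\<exists>F \<subseteq> poly_funs C. S - A = {x \<in> S. \<exists>p\<in>F. p x ~= 0})"
 then obtain F where "A \<subseteq> S" "F \<subseteq> poly_funs C" "S - A = {x \<in> S. \<exists>p\<in>F. p x ~= 0}" by blast
 moreover from this have "A = {x \<in> S. \<forall>p\<in>F. p x = 0}" by blast
 ultimately show "\<exists>F \<subseteq> poly_funs C. A = {x \<in> S. \<forall>p\<in>F. p x = 0}" by blast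
next
 assume "\<exists>F \<subseteq> poly_funs C. A = {x \<in> S. \<forall>p\<in>F. p x = 0}"
 then obtain F where F: "F \<subseteq> poly_funs C" "A = {x \<in> S. \<forall>p\<in>F. p x = 0}" by blast
 show "A \<subseteq> S" using F(2) by blast
 show "\<exists>F \<subseteq> poly_funs C. S - A = {x \<in> S. \<exists>p\<in>F. p x ~= 0}"
  by (rule exI[of _ F]) (use F in auto)
qed

lemma closedin_subzariski:
 assumes "T \<subseteq> S"
 shows "closedin (subtopology (zariski C S) T) A \<longleftrightarrow> (\<exists>F \<subseteq> poly_funs C. A = {x \<in> T. \<forall>p\<in>F. p x = 0})"
 unfolding closedin_subtopology closedin_zariski
proof (intro iffI)
 assume "\<exists>U. (\<exists>F \<subseteq> poly_funs C. U = {x \<in> S. \<forall>p\<in>F. p x = 0}) & A = U \<inter> T"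
 then obtain F where F: "F \<subseteq> poly_funs C" "A = {x \<in> S. \<forall>p\<in>F. p x = 0} \<inter> T" by blast
 then show "\<exists>F \<subseteq> poly_funs C. A = {x \<in> T. \<forall>p\<in>F. p x = 0}"
  using assms by (intro exI[of _ F]) auto
next
 assume "\<exists>F \<subseteq> poly_funs C. A = {x \<in> T. \<forall>p\<in>F. p x = 0}"
 then obtain F where F: "F \<subseteq> poly_funs C" "A = {x \<in> T. \<forall>p\<in>F. p x = 0}" by blast
 then show "\<exists>U. (\<exists>F \<subseteq> poly_funs C. U = {x \<in> S. \<forall>p\<in>F. p x = 0}) & A = U \<inter> T"
  using assms by (intro exI[of _ "{x \<in> S. \<forall>p\<in>F. p x = 0}"]) auto
qed

lemma zariski_closure_iff:
 assumes "A \<subseteq> S"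
 shows "x \<in> zariski C S closure_of A \<longleftrightarrow> x \<in> S & (\<forall>p \<in> poly_funs C. (\<forall>y\<in>A. p y = 0) --> p x = 0)"
 unfolding in_closure_of topspace_zariski openin_zariski
proof (intro iffI conjI ballI impI allI)
 fix p assume x: "x \<in> S & (\<forall>T. x \<in> T & (\<exists>F \<subseteq> poly_funs C. T = {x \<in> S. \<exists>p\<in>F. p x ~= 0}) --> (\<exists>y. y \<in> A & y \<in> T))"
  and p: "p \<in> poly_funs C" "\<forall>y\<in>A. p y = 0"
 show "p x = 0"
 proof (rule ccontr)
  assume "p x ~= 0"
  then have mem: "x \<in> {x \<in> S. \<exists>p\<in>{p}. p x ~= 0}" using x by simp
  have open_set: "\<exists>F \<subseteq> poly_funs C. {x \<in> S. \<exists>p\<in>{p}. p x ~= 0} = {x \<in> S. \<exists>p\<in>F. p x ~= 0}"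
   by (rule exI[of _ "{p}"]) (use p in simp)
  from x[THEN conjunct2, THEN spec, THEN mp, OF conjI, OF mem open_set]
  obtain y where "y \<in> A" "y \<in> {x \<in> S. \<exists>p\<in>{p}. p x ~= 0}" by (elim exE conjE)
  then show False using p(2) by simp
 qed
next
 fix T assume x: "x \<in> S & (\<forall>p \<in> poly_funs C. (\<forall>y\<in>A. p y = 0) --> p x = 0)"
  and T: "x \<in> T & (\<exists>F \<subseteq> poly_funs C. T = {x \<in> S. \<exists>p\<in>F. p x ~= 0})"
 then obtain F where F: "F \<subseteq> poly_funs C" "T = {x \<in> S. \<exists>p\<in>F. p x ~= 0}" by blast
 then obtain p where p: "p \<in> F" "p x ~= 0" using T by blast
 then obtain y where "y \<in> A" "p y ~= 0" using x F(1) by blast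
 then show "\<exists>y. y \<in> A & y \<in> T" unfolding F(2) using assms p(1) by blast
qed blast+

lemma conormal_closure_iff:
 assumes "fin_supp v" "f \<in> Zt_V v"
 shows "x \<in> conormal_closure v f \<longleftrightarrow> x \<in> rep_space v &
  (\<forall>p \<in> rep_polys v. (\<forall>y\<in>conormal v f. p y = 0) --> p x = 0)"
 unfolding conormal_closure_def
 by (rule zariski_closure_iff) (use conormal_rep_space[OF assms] in blast)

lemma conormal_subset_closure:
 assumes "fin_supp v" "f \<in> Zt_V v"
 shows "conormal v f \<subseteq> conormal_closure v f"
 using conormal_rep_space[OF assms] unfolding conormal_closure_iff[OF assms] subset_iff by blast

lemma conormal_closure_framed:
 assumes fin: "fin_supp v" and f: "f \<in> Zt_V v" and P: "P \<in> framed_polys v w"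
  and zero: "!!q. q \<in> conormal v f \<times> hom_space v w ==> P q = 0"
  and q: "q \<in> conormal_closure v f \<times> hom_space v w"
 shows "P q = 0"
proof -
 obtain x j where xj: "q = (x, j)" "x \<in> conormal_closure v f" "j \<in> hom_space v w" using q by blast
 have "\<forall>y\<in>conormal v f. P (y, j) = 0" using zero xj(3) by simp
 with xj(2)[unfolded conormal_closure_iff[OF fin f], THEN conjunct2, THEN bspec, OF framed_coords_fix[OF P, of j]]
 show ?thesis unfolding xj(1) by (rule mp)
qed

lemma conormal_closure_gauge:
 assumes fin: "fin_supp v" and f: "f \<in> Zt_V v" and x: "x \<in> conormal_closure v f" and g: "g \<in> gauge_group v"
 shows "gauge_act v g x \<in> conormal_closure v f"
 unfolding conormal_closure_iff[OF fin f]
proof (intro conjI ballI impI)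
 have xs: "x \<in> rep_space v" using x unfolding conormal_closure_iff[OF fin f] by blast
 show "gauge_act v g x \<in> rep_space v" by (rule gauge_act_rep_space[OF g xs])
 fix p assume p: "p \<in> rep_polys v" and zero: "\<forall>y\<in>conormal v f. p y = 0"
 \<comment> \<open>the action is polynomial on representations of the right format only, so it is extended to all families of matrices\<close>
 define \<sigma> :: "rep => rep" where "\<sigma> y = (%h. mat (v (in_v h)) (v (out_v h)) (%(a, b).
  \<Sum>d<v (out_v h). (\<Sum>c<v (in_v h). g (in_v h) $$ (a, c) * y h $$ (c, d)) * gauge_inv v g (out_v h) $$ (d, b)))" for y
 have \<sigma>: "\<sigma> y = gauge_act v g y" if y: "y \<in> rep_space v" for y
 proof
  fix h
  have c: "gauge_act v g y h \<in> carrier_mat (v (in_v h)) (v (out_v h))" by (rule rep_spaceD[OF gauge_act_rep_space[OF g y]])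
  show "\<sigma> y h = gauge_act v g y h"
   by (rule eq_matI)
    (use c gauge_act_entry[OF gauge_carrier[OF g] y gauge_inv_group(1)[OF g], of _ h] in \<open>auto simp: \<sigma>_def\<close>)
 qed
 have "(%y. p (\<sigma> y)) \<in> rep_polys v"
 proof (rule poly_funs_compose[OF p])
  fix c assume "c \<in> rep_coords v"
  then obtain h a b where c: "c = (%x. x h $$ (a, b))" "a < v (in_v h)" "b < v (out_v h)" by (rule rep_coordsE)
  have "(%y. \<Sum>d<v (out_v h). (\<Sum>c<v (in_v h). g (in_v h) $$ (a, c) * y h $$ (c, d)) * gauge_inv v g (out_v h) $$ (d, b))
    \<in> rep_polys v"
   by (intro poly_funs_sum poly_funs.mult poly_funs.const poly_funs.coord rep_coordsI) auto
  then show "(%y. c (\<sigma> y)) \<in> rep_polys v" unfolding c(1) \<sigma>_def using c(2,3) by simp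
 qed
 from x[unfolded conormal_closure_iff[OF fin f], THEN conjunct2, THEN bspec, OF this]
 have "(\<forall>y\<in>conormal v f. p (\<sigma> y) = 0) --> p (\<sigma> x) = 0" .
 moreover have "\<forall>y\<in>conormal v f. p (\<sigma> y) = 0"
 proof
  fix y assume y: "y \<in> conormal v f"
  show "p (\<sigma> y) = 0"
   unfolding \<sigma>[OF conormal_rep_space[OF fin f y]] by (rule bspec[OF zero conormal_gauge[OF fin f y g]])
 qed
 ultimately have "p (\<sigma> x) = 0" by (rule mp)
 then show "p (gauge_act v g x) = 0" using \<sigma>[OF xs] by simp
qed

lemma framed_orbit_eq_gauge:
 assumes "framed_orbit v p = framed_orbit v q" "fst p \<in> rep_space v"
 obtains g where "g \<in> gauge_group v" "fst p = gauge_act v g (fst q)"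
proof -
 have fst: "fst (framed_act v g p) = gauge_act v g (fst p)" for g p by (simp add: framed_act_def case_prod_unfold)
 have "framed_act v (%i. 1\<^sub>m (v i)) p \<in> framed_orbit v p" unfolding framed_orbit_def using gauge_one by blast
 then have "framed_act v (%i. 1\<^sub>m (v i)) p \<in> framed_orbit v q" unfolding assms(1) .
 then obtain g where g: "g \<in> gauge_group v" "framed_act v (%i. 1\<^sub>m (v i)) p = framed_act v g q"
  unfolding framed_orbit_def by blast
 from arg_cong[OF g(2), of fst] have "fst p = gauge_act v g (fst q)"
  unfolding fst gauge_act_one[OF assms(2)] .
 with g(1) show ?thesis by (rule that)
qed

text \<open>The closure of the conormal variety is invariant under the gauge group, so membership of an orbit can be
  tested on any representative.\<close>

lemma X_comp_preimage:
 assumes fin: "fin_supp v" and f: "f \<in> Zt_V v" and p: "p \<in> Lambda_st v w"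
 shows "framed_orbit v p \<in> X_comp v w f \<longleftrightarrow> fst p \<in> conormal_closure v f"
proof
 have ps: "fst p \<in> rep_space v" "snd p \<in> hom_space v w" using p Lambda_st_subset by fastforce+
 assume "framed_orbit v p \<in> X_comp v w f"
 then obtain q where q: "q \<in> conormal_closure v f \<times> hom_space v w" "framed_orbit v p = framed_orbit v q"
  unfolding X_comp_def by blast
 obtain g where g: "g \<in> gauge_group v" "fst p = gauge_act v g (fst q)" by (rule framed_orbit_eq_gauge[OF q(2) ps(1)])
 then show "fst p \<in> conormal_closure v f" using conormal_closure_gauge[OF fin f _ g(1)] q(1) by auto
next
 assume "fst p \<in> conormal_closure v f"
 moreover have "snd p \<in> hom_space v w" using p Lambda_st_subset by fastforce
 ultimately have "p \<in> (conormal_closure v f \<times> hom_space v w) \<inter> Lambda_st v w" using p by (cases p) simp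
 then show "framed_orbit v p \<in> X_comp v w f" unfolding X_comp_def by blast
qed

lemma topspace_nakajima: "topspace (nakajima_L v w) = framed_orbit v ` Lambda_st v w"
 unfolding nakajima_L_def topspace_quotient_topology topspace_subtopology topspace_zariski
 using Lambda_st_subset[of v w] by (simp add: Int_absorb1)

lemma closedin_nakajima:
 "closedin (nakajima_L v w) A \<longleftrightarrow> A \<subseteq> framed_orbit v ` Lambda_st v w &
  (\<exists>F \<subseteq> framed_polys v w. {p \<in> Lambda_st v w. framed_orbit v p \<in> A} = {p \<in> Lambda_st v w. \<forall>P\<in>F. P p = 0})"
proof -
 let ?X = "subtopology (zariski (framed_coords v w) (rep_space v \<times> hom_space v w)) (Lambda_st v w)"
 have top: "topspace ?X = Lambda_st v w"
  unfolding topspace_subtopology topspace_zariski using Lambda_st_subset[of v w] by (simp add: Int_absorb1)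
 have "quotient_map ?X (nakajima_L v w) (framed_orbit v)"
  unfolding nakajima_L_def by (rule quotient_map_quotient_topology)
 then have "closedin (nakajima_L v w) A \<longleftrightarrow> closedin ?X {p \<in> Lambda_st v w. framed_orbit v p \<in> A}"
  if "A \<subseteq> framed_orbit v ` Lambda_st v w"
  using that unfolding quotient_map_closedin top topspace_nakajima by blast
 then show ?thesis
  using closedin_subset[of "nakajima_L v w" A] unfolding topspace_nakajima closedin_subzariski[OF Lambda_st_subset] by blast
qed

text \<open>The dense part of the preimage of \<open>X_comp\<close> that is accessible through \<open>conormal_iff\<close>.\<close>

definition stable_conormal where
 "stable_conormal v w f = (conormal v f \<times> hom_space v w) \<inter> Lambda_st v w"

lemma stable_conormal_iff:
 assumes fin: "fin_supp v" and f: "f \<in> Zt_V v"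
 shows "(x, j) \<in> stable_conormal v w f \<longleftrightarrow> x \<in> conormal v f & j \<in> hom_space v w & jointly_injective v w (x, j)"
 unfolding stable_conormal_def using Lambda_st_iff[OF fin, of x j w] conormal_Lambda[OF fin f] by auto

text \<open>A nonempty open subset of an irreducible set is dense.\<close>

lemma stable_conormal_dense:
 assumes fin: "fin_supp v" and f: "f \<in> Zt_V v" and ne: "stable_conormal v w f ~= {}"
  and P: "P \<in> framed_polys v w" and zero: "!!q. q \<in> stable_conormal v w f ==> P q = 0"
  and q: "q \<in> conormal_closure v f \<times> hom_space v w"
 shows "P q = 0"
proof -
 obtain p where "p \<in> stable_conormal v w f" using ne by blast
 then have p: "p \<in> conormal v f \<times> hom_space v w" "jointly_injective v w p"
  using stable_conormal_iff[OF fin f] by (cases p; auto)+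
 have sub: "conormal v f \<times> hom_space v w \<subseteq> rep_space v \<times> hom_space v w" using conormal_rep_space[OF fin f] by blast
 obtain D where D: "D \<in> framed_polys v w" "D p ~= 0"
  "!!q. q \<in> rep_space v \<times> hom_space v w ==> D q ~= 0 ==> jointly_injective v w q"
  using jointly_injective_open[OF fin subsetD[OF sub p(1)] p(2)] by blast
 have "D q * P q = 0" if "q \<in> conormal v f \<times> hom_space v w" for q
 proof (cases "D q = 0")
  case False
  then have "jointly_injective v w q" using D(3) that sub by blast
  then have "q \<in> stable_conormal v w f" using stable_conormal_iff[OF fin f] that by (cases q) auto
  then show ?thesis using zero by simp
 qed simp
 from zariski_primeD[OF conormal_framed_prime[OF fin f] D(1) P this] have "P q = 0" if "q \<in> conormal v f \<times> hom_space v w" for q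
  using D(2) p(1) that by blast
 from conormal_closure_framed[OF fin f P this q] show ?thesis .
qed

lemma X_comp_closed:
 assumes fin: "fin_supp v" and f: "f \<in> Zt_V v"
 shows "closedin (nakajima_L v w) (X_comp v w f)"
 unfolding closedin_nakajima
proof (intro conjI)
 show "X_comp v w f \<subseteq> framed_orbit v ` Lambda_st v w" unfolding X_comp_def by blast
 define F where "F = (%p (q::framed). p (fst q)) ` {p \<in> rep_polys v. \<forall>y\<in>conormal v f. p y = 0}"
 have "F \<subseteq> framed_polys v w" unfolding F_def using framed_coords_fst by blast
 moreover have "{p \<in> Lambda_st v w. framed_orbit v p \<in> X_comp v w f} = {p \<in> Lambda_st v w. \<forall>P\<in>F. P p = 0}"
 proof (rule Collect_cong, rule conj_cong[OF refl])
  fix p assume p: "p \<in> Lambda_st v w"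
  then have "fst p \<in> rep_space v" using Lambda_st_subset by fastforce
  then show "framed_orbit v p \<in> X_comp v w f \<longleftrightarrow> (\<forall>P\<in>F. P p = 0)"
   unfolding X_comp_preimage[OF fin f p] conormal_closure_iff[OF fin f] F_def by auto
 qed
 ultimately show "\<exists>F \<subseteq> framed_polys v w.
   {p \<in> Lambda_st v w. framed_orbit v p \<in> X_comp v w f} = {p \<in> Lambda_st v w. \<forall>P\<in>F. P p = 0}" by blast
qed

lemma stable_conormal_X_comp:
 assumes "fin_supp v" "f \<in> Zt_V v" "p \<in> stable_conormal v w f"
 shows "p \<in> Lambda_st v w" "framed_orbit v p \<in> X_comp v w f"
proof -
 show p: "p \<in> Lambda_st v w" using assms(3) unfolding stable_conormal_def by blast
 show "framed_orbit v p \<in> X_comp v w f"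
  unfolding X_comp_preimage[OF assms(1,2) p]
  using assms(3) conormal_subset_closure[OF assms(1,2)] unfolding stable_conormal_def by auto
qed

lemma X_comp_irreducible:
 assumes fin: "fin_supp v" and f: "f \<in> Zt_V v" and ne: "stable_conormal v w f ~= {}"
 shows "irreducible_in (nakajima_L v w) (X_comp v w f)"
 unfolding irreducible_in_def
proof (intro conjI allI impI)
 show "X_comp v w f \<subseteq> topspace (nakajima_L v w)" unfolding topspace_nakajima X_comp_def by blast
 show "X_comp v w f ~= {}" using ne stable_conormal_X_comp[OF fin f] by blast
 have zero_set: "X_comp v w f \<subseteq> A"
  if A: "{p \<in> Lambda_st v w. framed_orbit v p \<in> A} = {p \<in> Lambda_st v w. \<forall>P\<in>F. P p = 0}"
   and F: "F \<subseteq> framed_polys v w" "!!P q. P \<in> F ==> q \<in> stable_conormal v w f ==> P q = 0" for A F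
 proof
  fix y assume "y \<in> X_comp v w f"
  then obtain p where p: "p \<in> conormal_closure v f \<times> hom_space v w" "p \<in> Lambda_st v w" "y = framed_orbit v p"
   unfolding X_comp_def by blast
  have "P p = 0" if "P \<in> F" for P
   by (rule stable_conormal_dense[where P = P, OF fin f ne _ _ p(1)]) (use F that in auto)
  then show "y \<in> A" using A p(2,3) by blast
 qed
 fix A B assume A: "closedin (nakajima_L v w) A" and B: "closedin (nakajima_L v w) B" and cover: "X_comp v w f \<subseteq> A \<union> B"
 obtain F where F: "F \<subseteq> framed_polys v w"
   "{p \<in> Lambda_st v w. framed_orbit v p \<in> A} = {p \<in> Lambda_st v w. \<forall>P\<in>F. P p = 0}"
  using A[unfolded closedin_nakajima, THEN conjunct2] by (elim exE conjE)
 obtain G where G: "G \<subseteq> framed_polys v w"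
   "{p \<in> Lambda_st v w. framed_orbit v p \<in> B} = {p \<in> Lambda_st v w. \<forall>P\<in>G. P p = 0}"
  using B[unfolded closedin_nakajima, THEN conjunct2] by (elim exE conjE)
 show "X_comp v w f \<subseteq> A \<or> X_comp v w f \<subseteq> B"
 proof (rule ccontr)
  assume "\<not> ?thesis"
  then obtain P q Q r where P: "P \<in> F" "q \<in> stable_conormal v w f" "P q ~= 0"
   and Q: "Q \<in> G" "r \<in> stable_conormal v w f" "Q r ~= 0"
   using zero_set[OF F(2,1)] zero_set[OF G(2,1)] by blast
  have poly: "P \<in> framed_polys v w" "Q \<in> framed_polys v w" using P(1) Q(1) F(1) G(1) by auto
  have sub: "stable_conormal v w f \<subseteq> conormal v f \<times> hom_space v w" unfolding stable_conormal_def by blast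
  have prod: "P p * Q p = 0" if "p \<in> stable_conormal v w f" for p
  proof -
   have "p \<in> Lambda_st v w" "framed_orbit v p \<in> A \<union> B" using stable_conormal_X_comp[OF fin f that] cover by auto
   then have "P p = 0 \<or> Q p = 0" using F(2) G(2) P(1) Q(1) by blast
   then show ?thesis by auto
  qed
  have "P p * Q p = 0" if "p \<in> conormal v f \<times> hom_space v w" for p
  proof (rule stable_conormal_dense[where P = "%p. P p * Q p", OF fin f ne poly_funs.mult[OF poly]])
   show "p \<in> conormal_closure v f \<times> hom_space v w" using that conormal_subset_closure[OF fin f] by blast
  qed (fact prod)
  from zariski_primeD[OF conormal_framed_prime[OF fin f] poly this] show False
   using P(2,3) Q(2,3) sub by blast
 qed
qed

text \<open>Both preimages are closed, and a function vanishing on one of them vanishes on a dense subset of the other.\<close>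

lemma X_comp_subset_eq:
 assumes fin: "fin_supp v" and f: "f \<in> Zt_V v" and g: "g \<in> Zt_V v" and ne: "stable_conormal v w f ~= {}"
  and sub: "X_comp v w f \<subseteq> X_comp v w g"
 shows "f = g"
proof (rule conormal_in_closure_eq[OF fin f g])
 fix p assume p: "p \<in> rep_polys v" "\<forall>x\<in>conormal v g. p x = 0"
 have "p (fst q) = 0" if q: "q \<in> stable_conormal v w f" for q
 proof -
  have "fst q \<in> conormal_closure v g"
   using stable_conormal_X_comp[OF fin f q] sub X_comp_preimage[OF fin g] by blast
  then show ?thesis using p unfolding conormal_closure_iff[OF fin g] by blast
 qed
 then have zero: "p (fst q) = 0" if "q \<in> conormal_closure v f \<times> hom_space v w" for q
  by (rule stable_conormal_dense[where P = "%q. p (fst q)", OF fin f ne framed_coords_fst[OF p(1)] _ that])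
 show "\<forall>x\<in>conormal v f. p x = 0"
  using zero[of "(_, %i. 0\<^sub>m (w i) (v i))"] hom_space_zero conormal_subset_closure[OF fin f] by auto
qed

text \<open>The conormal varieties cover \<open>Lambda_V\<close>, because every representation of the \<open>Om\<close> arrows is a direct sum of
  segments and there are finitely many orbits.\<close>

lemma nakajima_components:
 assumes fin: "fin_supp v"
 shows "irreducible_components (nakajima_L v w) = X_comp v w ` {f \<in> Zt_V v. stable_conormal v w f ~= {}}"
proof (rule irreducible_components_eq_cover)
 show "finite {f \<in> Zt_V v. stable_conormal v w f ~= {}}" using finite_Zt_V[OF fin] by simp
 show "closedin (nakajima_L v w) (X_comp v w f)" if "f \<in> {f \<in> Zt_V v. stable_conormal v w f ~= {}}" for f
  using X_comp_closed[OF fin] that by blast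
 show "irreducible_in (nakajima_L v w) (X_comp v w f)" if "f \<in> {f \<in> Zt_V v. stable_conormal v w f ~= {}}" for f
  using X_comp_irreducible[OF fin] that by blast
 show "topspace (nakajima_L v w) \<subseteq> (\<Union>f\<in>{f \<in> Zt_V v. stable_conormal v w f ~= {}}. X_comp v w f)"
 proof
  fix y assume "y \<in> topspace (nakajima_L v w)"
  then obtain x j where xj: "(x, j) \<in> Lambda_st v w" "y = framed_orbit v (x, j)" unfolding topspace_nakajima by auto
  have "x \<in> Lambda_V v" "j \<in> hom_space v w" using xj(1) unfolding Lambda_st_iff[OF fin] by auto
  obtain f where f: "f \<in> Zt_V v" "x \<in> conormal v f" using Lambda_V_cover[OF fin \<open>x \<in> Lambda_V v\<close>] by blast
  then have "(x, j) \<in> stable_conormal v w f" using xj(1) \<open>j \<in> hom_space v w\<close> unfolding stable_conormal_def by blast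
  then show "y \<in> (\<Union>f\<in>{f \<in> Zt_V v. stable_conormal v w f ~= {}}. X_comp v w f)"
   using f(1) stable_conormal_X_comp(2)[OF fin f(1)] xj(2) by blast
 qed
 show "X_comp v w f = X_comp v w g" if "f \<in> {f \<in> Zt_V v. stable_conormal v w f ~= {}}"
  "g \<in> {f \<in> Zt_V v. stable_conormal v w f ~= {}}" "X_comp v w f \<subseteq> X_comp v w g" for f g
  using X_comp_subset_eq[OF fin, of f g w] that by blast
qed

lemma stable_conormal_nonempty_iff:
 assumes fin: "fin_supp v" and f: "f \<in> Zt_V v" and sorted: "sorted \<gamma>s"
 shows "stable_conormal v (weight_vec \<gamma>s) f ~= {} \<longleftrightarrow> chainable (weight_vec \<gamma>s) f"
proof
 assume "stable_conormal v (weight_vec \<gamma>s) f ~= {}"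
 then obtain x j where "(x, j) \<in> stable_conormal v (weight_vec \<gamma>s) f" by (metis ex_in_conv surj_pair)
 then show "chainable (weight_vec \<gamma>s) f" using stable_conormal_chainable[OF fin f] unfolding stable_conormal_iff[OF fin f] by blast
next
 assume "chainable (weight_vec \<gamma>s) f"
 then have "f \<in> {f \<in> Zt_inf. chainable (weight_vec \<gamma>s) f}" using f unfolding Zt_V_def by simp
 then obtain M where M: "M \<in> maya_tuples \<gamma>s" "f = tuple_fun M"
  using tuple_fun_bij[OF sorted] unfolding bij_betw_def by blast
 obtain x j where "x \<in> conormal v (tuple_fun M)" "j \<in> hom_space v (weight_vec \<gamma>s)" "jointly_injective v (weight_vec \<gamma>s) (x, j)"
  by (rule maya_conormal_stable[OF fin M(1) f[unfolded M(2)]])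
 then have "(x, j) \<in> stable_conormal v (weight_vec \<gamma>s) f" unfolding M(2)[symmetric] stable_conormal_iff[OF fin f] by blast
 then show "stable_conormal v (weight_vec \<gamma>s) f ~= {}" by blast
qed

lemma seg_dim_support:
 assumes "f \<in> Zt_inf"
 shows "finite {i. seg_dim f i ~= 0}"
proof (rule finite_subset)
 have "finite {z. f z ~= 0}" using assms unfolding Zt_inf_def by simp
 then show "finite (\<Union>z\<in>{z. f z ~= 0}. {fst z..snd z})" by simp
 show "{i. seg_dim f i ~= 0} \<subseteq> (\<Union>z\<in>{z. f z ~= 0}. {fst z..snd z})"
 proof
  fix i assume "i \<in> {i. seg_dim f i ~= 0}"
  then have "{z. f z ~= 0 & fst z <= i & i <= snd z} ~= {}"
   unfolding seg_dim_def mem_Collect_eq by (metis (lifting) sum.empty)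
  then show "i \<in> (\<Union>z\<in>{z. f z ~= 0}. {fst z..snd z})" by auto
 qed
qed

theorem theorem5p1p2:
  fixes \<gamma>s :: "int list"
  assumes "\<gamma>s \<noteq> []" and "sorted \<gamma>s"
  shows "(\<forall>v :: int \<Rightarrow> nat. finite {i. v i \<noteq> 0} \<longrightarrow>
            irreducible_components (nakajima_L v (weight_vec \<gamma>s)) =
              {X_comp v (weight_vec \<gamma>s) f | f. f \<in> Zt_V v \<and> (\<exists>M \<in> maya_tuples \<gamma>s. f = tuple_fun M)})
       \<and> bij_betw
            (\<lambda>M. (seg_dim (tuple_fun M), X_comp (seg_dim (tuple_fun M)) (weight_vec \<gamma>s) (tuple_fun M)))
            {M \<in> maya_tuples \<gamma>s. successively maya_le M}
            (SIGMA v : {v. finite {i. v i \<noteq> 0}}.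
               irreducible_components (nakajima_L v (weight_vec \<gamma>s)))"
proof
 let ?w = "weight_vec \<gamma>s"
 let ?S = "SIGMA v : {v. fin_supp v}. irreducible_components (nakajima_L v ?w)"
 let ?F = "{f \<in> Zt_inf. chainable ?w f}" and ?M = "%f. \<exists>M \<in> maya_tuples \<gamma>s. f = tuple_fun M"
 have comps: "irreducible_components (nakajima_L v ?w) = X_comp v ?w ` {f \<in> Zt_V v. chainable ?w f}"
  if fin: "fin_supp v" for v
 proof -
  have "{f \<in> Zt_V v. stable_conormal v ?w f ~= {}} = {f \<in> Zt_V v. chainable ?w f}"
   using stable_conormal_nonempty_iff[OF fin _ assms(2)] by blast
  then show ?thesis unfolding nakajima_components[OF fin] by simp
 qed
 have maya: "?M f \<longleftrightarrow> chainable ?w f" if "f \<in> Zt_V v" for f v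
 proof
  assume "chainable ?w f"
  then have "f \<in> ?F" using that unfolding Zt_V_def by simp
  then show "?M f"
   using tuple_fun_bij[OF assms(2)] unfolding bij_betw_def by blast
 qed (use tuple_fun_chainable in blast)
 show "\<forall>v :: int => nat. fin_supp v --> irreducible_components (nakajima_L v ?w) =
   {X_comp v ?w f | f. f \<in> Zt_V v & ?M f}"
 proof (intro allI impI)
  fix v :: "int => nat" assume fin: "fin_supp v"
  show "irreducible_components (nakajima_L v ?w) =
    {X_comp v ?w f | f. f \<in> Zt_V v & ?M f}"
   unfolding comps[OF fin] setcompr_eq_image
   by (rule arg_cong[where f = "image (X_comp v ?w)"], rule Collect_cong, rule conj_cong[OF refl], rule maya[symmetric])
 qed
 let ?X = "%f. (seg_dim f, X_comp (seg_dim f) ?w f)"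
 have dim: "f \<in> Zt_V v \<longleftrightarrow> f \<in> Zt_inf & v = seg_dim f" for f v unfolding Zt_V_def by auto
 have "bij_betw ?X ?F
   ?S"
  unfolding bij_betw_def
 proof
  show "inj_on ?X ?F"
  proof (rule inj_onI)
   fix f g assume f: "f \<in> ?F" and g: "g \<in> ?F" and eq: "?X f = ?X g"
   let ?v = "seg_dim f"
   have fg: "f \<in> Zt_V ?v" "g \<in> Zt_V ?v" using f g eq dim by auto
   have fin: "finite {i. ?v i ~= 0}" using f by (intro seg_dim_support) simp
   have ne: "stable_conormal ?v ?w f ~= {}" using stable_conormal_nonempty_iff[OF fin fg(1) assms(2)] f by simp
   have eq': "?v = seg_dim g & X_comp ?v ?w f = X_comp (seg_dim g) ?w g" by (rule Pair_inject[OF eq]) (rule conjI)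
   note e = eq'[THEN conjunct1, symmetric] eq'[THEN conjunct2]
   show "f = g" by (rule X_comp_subset_eq[OF fin fg ne]) (simp only: e order_refl)
  qed
  show "?X ` ?F = ?S"
  proof (intro equalityI subsetI)
   fix y assume "y \<in> ?X ` ?F"
   then obtain f where f: "f \<in> Zt_inf" "chainable ?w f" "y = ?X f" by blast
   have "f \<in> Zt_V (seg_dim f)" using f(1) dim by simp
   then show "y \<in> ?S"
    unfolding f(3) using seg_dim_support[OF f(1)] f(2) by (intro SigmaI) (simp_all add: comps)
  next
   fix y assume "y \<in> ?S"
   then obtain v Z where y: "y = (v, Z)" "fin_supp v" "Z \<in> irreducible_components (nakajima_L v ?w)" by blast
   then obtain f where f: "f \<in> Zt_V v" "chainable ?w f" "Z = X_comp v ?w f" unfolding comps[OF y(2)] by blast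
   have e: "f \<in> Zt_inf" "seg_dim f = v" using f(1) dim by auto
   show "y \<in> ?X ` ?F"
    by (rule image_eqI[where x = f]) (simp_all add: y(1) f e)
  qed
 qed
 from bij_betw_trans[OF tuple_fun_bij[OF assms(2)] this]
 show "bij_betw (%M. (seg_dim (tuple_fun M), X_comp (seg_dim (tuple_fun M)) ?w (tuple_fun M)))
   {M \<in> maya_tuples \<gamma>s. successively maya_le M}
   ?S"
  by (simp add: o_def)
qed

end
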